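(* Let $n\ge2$. For every singular framed link $L$ in $\mathbb{R}^3$, $(L)_n$ is equal to the ($n$-th) Murakami–Ohtsuki–Yamada bracket $\{\Phi(L)\}_n$ of $\Phi(L)$, when $q$ in $(L)_n$ is identified with $q_M^{1/2}$, where $q_M$ is the variable of the Murakami–Ohtsuki–Yamada bracket.
   Context: An $n$-web is an oriented surface embedded in $\mathbb{R}^3$ composed of finitely many directed annuli, directed bands and discs. A band is an embedded square $[0,1]\times[0,1]$ directed from its source $[0,1]\times\{0\}$ to its target $[0,1]\times\{1\}$. The annuli, discs and interiors of bands are disjoint; sources and targets of bands are pairwise disjoint and lie in boundaries of discs; the boundary of each disc contains either exactly $n$ sources and no targets of bands (the disc is a source of the web) or exactly $n$ targets and no sources (a sink); each disc has a marked boundary point outside the bands. An $n$-web diagram is an orientation-preserving projection to $\mathbb{R}^2$ which is an embedding except for finitely many transverse crossings (with over/under information) away from the discs. The bands at a disc are ordered $1,\dots,n$ starting at the marked point, clockwise for a sink and counter-clockwise for a source. Notation: $[k]=\frac{q^k-q^{-k}}{q-q^{-1}}$, $[k]!=[1]\cdots[k]$, $[0]!=1$; for $\sigma\in S_n$, $l(\sigma)$ is the number of inversions and $b_\sigma$ is the positive braid with $l(\sigma)$ crossings on $n$ downward strands representing $\sigma$. $\langle\cdot\rangle_n\in\mathbb{Z}[q^{\pm1/n}]$ is the unique isotopy invariant of $n$-webs such that: (1) $q^{1/n}\langle\Gamma_+\rangle_n-q^{-1/n}\langle\Gamma_-\rangle_n=(q-q^{-1})\langle\Gamma_0\rangle_n$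 for diagrams differing only by a positive crossing, negative crossing, oriented smoothing; (2) adding a small curl with a positive (negative) crossing multiplies the bracket by $q^{n-1/n}$ (by $q^{1/n-n}$); (3) if in some disc $\Gamma$ consists of $n$ parallel downward strands running from the top into a sink with marked point at its bottom, and below it a source with marked point at its top with $n$ parallel downward strands running to the bottom, then $\langle\Gamma\rangle_n=q^{n(n-1)}\sum_{\sigma\in S_n}(-q^{(1-n)/n})^{l(\sigma)}\langle\Gamma_\sigma\rangle_n$, where $\Gamma_\sigma$ has the disc content replaced by $b_\sigma$; (4) adding an unlinked trivial framed knot multiplies the bracket by $[n]$; (5) $\langle\emptyset\rangle_n=1$. A singular framed link is a framed (ribbon) oriented graph in $\mathbb{R}^3$ (annuli allowed) each of whose vertices is $4$-valent with two incoming and two outgoing edges, the two incoming ones being adjacent in the cyclic order. For a singular framed link $L$, the $n$-web $\Psi_n(L)$ is obtained by replacing each vertex, drawn with both incoming strands arriving from the top and both outgoing strands leaving at the bottom, by one sink and one source such that: the incoming strands (left to right) are the first and second band at the sink; the outgoing strands (left to right) are the first and second band at the source; and for $3\le i\le n$ the $i$-th band at the source is the $i$-th band at the sink, these $n-2$ bands being parallel, directed from source to sink, without crossings. For a diagram $D$ of $L$, $(L)_n=(D)_n=\langle\Psi_n(D)\rangle_n\,\bigl([n-2]!\,q^{n(n-1)/2}\bigr)^{-v(D)}q^{w(D)/n}$, where $v(D)$ is the number of $4$-valent vertices and $w(D)$ the number of positive minus negative crossings. $\Phi(L)$ is the colored $3$-valent graph obtained by labeling all edges (and annuli) of $L$ by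 $1$ and replacing each $4$-valent vertex by a pair of $3$-valent vertices: the two incoming edges labeled $1$ merge into an edge labeled $2$, which then splits into the two outgoing edges labeled $1$. Murakami–Ohtsuki–Yamada bracket $\{\cdot\}_n$ of graphs of this type. For a planar (crossingless) graph $G$ with edge/annulus labels $|e|$, a state $s$ assigns to each edge or annulus $e$ an $|e|$-element subset $s(e)\subset\{1,\dots,n\}$ such that at each vertex $v$ the subsets of the two smaller edges are disjoint with union the subset of the largest edge. For each label $i$ the edges $e$ with $i\in s(e)$ form disjoint simple closed curves; let $rot(s)=\sum_C\bigl(s(C)-\frac{n+1}{2}\bigr)rot(C)$ over all these curves $C$ (for all labels), where $s(C)$ is the label of $C$ and $rot(C)=\pm1$ as $C$ is anti-clockwise or clockwise. At a vertex $v$, rotated so that all edges point upwards, let $f_1$ be the left and $f_2$ the right of the two smaller edges, and give $v$ the weight $q_M^{|f_1||f_2|/4-\pi(s(f_1),s(f_2))/2}$, where $\pi(A,B)=\#\{(a,b)\in A\times B:a>b\}$. Then $\{G\}_n=\sum_s q_M^{rot(s)}\prod_v\mathrm{weight}(v)$. For graphs with crossings between edges labeled $1$, $\{\cdot\}_n$ is determined by $\{\text{positive crossing}\}_n=q_M^{1/2}\{\text{oriented smoothing}\}_n-\{W\}_n$ and $\{\text{negative crossing}\}_n=q_M^{-1/2}\{\text{oriented smoothing}\}_n-\{W\}_n$, where $W$ is the graph in which the two incoming edges merge into an edge labeled $2$ which splits into the two outgoing edges. *)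

theory Defs
  imports
    "HOL-Combinatorics.Permutations"
    "HOL-Computational_Algebra.Formal_Laurent_Series"
begin

section \<open>Oriented plane diagrams as words\<close>

text \<open>
  A generic plane diagram is cut by horizontal lines into slices, each containing a single
  piece; it is recorded as the list of these pieces from top to bottom, a pair \<open>(i, p)\<close> standing
  for the piece \<open>p\<close> with exactly \<open>i\<close> vertical strands to its left.  After a planar isotopy all
  crossings and vertices are drawn with their strands running downwards.  This is the usual
  presentation of tangle and ribbon graph diagrams (Freyd-Yetter, Turaev, Reshetikhin-Turaev);
  framings are blackboard framings.
\<close>

datatype dir = Down | Up

fun opp :: "dir \<Rightarrow> dir" where
  "opp Down = Up"
| "opp Up = Down"

text \<open>
  \<open>Cap d\<close> is a local maximum and \<open>Cup d\<close> a local minimum, \<open>d\<close> being the direction of the left leg.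
  \<open>Pos\<close> and \<open>Neg\<close> are the positive and negative crossings of two downward strands: at \<open>Pos\<close>
  the strand going from the top right to the bottom left is the upper one, at \<open>Neg\<close> the lower one.
\<close>

datatype 'v piece = Cap dir | Cup dir | Pos | Neg | Node 'v

text \<open>
  In the functions below, \<open>U p\<close> and \<open>L p\<close> are the strands on the upper and on the lower boundary of
  the piece \<open>p\<close>, from left to right.
\<close>

definition replace_at :: "nat \<Rightarrow> nat \<Rightarrow> 's list \<Rightarrow> 's list \<Rightarrow> 's list" where
  "replace_at i m ys xs = take i xs @ ys @ drop (i + m) xs"

fun closes :: "('p \<Rightarrow> 's list) \<Rightarrow> ('p \<Rightarrow> 's list) \<Rightarrow> 's list \<Rightarrow> (nat \<times> 'p) list \<Rightarrow> bool" where
  "closes U L xs [] \<longleftrightarrow> xs = []"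
| "closes U L xs ((i, p) # w) \<longleftrightarrow>
     i + length (U p) \<le> length xs \<and> take (length (U p)) (drop i xs) = U p \<and>
     closes U L (replace_at i (length (U p)) (L p) xs) w"

fun levels :: "('p \<Rightarrow> 's list) \<Rightarrow> ('p \<Rightarrow> 's list) \<Rightarrow> 's list \<Rightarrow> (nat \<times> 'p) list \<Rightarrow> 's list list" where
  "levels U L xs [] = [xs]"
| "levels U L xs ((i, p) # w) = xs # levels U L (replace_at i (length (U p)) (L p) xs) w"

fun upper :: "('v \<Rightarrow> dir list) \<Rightarrow> 'v piece \<Rightarrow> dir list" where
  "upper U (Cap d) = []"
| "upper U (Cup d) = [d, opp d]"
| "upper U Pos = [Down, Down]"
| "upper U Neg = [Down, Down]"
| "upper U (Node v) = U v"

fun lower :: "('v \<Rightarrow> dir list) \<Rightarrow> 'v piece \<Rightarrow> dir list" where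
  "lower L (Cap d) = [d, opp d]"
| "lower L (Cup d) = []"
| "lower L Pos = [Down, Down]"
| "lower L Neg = [Down, Down]"
| "lower L (Node v) = L v"

section \<open>Webs and their isotopies\<close>

text \<open>
  A sink is drawn with its bands coming from the top and its marked point at the bottom, a source
  with its bands leaving at the bottom and its marked point at the top.  Hence in both cases the
  order of the bands prescribed by the marked point (clockwise at a sink, counter-clockwise at a
  source) is the order from left to right.  Bands and annuli are the strands between the discs
  and the closed strands.
\<close>

datatype web_node = Sink | Source

type_synonym web = "(nat \<times> web_node piece) list"

definition web_upper :: "nat \<Rightarrow> web_node piece \<Rightarrow> dir list" where
  "web_upper n = upper (\<lambda>v. case v of Sink \<Rightarrow> replicate n Down | Source \<Rightarrow> [])"

definition web_lower :: "nat \<Rightarrow> web_node piece \<Rightarrow> dir list" where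
  "web_lower n = lower (\<lambda>v. case v of Sink \<Rightarrow> [] | Source \<Rightarrow> replicate n Down)"

definition webs :: "nat \<Rightarrow> web set" where
  "webs n = {w. closes (web_upper n) (web_lower n) [] w}"

text \<open>
  A crossing of a downward and an upward strand, obtained by turning a crossing of downward strands
  by a right angle: \<open>leftward\<close> leads from \<open>Up, Down\<close> to \<open>Down, Up\<close>, \<open>rightward\<close> back.
\<close>

definition leftward :: "web_node piece \<Rightarrow> nat \<Rightarrow> web" where
  "leftward X i = [(i + 2, Cap Down), (i + 1, X), (i, Cup Up)]"

definition rightward :: "web_node piece \<Rightarrow> nat \<Rightarrow> web" where
  "rightward X i = [(i, Cap Up), (i + 1, X), (i + 2, Cup Down)]"

definition right_curl :: "web_node piece \<Rightarrow> nat \<Rightarrow> web" where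
  "right_curl X i = [(i + 1, Cap Down), (i, X), (i + 1, Cup Down)]"

definition left_curl :: "web_node piece \<Rightarrow> nat \<Rightarrow> web" where
  "left_curl X i = [(i, Cap Up), (i + 1, X), (i, Cup Up)]"

text \<open>The two ways of turning a piece, all of whose \<open>a + b\<close> strands run downwards, upside down.\<close>

definition turn_clockwise :: "nat \<Rightarrow> nat \<Rightarrow> web_node piece \<Rightarrow> nat \<Rightarrow> web" where
  "turn_clockwise a b p i =
     map (\<lambda>k. (i + b + k, Cap Down)) [0..<a] @ [(i + b, p)] @ map (\<lambda>k. (i + k, Cup Up)) (rev [0..<b])"

definition turn_anticlockwise :: "nat \<Rightarrow> nat \<Rightarrow> web_node piece \<Rightarrow> nat \<Rightarrow> web" where
  "turn_anticlockwise a b p i =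
     map (\<lambda>k. (i + k, Cap Up)) [0..<a] @ [(i + a, p)] @ map (\<lambda>k. (i + a + k, Cup Down)) (rev [0..<b])"

text \<open>The leftmost of \<open>m + 1\<close> downward strands crosses all the others.\<close>

definition pass :: "web_node piece \<Rightarrow> nat \<Rightarrow> nat \<Rightarrow> web" where
  "pass X m i = map (\<lambda>k. (i + k, X)) [0..<m]"

text \<open>
  Elementary isotopies.  The first four rules generate planar isotopy, where \<open>turn\<close> says that turning
  a crossing or a disc by a full angle is trivial.  Then come the second Reidemeister move for parallel
  and for antiparallel strands and the framed first Reidemeister move.  The rule \<open>slide\<close> is the third
  Reidemeister move if \<open>p\<close> is a crossing; otherwise a strand is moved below or above a disc.
\<close>

inductive elementary_isotopy :: "nat \<Rightarrow> web \<Rightarrow> web \<Rightarrow> bool" for n :: nat where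
  exchange: "elementary_isotopy n
      [(i, p), (i + length (web_lower n p) + k, p')]
      [(i + length (web_upper n p) + k, p'), (i, p)]"
| zigzag_left: "elementary_isotopy n [(i + 1, Cap d), (i, Cup (opp d))] []"
| zigzag_right: "elementary_isotopy n [(i, Cap d), (i + 1, Cup (opp d))] []"
| turn: "p \<in> {Pos, Neg, Node Sink, Node Source} \<Longrightarrow>
    a = length (web_upper n p) \<Longrightarrow> b = length (web_lower n p) \<Longrightarrow>
    elementary_isotopy n (turn_clockwise a b p i) (turn_anticlockwise a b p i)"
| reidemeister_2: "(X, Y) \<in> {(Pos, Neg), (Neg, Pos)} \<Longrightarrow> elementary_isotopy n [(i, X), (i, Y)] []"
| reidemeister_2_up_down: "(X, Y) \<in> {(Pos, Neg), (Neg, Pos)} \<Longrightarrow>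
    elementary_isotopy n (leftward X i @ rightward Y i) []"
| reidemeister_2_down_up: "(X, Y) \<in> {(Pos, Neg), (Neg, Pos)} \<Longrightarrow>
    elementary_isotopy n (rightward X i @ leftward Y i) []"
| framed_reidemeister_1: "X \<in> {Pos, Neg} \<Longrightarrow> elementary_isotopy n (right_curl X i) (left_curl X i)"
| slide: "X \<in> {Pos, Neg} \<Longrightarrow> p \<in> {Pos, Neg, Node Sink, Node Source} \<Longrightarrow>
    a = length (web_upper n p) \<Longrightarrow> b = length (web_lower n p) \<Longrightarrow>
    elementary_isotopy n (pass X a i @ [(i, p)]) ((i + 1, p) # pass X b i)"

text \<open>
  Elementary isotopies are applied inside a closed diagram; requiring both diagrams to be closed
  forces the strands involved to have the right number and directions.
\<close>

inductive isotopy_step :: "nat \<Rightarrow> web \<Rightarrow> web \<Rightarrow> bool" for n :: nat where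
  "elementary_isotopy n a b \<Longrightarrow> u @ a @ v \<in> webs n \<Longrightarrow> u @ b @ v \<in> webs n \<Longrightarrow>
   isotopy_step n (u @ a @ v) (u @ b @ v)"

definition isotopic :: "nat \<Rightarrow> web \<Rightarrow> web \<Rightarrow> bool" where
  "isotopic n = equivclp (isotopy_step n)"

section \<open>The bracket of webs\<close>

definition quantum_int :: "'a::field \<Rightarrow> nat \<Rightarrow> 'a" where
  "quantum_int q k = (q powi int k - q powi (- int k)) / (q - inverse q)"

definition quantum_fact :: "'a::field \<Rightarrow> nat \<Rightarrow> 'a" where
  "quantum_fact q k = (\<Prod>i = 1..k. quantum_int q i)"

definition inversions :: "nat \<Rightarrow> (nat \<Rightarrow> nat) \<Rightarrow> nat" where
  "inversions n \<sigma> = card {(i, j). i < j \<and> j < n \<and> \<sigma> j < \<sigma> i}"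

text \<open>\<open>k\<close> stands for the crossing of the strands in the positions \<open>k\<close> and \<open>k + 1\<close>.\<close>

definition braid_permutation :: "nat list \<Rightarrow> nat \<Rightarrow> nat" where
  "braid_permutation ks = fold (\<lambda>k f. transpose k (Suc k) \<circ> f) ks id"

text \<open>All choices give isotopic braids.\<close>

definition positive_braid :: "nat \<Rightarrow> (nat \<Rightarrow> nat) \<Rightarrow> nat list" where
  "positive_braid n \<sigma> = (SOME ks. (\<forall>k\<in>set ks. Suc k < n) \<and>
     length ks = inversions n \<sigma> \<and> braid_permutation ks = \<sigma>)"

definition braid_word :: "nat \<Rightarrow> nat list \<Rightarrow> web" where
  "braid_word i ks = map (\<lambda>k. (i + k, Pos)) ks"

definition integral_laurent_polys :: "'a::field \<Rightarrow> 'a set" where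
  "integral_laurent_polys t =
     {\<Sum>k\<in>K. of_int (c k) * t powi k | (K :: int set) (c :: int \<Rightarrow> int). finite K}"

text \<open>Here \<open>t\<close> is \<open>q\<close> to the power \<open>1 / n\<close>.\<close>

definition is_web_bracket :: "nat \<Rightarrow> 'a::field \<Rightarrow> (web \<Rightarrow> 'a) \<Rightarrow> bool" where
  "is_web_bracket n t br \<longleftrightarrow> (let q = t ^ n in
     (\<forall>w\<in>webs n. br w \<in> integral_laurent_polys t) \<and>
     (\<forall>w\<in>webs n. \<forall>w'\<in>webs n. isotopic n w w' \<longrightarrow> br w = br w') \<and>
     (\<forall>u i v. u @ [(i, Pos)] @ v \<in> webs n \<longrightarrow>
        t * br (u @ [(i, Pos)] @ v) - inverse t * br (u @ [(i, Neg)] @ v)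
          = (q - inverse q) * br (u @ v)) \<and>
     (\<forall>u i v. \<forall>curl\<in>{right_curl, left_curl}. u @ v \<in> webs n \<longrightarrow>
        (u @ curl Pos i @ v \<in> webs n \<longrightarrow>
           br (u @ curl Pos i @ v) = t powi (int n * int n - 1) * br (u @ v)) \<and>
        (u @ curl Neg i @ v \<in> webs n \<longrightarrow>
           br (u @ curl Neg i @ v) = t powi (1 - int n * int n) * br (u @ v))) \<and>
     (\<forall>u i v. u @ [(i, Node Sink), (i, Node Source)] @ v \<in> webs n \<longrightarrow>
        br (u @ [(i, Node Sink), (i, Node Source)] @ v) =
          q ^ (n * (n - 1)) *
          (\<Sum>\<sigma> | \<sigma> permutes {..<n}. (- (t powi (1 - int n))) ^ inversions n \<sigma> *
             br (u @ braid_word i (positive_braid n \<sigma>) @ v))) \<and>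
     (\<forall>u i d v. u @ [(i, Cap d), (i, Cup d)] @ v \<in> webs n \<longrightarrow>
        br (u @ [(i, Cap d), (i, Cup d)] @ v) = quantum_int q n * br (u @ v)) \<and>
     br [] = 1)"

section \<open>Singular framed links\<close>

text \<open>A vertex is drawn with its incoming strands at the top and its outgoing strands at the bottom.\<close>

datatype link_node = Vertex

type_synonym singular_link = "(nat \<times> link_node piece) list"

definition singular_links :: "singular_link set" where
  "singular_links = {D. closes (upper (\<lambda>_. [Down, Down])) (lower (\<lambda>_. [Down, Down])) [] D}"

text \<open>
  The caps and cups are nested, so that, to the right of the sink and of the source, each of the bands
  \<open>3, \<dots>, n\<close> leaves the source downwards, turns up and arrives at the sink from above.
\<close>

definition vertex_web :: "nat \<Rightarrow> nat \<Rightarrow> web" where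
  "vertex_web n i =
     map (\<lambda>k. (i + k, Cap Down)) [2..<n] @ [(i, Node Sink), (i, Node Source)] @
     map (\<lambda>k. (i + k, Cup Down)) (rev [2..<n])"

fun web_of_piece :: "nat \<Rightarrow> nat \<times> link_node piece \<Rightarrow> web" where
  "web_of_piece n (i, Cap d) = [(i, Cap d)]"
| "web_of_piece n (i, Cup d) = [(i, Cup d)]"
| "web_of_piece n (i, Pos) = [(i, Pos)]"
| "web_of_piece n (i, Neg) = [(i, Neg)]"
| "web_of_piece n (i, Node Vertex) = vertex_web n i"

definition Psi :: "nat \<Rightarrow> singular_link \<Rightarrow> web" where
  "Psi n D = concat (map (web_of_piece n) D)"

definition number_of :: "link_node piece \<Rightarrow> singular_link \<Rightarrow> nat" where
  "number_of p D = length (filter (\<lambda>(i, p'). p' = p) D)"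

definition writhe :: "singular_link \<Rightarrow> int" where
  "writhe D = int (number_of Pos D) - int (number_of Neg D)"

definition singular_bracket :: "nat \<Rightarrow> 'a::field \<Rightarrow> (web \<Rightarrow> 'a) \<Rightarrow> singular_link \<Rightarrow> 'a" where
  "singular_bracket n t br D =
     br (Psi n D)
       * (quantum_fact (t ^ n) (n - 2) * (t ^ n) ^ (n * (n - 1) div 2)) powi (- int (number_of (Node Vertex) D))
       * t powi writhe D"

section \<open>The Murakami-Ohtsuki-Yamada bracket\<close>

text \<open>
  Strands carry a direction and the label of their edge.  \<open>Merge\<close> and \<open>Split\<close> are the \<open>3\<close>-valent
  vertices, drawn downwards.
\<close>

datatype graph_piece = GCap dir nat | GCup dir nat | GPos | GNeg | Merge | Split

type_synonym graph = "(nat \<times> graph_piece) list"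

fun graph_upper :: "graph_piece \<Rightarrow> (dir \<times> nat) list" where
  "graph_upper (GCap d e) = []"
| "graph_upper (GCup d e) = [(d, e), (opp d, e)]"
| "graph_upper GPos = [(Down, 1), (Down, 1)]"
| "graph_upper GNeg = [(Down, 1), (Down, 1)]"
| "graph_upper Merge = [(Down, 1), (Down, 1)]"
| "graph_upper Split = [(Down, 2)]"

fun graph_lower :: "graph_piece \<Rightarrow> (dir \<times> nat) list" where
  "graph_lower (GCap d e) = [(d, e), (opp d, e)]"
| "graph_lower (GCup d e) = []"
| "graph_lower GPos = [(Down, 1), (Down, 1)]"
| "graph_lower GNeg = [(Down, 1), (Down, 1)]"
| "graph_lower Merge = [(Down, 2)]"
| "graph_lower Split = [(Down, 1), (Down, 1)]"

definition graph_levels :: "graph \<Rightarrow> (dir \<times> nat) list list" where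
  "graph_levels G = levels graph_upper graph_lower [] G"

fun graph_of_piece :: "nat \<times> link_node piece \<Rightarrow> graph" where
  "graph_of_piece (i, Cap d) = [(i, GCap d 1)]"
| "graph_of_piece (i, Cup d) = [(i, GCup d 1)]"
| "graph_of_piece (i, Pos) = [(i, GPos)]"
| "graph_of_piece (i, Neg) = [(i, GNeg)]"
| "graph_of_piece (i, Node Vertex) = [(i, Merge), (i, Split)]"

definition Phi :: "singular_link \<Rightarrow> graph" where
  "Phi D = concat (map graph_of_piece D)"

text \<open>
  The horizontal lines cut the edges into segments: segment \<open>(k, j)\<close> is strand \<open>j\<close> on line \<open>k\<close>, and
  \<open>S ! k ! j\<close> is the subset that the state \<open>S\<close> assigns to the edge containing it.  The predicate
  \<open>state_across\<close> says that segments of the same edge get the same subset and that the subsets match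
  at the vertices.
\<close>

fun state_at :: "graph_piece \<Rightarrow> nat set list \<Rightarrow> nat set list \<Rightarrow> bool" where
  "state_at (GCap d e) X Y \<longleftrightarrow> X = [] \<and> (\<exists>s. Y = [s, s])"
| "state_at (GCup d e) X Y \<longleftrightarrow> (\<exists>s. X = [s, s]) \<and> Y = []"
| "state_at Merge X Y \<longleftrightarrow> (\<exists>s s'. X = [s, s'] \<and> Y = [s \<union> s'] \<and> s \<inter> s' = {})"
| "state_at Split X Y \<longleftrightarrow> (\<exists>s s'. X = [s \<union> s'] \<and> Y = [s, s'] \<and> s \<inter> s' = {})"
| "state_at _ X Y \<longleftrightarrow> False"

definition state_across :: "nat \<times> graph_piece \<Rightarrow> nat set list \<Rightarrow> nat set list \<Rightarrow> bool" where
  "state_across = (\<lambda>(i, p) A B. \<exists>P X Y Q. length P = i \<and> A = P @ X @ Q \<and> B = P @ Y @ Q \<and> state_at p X Y)"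

definition states :: "nat \<Rightarrow> graph \<Rightarrow> nat set list list set" where
  "states n G = {S.
     list_all2 (list_all2 (\<lambda>s (d, e). s \<subseteq> {1..n} \<and> card s = e)) S (graph_levels G) \<and>
     (\<forall>k<length G. state_across (G ! k) (S ! k) (S ! Suc k))}"

text \<open>Pairs of neighbouring segments in the slice of the piece \<open>(i, p)\<close> below line \<open>k\<close>.\<close>

definition adjacent_in_slice :: "nat \<Rightarrow> nat \<times> graph_piece \<Rightarrow> ((nat \<times> nat) \<times> (nat \<times> nat)) set" where
  "adjacent_in_slice k = (\<lambda>(i, p).
     {((k, j), (Suc k, j)) | j. j < i} \<union>
     {((k, i + length (graph_upper p) + j), (Suc k, i + length (graph_lower p) + j)) | j. True} \<union>
     (case p of
        GCap d e \<Rightarrow> {((Suc k, i), (Suc k, i + 1))}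
      | GCup d e \<Rightarrow> {((k, i), (k, i + 1))}
      | Merge \<Rightarrow> {((k, i), (Suc k, i)), ((k, i + 1), (Suc k, i))}
      | Split \<Rightarrow> {((k, i), (Suc k, i)), ((k, i), (Suc k, i + 1))}
      | _ \<Rightarrow> {}))"

definition adjacent :: "graph \<Rightarrow> ((nat \<times> nat) \<times> (nat \<times> nat)) set" where
  "adjacent G = (\<Union>k<length G. adjacent_in_slice k (G ! k))"

text \<open>The curves formed by the edges whose subset contains the label \<open>c\<close>, as sets of segments.\<close>

definition curves :: "graph \<Rightarrow> nat set list list \<Rightarrow> nat \<Rightarrow> (nat \<times> nat) set set" where
  "curves G S c =
     (let V = {(k, j). k < length S \<and> j < length (S ! k) \<and> c \<in> S ! k ! j};
          E = adjacent G \<inter> V \<times> V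
      in V // (E \<union> E\<inverse>)\<^sup>*)"

text \<open>
  A simple closed curve is anti-clockwise if and only if its leftmost strand on a horizontal line
  meeting it is directed downwards; the highest line is used here.
\<close>

definition rot_curve :: "graph \<Rightarrow> (nat \<times> nat) set \<Rightarrow> int" where
  "rot_curve G C =
     (let k = Min (fst ` C); j = Min {j. (k, j) \<in> C}
      in if fst (graph_levels G ! k ! j) = Down then 1 else -1)"

definition rot :: "nat \<Rightarrow> graph \<Rightarrow> nat set list list \<Rightarrow> rat" where
  "rot n G S = (\<Sum>c = 1..n. \<Sum>C\<in>curves G S c. (of_nat c - (of_nat n + 1) / 2) * of_int (rot_curve G C))"

definition pi_count :: "nat set \<Rightarrow> nat set \<Rightarrow> nat" where
  "pi_count A B = card {(a, b). a \<in> A \<and> b \<in> B \<and> a > b}"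

text \<open>
  As the edges at a vertex point downwards here, \<open>f\<^sub>1\<close>, which is on the left when they point upwards,
  is the right one of the two smaller edges in the word.
\<close>

fun vertex_exponent :: "nat \<times> graph_piece \<Rightarrow> nat set list \<Rightarrow> nat set list \<Rightarrow> rat" where
  "vertex_exponent (i, Merge) A B =
     of_nat (card (A ! (i + 1)) * card (A ! i)) / 4 - of_nat (pi_count (A ! (i + 1)) (A ! i)) / 2"
| "vertex_exponent (i, Split) A B =
     of_nat (card (B ! (i + 1)) * card (B ! i)) / 4 - of_nat (pi_count (B ! (i + 1)) (B ! i)) / 2"
| "vertex_exponent (i, p) A B = 0"

text \<open>
  The variable \<open>q\<^sub>M\<close> is represented by its fourth root \<open>r\<close>; \<open>quarter_power r x\<close> is \<open>q\<^sub>M\<close> to the power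
  \<open>x\<close>, for a multiple \<open>x\<close> of \<open>1 / 4\<close>.
\<close>

definition quarter_power :: "'a::field \<Rightarrow> rat \<Rightarrow> 'a" where
  "quarter_power r x = r powi \<lfloor>4 * x\<rfloor>"

definition planar_bracket :: "nat \<Rightarrow> 'a::field \<Rightarrow> graph \<Rightarrow> 'a" where
  "planar_bracket n r G =
     (\<Sum>S\<in>states n G. quarter_power r (rot n G S) *
        (\<Prod>k<length G. quarter_power r (vertex_exponent (G ! k) (S ! k) (S ! Suc k))))"

text \<open>In \<open>resolve n r G H\<close> the part \<open>G\<close> of the diagram has already been freed of crossings.\<close>

fun resolve :: "nat \<Rightarrow> 'a::field \<Rightarrow> graph \<Rightarrow> graph \<Rightarrow> 'a" where
  "resolve n r G [] = planar_bracket n r G"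
| "resolve n r G ((i, GPos) # H) =
     quarter_power r (1 / 2) * resolve n r G H - resolve n r (G @ [(i, Merge), (i, Split)]) H"
| "resolve n r G ((i, GNeg) # H) =
     quarter_power r (- 1 / 2) * resolve n r G H - resolve n r (G @ [(i, Merge), (i, Split)]) H"
| "resolve n r G (x # H) = resolve n r (G @ [x]) H"

definition moy_bracket :: "nat \<Rightarrow> 'a::field \<Rightarrow> graph \<Rightarrow> 'a" where
  "moy_bracket n r G = resolve n r [] G"

end

theory Submission
  imports Defs
begin

text \<open>
  Partially closing the quantum antisymmetrizer of \<open>n\<close> strands on its last \<open>n - 2\<close> strands shows that
  the bracket of the web of a vertex is \<open>[n - 2]! q\<^bsup>n(n-1)/2\<^esup>\<close> times \<open>q\<close> times the smoothing minus
  the (renormalized) positive crossing. On the other side, \<open>W\<close> is by definition of the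
  Murakami--Ohtsuki--Yamada bracket \<open>q\<close> times the smoothing minus the positive crossing. So it suffices to
  compare the two brackets on links without vertices.

  There the Murakami--Ohtsuki--Yamada bracket is the state sum of an \<open>R\<close>-matrix: each cap and cup
  of a closed curve contributes half a turn to its rotation number, so that \<open>rot(s)\<close> splits into local
  contributions. This state sum and the web bracket corrected by the writhe have the same behaviour
  under isotopies, curls, the skein relation and the addition of circles, which determines
  them: a link becomes a closed braid after its upward strands are moved to the right of the downward
  ones, and the Hecke algebra is spanned by braid words with at most one last generator, so the
  last strand can be removed by a Markov move or as a circle.
\<close>

section \<open>Typed words\<close>

text \<open>Rule (1), rewritten for \<open>t\<close> times a positive crossing, where
  \<open>t\<close> is \<open>q\<close> to the power \<open>1 / n\<close>, becomes the quadratic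
  relation of the Hecke algebra with the eigenvalues \<open>q\<close> and \<open>- 1 / q\<close>.
  The coefficient in rule (3) is \<open>- 1 / q\<close> times \<open>t\<close>, which is why that
  rule inserts an antisymmetrizer. The bracket is an arbitrary function satisfying the axioms, and
  its invariance concerns closed words only. Local arguments therefore go through a typed equality
  of tangles, tested in every closed diagram, and uniqueness is phrased as a closure property of the
  set of links on which two invariants agree. Two obstacles shape the rest. The braid of a
  permutation in rule (3) is an arbitrary choice, so reduced words of one permutation have to be
  shown equal as braids. Rotation numbers are defined through equivalence classes of segments and
  have to be computed by sweeping the diagram from top to bottom while open arcs merge.\<close>

fun arr :: "nat \<Rightarrow> dir list \<Rightarrow> web \<Rightarrow> dir list \<Rightarrow> bool" where
  "arr n xs [] ys \<longleftrightarrow> xs = ys"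
| "arr n xs ((i, p) # w) ys \<longleftrightarrow>
     i + length (web_upper n p) \<le> length xs \<and>
     take (length (web_upper n p)) (drop i xs) = web_upper n p \<and>
     arr n (replace_at i (length (web_upper n p)) (web_lower n p) xs) w ys"

lemma closes_iff_arr: "closes (web_upper n) (web_lower n) xs w \<longleftrightarrow> arr n xs w []"
  by (induction "web_upper n" "web_lower n" xs w rule: closes.induct) auto

lemma webs_iff_arr: "w \<in> webs n \<longleftrightarrow> arr n [] w []"
  by (simp add: webs_def closes_iff_arr)

lemma arr_append: "arr n xs (a @ b) zs \<longleftrightarrow> (\<exists>ys. arr n xs a ys \<and> arr n ys b zs)"
  by (induction n xs a zs rule: arr.induct) auto

lemma arr_appendI: "arr n xs a ys \<Longrightarrow> arr n ys b zs \<Longrightarrow> arr n xs (a @ b) zs"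
  by (auto simp: arr_append)

lemma arr_unique: "arr n xs a ys \<Longrightarrow> arr n xs a zs \<Longrightarrow> ys = zs"
  by (induction n xs a ys rule: arr.induct) auto

lemma take_drop_eqD:
  assumes "i + length U \<le> length xs" "take (length U) (drop i xs) = U"
  shows "xs = take i xs @ U @ drop (i + length U) xs"
  by (metis append_take_drop_id assms(2) drop_drop add.commute)

text \<open>Explicit parts \<open>P\<close> and \<open>Q\<close> instead of \<open>take\<close> and
  \<open>drop\<close>; the inductions over typed words use this form.\<close>

lemma arr_Cons_iff:
  "arr n xs ((i, p) # w) ys \<longleftrightarrow>
     (\<exists>P Q. length P = i \<and> xs = P @ web_upper n p @ Q \<and> arr n (P @ web_lower n p @ Q) w ys)"
  (is "?L \<longleftrightarrow> ?R")
proof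
  assume ?L
  then have "xs = take i xs @ web_upper n p @ drop (i + length (web_upper n p)) xs"
    using take_drop_eqD by auto
  with \<open>?L\<close> show ?R
    by (intro exI[of _ "take i xs"] exI[of _ "drop (i + length (web_upper n p)) xs"])
      (auto simp: replace_at_def)
qed (auto simp: replace_at_def)

lemma arr_single:
  "i = length P \<Longrightarrow> xs = P @ web_upper n p @ Q \<Longrightarrow> ys = P @ web_lower n p @ Q \<Longrightarrow> arr n xs [(i, p)] ys"
  by (simp add: replace_at_def)

lemma arr_singleI: "arr n (P @ web_upper n p @ Q) [(length P, p)] (P @ web_lower n p @ Q)"
  by (simp add: replace_at_def)

text \<open>Juxtaposition with \<open>k\<close> vertical strands on the left; strands added on the
  right do not change a word at all.\<close>

definition shift :: "nat \<Rightarrow> (nat \<times> 'p) list \<Rightarrow> (nat \<times> 'p) list" where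
  "shift k = map (\<lambda>(i, p). (k + i, p))"

lemma shift_simps [simp]:
  "shift k [] = []"
  "shift k ((i, p) # w) = (k + i, p) # shift k w"
  "shift k (a @ b) = shift k a @ shift k b"
  "shift k (shift l w) = shift (k + l) w"
  "shift 0 w = w"
  by (auto simp: shift_def)

lemma arr_context:
  "arr n xs w ys \<Longrightarrow> arr n (P @ xs @ Q) (shift (length P) w) (P @ ys @ Q)"
proof (induction w arbitrary: xs)
  case (Cons x w)
  obtain i p where x: "x = (i, p)" by force
  with Cons.prems obtain A B where AB: "length A = i" "xs = A @ web_upper n p @ B"
    "arr n (A @ web_lower n p @ B) w ys" unfolding arr_Cons_iff x by blast
  have "arr n (P @ (A @ web_lower n p @ B) @ Q) (shift (length P) w) (P @ ys @ Q)"
    by (rule Cons.IH[OF AB(3)])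
  then have "arr n (P @ xs @ Q) ((length P + i, p) # shift (length P) w) (P @ ys @ Q)"
    unfolding arr_Cons_iff AB(2)
    by (intro exI[of _ "P @ A"] exI[of _ "B @ Q"]) (simp add: AB(1))
  then show ?case by (simp add: x)
qed simp

lemma arr_right: "arr n xs w ys \<Longrightarrow> arr n (xs @ Q) w (ys @ Q)"
  using arr_context[of n xs w ys "[]" Q] by simp

lemma arr_left: "arr n xs w ys \<Longrightarrow> arr n (P @ xs) (shift (length P) w) (P @ ys)"
  using arr_context[of n xs w ys P "[]"] by simp

text \<open>Words without discs are ordinary framed tangles. Isotopies are applied to such parts
  only, while discs may remain in the rest of the diagram.\<close>

definition plain :: "web \<Rightarrow> bool" where
  "plain w \<longleftrightarrow> (\<forall>i v. (i, Node v) \<notin> set w)"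

lemma plain_simps [simp]:
  "plain []"
  "plain (x # w) \<longleftrightarrow> (\<forall>v. snd x \<noteq> Node v) \<and> plain w"
  "plain (a @ b) \<longleftrightarrow> plain a \<and> plain b"
  by (cases x; force simp: plain_def)+

lemma plain_shift [simp]: "plain (shift k w) \<longleftrightarrow> plain w"
  by (induction w) auto

text \<open>The moves of disc-free diagrams on which everything below is based. The list is kept
  short, as each rule has to be verified for the state sum. Without discs the widths of the pieces
  do not depend on \<open>n\<close>, hence the \<open>0\<close> in the exchange rule.\<close>

inductive link_isotopy :: "web \<Rightarrow> web \<Rightarrow> bool" where
  exchange: "\<forall>v. p \<noteq> Node v \<Longrightarrow> \<forall>v. p' \<noteq> Node v \<Longrightarrow>
    l = length (web_lower 0 p) \<Longrightarrow> m = length (web_upper 0 p) \<Longrightarrow>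
    link_isotopy [(i, p), (i + l + k, p')] [(i + m + k, p'), (i, p)]"
| zigzag_left: "link_isotopy [(i + 1, Cap d), (i, Cup (opp d))] []"
| zigzag_right: "link_isotopy [(i, Cap d), (i + 1, Cup (opp d))] []"
| turn: "link_isotopy (turn_clockwise 2 2 Pos i) (turn_anticlockwise 2 2 Pos i)"
| reidemeister_2: "(X, Y) \<in> {(Pos, Neg), (Neg, Pos)} \<Longrightarrow> link_isotopy [(i, X), (i, Y)] []"
| reidemeister_2_up_down: "link_isotopy (leftward Neg i @ rightward Pos i) []"
| slide: "link_isotopy [(i, Pos), (i + 1, Pos), (i, Pos)] [(i + 1, Pos), (i, Pos), (i + 1, Pos)]"

lemma web_upper_plain:
  "web_upper n (Cap d) = []" "web_upper n (Cup d) = [d, opp d]"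
  "web_upper n Pos = [Down, Down]" "web_upper n Neg = [Down, Down]"
  "web_lower n (Cap d) = [d, opp d]" "web_lower n (Cup d) = []"
  "web_lower n Pos = [Down, Down]" "web_lower n Neg = [Down, Down]"
  by (simp_all add: web_upper_def web_lower_def)

lemma web_upper_indep:
  assumes "\<forall>v. p \<noteq> Node v"
  shows "web_upper n p = web_upper m p" "web_lower n p = web_lower m p"
  using assms by (cases p; simp add: web_upper_plain)+

lemma opp_opp [simp]: "opp (opp d) = d"
  by (cases d) auto

lemma link_isotopy_elementary: "link_isotopy a b \<Longrightarrow> elementary_isotopy n a b"
proof (induction rule: link_isotopy.induct)
  case (exchange p p' l m i k)
  then show ?case
    using elementary_isotopy.exchange[of n i p k p'] web_upper_indep[of p n 0] by simp
next
  case (turn i)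
  show ?case using elementary_isotopy.turn[of Pos 2 n 2 i] by (simp add: web_upper_plain)
next
  case (slide i)
  show ?case using elementary_isotopy.slide[of Pos Pos 2 n 2 i]
    by (simp add: web_upper_plain pass_def upt_rec)
next
  case (zigzag_left i d)
  show ?case by (rule elementary_isotopy.zigzag_left)
next
  case (zigzag_right i d)
  show ?case by (rule elementary_isotopy.zigzag_right)
qed (auto intro: elementary_isotopy.intros)

lemma link_isotopy_shift: "link_isotopy a b \<Longrightarrow> link_isotopy (shift c a) (shift c b)"
proof (induction rule: link_isotopy.induct)
  case (exchange p p' l m i k)
  then show ?case
    using link_isotopy.exchange[of p p' l m "c + i" k] by (simp add: add.assoc)
next
  case (zigzag_left i d)
  show ?case using link_isotopy.zigzag_left[of "c + i" d] by (simp)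
next
  case (zigzag_right i d)
  show ?case using link_isotopy.zigzag_right[of "c + i" d] by (simp)
next
  case (turn i)
  show ?case using link_isotopy.turn[of "c + i"]
    by (simp add: turn_clockwise_def turn_anticlockwise_def numeral_2_eq_2)
next
  case (reidemeister_2 X Y i)
  then show ?case using link_isotopy.reidemeister_2[of X Y "c + i"] by simp
next
  case (reidemeister_2_up_down i)
  then show ?case using link_isotopy.reidemeister_2_up_down[of "c + i"]
    by (simp add: leftward_def rightward_def)
next
  case (slide i)
  show ?case using link_isotopy.slide[of "c + i"] by simp
qed

section \<open>Equality of tangles in all contexts\<close>

text \<open>\<open>R\<close> is abstract since it has two kinds of instances: equality of brackets,
  and \<open>w \<in> Z \<longleftrightarrow> w' \<in> Z\<close> for a set \<open>Z\<close> of
  words.\<close>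

locale tangle_relation =
  fixes n :: nat and R :: "web \<Rightarrow> web \<Rightarrow> bool"
  assumes R_refl: "R w w"
    and R_sym: "R w w' \<Longrightarrow> R w' w"
    and R_trans: "R w w' \<Longrightarrow> R w' w'' \<Longrightarrow> R w w''"
    and R_isotopy: "link_isotopy a b \<Longrightarrow> u @ a @ v \<in> webs n \<Longrightarrow> u @ b @ v \<in> webs n \<Longrightarrow>
      R (u @ a @ v) (u @ b @ v)"
begin

abbreviation ar :: "dir list \<Rightarrow> web \<Rightarrow> dir list \<Rightarrow> bool" where
  "ar \<equiv> arr n"

text \<open>Equality of tangles with fixed boundaries, tested in all closed diagrams and between
  arbitrary further strands. Quantifying over the contexts makes it a congruence for vertical and
  horizontal composition, although \<open>R\<close> speaks of closed words only.\<close>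

definition teq :: "dir list \<Rightarrow> web \<Rightarrow> web \<Rightarrow> dir list \<Rightarrow> bool" where
  "teq xs a b ys \<longleftrightarrow> ar xs a ys \<and> ar xs b ys \<and>
     (\<forall>P Q u v. ar [] u (P @ xs @ Q) \<longrightarrow> ar (P @ ys @ Q) v [] \<longrightarrow>
        R (u @ shift (length P) a @ v) (u @ shift (length P) b @ v))"

lemma teqD:
  "teq xs a b ys \<Longrightarrow> ar xs a ys" "teq xs a b ys \<Longrightarrow> ar xs b ys"
  "teq xs a b ys \<Longrightarrow> ar [] u xs \<Longrightarrow> ar ys v [] \<Longrightarrow> R (u @ a @ v) (u @ b @ v)"
  unfolding teq_def by (blast, blast) (metis append_Nil append_Nil2 length_0_conv shift_simps(5))

lemma teq_refl: "ar xs a ys \<Longrightarrow> teq xs a a ys"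
  by (simp add: teq_def R_refl)

lemma teq_sym: "teq xs a b ys \<Longrightarrow> teq xs b a ys"
  unfolding teq_def using R_sym by blast

lemma teq_trans [trans]: "teq xs a b ys \<Longrightarrow> teq xs b c ys \<Longrightarrow> teq xs a c ys"
  unfolding teq_def using R_trans by blast

lemma teq_context:
  assumes "teq xs a b ys"
  shows "teq (P @ xs @ Q) (shift (length P) a) (shift (length P) b) (P @ ys @ Q)"
proof -
  have "R (u @ shift (length P' + length P) a @ v) (u @ shift (length P' + length P) b @ v)"
    if "ar [] u (P' @ (P @ xs @ Q) @ Q')" "ar (P' @ (P @ ys @ Q) @ Q') v []" for P' Q' u v
    using assms that unfolding teq_def
    by (metis (no_types, lifting) append.assoc length_append)
  then show ?thesis
    using assms by (auto simp: teq_def intro: arr_context)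
qed

lemma teq_right: "teq xs a b ys \<Longrightarrow> teq (xs @ Q) a b (ys @ Q)"
  using teq_context[of xs a b ys "[]" Q] by simp

lemma teq_left: "teq xs a b ys \<Longrightarrow> teq (P @ xs) (shift (length P) a) (shift (length P) b) (P @ ys)"
  using teq_context[of xs a b ys P "[]"] by simp

lemma teq_append:
  assumes "teq xs a a' ys" "teq ys b b' zs"
  shows "teq xs (a @ b) (a' @ b') zs"
proof -
  have R: "R (u @ shift (length P) (a @ b) @ v) (u @ shift (length P) (a' @ b') @ v)"
    if u: "ar [] u (P @ xs @ Q)" and v: "ar (P @ zs @ Q) v []" for P Q u v
  proof -
    have 1: "ar (P @ ys @ Q) (shift (length P) b @ v) []"
      using arr_context teqD(1)[OF assms(2)] v arr_appendI by blast
    have 2: "ar [] (u @ shift (length P) a') (P @ ys @ Q)"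
      using arr_context teqD(2)[OF assms(1)] u arr_appendI by blast
    have "R (u @ shift (length P) a @ (shift (length P) b @ v)) (u @ shift (length P) a' @ (shift (length P) b @ v))"
      using assms(1) u 1 unfolding teq_def by blast
    moreover have "R ((u @ shift (length P) a') @ shift (length P) b @ v) ((u @ shift (length P) a') @ shift (length P) b' @ v)"
      using assms(2) 2 v unfolding teq_def by blast
    ultimately show ?thesis using R_trans by auto
  qed
  have "ar xs (a @ b) zs" "ar xs (a' @ b') zs"
    using assms teqD(1,2) by (blast intro: arr_appendI)+
  with R show ?thesis by (auto simp: teq_def)
qed

lemma teq_append_left: "ar xs a ys \<Longrightarrow> teq ys b b' zs \<Longrightarrow> teq xs (a @ b) (a @ b') zs"
  by (blast intro: teq_append teq_refl)

lemma teq_append_right: "teq xs a a' ys \<Longrightarrow> ar ys b zs \<Longrightarrow> teq xs (a @ b) (a' @ b) zs"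
  by (blast intro: teq_append teq_refl)

text \<open>Placing a move between further strands is a shift, and \<open>link_isotopy\<close> is
  stable under shifts.\<close>

lemma teqI:
  assumes "link_isotopy a b" "ar xs a ys" "ar xs b ys"
  shows "teq xs a b ys"
proof -
  have "R (u @ shift (length P) a @ v) (u @ shift (length P) b @ v)"
    if u: "ar [] u (P @ xs @ Q)" and v: "ar (P @ ys @ Q) v []" for P Q u v
    using assms u v arr_context[of n xs _ ys P Q]
    by (intro R_isotopy link_isotopy_shift) (auto simp: webs_iff_arr intro!: arr_appendI)
  with assms show ?thesis by (auto simp: teq_def)
qed

lemma teq_step:
  assumes "link_isotopy a b" "ar xs (c @ a @ d) ys" "ar xs (c @ b @ d) ys"
  shows "teq xs (c @ a @ d) (c @ b @ d) ys"
proof -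
  obtain us vs where 1: "ar xs c us" "ar us a vs" "ar vs d ys"
    using assms(2) by (auto simp: arr_append)
  moreover obtain ws where 2: "ar us b ws" "ar ws d ys"
    using assms(3) 1(1) by (auto simp: arr_append dest: arr_unique)
  have "R (u @ shift (length P) (c @ a @ d) @ v) (u @ shift (length P) (c @ b @ d) @ v)"
    if u: "ar [] u (P @ xs @ Q)" and v: "ar (P @ ys @ Q) v []" for P Q u v
    using R_isotopy[of "shift (length P) a" "shift (length P) b" "u @ shift (length P) c" "shift (length P) d @ v"]
      assms u v arr_context[OF assms(2), of P Q] arr_context[OF assms(3), of P Q]
    by (simp add: webs_iff_arr link_isotopy_shift arr_append) metis
  with assms show ?thesis by (auto simp: teq_def)
qed

lemma teq_exchange_piece:
  assumes "\<forall>v. p \<noteq> Node v" "\<forall>v. p' \<noteq> Node v"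
  shows "teq (P @ web_upper n p @ K @ web_upper n p' @ Q)
     [(length P, p), (length P + length (web_lower n p) + length K, p')]
     [(length P + length (web_upper n p) + length K, p'), (length P, p)]
     (P @ web_lower n p @ K @ web_lower n p' @ Q)"
proof (rule teqI)
  show "link_isotopy
     [(length P, p), (length P + length (web_lower n p) + length K, p')]
     [(length P + length (web_upper n p) + length K, p'), (length P, p)]"
    using assms by (intro link_isotopy.exchange) (simp_all add: web_upper_indep[of _ n 0])
next
  show "ar (P @ web_upper n p @ K @ web_upper n p' @ Q)
     [(length P, p), (length P + length (web_lower n p) + length K, p')]
     (P @ web_lower n p @ K @ web_lower n p' @ Q)"
    using arr_appendI[OF arr_singleI[of n P p "K @ web_upper n p' @ Q"]
      arr_single[of _ "P @ web_lower n p @ K" _ n p' Q]] by (simp add: add.assoc del: arr.simps)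
next
  show "ar (P @ web_upper n p @ K @ web_upper n p' @ Q)
     [(length P + length (web_upper n p) + length K, p'), (length P, p)]
     (P @ web_lower n p @ K @ web_lower n p' @ Q)"
    using arr_appendI[OF arr_single[of _ "P @ web_upper n p @ K" _ n p' Q]
      arr_singleI[of n P p "K @ web_lower n p' @ Q"]] by (simp add: add.assoc del: arr.simps)
qed

lemma teq_exchange_one:
  assumes "plain b" "\<forall>v. p \<noteq> Node v" "ar xs' b ys'"
  shows "teq (P @ web_upper n p @ Q @ xs')
     ([(length P, p)] @ shift (length (P @ web_lower n p @ Q)) b)
     (shift (length (P @ web_upper n p @ Q)) b @ [(length P, p)])
     (P @ web_lower n p @ Q @ ys')"
  using assms(1,3)
proof (induction b arbitrary: xs')
  case Nil
  then show ?case by (auto simp: replace_at_def intro: teq_refl)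
next
  case (Cons x b)
  obtain j p' where x: "x = (j, p')" by force
  obtain A B where AB: "length A = j" "xs' = A @ web_upper n p' @ B"
    "ar (A @ web_lower n p' @ B) b ys'"
    using Cons.prems unfolding x arr_Cons_iff by blast
  have 1: "teq (P @ web_upper n p @ (Q @ A) @ web_upper n p' @ B)
     [(length P, p), (length P + length (web_lower n p) + length (Q @ A), p')]
     [(length P + length (web_upper n p) + length (Q @ A), p'), (length P, p)]
     (P @ web_lower n p @ (Q @ A) @ web_lower n p' @ B)"
    using Cons.prems x by (intro teq_exchange_piece assms) auto
  have "ar (P @ web_lower n p @ (Q @ A) @ web_lower n p' @ B)
     (shift (length (P @ web_lower n p @ Q)) b) (P @ web_lower n p @ Q @ ys')"
    using arr_left[OF AB(3), of "P @ web_lower n p @ Q"] by simp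
  from teq_append_right[OF 1 this]
  have *: "teq (P @ web_upper n p @ (Q @ A) @ web_upper n p' @ B)
     ([(length P, p), (length P + length (web_lower n p) + length (Q @ A), p')] @ shift (length (P @ web_lower n p @ Q)) b)
     ([(length P + length (web_upper n p) + length (Q @ A), p'), (length P, p)] @ shift (length (P @ web_lower n p @ Q)) b)
     (P @ web_lower n p @ Q @ ys')" .
  have 2: "teq (P @ web_upper n p @ Q @ A @ web_lower n p' @ B)
     ([(length P, p)] @ shift (length (P @ web_lower n p @ Q)) b)
     (shift (length (P @ web_upper n p @ Q)) b @ [(length P, p)])
     (P @ web_lower n p @ Q @ ys')"
    using Cons.IH[OF _ AB(3)] Cons.prems by simp
  have "ar (P @ web_upper n p @ (Q @ A) @ web_upper n p' @ B)
     [(length P + length (web_upper n p) + length (Q @ A), p')]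
     (P @ web_upper n p @ (Q @ A) @ web_lower n p' @ B)"
    using arr_singleI[of n "P @ web_upper n p @ (Q @ A)" p' B] by (simp add: add.assoc)
  from teq_append_left[OF this] 2
  have "teq (P @ web_upper n p @ (Q @ A) @ web_upper n p' @ B)
     ([(length P + length (web_upper n p) + length (Q @ A), p')] @ [(length P, p)] @ shift (length (P @ web_lower n p @ Q)) b)
     ([(length P + length (web_upper n p) + length (Q @ A), p')] @ shift (length (P @ web_upper n p @ Q)) b @ [(length P, p)])
     (P @ web_lower n p @ Q @ ys')" by simp
  then have "teq (P @ web_upper n p @ (Q @ A) @ web_upper n p' @ B)
     ([(length P + length (web_upper n p) + length (Q @ A), p'), (length P, p)] @ shift (length (P @ web_lower n p @ Q)) b)
     ([(length P + length (web_upper n p) + length (Q @ A), p')] @ shift (length (P @ web_upper n p @ Q)) b @ [(length P, p)])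
     (P @ web_lower n p @ Q @ ys')" by simp
  from teq_trans[OF * this] show ?case
    by (simp add: x AB add.assoc)
qed

text \<open>The interchange law of a monoidal category. Two inductions reduce it to single pieces:
  one over the right tangle with a single piece on the left, then one over the left tangle.\<close>

lemma teq_exchange:
  assumes "plain a" "plain b" "ar xs a ys" "ar xs' b ys'"
  shows "teq (xs @ xs') (a @ shift (length ys) b) (shift (length xs) b @ a) (ys @ ys')"
  using assms(1,3)
proof (induction a arbitrary: xs)
  case Nil
  then show ?case using arr_left[OF assms(4), of ys] by (auto intro: teq_refl)
next
  case (Cons x a)
  obtain i p where x: "x = (i, p)" by force
  obtain A B where AB: "length A = i" "xs = A @ web_upper n p @ B"
    "ar (A @ web_lower n p @ B) a ys"
    using Cons.prems unfolding x arr_Cons_iff by blast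
  have 1: "teq ((A @ web_lower n p @ B) @ xs') (a @ shift (length ys) b) (shift (length (A @ web_lower n p @ B)) b @ a) (ys @ ys')"
    by (rule Cons.IH[OF _ AB(3)]) (use Cons.prems in simp)
  have 2: "ar (xs @ xs') [(i, p)] ((A @ web_lower n p @ B) @ xs')"
    using arr_singleI[of n A p "B @ xs'"] AB by simp
  have 3: "teq (A @ web_upper n p @ B @ xs')
     ([(length A, p)] @ shift (length (A @ web_lower n p @ B)) b)
     (shift (length (A @ web_upper n p @ B)) b @ [(length A, p)])
     (A @ web_lower n p @ B @ ys')"
    using Cons.prems x by (intro teq_exchange_one assms) auto
  have 4: "ar (A @ web_lower n p @ B @ ys') a (ys @ ys')"
    using arr_right[OF AB(3), of ys'] by simp
  show ?case
    using teq_trans[OF teq_append_left[OF 2 1]] teq_append_right[OF 3 4] AB x by simp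
qed

end

section \<open>Elementary moves of oriented tangles\<close>

context tangle_relation
begin

lemmas eval = web_upper_plain replace_at_def leftward_def rightward_def right_curl_def left_curl_def
  turn_clockwise_def turn_anticlockwise_def numeral_2_eq_2

lemma teq_move:
  assumes "link_isotopy a b" "w = c @ a @ d" "w' = c @ b @ d" "ar xs w ys" "ar xs w' ys"
  shows "teq xs w w' ys"
  using teq_step[of a b xs c d ys] assms by simp

lemma teq_zigzag_left:
  assumes "w = c @ [(Suc i, Cap d), (i, Cup (opp d))] @ e" "w' = c @ e" "ar xs w ys" "ar xs w' ys"
  shows "teq xs w w' ys"
  using teq_move[OF link_isotopy.zigzag_left[of i d], of w c e w'] assms by simp

lemma teq_zigzag_right:
  assumes "w = c @ [(i, Cap d), (Suc i, Cup (opp d))] @ e" "w' = c @ e" "ar xs w ys" "ar xs w' ys"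
  shows "teq xs w w' ys"
  using teq_move[OF link_isotopy.zigzag_right[of i d], of w c e w'] assms by simp

text \<open>The interchange law inside a longer word. The proofs below are chains of explicit words,
  in which \<open>c\<close> and \<open>d\<close> are the untouched parts and \<open>a\<close> is the
  tangle on the left.\<close>

lemma teq_exch:
  fixes a b c d :: web
  assumes "w = c @ a @ shift (length ys) b @ d" "w' = c @ shift (length xs) b @ a @ d"
    "plain a" "plain b" "ar xs a ys" "ar xs' b ys'"
    "ar zs c (xs @ xs')" "ar (ys @ ys') d zs'"
  shows "teq zs w w' zs'"
  using teq_append_left[OF assms(7) teq_append_right[OF teq_exchange[OF assms(3-6)] assms(8)]] assms(1,2)
  by simp

lemma teq_in:
  assumes "teq xs a b ys" "w = c @ shift (length P) a @ d" "w' = c @ shift (length P) b @ d"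
    "ar zs c (P @ xs @ Q)" "ar (P @ ys @ Q) d zs'"
  shows "teq zs w w' zs'"
  using teq_append_left[OF assms(4) teq_append_right[OF teq_context[OF assms(1), of P Q] assms(5)]] assms(2,3)
  by simp

text \<open>Read downwards, an upward strand moves from the right of a downward strand to its left;
  it is the lower one of the two at the crossing.\<close>

abbreviation (input) rw :: "nat \<Rightarrow> web" where "rw \<equiv> rightward Pos"

lemma leftward_rightward: "teq [Up, Down] (leftward Neg 0 @ rw 0) [] [Up, Down]"
  by (rule teqI[OF link_isotopy.reidemeister_2_up_down]) (simp_all add: eval)

lemma pos_neg: "teq [Down, Down] [(0, Pos), (0, Neg)] [] [Down, Down]"
  by (rule teqI[OF link_isotopy.reidemeister_2]) (simp_all add: eval)

lemma neg_pos: "teq [Down, Down] [(0, Neg), (0, Pos)] [] [Down, Down]"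
  by (rule teqI[OF link_isotopy.reidemeister_2]) (simp_all add: eval)

lemma braid_relation:
  "teq [Down, Down, Down] [(0, Pos), (1, Pos), (0, Pos)] [(1, Pos), (0, Pos), (1, Pos)] [Down, Down, Down]"
  by (rule teqI) (use link_isotopy.slide[of 0] in \<open>simp_all add: eval\<close>)

lemma turn_crossing: "teq [Up, Up] (turn_clockwise 2 2 Pos 0) (turn_anticlockwise 2 2 Pos 0) [Up, Up]"
  by (rule teqI[OF link_isotopy.turn]) (simp_all add: eval)

text \<open>Below the cap a second Reidemeister move is inserted between the upward strand and the
  left leg. Its first half, together with a zigzag that makes room for a cap on the left, becomes a
  crossing of two upward strands.\<close>

lemma up_past_cap:
  "teq [Up] [(1, Cap Down)] ([(0, Cap Down)] @ turn_clockwise 2 2 Neg 1 @ rw 0) [Up, Down, Up]"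
proof -
  let ?b = "[(1, Cap Down), (2, Cap Down), (1, Neg), (0, Cup Up)] :: web"
  have "teq [Up] ([(0, Cap Down)] @ turn_clockwise 2 2 Neg 1 @ rw 0)
      (?b @ [(0, Cap Down), (1, Cup Up)] @ rw 0) [Up, Down, Up]"
    by (rule teq_exch[of _ "[]" "[(0, Cap Down)]" "[Down, Up]" ?b "[(1, Cup Up)] @ rw 0" _ "[]" "[Up]" "[Down, Up, Up]"])
      (simp_all add: eval)
  also have "teq [Up] (?b @ [(0, Cap Down), (1, Cup Up)] @ rw 0) (?b @ rw 0) [Up, Down, Up]"
    by (rule teq_zigzag_right[of _ ?b 0 Down "rw 0"]) (simp_all add: eval)
  also have "teq [Up] (?b @ rw 0) [(1, Cap Down)] [Up, Down, Up]"
    by (rule teq_in[OF leftward_rightward, of _ "[(1, Cap Down)]" "[]" "[]" _ _ "[Up]"]) (simp_all add: eval)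
  finally show ?thesis by (rule teq_sym)
qed

text \<open>The counterpart for cups. The crossing of upward strands appears turned anticlockwise
  here; \<open>turn_crossing\<close> brings it into the clockwise form used for sorted
  words.\<close>

lemma up_past_cup:
  "teq [Down, Up, Up] (rw 0 @ [(1, Cup Down)]) (turn_anticlockwise 2 2 Pos 1 @ [(0, Cup Down)]) [Up]"
proof -
  let ?b = "[(0, Cap Up), (1, Pos), (2, Cup Down), (1, Cup Down)] :: web"
  have "teq [Down, Up, Up] ([(1, Cap Up), (0, Cup Down)] @ ?b) (turn_anticlockwise 2 2 Pos 1 @ [(0, Cup Down)]) [Up]"
    by (rule teq_exch[of _ "[(1, Cap Up)]" "[(0, Cup Down)]" "[]" ?b "[]" _ "[Down, Up]" "[Down, Up, Up]" "[Up]"])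
      (simp_all add: eval)
  moreover have "teq [Down, Up, Up] ([(1, Cap Up), (0, Cup Down)] @ ?b) ?b [Up]"
    by (rule teq_zigzag_left[of _ "[]" 0 Up]) (simp_all add: eval)
  ultimately have "teq [Down, Up, Up] ?b (turn_anticlockwise 2 2 Pos 1 @ [(0, Cup Down)]) [Up]"
    using teq_sym teq_trans by blast
  then show ?thesis by (simp add: eval)
qed

text \<open>A crossing of the upward legs of two nested caps slides over the caps to the downward
  legs; what remains straightens out in two zigzags.\<close>

lemma nested_caps_turn:
  assumes "X \<in> {Pos, Neg}"
  shows "teq [] ([(0, Cap Down), (1, Cap Down)] @ turn_clockwise 2 2 X 2) [(0, Cap Down), (1, Cap Down), (0, X)]
    [Down, Down, Up, Up]"
proof -
  have X: "X \<noteq> Node v" "web_upper n X = [Down, Down]" "web_lower n X = [Down, Down]" for v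
    using assms by (auto simp: eval)
  let ?b = "[(0, Cap Down), (1, Cap Down), (0, X)] :: web"
  have "teq [] ([(0, Cap Down), (1, Cap Down)] @ turn_clockwise 2 2 X 2)
     (?b @ [(0, Cap Down), (1, Cap Down), (3, Cup Up), (2, Cup Up)]) [Down, Down, Up, Up]"
    by (rule teq_exch[of _ "[]" "[(0, Cap Down), (1, Cap Down)]" "[Down, Down, Up, Up]" ?b "[(3, Cup Up), (2, Cup Up)]"
          _ "[]" "[]" "[Down, Down, Up, Up]"]) (use X in \<open>simp_all add: eval\<close>)
  also have "teq [] (?b @ [(0, Cap Down), (1, Cap Down), (3, Cup Up), (2, Cup Up)])
     (?b @ [(0, Cap Down), (1, Cup Up), (1, Cap Down), (2, Cup Up)]) [Down, Down, Up, Up]"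
    by (rule teq_exch[of _ "?b @ [(0, Cap Down)]" "[(1, Cap Down)]" "[Down, Down, Up]" "[(0, Cup Up)]" "[(2, Cup Up)]"
          _ "[Down]" "[Up, Down, Down, Up, Up]" "[Down, Up, Up]"]) (use X in \<open>simp_all add: eval\<close>)
  also have "teq [] (?b @ [(0, Cap Down), (1, Cup Up), (1, Cap Down), (2, Cup Up)]) (?b @ [(1, Cap Down), (2, Cup Up)]) [Down, Down, Up, Up]"
    by (rule teq_zigzag_right[of _ ?b 0 Down "[(1, Cap Down), (2, Cup Up)]"]) (use X in \<open>simp_all add: eval\<close>)
  also have "teq [] (?b @ [(1, Cap Down), (2, Cup Up)]) ?b [Down, Down, Up, Up]"
    by (rule teq_zigzag_right[of _ ?b 1 Down "[]"]) (use X in \<open>simp_all add: eval\<close>)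
  finally show ?thesis by simp
qed

text \<open>The third Reidemeister move with one strand reversed. The two passages of the upward
  strand merge into the single sweep \<open>?f\<close>, a cap followed by two crossings and a cup,
  and there the braid relation applies.\<close>

lemma rw_slide_Pos:
  "teq [Down, Down, Up] (rw 1 @ rw 0 @ [(1, Pos)]) ([(0, Pos)] @ rw 1 @ rw 0) [Up, Down, Down]"
proof -
  let ?f = "[(0, Cap Up), (1, Pos), (2, Pos), (3, Cup Down)] :: web"
  have "teq [Down, Down, Up] ([(0, Cap Up), (3, Cap Up), (4, Pos), (5, Cup Down), (1, Pos), (2, Cup Down)]) (rw 1 @ rw 0) [Up, Down, Down]"
    by (rule teq_exch[of _ "[]" "[(0, Cap Up)]" "[Up, Down]" "[(1, Cap Up), (2, Pos), (3, Cup Down)]" "[(1, Pos), (2, Cup Down)]"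
          _ "[]" "[Down, Down, Up]" "[Down, Up, Down]"]) (simp_all add: eval)
  moreover have "teq [Down, Down, Up] [(0, Cap Up), (1, Pos), (3, Cap Up), (4, Pos), (5, Cup Down), (2, Cup Down)]
     [(0, Cap Up), (3, Cap Up), (4, Pos), (5, Cup Down), (1, Pos), (2, Cup Down)] [Up, Down, Down]"
    by (rule teq_exch[of _ "[(0, Cap Up)]" "[(1, Pos)]" "[Up, Down, Down]" "[(0, Cap Up), (1, Pos), (2, Cup Down)]" "[(2, Cup Down)]"
          _ "[Up, Down, Down]" "[Down, Up]" "[Up, Down]"]) (simp_all add: eval)
  moreover have "teq [Down, Down, Up] [(0, Cap Up), (1, Pos), (3, Cap Up), (2, Cup Down), (2, Pos), (3, Cup Down)]
    [(0, Cap Up), (1, Pos), (3, Cap Up), (4, Pos), (5, Cup Down), (2, Cup Down)] [Up, Down, Down]"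
    by (rule teq_exch[of _ "[(0, Cap Up), (1, Pos), (3, Cap Up)]" "[(2, Cup Down)]" "[Up, Down]" "[(0, Pos), (1, Cup Down)]" "[]"
          _ "[Up, Down, Down, Up]" "[Down, Down, Up]" "[Down]"]) (simp_all add: eval)
  moreover have "teq [Down, Down, Up] [(0, Cap Up), (1, Pos), (3, Cap Up), (2, Cup Down), (2, Pos), (3, Cup Down)] ?f [Up, Down, Down]"
    by (rule teq_zigzag_left[of _ "[(0, Cap Up), (1, Pos)]" 2 Up]) (simp_all add: eval)
  ultimately have f: "teq [Down, Down, Up] ?f (rw 1 @ rw 0) [Up, Down, Down]"
    by (blast intro: teq_sym teq_trans)
  have "teq [Down, Down, Up] (rw 1 @ rw 0 @ [(1, Pos)]) (?f @ [(1, Pos)]) [Up, Down, Down]"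
    by (rule teq_in[OF teq_sym[OF f], of _ "[]" "[]" "[(1, Pos)]" _ _ "[]"]) (simp_all add: eval)
  also have "teq [Down, Down, Up] (?f @ [(1, Pos)]) [(0, Cap Up), (1, Pos), (2, Pos), (1, Pos), (3, Cup Down)] [Up, Down, Down]"
    by (rule teq_sym, rule teq_exch[of _ "[(0, Cap Up), (1, Pos), (2, Pos)]" "[(1, Pos)]" "[Up, Down, Down]" "[(0, Cup Down)]" "[]"
          _ "[Up, Down, Down]" "[Down, Up]" "[]"]) (simp_all add: eval)
  also have "teq [Down, Down, Up] [(0, Cap Up), (1, Pos), (2, Pos), (1, Pos), (3, Cup Down)]
     [(0, Cap Up), (2, Pos), (1, Pos), (2, Pos), (3, Cup Down)] [Up, Down, Down]"
    by (rule teq_in[OF braid_relation, of _ "[(0, Cap Up)]" "[Up]" "[(3, Cup Down)]" _ _ "[Up]"]) (simp_all add: eval)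
  also have "teq [Down, Down, Up] [(0, Cap Up), (2, Pos), (1, Pos), (2, Pos), (3, Cup Down)] ([(0, Pos)] @ ?f) [Up, Down, Down]"
    by (rule teq_exch[of _ "[]" "[(0, Cap Up)]" "[Up, Down]" "[(0, Pos)]" "[(1, Pos), (2, Pos), (3, Cup Down)]"
          _ "[]" "[Down, Down, Up]" "[Down, Down, Up]"]) (simp_all add: eval)
  also have "teq [Down, Down, Up] ([(0, Pos)] @ ?f) ([(0, Pos)] @ rw 1 @ rw 0) [Up, Down, Down]"
    by (rule teq_in[OF f, of _ "[(0, Pos)]" "[]" "[]" _ _ "[]"]) (simp_all add: eval)
  finally show ?thesis .
qed

text \<open>A negative crossing slides because its inverse does.\<close>

lemma rw_slide:
  assumes "X \<in> {Pos, Neg}"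
  shows "teq [Down, Down, Up] (rw 1 @ rw 0 @ [(1, X)]) ([(0, X)] @ rw 1 @ rw 0) [Up, Down, Down]"
proof (cases "X = Pos")
  case True
  then show ?thesis using rw_slide_Pos by simp
next
  case False
  then have X: "X = Neg" using assms by simp
  have "teq [Down, Down, Up] (rw 1 @ rw 0 @ [(1, Neg)]) ([(0, Neg), (0, Pos)] @ rw 1 @ rw 0 @ [(1, Neg)]) [Up, Down, Down]"
    by (rule teq_in[OF teq_sym[OF neg_pos], of _ "[]" "[]" "rw 1 @ rw 0 @ [(1, Neg)]" _ _ "[Up]"]) (simp_all add: eval)
  also have "teq [Down, Down, Up] ([(0, Neg), (0, Pos)] @ rw 1 @ rw 0 @ [(1, Neg)])
      ([(0, Neg)] @ rw 1 @ rw 0 @ [(1, Pos), (1, Neg)]) [Up, Down, Down]"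
    by (rule teq_in[OF teq_sym[OF rw_slide_Pos], of _ "[(0, Neg)]" "[]" "[(1, Neg)]" _ _ "[]"]) (simp_all add: eval)
  also have "teq [Down, Down, Up] ([(0, Neg)] @ rw 1 @ rw 0 @ [(1, Pos), (1, Neg)]) ([(0, Neg)] @ rw 1 @ rw 0) [Up, Down, Down]"
    by (rule teq_in[OF pos_neg, of _ "[(0, Neg)] @ rw 1 @ rw 0" "[Up]" "[]" _ _ "[]"]) (simp_all add: eval)
  finally show ?thesis by (simp add: X)
qed

text \<open>One step of pulling a cap to the right behind downward strands: both its legs then pass
  below the strand.\<close>

lemma cap_past_down:
  "teq [Down] [(0, Cap Down)] ([(1, Cap Down), (0, Neg)] @ rw 1) [Down, Up, Down]"
proof -
  have "teq [Down] [(0, Cap Down)] ([(0, Cap Down)] @ shift 1 (leftward Neg 0 @ rw 0)) [Down, Up, Down]"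
    by (rule teq_in[OF teq_sym[OF leftward_rightward], of _ "[(0, Cap Down)]" "[Down]" "[]" _ _ "[]"]) (simp_all add: eval)
  also have "teq [Down] ([(0, Cap Down)] @ shift 1 (leftward Neg 0 @ rw 0))
     ([(1, Cap Down), (0, Neg)] @ [(0, Cap Down), (1, Cup Up)] @ rw 1) [Down, Up, Down]"
    by (rule teq_exch[of _ "[]" "[(0, Cap Down)]" "[Down, Up]" "[(1, Cap Down), (0, Neg)]" "[(1, Cup Up)] @ rw 1"
          _ "[]" "[Down]" "[Down, Down, Up]"]) (simp_all add: eval)
  also have "teq [Down] ([(1, Cap Down), (0, Neg)] @ [(0, Cap Down), (1, Cup Up)] @ rw 1)
     ([(1, Cap Down), (0, Neg)] @ rw 1) [Down, Up, Down]"
    by (rule teq_zigzag_right[of _ "[(1, Cap Down), (0, Neg)]" 0 Down]) (simp_all add: eval)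
  finally show ?thesis .
qed

lemma cup_past_down:
  "teq [Down, Down, Up] (rw 1 @ [(0, Cup Down)]) [(0, Pos), (1, Cup Down)] [Down]"
proof -
  have "teq [Down, Down, Up] [(1, Cap Up), (0, Cup Down), (0, Pos), (1, Cup Down)] (rw 1 @ [(0, Cup Down)]) [Down]"
    by (rule teq_exch[of _ "[(1, Cap Up)]" "[(0, Cup Down)]" "[]" "[(0, Pos), (1, Cup Down)]" "[]"
          _ "[Down, Up]" "[Down, Down, Up]" "[Down]"]) (simp_all add: eval)
  moreover have "teq [Down, Down, Up] [(1, Cap Up), (0, Cup Down), (0, Pos), (1, Cup Down)] [(0, Pos), (1, Cup Down)] [Down]"
    by (rule teq_zigzag_left[of _ "[]" 0 Up]) (simp_all add: eval)
  ultimately show ?thesis by (blast intro: teq_sym teq_trans)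
qed

end

section \<open>Moving upward strands to the right of downward ones\<close>

definition up_over :: "nat \<Rightarrow> web" where
  "up_over a = concat (map (rightward Pos) (rev [0..<a]))"

lemma shift_rightward [simp]: "shift k (rightward X i) = rightward X (k + i)"
  by (simp add: rightward_def)

lemma shift_turn_clockwise [simp]: "shift k (turn_clockwise a b X i) = turn_clockwise a b X (k + i)"
  by (simp add: turn_clockwise_def shift_def rev_map add.assoc)

lemma shift_turn_anticlockwise [simp]: "shift k (turn_anticlockwise a b X i) = turn_anticlockwise a b X (k + i)"
  by (simp add: turn_anticlockwise_def shift_def rev_map add.assoc)

lemma up_over_0 [simp]: "up_over 0 = []"
  by (simp add: up_over_def)

lemma up_over_Suc: "up_over (Suc a) = rightward Pos a @ up_over a"
  by (simp add: up_over_def)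

lemma up_over_add: "up_over (a + c) = shift a (up_over c) @ up_over a"
  by (induction c) (simp_all add: up_over_Suc)

lemma up_over_Suc': "up_over (Suc a) = shift 1 (up_over a) @ rightward Pos 0"
  using up_over_add[of 1 a] by (simp add: up_over_Suc)

lemma plain_rightward [simp]: "plain (rightward Pos i)"
  by (simp add: rightward_def)

lemma plain_up_over [simp]: "plain (up_over a)"
  by (induction a) (simp_all add: up_over_Suc)

text \<open>A fixed tangle from the sorted boundary to \<open>xs\<close>. Each time, the leftmost of
  the remaining upward strands moves to the left behind the downward ones, so that no two upward
  strands cross.\<close>

fun unsort :: "dir list \<Rightarrow> web" where
  "unsort [] = []"
| "unsort (Down # xs) = shift 1 (unsort xs)"
| "unsort (Up # xs) = up_over (count_list xs Down) @ shift 1 (unsort xs)"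

lemma plain_unsort [simp]: "plain (unsort xs)"
  by (induction xs rule: unsort.induct) simp_all

abbreviation downs :: "nat \<Rightarrow> dir list" where "downs a \<equiv> replicate a Down"
abbreviation ups :: "nat \<Rightarrow> dir list" where "ups a \<equiv> replicate a Up"

lemmas replicate_simps = replicate_add numeral_2_eq_2 replicate_app_Cons_same replicate_append_same

text \<open>A word is straightened by moving all upward strands to the right of the downward ones.\<close>

definition sorted_dirs :: "dir list \<Rightarrow> dir list" where
  "sorted_dirs xs = downs (count_list xs Down) @ ups (count_list xs Up)"

text \<open>Between consecutive blocks all downward strands stand to the left of all upward ones.
  Hence caps and cups sit at the border between them and only parallel strands cross; a crossing of
  upward strands is a turned crossing.\<close>

inductive sorted_word :: "nat \<Rightarrow> nat \<Rightarrow> web \<Rightarrow> nat \<Rightarrow> nat \<Rightarrow> bool" where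
  nil: "sorted_word a b [] a b"
| crossing: "X \<in> {Pos, Neg} \<Longrightarrow> Suc j < a \<Longrightarrow> sorted_word a b t a' b' \<Longrightarrow> sorted_word a b ([(j, X)] @ t) a' b'"
| up_crossing: "X \<in> {Pos, Neg} \<Longrightarrow> Suc j < b \<Longrightarrow> sorted_word a b t a' b' \<Longrightarrow>
    sorted_word a b (turn_clockwise 2 2 X (a + j) @ t) a' b'"
| cap: "sorted_word (Suc a) (Suc b) t a' b' \<Longrightarrow> sorted_word a b ([(a, Cap Down)] @ t) a' b'"
| cup: "sorted_word a b t a' b' \<Longrightarrow> sorted_word (Suc a) (Suc b) ([(a, Cup Down)] @ t) a' b'"

lemma sorted_word_append:
  "sorted_word a b s a' b' \<Longrightarrow> sorted_word a' b' t a'' b'' \<Longrightarrow> sorted_word a b (s @ t) a'' b''"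
  by (induction rule: sorted_word.induct) (simp_all only: append_assoc append_Nil sorted_word.intros)

lemma sorted_word_shift:
  "sorted_word a b t a' b' \<Longrightarrow> sorted_word (Suc a) b (shift 1 t) (Suc a') b'"
proof (induction rule: sorted_word.induct)
  case (crossing X j a b t a' b')
  then show ?case using sorted_word.crossing[of X "Suc j" "Suc a" b "shift 1 t" "Suc a'" b'] by simp
next
  case (up_crossing X j b a t a' b')
  then show ?case using sorted_word.up_crossing[of X j b "Suc a" "shift 1 t" "Suc a'" b'] by simp
next
  case (cap a b t a' b')
  then show ?case using sorted_word.cap[of "Suc a" b "shift 1 t" "Suc a'" b'] by simp
next
  case (cup a b t a' b')
  then show ?case using sorted_word.cup[of "Suc a" b "shift 1 t" "Suc a'" b'] by simp
qed (simp add: sorted_word.nil)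

text \<open>Positive curls may be removed as well. On the set where two invariants agree this is
  legitimate if a curl multiplies both by the same invertible factor.\<close>

locale unframed_relation = tangle_relation +
  assumes R_curl: "curl \<in> {right_curl Pos, left_curl Pos} \<Longrightarrow> u @ curl i @ v \<in> webs n \<Longrightarrow>
      u @ v \<in> webs n \<Longrightarrow> R (u @ curl i @ v) (u @ v)"

context tangle_relation
begin

lemma arr_rw: "ar [Down, Up] (rw 0) [Up, Down]"
  by (simp add: eval)

lemma arr_up_over: "ar (downs a @ [Up]) (up_over a) ([Up] @ downs a)"
proof (induction a)
  case (Suc a)
  have 1: "ar (downs a @ [Down, Up]) (rw a) (downs a @ [Up, Down])"
    using arr_left[OF arr_rw, of "downs a"] by simp
  have 2: "ar ((downs a @ [Up]) @ [Down]) (up_over a) (([Up] @ downs a) @ [Down])"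
    by (rule arr_right[OF Suc])
  from arr_appendI[OF 1] 2 show ?case
    by (simp add: up_over_Suc replicate_simps)
qed simp

lemma arr_turn: "X \<in> {Pos, Neg} \<Longrightarrow> ar (ups 2) (turn_clockwise 2 2 X 0) (ups 2)"
  by (auto simp: eval)

lemma plain_turn: "X \<in> {Pos, Neg} \<Longrightarrow> plain (turn_clockwise 2 2 X i)"
  by (auto simp: eval)

lemma arr_crossing:
  assumes "X \<in> {Pos, Neg}" "Suc j < a"
  shows "ar (downs a @ Q) [(j, X)] (downs a @ Q)"
proof -
  obtain c where "a = j + 2 + c" using assms(2) by (metis less_iff_Suc_add add_2_eq_Suc' add_Suc_right add_Suc)
  then have "downs a = downs j @ [Down, Down] @ downs (a - j - 2)"
    by (simp add: replicate_simps)
  then show ?thesis using assms(1)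
    by (intro arr_single[of _ "downs j" _ _ _ "downs (a - j - 2) @ Q"]) (auto simp: eval)
qed

lemma arr_up_crossing:
  assumes "X \<in> {Pos, Neg}" "Suc j < b"
  shows "ar (P @ ups b) (turn_clockwise 2 2 X (length P + j)) (P @ ups b)"
proof -
  obtain c where "b = j + 2 + c" using assms(2) by (metis less_iff_Suc_add add_2_eq_Suc' add_Suc_right add_Suc)
  then have "ups b = ups j @ ups 2 @ ups (b - j - 2)"
    by (simp add: replicate_simps)
  then show ?thesis
    using arr_context[OF arr_turn[OF assms(1)], of "P @ ups j" "ups (b - j - 2)"] by simp
qed

lemma arr_sorted_word: "sorted_word a b t a' b' \<Longrightarrow> ar (downs a @ ups b) t (downs a' @ ups b')"
proof (induction rule: sorted_word.induct)
  case (crossing X j a b t a' b')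
  then show ?case using arr_crossing by (blast intro: arr_appendI)
next
  case (up_crossing X j b a t a' b')
  then show ?case using arr_up_crossing[of X j b "downs a"] by (auto intro: arr_appendI)
next
  case (cap a b t a' b')
  have "ar (downs a @ ups b) [(a, Cap Down)] (downs (Suc a) @ ups (Suc b))"
    by (rule arr_single[of _ "downs a" _ _ _ "ups b"]) (simp_all add: eval replicate_app_Cons_same)
  with cap.IH show ?case by (rule arr_appendI[rotated])
next
  case (cup a b t a' b')
  have "ar (downs (Suc a) @ ups (Suc b)) [(a, Cup Down)] (downs a @ ups b)"
    by (rule arr_single[of _ "downs a" _ _ _ "ups b"]) (simp_all add: eval replicate_app_Cons_same)
  with cup.IH show ?case by (rule arr_appendI[rotated])
qed simp

lemma arr_unsort: "ar (sorted_dirs xs) (unsort xs) xs"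
proof (induction xs rule: unsort.induct)
  case (2 xs)
  then show ?case using arr_left[OF 2, of "[Down]"] by (simp add: sorted_dirs_def)
next
  case (3 xs)
  have "ar ((downs (count_list xs Down) @ [Up]) @ ups (count_list xs Up)) (up_over (count_list xs Down))
     (([Up] @ downs (count_list xs Down)) @ ups (count_list xs Up))"
    by (rule arr_right[OF arr_up_over])
  from arr_appendI[OF this] show ?case using arr_left[OF 3, of "[Up]"] by (simp add: sorted_dirs_def)
qed (simp add: sorted_dirs_def)

text \<open>The upward strand passes the \<open>c\<close> strands to the right of the crossing, then
  the two strands that cross, then the \<open>j\<close> strands to the left. Only the middle passage
  meets the crossing, and \<open>rw_slide\<close> applies to it.\<close>

lemma up_over_crossing:
  assumes "X \<in> {Pos, Neg}" "Suc j < a"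
  shows "teq (downs a @ [Up]) (up_over a @ [(Suc j, X)]) ([(j, X)] @ up_over a) ([Up] @ downs a)"
proof -
  define c where "c = a - j - 2"
  have a: "a = j + 2 + c" using assms(2) by (simp add: c_def)
  have X: "plain [(i, X)]" "ar [Down, Down] [(0, X)] [Down, Down]" for i using assms(1) by (auto simp: eval)
  have e: "up_over a = shift (j + 2) (up_over c) @ rw (Suc j) @ rw j @ up_over j"
    unfolding a up_over_add[of "j + 2"] by (simp add: up_over_Suc)
  have d: "downs a = downs j @ [Down, Down] @ downs c"
    by (simp add: a replicate_simps)
  have c: "ar (downs (j + 2) @ downs c @ [Up]) (shift (j + 2) (up_over c)) (downs (j + 2) @ [Up] @ downs c)"
    using arr_left[OF arr_up_over[of c], of "downs (j + 2)"] by simp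
  have r: "ar (downs j @ [Down, Down, Up] @ downs c) (rw (Suc j) @ rw j) (downs j @ [Up, Down, Down] @ downs c)"
    using arr_context[of n "[Down, Down, Up]" "rw 1 @ rw 0" "[Up, Down, Down]" "downs j" "downs c"]
    by (simp add: eval)
  have u: "ar (downs j @ [Up] @ Q) (up_over j) ([Up] @ downs j @ Q)" for Q
    using arr_right[OF arr_up_over, of j Q] by simp
  have X2: "ar (downs j @ [Down, Down] @ Q) [(j, X)] (downs j @ [Down, Down] @ Q)" for Q
    using arr_context[OF X(2), of "downs j" Q] by simp
  have dd: "downs (j + 2) @ Q = downs j @ [Down, Down] @ Q" for Q
    by (simp add: replicate_simps)
  have cr: "ar (downs a @ [Up]) (shift (j + 2) (up_over c) @ rw (Suc j) @ rw j) (downs j @ [Up, Down, Down] @ downs c)"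
    using arr_appendI[OF c[unfolded dd]] r by (simp add: d)
  have ru: "ar (downs j @ [Down, Down, Up] @ downs c) (rw (Suc j) @ rw j @ up_over j) ([Up] @ downs a)"
    using arr_appendI[OF r] u[of "[Down, Down] @ downs c"] by (simp add: d)
  have "teq (downs a @ [Up]) (up_over a @ [(Suc j, X)])
     (shift (j + 2) (up_over c) @ (rw (Suc j) @ rw j) @ [(Suc j, X)] @ up_over j) ([Up] @ downs a)"
    by (rule teq_exch[of _ "shift (j + 2) (up_over c) @ rw (Suc j) @ rw j" "up_over j" "[Up] @ downs j"
          "[(0, X)]" "[]" _ "downs j @ [Up]" "[Down, Down] @ downs c" "[Down, Down] @ downs c"])
      (use X u[of "[]"] arr_right[OF X(2), of "downs c"] cr in \<open>simp_all add: e d del: arr.simps(2)\<close>)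
  also have "teq (downs a @ [Up]) (shift (j + 2) (up_over c) @ (rw (Suc j) @ rw j) @ [(Suc j, X)] @ up_over j)
     (shift (j + 2) (up_over c) @ [(j, X)] @ rw (Suc j) @ rw j @ up_over j) ([Up] @ downs a)"
    by (rule teq_in[OF rw_slide[OF assms(1)], of _ "shift (j + 2) (up_over c)" "downs j" "up_over j" _ _ "downs c"])
      (use c[unfolded dd] u[of "[Down, Down] @ downs c"] in \<open>simp_all add: e d del: arr.simps(2)\<close>)
  also have "teq (downs a @ [Up]) (shift (j + 2) (up_over c) @ [(j, X)] @ rw (Suc j) @ rw j @ up_over j)
     ([(j, X)] @ up_over a) ([Up] @ downs a)"
    by (rule teq_sym, rule teq_exch[of _ "[]" "[(j, X)]" "downs (j + 2)" "up_over c" "rw (Suc j) @ rw j @ up_over j"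
          _ "downs (j + 2)" "downs c @ [Up]" "[Up] @ downs c"])
      (use X X2[of "[]"] arr_up_over[of c] ru in \<open>simp_all add: e d dd dd[of "[]", simplified] del: arr.simps(2)\<close>)
  finally show ?thesis .
qed

text \<open>An upward strand to the left of a sorted word moves, from the top down, to the border
  between downward and upward strands, where it extends the word to a sorted one. At a cap or cup it
  crosses the upward leg, which contributes a crossing of two upward strands.\<close>

lemma up_over_sorted_word:
  "sorted_word a b t a' b' \<Longrightarrow> \<exists>t'. sorted_word a (Suc b) t' a' (Suc b') \<and>
     teq (downs a @ ups (Suc b)) (up_over a @ shift 1 t) (t' @ up_over a') ([Up] @ downs a' @ ups b')"
proof (induction rule: sorted_word.induct)
  case (nil a b)
  then show ?case using arr_right[OF arr_up_over[of a], of "ups b"]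
    by (intro exI[of _ "[]"]) (auto intro: teq_refl sorted_word.nil)
next
  case (crossing X j a b t a' b')
  then obtain t' where t': "sorted_word a (Suc b) t' a' (Suc b')"
    "teq (downs a @ ups (Suc b)) (up_over a @ shift 1 t) (t' @ up_over a') ([Up] @ downs a' @ ups b')"
    by blast
  have t: "ar ([Up] @ downs a @ ups b) (shift 1 t) ([Up] @ downs a' @ ups b')"
    using arr_left[OF arr_sorted_word[OF crossing.hyps(3)], of "[Up]"] by simp
  have "teq (downs a @ ups (Suc b)) ((up_over a @ [(Suc j, X)]) @ shift 1 t) (([(j, X)] @ up_over a) @ shift 1 t)
     ([Up] @ downs a' @ ups b')"
    using teq_append_right[OF teq_right[OF up_over_crossing[OF crossing(1,2)], of "ups b"]] t by simp
  also have "teq (downs a @ ups (Suc b)) (([(j, X)] @ up_over a) @ shift 1 t) ([(j, X)] @ t' @ up_over a')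
     ([Up] @ downs a' @ ups b')"
    using teq_append_left[OF arr_crossing[OF crossing(1,2), of "ups (Suc b)"] t'(2)] by simp
  finally show ?case
    using sorted_word.crossing[OF crossing(1,2) t'(1)] by (intro exI[of _ "[(j, X)] @ t'"]) simp
next
  case (up_crossing X j b a t a' b')
  then obtain t' where t': "sorted_word a (Suc b) t' a' (Suc b')"
    "teq (downs a @ ups (Suc b)) (up_over a @ shift 1 t) (t' @ up_over a') ([Up] @ downs a' @ ups b')"
    by blast
  let ?T = "turn_clockwise 2 2 X"
  have t: "ar ([Up] @ downs a @ ups b) (shift 1 t) ([Up] @ downs a' @ ups b')"
    using arr_left[OF arr_sorted_word[OF up_crossing.hyps(3)], of "[Up]"] by simp
  have T: "ar (ups b) (?T j) (ups b)" using arr_up_crossing[OF up_crossing(1,2), of "[]"] by simp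
  have "teq (downs a @ ups (Suc b)) (up_over a @ ?T (Suc (a + j)) @ shift 1 t) (?T (a + Suc j) @ up_over a @ shift 1 t)
     ([Up] @ downs a' @ ups b')"
    by (rule teq_exch[of _ "[]" "up_over a" "[Up] @ downs a" "?T j" "shift 1 t" _ "downs a @ [Up]" "ups b" "ups b"])
      (use t T arr_up_over[of a] plain_turn up_crossing(1) in simp_all)
  also have "teq (downs a @ ups (Suc b)) (?T (a + Suc j) @ up_over a @ shift 1 t) (?T (a + Suc j) @ t' @ up_over a')
     ([Up] @ downs a' @ ups b')"
    using teq_append_left[OF _ t'(2)] arr_up_crossing[OF up_crossing(1), of "Suc j" "Suc b" "downs a"] up_crossing(2) by simp
  finally show ?case
    using sorted_word.up_crossing[of X "Suc j" "Suc b" a, OF up_crossing(1) _ t'(1)] up_crossing(2)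
    by (intro exI[of _ "?T (a + Suc j) @ t'"]) simp
next
  case (cap a b t a' b')
  then obtain t' where t': "sorted_word (Suc a) (Suc (Suc b)) t' a' (Suc b')"
    "teq (downs (Suc a) @ ups (Suc (Suc b))) (up_over (Suc a) @ shift 1 t) (t' @ up_over a') ([Up] @ downs a' @ ups b')"
    by blast
  let ?T = "turn_clockwise 2 2 Neg"
  have t: "ar ([Up] @ downs (Suc a) @ ups (Suc b)) (shift 1 t) ([Up] @ downs a' @ ups b')"
    using arr_left[OF arr_sorted_word[OF cap.hyps(1)], of "[Up]"] by simp
  have c: "ar (downs a @ Q) [(a, Cap Down)] (downs a @ [Down, Up] @ Q)" for Q
    by (rule arr_single[of _ "downs a" _ _ _ Q]) (simp_all add: eval)
  have u: "ar (downs a @ [Up] @ Q) (up_over a) ([Up] @ downs a @ Q)" for Q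
    using arr_right[OF arr_up_over, of a Q] by simp
  have ut: "ar (downs a @ [Up, Down] @ ups (Suc b)) (up_over a @ shift 1 t) ([Up] @ downs a' @ ups b')"
    by (rule arr_appendI[OF _ t]) (use u[of "[Down] @ ups (Suc b)"] in \<open>simp add: replicate_simps\<close>)
  have "teq (downs a @ ups (Suc b)) (up_over a @ [(Suc a, Cap Down)] @ shift 1 t) ([(Suc a, Cap Down)] @ up_over a @ shift 1 t)
     ([Up] @ downs a' @ ups b')"
    by (rule teq_exch[of _ "[]" "up_over a" "[Up] @ downs a" "[(0, Cap Down)]" "shift 1 t" _ "downs a @ [Up]" "ups b" "[Down, Up] @ ups b"])
      (use t arr_up_over[of a] in \<open>simp_all add: eval replicate_simps\<close>)
  also have "teq (downs a @ ups (Suc b)) ([(Suc a, Cap Down)] @ up_over a @ shift 1 t)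
     (([(a, Cap Down)] @ ?T (Suc a) @ rw a) @ up_over a @ shift 1 t) ([Up] @ downs a' @ ups b')"
    by (rule teq_in[OF up_past_cap, of _ "[]" "downs a" _ _ _ "ups b"])
      (use ut in \<open>simp_all\<close>)
  also have "teq (downs a @ ups (Suc b)) (([(a, Cap Down)] @ ?T (Suc a) @ rw a) @ up_over a @ shift 1 t)
     (([(a, Cap Down)] @ ?T (Suc a)) @ t' @ up_over a') ([Up] @ downs a' @ ups b')"
  proof -
    have "ar (downs a @ ups (Suc b)) ([(a, Cap Down)] @ ?T (Suc a)) (downs (Suc a) @ ups (Suc (Suc b)))"
      using arr_appendI[OF c[of "ups (Suc b)"]] arr_up_crossing[of Neg 0 "Suc (Suc b)" "downs (Suc a)"]
      by (simp add: replicate_simps)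
    from teq_append_left[OF this t'(2)] show ?thesis by (simp add: up_over_Suc)
  qed
  finally have "teq (downs a @ ups (Suc b)) (up_over a @ [(Suc a, Cap Down)] @ shift 1 t)
     (([(a, Cap Down)] @ ?T (Suc a)) @ t' @ up_over a') ([Up] @ downs a' @ ups b')" .
  \<comment> \<open>The moved strand crosses the upward leg of the new cap; these are the first two
    upward strands, so the crossing has index \<open>0\<close> among them.\<close>
  moreover have "sorted_word a (Suc b) ([(a, Cap Down)] @ ?T (Suc a + 0) @ t') a' (Suc b')"
    by (intro sorted_word.cap sorted_word.up_crossing t') simp_all
  ultimately show ?case
    by (intro exI[of _ "[(a, Cap Down)] @ ?T (Suc a) @ t'"]) simp
next
  case (cup a b t a' b')
  then obtain t' where t': "sorted_word a (Suc b) t' a' (Suc b')"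
    "teq (downs a @ ups (Suc b)) (up_over a @ shift 1 t) (t' @ up_over a') ([Up] @ downs a' @ ups b')"
    by blast
  let ?T = "turn_clockwise 2 2 Pos"
  have t: "ar ([Up] @ downs a @ ups b) (shift 1 t) ([Up] @ downs a' @ ups b')"
    using arr_left[OF arr_sorted_word[OF cup.hyps(1)], of "[Up]"] by simp
  have r: "ar (downs a @ [Down, Up] @ Q) (rw a) (downs a @ [Up, Down] @ Q)" for Q
    using arr_context[OF arr_rw, of "downs a" Q] by simp
  have c: "ar (downs a @ [Down, Up] @ Q) [(a, Cup Down)] (downs a @ Q)" for Q
    by (rule arr_single[of _ "downs a" _ _ _ Q]) (simp_all add: eval)
  have ut: "ar (downs a @ [Up] @ ups b) (up_over a @ shift 1 t) ([Up] @ downs a' @ ups b')"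
    by (rule arr_appendI[OF _ t]) (use arr_right[OF arr_up_over[of a], of "ups b"] in simp)
  have T: "teq [Up, Up] (turn_anticlockwise 2 2 Pos 0) (?T 0) [Up, Up]"
    by (rule teq_sym[OF turn_crossing])
  have "teq (downs (Suc a) @ ups (Suc (Suc b))) (rw a @ [(Suc a, Cup Down)] @ up_over a @ shift 1 t) 
     (up_over (Suc a) @ [(Suc a, Cup Down)] @ shift 1 t) ([Up] @ downs a' @ ups b')"
    by (rule teq_sym, rule teq_exch[of _ "rw a" "up_over a" "[Up] @ downs a" "[(0, Cup Down)]" "shift 1 t" _ "downs a @ [Up]"
          "[Down, Up] @ ups b" "ups b"])
      (use t arr_up_over[of a] r[of "ups (Suc b)"] in \<open>simp_all add: eval replicate_simps up_over_Suc\<close>)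
  note teq_sym[OF this]
  also have "teq (downs (Suc a) @ ups (Suc (Suc b))) (rw a @ [(Suc a, Cup Down)] @ up_over a @ shift 1 t)
     ((turn_anticlockwise 2 2 Pos (Suc a) @ [(a, Cup Down)]) @ up_over a @ shift 1 t) ([Up] @ downs a' @ ups b')"
    by (rule teq_in[OF up_past_cup, of _ "[]" "downs a" "up_over a @ shift 1 t" _ _ "ups b"])
      (use ut in \<open>simp_all add: replicate_simps\<close>)
  also have "teq (downs (Suc a) @ ups (Suc (Suc b))) ((turn_anticlockwise 2 2 Pos (Suc a) @ [(a, Cup Down)]) @ up_over a @ shift 1 t)
     (?T (Suc a) @ [(a, Cup Down)] @ up_over a @ shift 1 t) ([Up] @ downs a' @ ups b')"
    by (rule teq_in[OF T, of _ "[]" "downs (Suc a)" "[(a, Cup Down)] @ up_over a @ shift 1 t" _ _ "ups b"])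
      (use arr_appendI[OF c[of "ups (Suc b)"]] ut in \<open>simp_all add: replicate_simps del: arr.simps(2)\<close>)
  also have "teq (downs (Suc a) @ ups (Suc (Suc b))) (?T (Suc a) @ [(a, Cup Down)] @ up_over a @ shift 1 t)
     (?T (Suc a) @ [(a, Cup Down)] @ t' @ up_over a') ([Up] @ downs a' @ ups b')"
  proof -
    have "ar (downs (Suc a) @ ups (Suc (Suc b))) (?T (Suc a) @ [(a, Cup Down)]) (downs a @ ups (Suc b))"
      using arr_appendI[OF arr_up_crossing[of Pos 0 "Suc (Suc b)" "downs (Suc a)"]] c[of "ups (Suc b)"]
      by (simp add: replicate_simps del: arr.simps(2))
    from teq_append_left[OF this t'(2)] show ?thesis by simp
  qed
  finally have "teq (downs (Suc a) @ ups (Suc (Suc b))) (up_over (Suc a) @ [(Suc a, Cup Down)] @ shift 1 t)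
     (?T (Suc a) @ [(a, Cup Down)] @ t' @ up_over a') ([Up] @ downs a' @ ups b')" .
  moreover have "sorted_word (Suc a) (Suc (Suc b)) (?T (Suc a + 0) @ [(a, Cup Down)] @ t') a' (Suc b')"
    by (intro sorted_word.cup sorted_word.up_crossing t') simp_all
  ultimately show ?case
    by (intro exI[of _ "?T (Suc a) @ [(a, Cup Down)] @ t'"]) simp
qed

end

section \<open>Pulling caps and cups behind downward strands\<close>

definition over_left :: "nat \<Rightarrow> web" where
  "over_left a = map (\<lambda>j. (j, Neg)) (rev [0..<a])"

definition under_right :: "nat \<Rightarrow> web" where
  "under_right a = map (\<lambda>j. (j, Pos)) [0..<a]"

lemma over_left_Suc: "over_left (Suc a) = [(a, Neg)] @ over_left a"
  by (simp add: over_left_def)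

lemma under_right_Suc: "under_right (Suc a) = under_right a @ [(a, Pos)]"
  by (simp add: under_right_def)

lemma plain_over_left [simp]: "plain (over_left a)"
  by (induction a) (simp_all add: over_left_Suc, simp add: over_left_def)

lemma plain_under_right [simp]: "plain (under_right a)"
  by (induction a) (simp_all add: under_right_Suc, simp add: under_right_def)

lemma sorted_word_over_left: "a < c \<Longrightarrow> sorted_word c b (over_left a) c b"
proof (induction a)
  case 0
  then show ?case by (simp add: over_left_def sorted_word.nil)
next
  case (Suc a)
  then show ?case using sorted_word.crossing[of Neg a c b "over_left a" c b] by (simp add: over_left_Suc)
qed

lemma sorted_word_under_right: "a < c \<Longrightarrow> sorted_word c b (under_right a) c b"
proof (induction a)
  case 0
  then show ?case by (simp add: under_right_def sorted_word.nil)
next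
  case (Suc a)
  then show ?case
    using sorted_word_append[OF _ sorted_word.crossing[of Pos a c b "[]" c b]] by (simp add: under_right_Suc sorted_word.nil)
qed

context tangle_relation
begin

lemma arr_over_left: "ar (downs (Suc a)) (over_left a) (downs (Suc a))"
  using arr_sorted_word[OF sorted_word_over_left[of a "Suc a" 0]] by simp

lemma arr_under_right: "ar (downs (Suc a)) (under_right a) (downs (Suc a))"
  using arr_sorted_word[OF sorted_word_under_right[of a "Suc a" 0]] by simp

lemma arr_cap_Down: "ar (downs a @ Q) [(a, Cap Down)] (downs a @ [Down, Up] @ Q)"
  by (rule arr_single[of _ "downs a" _ _ _ Q]) (simp_all add: eval)

lemma arr_cup_Down: "ar (downs a @ [Down, Up] @ Q) [(a, Cup Down)] (downs a @ Q)"
  by (rule arr_single[of _ "downs a" _ _ _ Q]) (simp_all add: eval)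

lemma arr_up_over': "ar ([Down] @ downs a @ [Up] @ Q) (shift 1 (up_over a)) ([Down, Up] @ downs a @ Q)"
  using arr_context[OF arr_up_over[of a], of "[Down]" Q] by simp

lemma arr_rw': "ar (downs a @ [Down, Up] @ Q) (rw a) (downs a @ [Up, Down] @ Q)"
  using arr_context[OF arr_rw, of "downs a" Q] by simp

text \<open>The cap is pulled to the right behind the \<open>a\<close> downward strands, so that
  both its legs cross below them: the downward leg along \<open>over_left\<close>, the upward leg
  along \<open>up_over\<close>.\<close>

lemma cap_to_right:
  "teq (downs a) [(0, Cap Down)] ([(a, Cap Down)] @ over_left a @ shift 1 (up_over a)) ([Down, Up] @ downs a)"
proof (induction a)
  case 0
  then show ?case by (simp add: over_left_def teq_refl eval)
next
  case (Suc a)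
  have lu: "ar (downs a @ [Down, Up] @ [Down]) (over_left a @ shift 1 (up_over a)) ([Down, Up] @ downs (Suc a))"
    using arr_appendI[OF arr_right[OF arr_over_left[of a], of "[Up, Down]"]] arr_up_over'[of a "[Down]"]
    by (simp add: replicate_simps)
  have cx: "ar (downs (Suc a)) [(Suc a, Cap Down), (a, Neg)] (downs (Suc a) @ [Down, Up])"
    using arr_appendI[OF arr_cap_Down[of "Suc a" "[]"]] arr_crossing[of Neg a "Suc (Suc a)" "[Up]"]
    by (simp add: replicate_simps del: arr.simps(2))
  have "teq (downs (Suc a)) [(0, Cap Down)] ([(a, Cap Down)] @ over_left a @ shift 1 (up_over a)) ([Down, Up] @ downs (Suc a))"
    using teq_right[OF Suc, of "[Down]"] by (simp add: replicate_simps)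
  also have "teq (downs (Suc a)) ([(a, Cap Down)] @ over_left a @ shift 1 (up_over a))
     (([(Suc a, Cap Down), (a, Neg)] @ rw (Suc a)) @ over_left a @ shift 1 (up_over a)) ([Down, Up] @ downs (Suc a))"
    by (rule teq_in[OF cap_past_down, of _ "[]" "downs a" _ _ _ "[]"]) (use lu in \<open>simp_all add: replicate_simps\<close>)
  also have "teq (downs (Suc a)) ([(Suc a, Cap Down), (a, Neg)] @ over_left a @ rw (Suc a) @ shift 1 (up_over a))
     (([(Suc a, Cap Down), (a, Neg)] @ rw (Suc a)) @ over_left a @ shift 1 (up_over a)) ([Down, Up] @ downs (Suc a))"
    by (rule teq_exch[of _ "[(Suc a, Cap Down), (a, Neg)]" "over_left a" "downs (Suc a)" "rw 0" "shift 1 (up_over a)" _ 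
          "downs (Suc a)" "[Down, Up]" "[Up, Down]"])
      (use arr_over_left[of a] cx arr_rw arr_up_over'[of a "[Down]"] in \<open>simp_all add: replicate_simps del: arr.simps(2)\<close>)
  note teq_sym[OF this]
  finally show ?case by (simp add: over_left_Suc up_over_Suc)
qed

text \<open>When the cup is pulled to the right, the passage of its upward leg is undone, and the
  downward leg crosses below the other strands instead.\<close>

lemma cup_to_right:
  "teq ([Down] @ downs a @ [Up]) (shift 1 (up_over a) @ [(0, Cup Down)]) (under_right a @ [(a, Cup Down)]) (downs a)"
proof (induction a)
  case 0
  then show ?case by (simp add: under_right_def teq_refl eval)
next
  case (Suc a)
  let ?xs = "[Down] @ downs (Suc a) @ [Up]"
  have r: "ar ?xs (rw (Suc a)) ([Down] @ downs a @ [Up, Down])"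
    using arr_rw'[of "Suc a" "[]"] by (simp add: replicate_simps)
  have ur: "ar ?xs (under_right a) (downs a @ [Down, Down, Up])"
    using arr_right[OF arr_under_right[of a], of "[Down, Up]"] by (simp add: replicate_simps)
  have "teq ?xs (shift 1 (up_over (Suc a)) @ [(0, Cup Down)]) (rw (Suc a) @ under_right a @ [(a, Cup Down)]) (downs (Suc a))"
    using teq_append_left[OF r, of _ _ "downs (Suc a)"] teq_right[OF Suc, of "[Down]"] by (simp add: up_over_Suc replicate_simps)
  also have "teq ?xs (under_right a @ rw (Suc a) @ [(a, Cup Down)]) (rw (Suc a) @ under_right a @ [(a, Cup Down)]) (downs (Suc a))"
    by (rule teq_exch[of _ "[]" "under_right a" "downs (Suc a)" "rw 0" "[(a, Cup Down)]" _ "downs (Suc a)" "[Down, Up]" "[Up, Down]"])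
      (use arr_under_right[of a] arr_rw arr_cup_Down[of a "[Down]"] in \<open>simp_all add: replicate_simps del: arr.simps(2)\<close>)
  note teq_sym[OF this]
  also have "teq ?xs (under_right a @ rw (Suc a) @ [(a, Cup Down)]) (under_right a @ [(a, Pos), (Suc a, Cup Down)]) (downs (Suc a))"
    by (rule teq_in[OF cup_past_down, of _ "under_right a" "downs a" "[]" _ _ "[]"])
      (use ur in \<open>simp_all add: replicate_simps\<close>)
  finally show ?case by (simp add: under_right_Suc)
qed

text \<open>After conjugation with the fixed tangles \<open>unsort\<close> the word becomes a sorted
  one. This property is compatible with composition and with a further strand on the left, so that
  single pieces at position \<open>0\<close> suffice.\<close>

definition sortable :: "dir list \<Rightarrow> web \<Rightarrow> dir list \<Rightarrow> bool" where
  "sortable xs w ys \<longleftrightarrow> (\<exists>t. sorted_word (count_list xs Down) (count_list xs Up) t (count_list ys Down) (count_list ys Up) \<and>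
     teq (sorted_dirs xs) (unsort xs @ w) (t @ unsort ys) ys)"

lemma sortable_Nil: "sortable xs [] xs"
  unfolding sortable_def by (intro exI[of _ "[]"]) (simp add: sorted_word.nil teq_refl arr_unsort)

lemma sortable_append:
  assumes "sortable xs a ys" "sortable ys b zs" "ar ys b zs"
  shows "sortable xs (a @ b) zs"
proof -
  obtain s t where s: "sorted_word (count_list xs Down) (count_list xs Up) s (count_list ys Down) (count_list ys Up)"
    "teq (sorted_dirs xs) (unsort xs @ a) (s @ unsort ys) ys"
    and t: "sorted_word (count_list ys Down) (count_list ys Up) t (count_list zs Down) (count_list zs Up)"
    "teq (sorted_dirs ys) (unsort ys @ b) (t @ unsort zs) zs"
    using assms by (auto simp: sortable_def)
  have "teq (sorted_dirs xs) ((unsort xs @ a) @ b) ((s @ unsort ys) @ b) zs"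
    by (rule teq_append_right[OF s(2) assms(3)])
  also have "teq (sorted_dirs xs) ((s @ unsort ys) @ b) (s @ t @ unsort zs) zs"
    using teq_append_left[OF arr_sorted_word[OF s(1), folded sorted_dirs_def] t(2)] by simp
  finally show ?thesis
    unfolding sortable_def using sorted_word_append[OF s(1) t(1)] by (intro exI[of _ "s @ t"]) simp
qed

text \<open>Next to a downward strand the sorted word is just shifted; an upward strand is carried
  through it by \<open>up_over_sorted_word\<close>.\<close>

lemma sortable_left:
  assumes "sortable xs w ys"
  shows "sortable (d # xs) (shift 1 w) (d # ys)"
proof -
  obtain t where t: "sorted_word (count_list xs Down) (count_list xs Up) t (count_list ys Down) (count_list ys Up)"
    "teq (sorted_dirs xs) (unsort xs @ w) (t @ unsort ys) ys"
    using assms by (auto simp: sortable_def)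
  show ?thesis
  proof (cases d)
    case Down
    then show ?thesis using sorted_word_shift[OF t(1)] teq_left[OF t(2), of "[Down]"]
      unfolding sortable_def by (intro exI[of _ "shift 1 t"]) (simp add: sorted_dirs_def)
  next
    case Up
    let ?a = "count_list xs Down" and ?b = "count_list xs Up" and ?a' = "count_list ys Down" and ?b' = "count_list ys Up"
    obtain t' where t': "sorted_word ?a (Suc ?b) t' ?a' (Suc ?b')"
      "teq (downs ?a @ ups (Suc ?b)) (up_over ?a @ shift 1 t) (t' @ up_over ?a') ([Up] @ downs ?a' @ ups ?b')"
      using up_over_sorted_word[OF t(1)] by blast
    have "teq (downs ?a @ ups (Suc ?b)) (up_over ?a @ shift 1 (unsort xs @ w)) (up_over ?a @ shift 1 (t @ unsort ys)) (Up # ys)"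
      using teq_append_left[OF arr_right[OF arr_up_over[of ?a], of "ups ?b"]] teq_left[OF t(2), of "[Up]"]
      by (simp add: sorted_dirs_def)
    also have "teq (downs ?a @ ups (Suc ?b)) (up_over ?a @ shift 1 (t @ unsort ys)) (t' @ up_over ?a' @ shift 1 (unsort ys)) (Up # ys)"
      using teq_append_right[OF t'(2)] arr_left[OF arr_unsort[of ys], of "[Up]"] by (simp add: sorted_dirs_def)
    finally show ?thesis
      unfolding sortable_def Up using t'(1) by (intro exI[of _ t']) (simp add: sorted_dirs_def)
  qed
qed

end

section \<open>Sorting tangles up to curls\<close>

context unframed_relation
begin

lemma teq_curl:
  assumes "curl \<in> {right_curl Pos, left_curl Pos}"
  shows "teq [Down] (curl 0) [] [Down]"
proof -
  have c: "ar [Down] (curl 0) [Down]" "shift k (curl i) = curl (k + i)" for k i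
    using assms by (auto simp: eval)
  have "R (u @ curl (length P) @ v) (u @ v)"
    if u: "ar [] u (P @ [Down] @ Q)" and v: "ar (P @ [Down] @ Q) v []" for P Q u v
    using R_curl[OF assms, of u "length P" v] arr_appendI[OF arr_appendI[OF u arr_context[OF c(1)]] v]
      arr_appendI[OF u v] by (simp add: webs_iff_arr c)
  with c show ?thesis by (auto simp: teq_def)
qed

text \<open>The two kinds of caps differ by a crossing of their legs and a curl, so this is where
  the framing is given up.\<close>

lemma cap_Up: "teq [] [(0, Cap Up)] ([(0, Cap Down)] @ rw 0) [Up, Down]"
proof -
  have "teq [] [(0, Cap Up)] ([(0, Cap Up)] @ shift 1 (right_curl Pos 0)) [Up, Down]"
    by (rule teq_sym, rule teq_in[OF teq_curl[of "right_curl Pos", simplified], of _ "[(0, Cap Up)]" "[Up]" "[]" _ _ "[]"]) (simp_all add: eval)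
  also have "teq [] ([(0, Cap Up)] @ shift 1 (right_curl Pos 0)) ([(0, Cap Down)] @ rw 0) [Up, Down]"
    by (rule teq_exch[of _ "[]" "[(0, Cap Up)]" "[Up, Down]" "[(0, Cap Down)]" "[(1, Pos), (2, Cup Down)]" _ "[]" "[]" "[Down, Up]"])
      (simp_all add: eval)
  finally show ?thesis .
qed


lemma cup_Up: "teq [Down, Up] (rw 0 @ [(0, Cup Up)]) [(0, Cup Down)] []"
proof -
  have "teq [Down, Up] (left_curl Pos 0 @ [(0, Cup Down)]) (rw 0 @ [(0, Cup Up)]) []"
    by (rule teq_exch[of _ "[(0, Cap Up), (1, Pos)]" "[(0, Cup Up)]" "[]" "[(0, Cup Down)]" "[]" _ "[Up, Down]" "[Down, Up]" "[]"])
      (simp_all add: eval)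
  note teq_sym[OF this]
  also have "teq [Down, Up] (left_curl Pos 0 @ [(0, Cup Down)]) [(0, Cup Down)] []"
    by (rule teq_in[OF teq_curl[of "left_curl Pos", simplified], of _ "[]" "[]" "[(0, Cup Down)]" _ _ "[Up]"]) (simp_all add: eval)
  finally show ?thesis .
qed

text \<open>The piece commutes with \<open>unsort Q\<close> on its right. A crossing is then already
  sorted; a cap or cup is first given a downward left leg and then pulled to the border behind the
  downward strands.\<close>

lemma sortable_piece_0:
  assumes "\<forall>v. p \<noteq> Node v"
  shows "sortable (web_upper n p @ Q) [(0, p)] (web_lower n p @ Q)"
proof -
  let ?a = "count_list Q Down" and ?b = "count_list Q Up"
  have exc: "teq (sorted_dirs Q) (unsort Q @ [(0, Cap d)]) ([(0, Cap d)] @ shift 2 (unsort Q)) ([d, opp d] @ Q)" for d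
    by (rule teq_sym, rule teq_exch[of _ "[]" "[(0, Cap d)]" "[d, opp d]" "unsort Q" "[]" _ "[]" "sorted_dirs Q" Q])
      (simp_all add: eval arr_unsort)
  have exu: "teq ([d, opp d] @ sorted_dirs Q) (shift 2 (unsort Q) @ [(0, Cup d)]) ([(0, Cup d)] @ unsort Q) Q" for d
    by (rule teq_sym, rule teq_exch[of _ "[]" "[(0, Cup d)]" "[]" "unsort Q" "[]" _ "[d, opp d]" "sorted_dirs Q" Q])
      (simp_all add: eval arr_unsort)
  have cr: ?thesis if "X = p" "X \<in> {Pos, Neg}" for X
  proof -
    have X: "plain [(0, X)]" "ar [Down, Down] [(0, X)] [Down, Down]" using that by (auto simp: eval)
    have "teq ([Down, Down] @ sorted_dirs Q) ([(0, X)] @ shift 2 (unsort Q)) (shift 2 (unsort Q) @ [(0, X)]) ([Down, Down] @ Q)"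
      by (rule teq_exch[of _ "[]" "[(0, X)]" "[Down, Down]" "unsort Q" "[]" _ "[Down, Down]" "sorted_dirs Q" Q])
        (use X arr_unsort in \<open>simp_all add: numeral_2_eq_2\<close>)
    note teq_sym[OF this]
    moreover have "sorted_word (Suc (Suc ?a)) ?b ([(0, X)] @ []) (Suc (Suc ?a)) ?b"
      using that by (intro sorted_word.intros) simp_all
    ultimately show ?thesis
      unfolding sortable_def using that by (intro exI[of _ "[(0, X)]"]) (auto simp: eval sorted_dirs_def)
  qed
  have s2: "ar ([d, opp d] @ sorted_dirs Q) (shift 2 (unsort Q)) ([d, opp d] @ Q)" for d
    using arr_left[OF arr_unsort, of "[d, opp d]" Q] by (simp add: numeral_2_eq_2)
  let ?t = "[(?a, Cap Down)] @ over_left ?a"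
  have capt: "sorted_word ?a ?b ?t (Suc ?a) (Suc ?b)"
    by (intro sorted_word.intros sorted_word_over_left) simp
  let ?u = "under_right ?a @ [(?a, Cup Down)] @ []"
  have cupt: "sorted_word (Suc ?a) (Suc ?b) ?u ?a ?b"
    by (rule sorted_word_append[OF sorted_word_under_right], simp) (intro sorted_word.intros)
  have sd: "sorted_dirs Q = downs ?a @ ups ?b" by (simp add: sorted_dirs_def)
  have capD: "teq (sorted_dirs Q) [(0, Cap Down)] (?t @ shift 1 (up_over ?a)) ([Down, Up] @ sorted_dirs Q)"
    using teq_right[OF cap_to_right[of ?a], of "ups ?b"] by (simp add: sd)
  have cupD: "teq ([Down] @ downs ?a @ ups (Suc ?b)) (shift 1 (up_over ?a) @ [(0, Cup Down)]) ?u (sorted_dirs Q)"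
    using teq_right[OF cup_to_right[of ?a], of "ups ?b"] by (simp add: sd)
  show ?thesis
  proof (cases p)
    case (Cap d)
    have "sortable Q [(0, Cap d)] ([d, opp d] @ Q)"
    proof (cases d)
      case Down
      have "teq (sorted_dirs Q) (unsort Q @ [(0, Cap d)]) ((?t @ shift 1 (up_over ?a)) @ shift 2 (unsort Q)) ([d, opp d] @ Q)"
        by (rule teq_trans[OF exc[of d]]) (use teq_append_right[OF capD] s2[of d] in \<open>simp add: Down\<close>)
      then show ?thesis using capt unfolding sortable_def
        by (intro exI[of _ ?t]) (simp add: Down numeral_2_eq_2)
    next
      case Up
      have r: "ar ([Down, Up] @ sorted_dirs Q) (rw 0 @ shift 2 (unsort Q)) ([d, opp d] @ Q)"
        by (rule arr_appendI[OF arr_right[OF arr_rw]]) (use s2[of Up] in \<open>simp add: Up\<close>)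
      note exc[of d]
      also have "teq (sorted_dirs Q) ([(0, Cap d)] @ shift 2 (unsort Q)) (([(0, Cap Down)] @ rw 0) @ shift 2 (unsort Q)) ([d, opp d] @ Q)"
        using teq_append_right[OF teq_right[OF cap_Up, of "sorted_dirs Q"]] s2[of d] by (simp add: Up)
      also have "teq (sorted_dirs Q) (([(0, Cap Down)] @ rw 0) @ shift 2 (unsort Q)) ((?t @ shift 1 (up_over ?a)) @ rw 0 @ shift 2 (unsort Q)) ([d, opp d] @ Q)"
        using teq_append_right[OF capD r] by simp
      finally show ?thesis using capt unfolding sortable_def
        by (intro exI[of _ ?t]) (simp add: Up up_over_Suc'[of ?a, simplified] numeral_2_eq_2)
    qed
    then show ?thesis by (simp add: Cap eval)
  next
    case (Cup d)
    have "sortable ([d, opp d] @ Q) [(0, Cup d)] Q"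
    proof (cases d)
      case Down
      have 1: "ar ([Down] @ downs ?a @ ups (Suc ?b)) (shift 1 (up_over ?a)) ([d, opp d] @ sorted_dirs Q)"
        using arr_up_over'[of ?a "ups ?b"] by (simp add: Down sd)
      have "teq ([Down] @ downs ?a @ ups (Suc ?b)) (shift 1 (up_over ?a) @ shift 2 (unsort Q) @ [(0, Cup d)]) (?u @ unsort Q) Q"
        by (rule teq_trans[OF teq_append_left[OF 1 exu[of d]]])
          (use teq_append_right[OF cupD arr_unsort[of Q]] in \<open>simp add: Down\<close>)
      then show ?thesis using cupt unfolding sortable_def
        by (intro exI[of _ ?u]) (simp add: Down numeral_2_eq_2 sorted_dirs_def)
    next
      case Up
      have 1: "ar ([Down] @ downs ?a @ ups (Suc ?b)) (shift 1 (up_over ?a) @ rw 0) ([d, opp d] @ sorted_dirs Q)"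
        using arr_appendI[OF arr_up_over'[of ?a "ups ?b"]] arr_right[OF arr_rw, of "downs ?a @ ups ?b"] by (simp add: Up sd)
      have 2: "ar ([Down] @ downs ?a @ ups (Suc ?b)) (shift 1 (up_over ?a)) ([Down, Up] @ sorted_dirs Q)"
        using arr_up_over'[of ?a "ups ?b"] by (simp add: sd)
      have "teq ([Down] @ downs ?a @ ups (Suc ?b)) ((shift 1 (up_over ?a) @ rw 0) @ shift 2 (unsort Q) @ [(0, Cup d)])
          ((shift 1 (up_over ?a) @ rw 0) @ [(0, Cup d)] @ unsort Q) Q"
        by (rule teq_append_left[OF 1 exu[of d]])
      also have "teq ([Down] @ downs ?a @ ups (Suc ?b)) ((shift 1 (up_over ?a) @ rw 0) @ [(0, Cup d)] @ unsort Q)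
          ((shift 1 (up_over ?a) @ [(0, Cup Down)]) @ unsort Q) Q"
        using teq_append_left[OF 2 teq_append_right[OF teq_right[OF cup_Up, of "sorted_dirs Q"]]] arr_unsort[of Q]
        by (simp add: Up)
      also have "teq ([Down] @ downs ?a @ ups (Suc ?b)) ((shift 1 (up_over ?a) @ [(0, Cup Down)]) @ unsort Q) (?u @ unsort Q) Q"
        by (rule teq_append_right[OF cupD arr_unsort])
      finally show ?thesis using cupt unfolding sortable_def
        by (intro exI[of _ ?u]) (simp add: Up numeral_2_eq_2 sorted_dirs_def up_over_Suc'[of ?a, simplified])
    qed
    then show ?thesis by (simp add: Cup eval)
  qed (use assms cr in \<open>simp_all\<close>)
qed

lemma sortable_piece:
  assumes "\<forall>v. p \<noteq> Node v"
  shows "sortable (P @ web_upper n p @ Q) [(length P, p)] (P @ web_lower n p @ Q)"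
proof (induction P)
  case Nil
  then show ?case using sortable_piece_0[OF assms] by simp
next
  case (Cons d P)
  then show ?case using sortable_left[OF Cons, of d] by simp
qed

lemma sortable_word:
  assumes "plain w" "ar xs w ys"
  shows "sortable xs w ys"
  using assms
proof (induction w arbitrary: xs)
  case Nil
  then show ?case by (simp add: sortable_Nil)
next
  case (Cons x w)
  obtain i p where x: "x = (i, p)" by force
  obtain P Q where P: "length P = i" "xs = P @ web_upper n p @ Q" "ar (P @ web_lower n p @ Q) w ys"
    using Cons.prems unfolding x arr_Cons_iff by blast
  have "sortable xs [(i, p)] (P @ web_lower n p @ Q)"
    using sortable_piece[of p P Q] Cons.prems P x by simp
  from sortable_append[OF this Cons.IH[OF _ P(3)] P(3)] Cons.prems show ?case by (simp add: x)
qed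

text \<open>This plays the role of Alexander's theorem: in a sorted closed word the cups and caps
  can be nested, so that it is the closure of a braid.\<close>

lemma closed_word_sorted:
  assumes "plain w" "w \<in> webs n"
  obtains t where "sorted_word 0 0 t 0 0" "R w t"
proof -
  have "sortable [] w []" using sortable_word assms by (simp add: webs_iff_arr)
  then obtain t where t: "sorted_word 0 0 t 0 0" "teq [] w t []"
    by (auto simp: sortable_def sorted_dirs_def)
  from teqD(3)[OF t(2), of "[]" "[]"] t(1) that show ?thesis by simp
qed

end

section \<open>Closed braids\<close>

text \<open>Models the set of words at which two linear functionals on the Hecke algebra with
  \<open>k\<close> generators agree; the last clause is what the quadratic relation says about such
  a set.\<close>

definition hecke_closed :: "nat \<Rightarrow> nat list set \<Rightarrow> bool" where
  "hecke_closed k S \<longleftrightarrow> (\<forall>a b. set a \<subseteq> {..<k} \<longrightarrow> set b \<subseteq> {..<k} \<longrightarrow>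
     (\<forall>i j. Suc i < j \<longrightarrow> j < k \<longrightarrow> a @ [i, j] @ b \<in> S \<longleftrightarrow> a @ [j, i] @ b \<in> S) \<and>
     (\<forall>i. Suc i < k \<longrightarrow> a @ [i, Suc i, i] @ b \<in> S \<longleftrightarrow> a @ [Suc i, i, Suc i] @ b \<in> S) \<and>
     (\<forall>i<k. a @ [i] @ b \<in> S \<longrightarrow> a @ b \<in> S \<longrightarrow> a @ [i, i] @ b \<in> S))"

lemma hecke_closedD:
  assumes "hecke_closed k S" "set a \<subseteq> {..<k}" "set b \<subseteq> {..<k}"
  shows "Suc i < j \<Longrightarrow> j < k \<Longrightarrow> a @ [i, j] @ b \<in> S \<longleftrightarrow> a @ [j, i] @ b \<in> S"
    "Suc i < k \<Longrightarrow> a @ [i, Suc i, i] @ b \<in> S \<longleftrightarrow> a @ [Suc i, i, Suc i] @ b \<in> S"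
    "i < k \<Longrightarrow> a @ [i] @ b \<in> S \<Longrightarrow> a @ b \<in> S \<Longrightarrow> a @ [i, i] @ b \<in> S"
  using assms unfolding hecke_closed_def by blast+

lemma hecke_closed_commute:
  assumes "hecke_closed k S" "set a \<subseteq> {..<k}" "set b \<subseteq> {..<k}" "m < k" "\<forall>x\<in>set c. Suc x < m"
  shows "a @ [m] @ c @ b \<in> S \<longleftrightarrow> a @ c @ [m] @ b \<in> S"
  using assms(2,5)
proof (induction c arbitrary: a)
  case (Cons x c)
  have "a @ [m] @ (x # c) @ b \<in> S \<longleftrightarrow> a @ [x, m] @ (c @ b) \<in> S"
    using hecke_closedD(1)[OF assms(1) Cons.prems(1), of "c @ b" x m] Cons.prems assms by force
  also have "\<dots> \<longleftrightarrow> (a @ [x]) @ c @ [m] @ b \<in> S"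
    using Cons.IH[of "a @ [x]"] Cons.prems assms(4) by force
  finally show ?case by simp
qed simp

text \<open>Double induction, on \<open>k\<close> and on the number of occurrences of the last
  generator. Between two consecutive occurrences stands a word in the lower generators, to which the
  outer induction applies.\<close>

lemma hecke_span:
  assumes "hecke_closed k S" "\<And>w. set w \<subseteq> {..<k} \<Longrightarrow> count_list w (k - 1) \<le> 1 \<Longrightarrow> w \<in> S"
    and "set w \<subseteq> {..<k}"
  shows "w \<in> S"
  using assms
proof (induction k arbitrary: S w)
  case 0
  then show ?case by simp
next
  case (Suc m)
  show ?case using Suc.prems(3)
  proof (induction "count_list w m" arbitrary: w rule: less_induct)
    case (less w)
    note IH = less(1) and w = less(2)
    show ?case
    proof (cases "count_list w m \<le> 1")
      case True
      then show ?thesis using Suc.prems(2) w by simp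
    next
      case False
      then have "m \<in> set w" by (metis count_notin zero_le)
      then obtain a r where a: "w = a @ m # r" "m \<notin> set a" by (meson split_list_first)
      with False have "m \<in> set r" by (metis One_nat_def add.commute add_0 count_list.simps(2) count_list_append count_notin le_refl plus_1_eq_Suc)
      then obtain c d where c: "r = c @ m # d" "m \<notin> set c" by (meson split_list_first)
      have sets: "set a \<subseteq> {..<Suc m}" "set d \<subseteq> {..<Suc m}" "set c \<subseteq> {..<m}"
        using w a c by (auto simp: less_Suc_eq)
      have cnt: "count_list w m = count_list d m + 2" using a c by simp
      \<comment> \<open>All words that may stand between the first two occurrences of
        \<open>m\<close>. This set inherits the closure properties for the generators below
        \<open>m\<close>.\<close>
      define S' where "S' = {c. a @ [m] @ c @ [m] @ d \<in> S}"
      have "hecke_closed m S'"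
        unfolding hecke_closed_def
      proof (intro allI impI)
        fix x y assume xy: "set x \<subseteq> {..<m}" "set y \<subseteq> {..<m}"
        then have "set (a @ [m] @ x) \<subseteq> {..<Suc m}" "set (y @ [m] @ d) \<subseteq> {..<Suc m}"
          using sets by (auto simp: less_Suc_eq)
        note * = hecke_closedD[OF Suc.prems(1) this]
        have "x @ [i, j] @ y \<in> S' \<longleftrightarrow> x @ [j, i] @ y \<in> S'" if "Suc i < j" "j < m" for i j
          using *(1)[of i j] that by (simp add: S'_def)
        moreover have "x @ [i, Suc i, i] @ y \<in> S' \<longleftrightarrow> x @ [Suc i, i, Suc i] @ y \<in> S'" if "Suc i < m" for i
          using *(2)[of i] that by (simp add: S'_def)
        moreover have "x @ [i, i] @ y \<in> S'" if "i < m" "x @ [i] @ y \<in> S'" "x @ y \<in> S'" for i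
          using *(3)[of i] that by (simp add: S'_def)
        ultimately show "(\<forall>i j. Suc i < j \<longrightarrow> j < m \<longrightarrow> x @ [i, j] @ y \<in> S' \<longleftrightarrow> x @ [j, i] @ y \<in> S') \<and>
           (\<forall>i. Suc i < m \<longrightarrow> x @ [i, Suc i, i] @ y \<in> S' \<longleftrightarrow> x @ [Suc i, i, Suc i] @ y \<in> S') \<and>
           (\<forall>i<m. x @ [i] @ y \<in> S' \<longrightarrow> x @ y \<in> S' \<longrightarrow> x @ [i, i] @ y \<in> S')"
          by blast
      qed
      moreover have "e \<in> S'" if e: "set e \<subseteq> {..<m}" "count_list e (m - 1) \<le> 1" for e
      proof (cases "m - 1 \<in> set e")
        case False
        have e': "\<forall>x\<in>set e. Suc x < m"
        proof
          fix x assume "x \<in> set e"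
          then have "x < m" "x \<noteq> m - 1" using e False by auto
          then show "Suc x < m" by simp
        qed
        have e'': "set e \<subseteq> {..<Suc m}" "count_list e m = 0"
          using e by (auto simp: less_Suc_eq intro: count_notin)
        \<comment> \<open>Both words contain \<open>m\<close> less often. They yield the word with
          \<open>m\<close> squared, and commuting one \<open>m\<close> back across \<open>e\<close>
          separates the two letters again.\<close>
        have "a @ e @ [m] @ d \<in> S" "a @ e @ d \<in> S"
          by (rule IH; use sets e'' cnt a in \<open>auto\<close>)+
        then have "(a @ e) @ [m, m] @ d \<in> S"
          using hecke_closedD(3)[OF Suc.prems(1), of "a @ e" d m] sets e'' by auto
        then have "a @ [m] @ e @ ([m] @ d) \<in> S"
          using hecke_closed_commute[OF Suc.prems(1) sets(1), of "[m] @ d" m e] sets(2) e' by auto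
        then show ?thesis by (simp add: S'_def)
      next
        case True
        then obtain p where p: "m = Suc p" using e by (cases m) auto
        obtain x y where xy: "e = x @ p # y" using True by (auto simp: p dest: split_list)
        with e have 0: "count_list x p = 0" "count_list y p = 0" by (simp_all add: p)
        have "\<forall>z\<in>set x \<union> set y. Suc z < m"
        proof
          fix z assume z: "z \<in> set x \<union> set y"
          then have "z \<noteq> p" using 0 by (auto simp: count_list_0_iff)
          moreover have "z < Suc p" using z e xy p by auto
          ultimately show "Suc z < m" using p by simp
        qed
        then have e': "\<forall>z\<in>set x. Suc z < m" "\<forall>z\<in>set y. Suc z < m" by auto
        have e'': "set x \<subseteq> {..<Suc m}" "set y \<subseteq> {..<Suc m}" "count_list x m = 0" "count_list y m = 0"
          using e xy by (auto simp: less_Suc_eq intro!: count_notin)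
        \<comment> \<open>The word \<open>m x p y m\<close> equals \<open>x m p m y\<close>, and the
          braid relation turns \<open>m p m\<close> into \<open>p m p\<close>, which contains
          \<open>m\<close> only once.\<close>
        have "a @ x @ [p, m, p] @ y @ d \<in> S"
          by (rule IH) (use sets e'' cnt a p in auto)
        then have "(a @ x) @ [m, p, m] @ (y @ d) \<in> S"
          using hecke_closedD(2)[OF Suc.prems(1), of "a @ x" "y @ d" p] sets e'' p by auto
        then have "(a @ x @ [m, p]) @ y @ [m] @ d \<in> S"
          using hecke_closed_commute[OF Suc.prems(1) _ sets(2) _ e'(2), of "a @ x @ [m, p]"] sets e'' p by auto
        then have "a @ [m] @ x @ ([p] @ y @ [m] @ d) \<in> S"
          using hecke_closed_commute[OF Suc.prems(1) sets(1) _ _ e'(1), of "[p] @ y @ [m] @ d"] sets e'' p by auto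
        then show ?thesis by (simp add: S'_def xy)
      qed
      ultimately have "c \<in> S'" using sets(3) by (rule Suc.IH)
      then show ?thesis by (simp add: S'_def a c)
    qed
  qed
qed

text \<open>The top of a closed braid: each new cap is inserted in the middle, with all earlier ones
  around it.\<close>

definition nested_caps :: "nat \<Rightarrow> web" where
  "nested_caps k = map (\<lambda>j. (j, Cap Down)) [0..<k]"

lemma nested_caps_Suc: "nested_caps (Suc k) = nested_caps k @ [(k, Cap Down)]"
  by (simp add: nested_caps_def)

lemma nested_caps_add: "nested_caps (a + b) = nested_caps a @ shift a (nested_caps b)"
  by (induction b) (simp_all add: nested_caps_Suc, simp add: nested_caps_def)

lemma nested_caps_0 [simp]: "nested_caps 0 = []"
  by (simp add: nested_caps_def)

lemma plain_nested_caps [simp]: "plain (nested_caps k)"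
  by (induction k) (simp_all add: nested_caps_Suc)

lemma braid_word_simps [simp]:
  "braid_word i [] = []" "braid_word i (k # ks) = (i + k, Pos) # braid_word i ks"
  "braid_word i (ks @ ks') = braid_word i ks @ braid_word i ks'"
  by (simp_all add: braid_word_def)

lemma plain_braid_word [simp]: "plain (braid_word i ks)"
  by (induction ks) simp_all

context tangle_relation
begin

lemma arr_nested_caps: "ar [] (nested_caps k) (downs k @ ups k)"
proof (induction k)
  case (Suc k)
  then show ?case using arr_appendI[OF Suc arr_cap_Down] by (simp add: nested_caps_Suc replicate_simps)
qed simp

lemma arr_braid_word: "\<forall>k\<in>set ks. Suc k < a \<Longrightarrow> ar (downs a @ Q) (braid_word 0 ks) (downs a @ Q)"
proof (induction ks)
  case (Cons k ks)
  then show ?case using arr_appendI[OF arr_crossing[of Pos k a Q]] by simp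
qed simp

text \<open>The caps pair the upward strands \<open>j\<close> and \<open>j + 1\<close> with the
  downward strands \<open>c + 1\<close> and \<open>c\<close>, so that the crossing slides over them
  to position \<open>c\<close>. The \<open>j\<close> inner caps are moved out of the way and
  restored afterwards.\<close>

lemma nested_caps_up_crossing:
  assumes "X \<in> {Pos, Neg}"
  shows "teq [] (nested_caps (c + 2 + j) @ turn_clockwise 2 2 X (c + 2 + j + j)) (nested_caps (c + 2 + j) @ [(c, X)])
    (downs (c + 2 + j) @ ups (c + 2 + j))"
proof -
  let ?T = "turn_clockwise 2 2 X" and ?ys = "downs (c + 2 + j) @ ups (c + 2 + j)"
  have X: "plain [(c, X)]" using assms by auto
  have comm: "ups j @ ups c = ups c @ ups j" by (simp add: add.commute flip: replicate_add)
  have inner: "ar (downs (c + 2) @ Q) (shift (c + 2) (nested_caps j)) (downs (c + 2) @ downs j @ ups j @ Q)" for Q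
    using arr_context[OF arr_nested_caps[of j], of "downs (c + 2)" Q] by (simp)
  have T: "ar (ups (c + 2)) (?T 0) (ups (c + 2))"
    using arr_up_crossing[OF assms, of 0 "c + 2" "[]"] by simp
  have "teq [] (nested_caps (c + 2) @ shift (c + 2) (nested_caps j) @ ?T (c + 2 + j + j))
      (nested_caps (c + 2) @ ?T (c + 2) @ shift (c + 2) (nested_caps j)) ?ys"
    by (rule teq_exch[of _ _ "shift (c + 2) (nested_caps j)" "downs (c + 2) @ downs j @ ups j" "?T 0" "[]" _ "downs (c + 2)" "ups (c + 2)" "ups (c + 2)"])
      (use inner[of "[]"] T plain_turn[OF assms] arr_nested_caps[of "c + 2"] in \<open>simp_all add: replicate_simps comm add.assoc\<close>)
  also have "teq [] (nested_caps (c + 2) @ ?T (c + 2) @ shift (c + 2) (nested_caps j))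
      (nested_caps c @ [(c, Cap Down), (Suc c, Cap Down), (c, X)] @ shift (c + 2) (nested_caps j)) ?ys"
    by (rule teq_in[OF nested_caps_turn[OF assms], of _ "nested_caps c" "downs c" "shift (c + 2) (nested_caps j)" _ _ "ups c"])
      (use arr_nested_caps[of c] inner[of "ups (c + 2)"] in \<open>simp_all add: nested_caps_Suc replicate_simps comm\<close>)
  also have "teq [] (nested_caps c @ [(c, Cap Down), (Suc c, Cap Down), (c, X)] @ shift (c + 2) (nested_caps j))
     (nested_caps (c + 2) @ shift (c + 2) (nested_caps j) @ [(c, X)]) ?ys"
    by (rule teq_exch[of _ "nested_caps (c + 2)" "[(c, X)]" "downs (c + 2)" "nested_caps j" "[]" _ "downs (c + 2)" "ups (c + 2)" "downs j @ ups j @ ups (c + 2)"])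
      (use X arr_crossing[OF assms, of c "c + 2" "[]"] arr_nested_caps[of "c + 2"] arr_right[OF arr_nested_caps[of j], of "ups (c + 2)"] in
        \<open>simp_all add: replicate_simps nested_caps_Suc comm del: arr.simps(2)\<close>)
  finally show ?thesis unfolding nested_caps_add[of "c + 2" j] by simp
qed

lemma braid_word_far:
  assumes "Suc i < j" "Suc j < a"
  shows "teq (downs a @ Q) (braid_word 0 [i, j]) (braid_word 0 [j, i]) (downs a @ Q)"
proof -
  define d where "d = j - (i + 2)"
  define e where "e = a - (j + 2)"
  have j: "j = i + 2 + d" and a: "a = i + 2 + d + 2 + e" using assms by (simp_all add: d_def e_def)
  show ?thesis
    by (rule teq_exch[of _ "[]" "[(i, Pos)]" "downs (i + 2)" "[(d, Pos)]" "[]" _ "downs (i + 2)" "downs (d + 2 + e) @ Q" "downs (d + 2 + e) @ Q"])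
      (use arr_crossing[of Pos i "i + 2" "[]"] arr_crossing[of Pos d "d + 2 + e" Q] in
        \<open>simp_all add: j a replicate_simps del: arr.simps(2)\<close>)
qed

lemma braid_word_braid:
  assumes "Suc (Suc i) < a"
  shows "teq (downs a @ Q) (braid_word 0 [i, Suc i, i]) (braid_word 0 [Suc i, i, Suc i]) (downs a @ Q)"
proof -
  define e where "e = a - (i + 3)"
  have a: "a = i + 3 + e" using assms by (simp add: e_def)
  have d: "downs a = downs i @ [Down, Down, Down] @ downs e" by (simp add: a replicate_simps numeral_3_eq_3)
  show ?thesis
    by (rule teq_in[OF braid_relation, of _ "[]" "downs i" "[]" _ _ "downs e @ Q"]) (simp_all add: d)
qed

end

text \<open>\<open>Z\<close> stands for the links on which two invariants agree. In this form the
  uniqueness argument involves no coefficients: every defining relation becomes a closure property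
  of \<open>Z\<close>.\<close>

locale link_evaluation =
  fixes n :: nat and Z :: "web set"
  assumes isotopy: "link_isotopy a b \<Longrightarrow> u @ a @ v \<in> webs n \<Longrightarrow> u @ b @ v \<in> webs n \<Longrightarrow>
      u @ a @ v \<in> Z \<longleftrightarrow> u @ b @ v \<in> Z"
    and curl: "curl \<in> {right_curl Pos, left_curl Pos} \<Longrightarrow> u @ curl i @ v \<in> webs n \<Longrightarrow> u @ v \<in> webs n \<Longrightarrow>
      u @ curl i @ v \<in> Z \<longleftrightarrow> u @ v \<in> Z"
    and skein_Pos: "u @ [(i, Pos)] @ v \<in> webs n \<Longrightarrow> u @ [(i, Neg)] @ v \<in> Z \<Longrightarrow> u @ v \<in> Z \<Longrightarrow> u @ [(i, Pos)] @ v \<in> Z"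
    and skein_Neg: "u @ [(i, Pos)] @ v \<in> webs n \<Longrightarrow> u @ [(i, Pos)] @ v \<in> Z \<Longrightarrow> u @ v \<in> Z \<Longrightarrow> u @ [(i, Neg)] @ v \<in> Z"
    and circle: "u @ [(i, Cap Down), (i, Cup Down)] @ v \<in> webs n \<Longrightarrow> u @ v \<in> Z \<Longrightarrow>
      u @ [(i, Cap Down), (i, Cup Down)] @ v \<in> Z"
    and empty: "[] \<in> Z"
begin

sublocale unframed_relation n "\<lambda>w w'. w \<in> Z \<longleftrightarrow> w' \<in> Z"
  by unfold_locales (use isotopy curl in auto)

lemma skein_Neg': "ar [] u xs \<Longrightarrow> ar xs [(i, Pos)] ys \<Longrightarrow> ar ys v [] \<Longrightarrow>
    u @ [(i, Pos)] @ v \<in> Z \<Longrightarrow> u @ v \<in> Z \<Longrightarrow> u @ [(i, Neg)] @ v \<in> Z"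
  using skein_Neg[of u i v] arr_appendI[of n "[]" u xs "[(i, Pos)] @ v" "[]"] arr_appendI[of n xs "[(i, Pos)]" ys v "[]"]
  by (simp add: webs_iff_arr)

text \<open>The quadratic clause is the skein relation at the second of two equal crossings: its
  negative version cancels the first crossing, and its smoothing leaves that crossing alone.\<close>

lemma hecke_closed_closure:
  assumes v: "ar (downs (Suc k) @ Q) v []" and u: "ar [] u (downs (Suc k) @ Q)"
  shows "hecke_closed k {ks. u @ braid_word 0 ks @ v \<in> Z}"
  unfolding hecke_closed_def mem_Collect_eq
proof (intro allI impI)
  fix a b assume ab: "set a \<subseteq> {..<k}" "set b \<subseteq> {..<k}"
  have A: "ar [] (u @ braid_word 0 a) (downs (Suc k) @ Q)"
    by (rule arr_appendI[OF u arr_braid_word]) (use ab in auto)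
  have B: "ar (downs (Suc k) @ Q) (braid_word 0 b @ v) []"
    by (rule arr_appendI[OF arr_braid_word v]) (use ab in auto)
  have "u @ braid_word 0 (a @ [i, j] @ b) @ v \<in> Z \<longleftrightarrow> u @ braid_word 0 (a @ [j, i] @ b) @ v \<in> Z"
    if "Suc i < j" "j < k" for i j
    using teqD(3)[OF braid_word_far[of i j "Suc k" Q] A B] that by simp
  moreover have "u @ braid_word 0 (a @ [i, Suc i, i] @ b) @ v \<in> Z \<longleftrightarrow> u @ braid_word 0 (a @ [Suc i, i, Suc i] @ b) @ v \<in> Z"
    if "Suc i < k" for i
    using teqD(3)[OF braid_word_braid[of i "Suc k" Q] A B] that by simp
  moreover have "u @ braid_word 0 (a @ [i, i] @ b) @ v \<in> Z"
    if i: "i < k" "u @ braid_word 0 (a @ [i] @ b) @ v \<in> Z" "u @ braid_word 0 (a @ b) @ v \<in> Z" for i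
  proof -
    obtain e where e: "k = i + 1 + e" using i(1) by (metis less_iff_Suc_add Suc_eq_plus1 add_Suc)
    have X: "ar (downs (Suc k) @ Q) [(i, Pos)] (downs (Suc k) @ Q)"
      using i(1) by (intro arr_crossing) auto
    let ?u = "u @ braid_word 0 a @ [(i, Pos)]" and ?v = "braid_word 0 b @ v"
    have "teq (downs (Suc k) @ Q) [(i, Pos), (i, Neg)] [] (downs (Suc k) @ Q)"
      by (rule teq_in[OF pos_neg, of _ "[]" "downs i" "[]" _ _ "downs e @ Q"]) (simp_all add: e replicate_simps)
    from teqD(3)[OF this A B] i(3) have "?u @ [(i, Neg)] @ ?v \<in> Z" by simp
    moreover have "?u @ ?v \<in> Z" using i(2) by simp
    moreover have "?u @ [(i, Pos)] @ ?v \<in> webs n"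
      using arr_appendI[OF arr_appendI[OF arr_appendI[OF A X] X] B] by (simp add: webs_iff_arr)
    ultimately have "?u @ [(i, Pos)] @ ?v \<in> Z" by (rule skein_Pos[rotated])
    then show ?thesis by simp
  qed
  ultimately show "(\<forall>i j. Suc i < j \<longrightarrow> j < k \<longrightarrow> u @ braid_word 0 (a @ [i, j] @ b) @ v \<in> Z \<longleftrightarrow> u @ braid_word 0 (a @ [j, i] @ b) @ v \<in> Z) \<and>
     (\<forall>i. Suc i < k \<longrightarrow> u @ braid_word 0 (a @ [i, Suc i, i] @ b) @ v \<in> Z \<longleftrightarrow> u @ braid_word 0 (a @ [Suc i, i, Suc i] @ b) @ v \<in> Z) \<and>
     (\<forall>i<k. u @ braid_word 0 (a @ [i] @ b) @ v \<in> Z \<longrightarrow> u @ braid_word 0 (a @ b) @ v \<in> Z \<longrightarrow> u @ braid_word 0 (a @ [i, i] @ b) @ v \<in> Z)"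
    by blast
qed

text \<open>The diagram consists of nested caps, a braid \<open>ks\<close> and a remaining sorted
  word \<open>t\<close>. Induction over \<open>t\<close> moves its pieces one by one into the upper
  part, so \<open>ks\<close> is arbitrary. A cup closes the last strand, which can be removed once
  \<open>hecke_span\<close> has reduced the braid.\<close>

lemma braid_closure_Z:
  "sorted_word a b t a' b' \<Longrightarrow> b = a \<Longrightarrow> a' = 0 \<Longrightarrow> b' = 0 \<Longrightarrow> \<forall>k\<in>set ks. Suc k < a \<Longrightarrow>
     nested_caps a @ braid_word 0 ks @ t \<in> Z"
proof (induction arbitrary: ks rule: sorted_word.induct)
  case (nil a b)
  then show ?case by (cases ks) (auto simp: empty)
next
  case (crossing X j a b t a' b')
  have cb: "ar [] (nested_caps a @ braid_word 0 ks) (downs a @ ups a)"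
    by (rule arr_appendI[OF arr_nested_caps arr_braid_word]) (use crossing.prems in auto)
  have t: "ar (downs a @ ups a) t []" using arr_sorted_word[OF crossing.hyps(3)] crossing.prems by simp
  have 1: "nested_caps a @ braid_word 0 (ks @ [j]) @ t \<in> Z" "nested_caps a @ braid_word 0 ks @ t \<in> Z"
    using crossing.IH[of "ks @ [j]"] crossing.IH[of ks] crossing.prems crossing.hyps by simp_all
  have "(nested_caps a @ braid_word 0 ks) @ [(j, Neg)] @ t \<in> Z"
    by (rule skein_Neg'[OF cb arr_crossing[of Pos j a] t]) (use 1 crossing.hyps in simp_all)
  with 1 crossing.hyps(1) show ?case by auto
next
  case (up_crossing X j b a t a' b')
  then have a: "b = a" by simp
  let ?T = "turn_clockwise 2 2 X (a + j)"
  define c where "c = a - (j + 2)"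
  have c: "a = c + 2 + j" using up_crossing(2) a by (simp add: c_def)
  have t: "ar (downs a @ ups a) t []" using arr_sorted_word[OF up_crossing.hyps(3)] up_crossing.prems by simp
  have bw: "ar (downs a @ Q) (braid_word 0 ks) (downs a @ Q)" for Q
    by (rule arr_braid_word) (use up_crossing.prems in auto)
  have T: "ar (ups a) (turn_clockwise 2 2 X j) (ups a)"
    using arr_up_crossing[OF up_crossing(1), of j a "[]"] up_crossing.prems up_crossing.hyps(2) by simp
  have bt: "ar (downs a @ ups a) (braid_word 0 ks @ t) []" by (rule arr_appendI[OF bw t])
  \<comment> \<open>The crossing climbs along the upward legs and over the nested caps, and so
    becomes the first letter of the braid.\<close>
  have "teq [] (nested_caps a @ braid_word 0 ks @ ?T @ t) (nested_caps a @ ?T @ braid_word 0 ks @ t) []"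
    by (rule teq_exch[of _ "nested_caps a" "braid_word 0 ks" "downs a" "turn_clockwise 2 2 X j" t _ "downs a" "ups a" "ups a"])
      (use T bw[of "[]"] t arr_nested_caps[of a] plain_turn up_crossing(1) in simp_all)
  also have "teq [] (nested_caps a @ ?T @ braid_word 0 ks @ t) (nested_caps a @ [(c, X)] @ braid_word 0 ks @ t) []"
    using teq_append_right[OF nested_caps_up_crossing[OF up_crossing(1), of c j] bt[unfolded c]]
    by (simp add: c ac_simps)
  finally have *: "nested_caps a @ braid_word 0 ks @ ?T @ t \<in> Z \<longleftrightarrow> nested_caps a @ [(c, X)] @ braid_word 0 ks @ t \<in> Z"
    by (auto dest: teqD(3)[of _ _ _ _ "[]" "[]"])
  have 1: "nested_caps a @ braid_word 0 (c # ks) @ t \<in> Z" "nested_caps a @ braid_word 0 ks @ t \<in> Z"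
    using up_crossing.IH[of "c # ks"] up_crossing.IH[of ks] up_crossing.prems up_crossing.hyps(2) c by simp_all
  have "nested_caps a @ [(c, Neg)] @ braid_word 0 ks @ t \<in> Z"
    by (rule skein_Neg'[OF arr_nested_caps arr_crossing[of Pos c a] bt]) (use 1 c in simp_all)
  with 1 * up_crossing(1) show ?case by auto
next
  case (cap a b t a' b')
  have t: "ar (downs (Suc a) @ ups (Suc a)) t []" using arr_sorted_word[OF cap.hyps] cap.prems by simp
  have bw: "ar (downs a @ Q) (braid_word 0 ks) (downs a @ Q)" for Q
    by (rule arr_braid_word) (use cap.prems in auto)
  have "teq [] (nested_caps a @ braid_word 0 ks @ [(a, Cap Down)] @ t) (nested_caps a @ [(a, Cap Down)] @ braid_word 0 ks @ t) []"
    by (rule teq_exch[of _ "nested_caps a" "braid_word 0 ks" "downs a" "[(0, Cap Down)]" t _ "downs a" "ups a" "[Down, Up] @ ups a"])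
      (use bw[of "[]"] t arr_nested_caps[of a] in \<open>simp_all add: eval replicate_simps\<close>)
  moreover have "nested_caps (Suc a) @ braid_word 0 ks @ t \<in> Z"
    by (rule cap.IH) (use cap.prems in auto)
  ultimately show ?case by (auto simp: nested_caps_Suc dest: teqD(3)[of _ _ _ _ "[]" "[]"])
next
  case (cup a b t a' b')
  have t: "ar (downs a @ ups a) t []" using arr_sorted_word[OF cup.hyps] cup.prems by simp
  have bw: "ar (downs a @ Q) (braid_word 0 ks) (downs a @ Q)" if "\<forall>k\<in>set ks. Suc k < a" for ks Q
    by (rule arr_braid_word) (use that in auto)
  have ct: "ar (downs (Suc a) @ ups (Suc a)) ([(a, Cup Down)] @ t) []"
    using arr_appendI[OF arr_cup_Down[of a "ups a"] t] by (simp add: replicate_simps del: arr.simps(2))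
  define S where "S = {ks. nested_caps (Suc a) @ braid_word 0 ks @ [(a, Cup Down)] @ t \<in> Z}"
  have "hecke_closed a S"
    unfolding S_def using hecke_closed_closure[OF ct arr_nested_caps[of "Suc a"]] by simp
  moreover have "w \<in> S" if w: "set w \<subseteq> {..<a}" "count_list w (a - 1) \<le> 1" for w
  proof (cases "a - 1 \<in> set w")
    case False
    have w': "\<forall>k\<in>set w. Suc k < a"
    proof
      fix k assume "k \<in> set w"
      then have "k < a" "k \<noteq> a - 1" using w False by auto
      then show "Suc k < a" by simp
    qed
    \<comment> \<open>No crossing involves the last strand, so its cap descends to its cup and the
      two form a circle.\<close>
    have "teq [] (nested_caps a @ braid_word 0 w @ [(a, Cap Down)] @ [(a, Cup Down)] @ t)
      (nested_caps a @ [(a, Cap Down)] @ braid_word 0 w @ [(a, Cup Down)] @ t) []"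
      by (rule teq_exch[of _ "nested_caps a" "braid_word 0 w" "downs a" "[(0, Cap Down)]" "[(a, Cup Down)] @ t" _ "downs a" "ups a" "[Down, Up] @ ups a"])
        (use bw[OF w', of "[]"] ct arr_nested_caps[of a] in \<open>simp_all add: eval replicate_simps\<close>)
    from teqD(3)[OF this, of "[]" "[]"]
    have "nested_caps (Suc a) @ braid_word 0 w @ [(a, Cup Down)] @ t \<in> Z \<longleftrightarrow>
      (nested_caps a @ braid_word 0 w) @ [(a, Cap Down), (a, Cup Down)] @ t \<in> Z"
      by (simp add: nested_caps_Suc)
    moreover have "nested_caps a @ braid_word 0 w @ t \<in> Z" by (rule cup.IH) (use cup.prems w' in auto)
    moreover have "(nested_caps a @ braid_word 0 w) @ [(a, Cap Down), (a, Cup Down)] @ t \<in> webs n"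
      unfolding webs_iff_arr using arr_appendI[OF arr_appendI[OF arr_appendI[OF arr_nested_caps[of a] bw[OF w']] arr_cap_Down] arr_appendI[OF arr_cup_Down t]]
      by simp
    ultimately show ?thesis using circle[of "nested_caps a @ braid_word 0 w" a t] by (simp add: S_def)
  next
    case True
    then obtain p where p: "a = Suc p" using w by (cases a) auto
    obtain x y where xy: "w = x @ p # y" using True by (auto simp: p dest: split_list)
    with w have 0: "count_list x p = 0" "count_list y p = 0" by (simp_all add: p)
    have "\<forall>z\<in>set x \<union> set y. Suc z < a"
    proof
      fix z assume z: "z \<in> set x \<union> set y"
      then have "z \<noteq> p" using 0 by (auto simp: count_list_0_iff)
      moreover have "z < Suc p" using z w xy p by auto
      ultimately show "Suc z < a" using p by simp
    qed
    then have x: "\<forall>z\<in>set x. Suc z < a" and y: "\<forall>z\<in>set y. Suc z < a" by auto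
    let ?r = "[(p, Pos)] @ braid_word 0 y @ [(a, Cup Down)] @ t"
    have P: "ar (downs (Suc a) @ ups (Suc a)) [(p, Pos)] (downs (Suc a) @ ups (Suc a))"
      by (rule arr_crossing) (simp_all add: p)
    have y2: "ar (downs (Suc a) @ ups (Suc a)) (braid_word 0 y) (downs (Suc a) @ ups (Suc a))"
      using bw[OF y, of "[Down] @ ups (Suc a)"] by (simp add: replicate_simps)
    have r: "ar (downs (Suc a) @ ups (Suc a)) ?r []"
      by (rule arr_appendI[OF P arr_appendI[OF y2 ct]])
    have cx: "ar [] (nested_caps a @ braid_word 0 x) (downs a @ ups a)"
      by (rule arr_appendI[OF arr_nested_caps bw[OF x]])
    have cxcp: "ar [] (nested_caps a @ braid_word 0 x @ [(a, Cap Down), (p, Pos)]) (downs a @ [Down, Up] @ ups a)"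
      using arr_appendI[OF arr_appendI[OF cx arr_cap_Down]] P by (simp add: replicate_simps del: arr.simps(2))
    \<comment> \<open>A single crossing involves the last strand: its cap and its cup move next to
      that crossing and form a curl.\<close>
    have "teq [] (nested_caps a @ braid_word 0 x @ [(a, Cap Down)] @ ?r) (nested_caps a @ [(a, Cap Down)] @ braid_word 0 x @ ?r) []"
      by (rule teq_exch[of _ "nested_caps a" "braid_word 0 x" "downs a" "[(0, Cap Down)]" ?r _ "downs a" "ups a" "[Down, Up] @ ups a"])
        (use bw[OF x, of "[]"] r arr_nested_caps[of a] in \<open>simp_all add: eval replicate_simps\<close>)
    from teqD(3)[OF this, of "[]" "[]"]
    have 1: "nested_caps (Suc a) @ braid_word 0 w @ [(a, Cup Down)] @ t \<in> Z \<longleftrightarrow>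
      nested_caps a @ braid_word 0 x @ [(a, Cap Down)] @ ?r \<in> Z"
      by (simp add: nested_caps_Suc xy)
    have "teq [] ((nested_caps a @ braid_word 0 x @ [(a, Cap Down), (p, Pos)]) @ braid_word 0 y @ [(a, Cup Down)] @ t)
      ((nested_caps a @ braid_word 0 x @ [(a, Cap Down), (p, Pos)]) @ [(a, Cup Down)] @ braid_word 0 y @ t) []"
      by (rule teq_exch[of _ _ "braid_word 0 y" "downs a" "[(0, Cup Down)]" t _ "downs a" "[Down, Up] @ ups a" "ups a"])
        (use bw[OF y, of "[]"] t cxcp in \<open>simp_all add: eval replicate_simps\<close>)
    from teqD(3)[OF this, of "[]" "[]"]
    have 2: "nested_caps a @ braid_word 0 x @ [(a, Cap Down)] @ ?r \<in> Z \<longleftrightarrow>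
      (nested_caps a @ braid_word 0 x) @ right_curl Pos p @ (braid_word 0 y @ t) \<in> Z"
      by (simp add: right_curl_def p)
    have "nested_caps a @ braid_word 0 (x @ y) @ t \<in> Z" by (rule cup.IH) (use cup.prems x y in auto)
    moreover have "teq (downs a @ ups a) (right_curl Pos p) [] (downs a @ ups a)"
      by (rule teq_in[OF teq_curl[of "right_curl Pos"], of _ "[]" "downs p" "[]" _ _ "ups a"])
        (simp_all add: p replicate_simps right_curl_def)
    from teqD(3)[OF this cx arr_appendI[OF bw[OF y] t]]
    have "(nested_caps a @ braid_word 0 x) @ right_curl Pos p @ (braid_word 0 y @ t) \<in> Z \<longleftrightarrow>
       (nested_caps a @ braid_word 0 x) @ [] @ (braid_word 0 y @ t) \<in> Z" .
    ultimately show ?thesis using 1 2 by (simp add: S_def)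
  qed
  moreover have "set ks \<subseteq> {..<a}" using cup.prems by auto
  ultimately have "ks \<in> S" by (rule hecke_span)
  then show ?case by (simp add: S_def)
qed

theorem plain_webs_Z:
  assumes "plain w" "w \<in> webs n"
  shows "w \<in> Z"
proof -
  obtain t where t: "sorted_word 0 0 t 0 0" "w \<in> Z \<longleftrightarrow> t \<in> Z"
    using closed_word_sorted assms by blast
  then show ?thesis using braid_closure_Z[of 0 0 t 0 0 "[]"] by simp
qed

end

section \<open>The quantum antisymmetrizer\<close>

text \<open>Equality in the monoid of positive braids.\<close>

inductive braid_equiv :: "nat list \<Rightarrow> nat list \<Rightarrow> bool" where
  equiv_refl: "braid_equiv a a"
| equiv_sym: "braid_equiv a b \<Longrightarrow> braid_equiv b a"
| equiv_trans: "braid_equiv a b \<Longrightarrow> braid_equiv b c \<Longrightarrow> braid_equiv a c"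
| far: "Suc i < j \<Longrightarrow> braid_equiv (a @ [i, j] @ b) (a @ [j, i] @ b)"
| braid: "braid_equiv (a @ [i, Suc i, i] @ b) (a @ [Suc i, i, Suc i] @ b)"

lemmas [trans] = braid_equiv.equiv_trans

lemma braid_equiv_context: "braid_equiv a b \<Longrightarrow> braid_equiv (c @ a @ d) (c @ b @ d)"
proof (induction rule: braid_equiv.induct)
  case (far i j a b)
  then show ?case using braid_equiv.far[of i j "c @ a" "b @ d"] by simp
next
  case (braid a i b)
  then show ?case using braid_equiv.braid[of "c @ a" i "b @ d"] by simp
qed (blast intro: braid_equiv.intros)+

lemma braid_permutation_Cons: "braid_permutation (k # ks) = braid_permutation ks \<circ> transpose k (Suc k)"
proof -
  have "fold (\<lambda>k f. transpose k (Suc k) \<circ> f) ks g = fold (\<lambda>k f. transpose k (Suc k) \<circ> f) ks id \<circ> g" for g :: "nat \<Rightarrow> nat"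
  proof (induction ks arbitrary: g)
    case (Cons k ks)
    show ?case using Cons[of "transpose k (Suc k) \<circ> g"] Cons[of "transpose k (Suc k)"] by (simp add: comp_assoc)
  qed simp
  from this[of "transpose k (Suc k)"] show ?thesis by (simp add: braid_permutation_def)
qed

lemma braid_permutation_Nil [simp]: "braid_permutation [] = id"
  by (simp add: braid_permutation_def)

lemma braid_permutation_append: "braid_permutation (a @ b) = braid_permutation b \<circ> braid_permutation a"
  by (induction a) (simp_all add: braid_permutation_Cons comp_assoc)

lemma braid_permutation_permutes: "\<forall>k\<in>set ks. Suc k < n \<Longrightarrow> braid_permutation ks permutes {..<n}"
proof (induction ks)
  case Nil
  then show ?case by (simp only: braid_permutation_Nil permutes_id)
next
  case (Cons k ks)
  then show ?case unfolding braid_permutation_Cons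
    by (intro permutes_compose permutes_swap_id) auto
qed

lemma braid_equiv_invariants:
  "braid_equiv a b \<Longrightarrow> set a = set b \<and> length a = length b \<and> braid_permutation a = braid_permutation b"
proof (induction rule: braid_equiv.induct)
  case (far i j a b)
  have "transpose j (Suc j) (transpose i (Suc i) x) = transpose i (Suc i) (transpose j (Suc j) x)" for x
    using far by (auto simp: transpose_def)
  then show ?case by (auto simp: braid_permutation_append braid_permutation_Cons fun_eq_iff)
next
  case (braid a i b)
  have "transpose i (Suc i) (transpose (Suc i) (Suc (Suc i)) (transpose i (Suc i) x)) =
    transpose (Suc i) (Suc (Suc i)) (transpose i (Suc i) (transpose (Suc i) (Suc (Suc i)) x))" for x
    by (auto simp: transpose_def)
  then show ?case by (auto simp: braid_permutation_append braid_permutation_Cons fun_eq_iff)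
qed auto

lemma braid_equiv_commute:
  "\<forall>x\<in>set c. Suc k < x \<or> Suc x < k \<Longrightarrow> braid_equiv (a @ c @ [k] @ b) (a @ [k] @ c @ b)"
proof (induction c arbitrary: a)
  case Nil
  then show ?case by (simp add: braid_equiv.equiv_refl)
next
  case (Cons x c)
  have "braid_equiv ((a @ [x]) @ c @ [k] @ b) ((a @ [x]) @ [k] @ c @ b)" by (rule Cons.IH) (use Cons.prems in simp)
  moreover have "braid_equiv (a @ [x, k] @ (c @ b)) (a @ [k, x] @ (c @ b))"
    using Cons.prems braid_equiv.far[of k x a "c @ b"] braid_equiv.far[of x k a "c @ b"] by (auto intro: braid_equiv.equiv_sym)
  ultimately show ?case by (auto intro: braid_equiv.equiv_trans)
qed

section \<open>Normal forms of words in the symmetric group\<close>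

definition descending :: "nat \<Rightarrow> nat \<Rightarrow> nat list" where
  "descending m j = rev [m - j..<m]"

lemma descending_0 [simp]: "descending m 0 = []"
  by (simp add: descending_def)

lemma set_descending: "set (descending m j) = {m - j..<m}"
  by (simp add: descending_def)

lemma length_descending: "j \<le> m \<Longrightarrow> length (descending m j) = j"
  by (simp add: descending_def)

lemma descending_Suc: "j < m \<Longrightarrow> descending m (Suc j) = descending m j @ [m - Suc j]"
  using upt_rec[of "m - Suc j" m] by (simp add: descending_def Suc_diff_Suc)

lemma descending_Suc_Suc: "descending (Suc m) (Suc j) = m # descending m j"
  by (simp add: descending_def)

lemma descending_append: "i + j \<le> m \<Longrightarrow> descending m (i + j) = descending m i @ descending (m - i) j"
proof (induction j)
  case (Suc j)
  then show ?case using descending_Suc[of "i + j" m] descending_Suc[of j "m - i"] by simp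
qed simp

lemma descending_commute_low:
  assumes "k + j + 1 < m"
  shows "braid_equiv (a @ descending m j @ [k] @ b) (a @ [k] @ descending m j @ b)"
  by (rule braid_equiv_commute) (use assms in \<open>auto simp: set_descending\<close>)

text \<open>The descending word contains \<open>k, k - 1\<close>. The generator \<open>k\<close>
  moves left up to these letters, passes them by the braid relation as \<open>k - 1\<close>, and
  commutes with everything before them.\<close>

lemma descending_commute_high:
  assumes "m < k + j" "j \<le> m" "k < m"
  shows "braid_equiv (a @ descending m j @ [k] @ b) (a @ [k - 1] @ descending m j @ b)"
proof -
  define h where "h = m - Suc k"
  define l where "l = j - h - 2"
  obtain p where k: "k = Suc p" using assms by (cases k) auto
  have j: "j = h + (2 + l)" "m - h = Suc (Suc p)" using assms k by (auto simp: h_def l_def)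
  have d: "descending m j = descending m h @ [Suc p, p] @ descending p l"
    using descending_append[of h "2 + l" m] assms(2) descending_Suc_Suc[of "Suc p" "Suc l"] descending_Suc_Suc[of p l]
    unfolding j by simp
  have "braid_equiv ((a @ descending m h @ [Suc p, p]) @ descending p l @ [Suc p] @ b)
     ((a @ descending m h @ [Suc p, p]) @ [Suc p] @ descending p l @ b)"
    by (rule braid_equiv_commute) (auto simp: set_descending)
  also have "braid_equiv \<dots> ((a @ descending m h) @ [p, Suc p, p] @ (descending p l @ b))"
    using braid_equiv.equiv_sym[OF braid_equiv.braid[of "a @ descending m h" p "descending p l @ b"]] by simp
  also have "braid_equiv \<dots> (a @ [p] @ descending m h @ ([Suc p, p] @ descending p l @ b))"
    using braid_equiv_commute[of "descending m h" p a "[Suc p, p] @ descending p l @ b"] j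
    by (auto simp: set_descending)
  finally show ?thesis by (simp add: d k)
qed

text \<open>The words \<open>descending m j\<close> with \<open>j \<le> m\<close> represent the
  cosets of the symmetric group on \<open>m\<close> letters in the one on \<open>m + 1\<close>
  letters.\<close>

fun canonical_words :: "nat \<Rightarrow> nat list list" where
  "canonical_words 0 = [[]]"
| "canonical_words (Suc m) = concat (map (\<lambda>w. map (\<lambda>j. w @ descending m j) [0..<Suc m]) (canonical_words m))"

lemma in_canonical_words_Suc:
  "w \<in> set (canonical_words (Suc m)) \<longleftrightarrow> (\<exists>w'\<in>set (canonical_words m). \<exists>j\<le>m. w = w' @ descending m j)"
  by (simp add: atLeast0LessThan lessThan_Suc_atMost image_iff Bex_def del: upt_Suc) auto

lemma set_canonical_word: "w \<in> set (canonical_words m) \<Longrightarrow> k \<in> set w \<Longrightarrow> Suc k < m"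
proof (induction m arbitrary: w)
  case (Suc m)
  then obtain w' j where w: "w' \<in> set (canonical_words m)" "j \<le> m" "w = w' @ descending m j"
    by (auto simp only: in_canonical_words_Suc)
  then show ?case using Suc.IH[OF w(1)] Suc.prems(2) by (auto simp: set_descending)
qed simp

lemma length_canonical_words: "length (canonical_words m) = fact m"
proof (induction m)
  case (Suc m)
  have "length (canonical_words (Suc m)) = (\<Sum>w\<leftarrow>canonical_words m. Suc m)"
    by (simp add: length_concat comp_def del: upt_Suc)
  then show ?case using Suc by (simp only: sum_list_triv) (simp add: mult.commute)
qed simp

text \<open>Depending on its position relative to the last descending factor, the new generator
  passes it unchanged, lengthens it, cancels its last letter, or passes it with the index lowered by
  one. Cancellation holds for permutations only, hence the second alternative.\<close>

lemma canonical_word_snoc: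
  "w \<in> set (canonical_words m) \<Longrightarrow> Suc k < m \<Longrightarrow>
     (\<exists>w'\<in>set (canonical_words m). braid_equiv (w @ [k]) w') \<or>
     (\<exists>ks. (\<forall>i\<in>set ks. Suc i < m) \<and> Suc (length ks) \<le> length w \<and> braid_permutation ks = braid_permutation (w @ [k]))"
proof (induction m arbitrary: w k)
  case (Suc m)
  then obtain w0 j where w: "w0 \<in> set (canonical_words m)" "j \<le> m" "w = w0 @ descending m j"
    by (auto simp only: in_canonical_words_Suc)
  have w0: "\<forall>i\<in>set w0. Suc i < Suc m" by (intro ballI, rule less_SucI, rule set_canonical_word[OF w(1)])
  have d: "\<forall>i\<in>set (descending m j). Suc i < Suc m" by (auto simp: set_descending)
  have move: ?case if k': "Suc k' < m" "braid_equiv (w0 @ descending m j @ [k]) (w0 @ [k'] @ descending m j)" for k'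
  proof -
    have eq: "braid_permutation (w0 @ descending m j @ [k]) = braid_permutation (w0 @ [k'] @ descending m j)"
      using braid_equiv_invariants[OF k'(2)] by simp
    from Suc.IH[OF w(1) k'(1)] show ?thesis
    proof (elim disjE bexE exE conjE)
      fix w' assume w': "w' \<in> set (canonical_words m)" "braid_equiv (w0 @ [k']) w'"
      then have "braid_equiv ([] @ (w0 @ [k']) @ descending m j) ([] @ w' @ descending m j)"
        by (intro braid_equiv_context)
      then have "braid_equiv (w @ [k]) (w' @ descending m j)" using k'(2) w(3) by (auto intro: braid_equiv.equiv_trans)
      moreover have "w' @ descending m j \<in> set (canonical_words (Suc m))"
        using w'(1) w(2) unfolding in_canonical_words_Suc by blast
      ultimately show ?thesis by blast
    next
      fix ks assume ks: "\<forall>i\<in>set ks. Suc i < m" "Suc (length ks) \<le> length w0"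
        "braid_permutation ks = braid_permutation (w0 @ [k'])"
      have "braid_permutation (ks @ descending m j) = braid_permutation ((w0 @ [k']) @ descending m j)"
        by (simp only: braid_permutation_append[of _ "descending m j"] ks(3))
      then have "braid_permutation (ks @ descending m j) = braid_permutation (w @ [k])"
        using eq w(3) by simp
      then show ?thesis using ks d w by (intro disjI2 exI[of _ "ks @ descending m j"]) (auto intro: less_SucI)
    qed
  qed
  consider "k + j + 1 < m" | "k + j + 1 = m" | "k + j = m" | "m < k + j" by linarith
  then show ?case
  proof cases
    case 1
    then show ?thesis using move[of k] descending_commute_low[of k j m w0 "[]"] by simp
  next
    case 2
    then have "w @ [k] = w0 @ descending m (Suc j)" using w(3) descending_Suc[of j m] by auto
    then have "w @ [k] \<in> set (canonical_words (Suc m))" using w(1) 2 unfolding in_canonical_words_Suc by (intro bexI[of _ w0] exI[of _ "Suc j"]) simp_all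
    then show ?thesis using braid_equiv.equiv_refl by blast
  next
    case 3
    have "j \<noteq> 0" using 3 Suc.prems by auto
    then obtain l where l: "j = Suc l" by (cases j) auto
    have "descending m j = descending m l @ [k]" using descending_Suc[of l m] 3 w(2) l by auto
    then have "braid_permutation (w0 @ descending m l) = braid_permutation (w @ [k])" "length w = Suc (length (w0 @ descending m l))"
      using w(3) by (auto simp: braid_permutation_append braid_permutation_Cons fun_eq_iff)
    then show ?thesis using w0 by (intro disjI2 exI[of _ "w0 @ descending m l"]) (auto simp: set_descending)
  next
    case 4
    then show ?thesis using move[of "k - 1"] descending_commute_high[of m k j w0 "[]"] w(2) Suc.prems by simp
  qed
qed simp

text \<open>For reduced words the second alternative is impossible; this is the part of Matsumoto's
  theorem that is used.\<close>

lemma word_canonical_or_shorter: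
  "\<forall>k\<in>set ks. Suc k < m \<Longrightarrow>
     (\<exists>w\<in>set (canonical_words m). braid_equiv ks w) \<or>
     (\<exists>ks'. (\<forall>i\<in>set ks'. Suc i < m) \<and> length ks' < length ks \<and> braid_permutation ks' = braid_permutation ks)"
proof (induction ks rule: rev_induct)
  case Nil
  have "[] \<in> set (canonical_words m)"
  proof (induction m)
    case (Suc m)
    then show ?case unfolding in_canonical_words_Suc by (intro bexI[of _ "[]"] exI[of _ 0]) simp_all
  qed simp
  then show ?case using braid_equiv.equiv_refl by blast
next
  case (snoc k ks)
  then consider w where "w \<in> set (canonical_words m)" "braid_equiv ks w"
    | ks' where "\<forall>i\<in>set ks'. Suc i < m" "length ks' < length ks" "braid_permutation ks' = braid_permutation ks"
    by auto
  then show ?case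
  proof cases
    case (1 w)
    have e: "braid_equiv (ks @ [k]) (w @ [k])" using braid_equiv_context[OF 1(2), of "[]" "[k]"] by simp
    have i: "length ks = length w" "braid_permutation (ks @ [k]) = braid_permutation (w @ [k])"
      using braid_equiv_invariants[OF e] by auto
    from canonical_word_snoc[OF 1(1), of k] snoc.prems show ?thesis
      using e i by (fastforce intro: braid_equiv.equiv_trans)
  next
    case (2 ks')
    then show ?thesis using snoc.prems
      by (intro disjI2 exI[of _ "ks' @ [k]"]) (auto simp: braid_permutation_append)
  qed
qed

section \<open>Inversions and reduced words\<close>

definition inversion_set :: "nat \<Rightarrow> (nat \<Rightarrow> nat) \<Rightarrow> (nat \<times> nat) set" where
  "inversion_set n \<sigma> = {(i, j). i < j \<and> j < n \<and> \<sigma> j < \<sigma> i}"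

lemma finite_inversion_set [simp]: "finite (inversion_set n \<sigma>)"
  by (rule finite_subset[of _ "{..<n} \<times> {..<n}"]) (auto simp: inversion_set_def)

lemma inversions_card: "inversions n \<sigma> = card (inversion_set n \<sigma>)"
  by (simp add: inversions_def inversion_set_def)

text \<open>No value lies between \<open>k\<close> and \<open>k + 1\<close>, so exchanging them
  affects the order of the pair \<open>i\<close>, \<open>j\<close> only.\<close>

lemma inversion_set_transpose:
  assumes "\<sigma> permutes {..<n}" "Suc k < n" "i < j" "j < n" "\<sigma> i = k" "\<sigma> j = Suc k"
  shows "inversion_set n (transpose k (Suc k) \<circ> \<sigma>) = insert (i, j) (inversion_set n \<sigma>)" "(i, j) \<notin> inversion_set n \<sigma>"
proof -
  have inj: "\<sigma> x = \<sigma> y \<longleftrightarrow> x = y" for x y using permutes_inj[OF assms(1)] by (auto simp: inj_def)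
  have "(x, y) \<in> inversion_set n (transpose k (Suc k) \<circ> \<sigma>) \<longleftrightarrow> (x, y) \<in> insert (i, j) (inversion_set n \<sigma>)" for x y
  proof (cases "x \<in> {i, j} \<and> y \<in> {i, j}")
    case True
    then show ?thesis using assms(3-6) by (auto simp: inversion_set_def)
  next
    case False
    have "\<sigma> u = k \<longleftrightarrow> u = i" "\<sigma> u = Suc k \<longleftrightarrow> u = j" for u using assms(5,6) inj by metis+
    then have "\<not> (\<sigma> x \<in> {k, Suc k} \<and> \<sigma> y \<in> {k, Suc k})" using False by auto
    then have "transpose k (Suc k) (\<sigma> y) < transpose k (Suc k) (\<sigma> x) \<longleftrightarrow> \<sigma> y < \<sigma> x"
      by (auto simp: transpose_def)
    then show ?thesis using False by (auto simp: inversion_set_def)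
  qed
  then show "inversion_set n (transpose k (Suc k) \<circ> \<sigma>) = insert (i, j) (inversion_set n \<sigma>)" by auto
  show "(i, j) \<notin> inversion_set n \<sigma>" using assms by (simp add: inversion_set_def)
qed

lemma inversions_transpose:
  assumes "\<sigma> permutes {..<n}" "Suc k < n"
  shows "if inv \<sigma> k < inv \<sigma> (Suc k) then inversions n (transpose k (Suc k) \<circ> \<sigma>) = Suc (inversions n \<sigma>)
    else inversions n \<sigma> = Suc (inversions n (transpose k (Suc k) \<circ> \<sigma>))"
proof -
  let ?i = "inv \<sigma> k" and ?j = "inv \<sigma> (Suc k)" and ?\<tau> = "transpose k (Suc k) \<circ> \<sigma>"
  have \<sigma>: "\<sigma> ?i = k" "\<sigma> ?j = Suc k" using permutes_inverses[OF assms(1)] by auto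
  have lt: "?i < n" "?j < n" using permutes_in_image[OF permutes_inv[OF assms(1)]] assms(2) by auto
  have ne: "?i \<noteq> ?j" using \<sigma> by auto
  show ?thesis
  proof (cases "?i < ?j")
    case True
    then show ?thesis using inversion_set_transpose[OF assms True lt(2) \<sigma>] by (simp add: inversions_card)
  next
    case False
    have "?\<tau> permutes {..<n}" using assms by (intro permutes_compose permutes_swap_id) auto
    moreover have "?\<tau> ?j = k" "?\<tau> ?i = Suc k" using \<sigma> by auto
    moreover have "transpose k (Suc k) \<circ> ?\<tau> = \<sigma>" by (auto simp: fun_eq_iff)
    ultimately show ?thesis using inversion_set_transpose[of ?\<tau> n k ?j ?i] assms(2) False ne lt
      by (simp add: inversions_card)
  qed
qed

lemma permutes_increasing_id:
  assumes "\<sigma> permutes {..<n}" "\<And>k. Suc k < n \<Longrightarrow> \<sigma> k < \<sigma> (Suc k)"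
  shows "\<sigma> = id"
proof
  have lo: "k < n \<Longrightarrow> k \<le> \<sigma> k" for k
  proof (induction k)
    case (Suc k)
    then show ?case using assms(2)[of k] by simp
  qed simp
  have hi: "k < n \<Longrightarrow> \<sigma> (n - Suc k) \<le> n - Suc k" for k
  proof (induction k)
    case 0
    then show ?case using permutes_in_image[OF assms(1), of "n - 1"] by auto
  next
    case (Suc k)
    then show ?case using assms(2)[of "n - Suc (Suc k)"] by (simp add: Suc_diff_Suc)
  qed
  fix k
  show "\<sigma> k = id k"
  proof (cases "k < n")
    case True
    then show ?thesis using lo[of k] hi[of "n - Suc k"] by simp
  next
    case False
    then show ?thesis using assms(1) by (simp add: permutes_not_in)
  qed
qed

lemma inversions_id [simp]: "inversions n id = 0"
proof -
  have "inversion_set n id = {}" by (auto simp: inversion_set_def)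
  then show ?thesis by (simp add: inversions_card)
qed

text \<open>Bubble sort on the values: a permutation other than the identity has two neighbouring
  values in the wrong order, and exchanging them removes one inversion. This gives the choice in
  \<open>positive_braid\<close> its meaning.\<close>

lemma reduced_word_exists:
  "\<sigma> permutes {..<n} \<Longrightarrow> \<exists>ks. (\<forall>k\<in>set ks. Suc k < n) \<and> length ks = inversions n \<sigma> \<and> braid_permutation ks = \<sigma>"
proof (induction "inversions n \<sigma>" arbitrary: \<sigma> rule: less_induct)
  case (less \<sigma>)
  show ?case
  proof (cases "\<exists>k. Suc k < n \<and> \<not> inv \<sigma> k < inv \<sigma> (Suc k)")
    case True
    then obtain k where k: "Suc k < n" "\<not> inv \<sigma> k < inv \<sigma> (Suc k)" by auto
    let ?\<tau> = "transpose k (Suc k) \<circ> \<sigma>"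
    have inv: "inversions n \<sigma> = Suc (inversions n ?\<tau>)" using inversions_transpose[OF less(2) k(1)] k(2) by simp
    have "?\<tau> permutes {..<n}" using less(2) k by (intro permutes_compose permutes_swap_id) auto
    then obtain ks where ks: "\<forall>k\<in>set ks. Suc k < n" "length ks = inversions n ?\<tau>" "braid_permutation ks = ?\<tau>"
      using less(1)[of ?\<tau>] inv by auto
    then show ?thesis using inv k(1)
      by (intro exI[of _ "ks @ [k]"]) (auto simp: braid_permutation_append braid_permutation_Cons fun_eq_iff)
  next
    case False
    then have "inv \<sigma> = id" by (intro permutes_increasing_id[OF permutes_inv[OF less(2)]]) auto
    then have "\<sigma> = id" using permutes_inv_inv[OF less(2)] by (metis inv_id)
    then show ?thesis by (intro exI[of _ "[]"]) (simp only: braid_permutation_Nil inversions_id list.size list.set ball_empty simp_thms)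
  qed
qed

lemma inversions_le_length:
  "\<forall>k\<in>set ks. Suc k < n \<Longrightarrow> inversions n (braid_permutation ks) \<le> length ks"
proof (induction ks rule: rev_induct)
  case Nil
  then show ?case by (simp only: braid_permutation_Nil inversions_id le0)
next
  case (snoc k ks)
  have "braid_permutation ks permutes {..<n}" by (rule braid_permutation_permutes) (use snoc in auto)
  have "x \<le> Suc y" if "if c then x = Suc y else y = Suc x" for c and x y :: nat
    using that by (auto split: if_splits)
  from this[OF inversions_transpose[OF \<open>braid_permutation ks permutes {..<n}\<close>, of k]]
  have "inversions n (braid_permutation (ks @ [k])) \<le> Suc (inversions n (braid_permutation ks))"
    using snoc.prems by (simp only: braid_permutation_append braid_permutation_Cons braid_permutation_Nil id_comp) simp
  with snoc show ?case by simp
qed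

lemma reduced_word_canonical:
  assumes "\<forall>k\<in>set ks. Suc k < n" "length ks = inversions n (braid_permutation ks)"
  shows "\<exists>w\<in>set (canonical_words n). braid_equiv ks w"
  using word_canonical_or_shorter[OF assms(1)] inversions_le_length assms(2) by (metis not_le)

text \<open>There are \<open>n!\<close> canonical words and every permutation is attained, so each
  is attained exactly once.\<close>

lemma canonical_words_permutations:
  "distinct (map braid_permutation (canonical_words n))"
  "set (map braid_permutation (canonical_words n)) = {\<sigma>. \<sigma> permutes {..<n}}"
proof -
  show s: "set (map braid_permutation (canonical_words n)) = {\<sigma>. \<sigma> permutes {..<n}}"
  proof (intro equalityI subsetI)
    fix \<sigma> assume "\<sigma> \<in> set (map braid_permutation (canonical_words n))"
    then show "\<sigma> \<in> {\<sigma>. \<sigma> permutes {..<n}}" using braid_permutation_permutes set_canonical_word by fastforce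
  next
    fix \<sigma> :: "nat \<Rightarrow> nat" assume "\<sigma> \<in> {\<sigma>. \<sigma> permutes {..<n}}"
    then obtain ks where "\<forall>k\<in>set ks. Suc k < n" "length ks = inversions n \<sigma>" "braid_permutation ks = \<sigma>"
      using reduced_word_exists by auto
    with reduced_word_canonical[of ks n] braid_equiv_invariants
    show "\<sigma> \<in> set (map braid_permutation (canonical_words n))" by force
  qed
  have "card (set (map braid_permutation (canonical_words n))) = length (map braid_permutation (canonical_words n))"
    unfolding s by (simp add: card_permutations[of _ n] length_canonical_words)
  then show "distinct (map braid_permutation (canonical_words n))" by (rule card_distinct)
qed

lemma positive_braid_reduced:
  assumes "\<sigma> permutes {..<n}"
  shows "\<forall>k\<in>set (positive_braid n \<sigma>). Suc k < n" "length (positive_braid n \<sigma>) = inversions n \<sigma>"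
    "braid_permutation (positive_braid n \<sigma>) = \<sigma>"
  using someI_ex[OF reduced_word_exists[OF assms]] unfolding positive_braid_def by blast+

text \<open>The arbitrarily chosen reduced word is the same braid as the canonical one, so that rule
  (3) becomes a sum over canonical words.\<close>

lemma positive_braid_canonical:
  assumes w: "w \<in> set (canonical_words n)"
  shows "braid_equiv (positive_braid n (braid_permutation w)) w" "length w = inversions n (braid_permutation w)"
proof -
  let ?\<sigma> = "braid_permutation w"
  have \<sigma>: "?\<sigma> permutes {..<n}" using braid_permutation_permutes set_canonical_word[OF w] by blast
  define ks where "ks = positive_braid n ?\<sigma>"
  note ks = positive_braid_reduced[OF \<sigma>, folded ks_def]
  from ks obtain w' where w': "w' \<in> set (canonical_words n)" "braid_equiv ks w'"
    using reduced_word_canonical[of ks n] by auto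
  have "braid_permutation w' = ?\<sigma>" using braid_equiv_invariants[OF w'(2)] ks by simp
  then have "w' = w" using canonical_words_permutations(1)[of n] w w'(1) by (auto simp: distinct_map inj_on_def)
  then show "braid_equiv (positive_braid n ?\<sigma>) w" "length w = inversions n ?\<sigma>"
    using w' ks braid_equiv_invariants[OF w'(2)] by (auto simp: ks_def)
qed

section \<open>Functionals on the Hecke algebra\<close>

definition hecke_functional :: "'a::field \<Rightarrow> nat \<Rightarrow> (nat list \<Rightarrow> 'a) \<Rightarrow> bool" where
  "hecke_functional q k \<beta> \<longleftrightarrow> (\<forall>a b. set a \<subseteq> {..<k} \<longrightarrow> set b \<subseteq> {..<k} \<longrightarrow>
     (\<forall>i j. Suc i < j \<longrightarrow> j < k \<longrightarrow> \<beta> (a @ [i, j] @ b) = \<beta> (a @ [j, i] @ b)) \<and>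
     (\<forall>i. Suc i < k \<longrightarrow> \<beta> (a @ [i, Suc i, i] @ b) = \<beta> (a @ [Suc i, i, Suc i] @ b)) \<and>
     (\<forall>i<k. \<beta> (a @ [i, i] @ b) = (q - inverse q) * \<beta> (a @ [i] @ b) + \<beta> (a @ b)))"

lemma hecke_functional_equiv:
  assumes "hecke_functional q k \<beta>" "braid_equiv a b" "set a \<subseteq> {..<k}"
  shows "\<beta> a = \<beta> b"
  using assms(2,3)
proof (induction rule: braid_equiv.induct)
  case (equiv_sym a b)
  then show ?case using braid_equiv_invariants[OF equiv_sym(1)] by simp
next
  case (equiv_trans a b c)
  then show ?case using braid_equiv_invariants[OF equiv_trans(1)] by simp
next
  case (far i j a b)
  then have "set a \<subseteq> {..<k}" "set b \<subseteq> {..<k}" "j < k" by auto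
  with far(1) show ?case using assms(1) unfolding hecke_functional_def by blast
next
  case (braid a i b)
  then have "set a \<subseteq> {..<k}" "set b \<subseteq> {..<k}" "Suc i < k" by auto
  then show ?case using assms(1) unfolding hecke_functional_def by blast
qed simp

lemma hecke_functional_square:
  "hecke_functional q k \<beta> \<Longrightarrow> set a \<subseteq> {..<k} \<Longrightarrow> set b \<subseteq> {..<k} \<Longrightarrow> i < k \<Longrightarrow>
     \<beta> (a @ [i, i] @ b) = (q - inverse q) * \<beta> (a @ [i] @ b) + \<beta> (a @ b)"
  unfolding hecke_functional_def by blast

text \<open>For \<open>c = - 1 / q\<close> this is the value of \<open>\<beta>\<close> at the quantum antisymmetrizer of \<open>m\<close> strands.\<close>

definition antisym :: "'a::field \<Rightarrow> nat \<Rightarrow> (nat list \<Rightarrow> 'a) \<Rightarrow> 'a" where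
  "antisym c m \<beta> = (\<Sum>w\<leftarrow>canonical_words m. c ^ length w * \<beta> w)"

lemma antisym_0 [simp]: "antisym c 0 \<beta> = \<beta> []"
  by (simp add: antisym_def)

text \<open>Factorization of the antisymmetrizer over the coset representatives
  \<open>descending m j\<close>.\<close>

lemma antisym_Suc: "antisym c (Suc m) \<beta> = antisym c m (\<lambda>w. \<Sum>j\<le>m. c ^ j * \<beta> (w @ descending m j))"
proof -
  have *: "(\<Sum>w\<leftarrow>concat (map (\<lambda>w. map (g w) xs) ws). F w) = (\<Sum>w\<leftarrow>ws. \<Sum>x\<leftarrow>xs. F (g w x))"
    for F :: "nat list \<Rightarrow> 'a" and g :: "nat list \<Rightarrow> nat \<Rightarrow> nat list" and xs ws
    by (induction ws) (simp_all add: comp_def)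
  have "(\<Sum>j\<leftarrow>[0..<Suc m]. c ^ length (w @ descending m j) * \<beta> (w @ descending m j)) =
     c ^ length w * (\<Sum>j\<le>m. c ^ j * \<beta> (w @ descending m j))" for w
  proof -
    have "(\<Sum>j\<leftarrow>[0..<Suc m]. c ^ length (w @ descending m j) * \<beta> (w @ descending m j)) =
      (\<Sum>j\<in>{0..<Suc m}. c ^ length (w @ descending m j) * \<beta> (w @ descending m j))"
      using sum.distinct_set_conv_list[of "[0..<Suc m]" "\<lambda>j. c ^ length (w @ descending m j) * \<beta> (w @ descending m j)"] by (simp del: upt_Suc)
    also have "\<dots> = (\<Sum>j\<le>m. c ^ length w * (c ^ j * \<beta> (w @ descending m j)))"
      by (intro sum.cong) (auto simp: length_descending power_add)
    finally show ?thesis by (simp add: sum_distrib_left)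
  qed
  then show ?thesis
    unfolding antisym_def canonical_words.simps * by simp
qed

lemma antisym_cong: "(\<And>w. \<forall>k\<in>set w. Suc k < m \<Longrightarrow> \<beta> w = \<gamma> w) \<Longrightarrow> antisym c m \<beta> = antisym c m \<gamma>"
  unfolding antisym_def using set_canonical_word by (intro arg_cong[of _ _ sum_list] map_cong) auto

lemma antisym_add: "antisym c m (\<lambda>w. \<beta> w + \<gamma> w) = antisym c m \<beta> + antisym c m \<gamma>"
  by (simp add: antisym_def distrib_left sum_list_addf)

lemma antisym_scale: "antisym c m (\<lambda>w. x * \<beta> w) = x * antisym c m \<beta>"
  by (simp add: antisym_def mult.left_commute flip: sum_list_const_mult)

lemma antisym_sum: "finite J \<Longrightarrow> antisym c m (\<lambda>w. \<Sum>j\<in>J. x j * f j w) = (\<Sum>j\<in>J. x j * antisym c m (f j))"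
proof (induction J rule: finite_induct)
  case empty
  then show ?case by (simp add: antisym_def)
next
  case (insert j J)
  then show ?case by (simp add: antisym_add antisym_scale)
qed

text \<open>The antisymmetrizer absorbs a generator on its right with the eigenvalue
  \<open>c\<close>. In the coset expansion the generator passes most representatives and is absorbed
  by the smaller antisymmetrizer; the two representatives that differ by a final \<open>k\<close>
  have to be treated together.\<close>

lemma antisym_absorb:
  assumes \<beta>: "hecke_functional q K \<beta>" and q: "q \<noteq> 0" and c: "c = - inverse q"
  shows "Suc k < m \<Longrightarrow> m \<le> Suc K \<Longrightarrow> set b \<subseteq> {..<K} \<Longrightarrow>
     antisym c m (\<lambda>w. \<beta> (w @ [k] @ b)) = c * antisym c m (\<lambda>w. \<beta> (w @ b))"
proof (induction m arbitrary: k b)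
  case (Suc m)
  have k: "k < m" and m: "m \<le> K" using Suc.prems by auto
  define t where "t = (\<lambda>j. antisym c m (\<lambda>w. \<beta> (w @ descending m j @ [k] @ b)))"
  define s where "s = (\<lambda>j. antisym c m (\<lambda>w. \<beta> (w @ descending m j @ b)))"
  have sets: "set w \<subseteq> {..<K}" if "\<forall>k\<in>set w. Suc k < m" for w using that m by auto
  have d: "set (descending m j) \<subseteq> {..<K}" for j using m by (auto simp: set_descending)
  have L: "antisym c (Suc m) (\<lambda>w. \<beta> (w @ [k] @ b)) = (\<Sum>j\<le>m. c ^ j * t j)"
    unfolding antisym_Suc t_def by (simp add: antisym_sum)
  have R: "antisym c (Suc m) (\<lambda>w. \<beta> (w @ b)) = (\<Sum>j\<le>m. c ^ j * s j)"
    unfolding antisym_Suc s_def by (simp add: antisym_sum)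
  have low: "t j = c * s j" if "j + k + 1 < m" for j
  proof -
    have "t j = antisym c m (\<lambda>w. \<beta> (w @ [k] @ (descending m j @ b)))"
      unfolding t_def
      by (intro antisym_cong hecke_functional_equiv[OF \<beta>] descending_commute_low)
        (use that sets d[of j] k m Suc.prems in \<open>auto\<close>)
    also have "\<dots> = c * s j"
      unfolding s_def by (rule Suc.IH) (use that d[of j] Suc.prems in auto)
    finally show ?thesis .
  qed
  have high: "t j = c * s j" if "m < k + j" "j \<le> m" for j
  proof -
    have "t j = antisym c m (\<lambda>w. \<beta> (w @ [k - 1] @ (descending m j @ b)))"
      unfolding t_def
      by (intro antisym_cong hecke_functional_equiv[OF \<beta>] descending_commute_high)
        (use that sets d[of j] k m Suc.prems in \<open>auto\<close>)
    also have "\<dots> = c * s j"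
      unfolding s_def by (rule Suc.IH) (use that k d[of j] Suc.prems in auto)
    finally show ?thesis .
  qed
  \<comment> \<open>The length after which the next letter of the descending word is
    \<open>k\<close>.\<close>
  define l where "l = m - Suc k"
  have l: "Suc l \<le> m" "l < m" "descending m (Suc l) = descending m l @ [k]"
    using k descending_Suc[of l m] by (auto simp: l_def)
  have t1: "t l = s (Suc l)" by (simp add: t_def s_def l(3))
  have t2: "t (Suc l) = (q - inverse q) * s (Suc l) + s l"
  proof -
    have "t (Suc l) = antisym c m (\<lambda>w. (q - inverse q) * \<beta> (w @ descending m (Suc l) @ b) + \<beta> (w @ descending m l @ b))"
      unfolding t_def
    proof (rule antisym_cong)
      fix w assume "\<forall>k\<in>set w. Suc k < m"
      then have "set (w @ descending m l) \<subseteq> {..<K}" using sets d[of l] by simp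
      from hecke_functional_square[OF \<beta> this Suc.prems(3), of k] k m
      show "\<beta> (w @ descending m (Suc l) @ [k] @ b) = (q - inverse q) * \<beta> (w @ descending m (Suc l) @ b) + \<beta> (w @ descending m l @ b)"
        by (simp add: l(3))
    qed
    then show ?thesis by (simp add: antisym_add antisym_scale s_def)
  qed
  have pair: "c ^ l * t l + c ^ Suc l * t (Suc l) = c * (c ^ l * s l + c ^ Suc l * s (Suc l))"
  proof -
    \<comment> \<open>The quadratic equation with the roots \<open>q\<close> and
      \<open>- 1 / q\<close>.\<close>
    have "1 + c * (q - inverse q) = c * c" using q by (simp add: c field_simps)
    then have "s (Suc l) + c * ((q - inverse q) * s (Suc l)) = c * c * s (Suc l)"
      by (metis mult.assoc mult_1 distrib_right)
    then have "s (Suc l) + c * t (Suc l) = c * (s l + c * s (Suc l))"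
      unfolding t2 by (simp add: algebra_simps)
    then have "c ^ l * (s (Suc l) + c * t (Suc l)) = c ^ l * (c * (s l + c * s (Suc l)))" by simp
    then show ?thesis unfolding t1 by (simp add: algebra_simps)
  qed
  have split: "(\<Sum>j\<le>m. f j) = (\<Sum>j\<in>{..m} - {l, Suc l}. f j) + (f l + f (Suc l))" for f :: "nat \<Rightarrow> 'a"
    using sum.subset_diff[of "{l, Suc l}" "{..m}" f] l by simp
  have "(\<Sum>j\<in>{..m} - {l, Suc l}. c ^ j * t j) = (\<Sum>j\<in>{..m} - {l, Suc l}. c * (c ^ j * s j))"
  proof (rule sum.cong[OF refl])
    fix j assume j: "j \<in> {..m} - {l, Suc l}"
    then have "j + k + 1 < m \<or> m < k + j" using k by (auto simp: l_def)
    then have "t j = c * s j" using low high j by auto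
    then show "c ^ j * t j = c * (c ^ j * s j)" by simp
  qed
  then have "(\<Sum>j\<le>m. c ^ j * t j) = c * (\<Sum>j\<le>m. c ^ j * s j)"
    unfolding split[of "\<lambda>j. c ^ j * t j"] split[of "\<lambda>j. c ^ j * s j"] using pair by (simp add: distrib_left sum_distrib_left)
  then show ?case using L R by simp
qed simp

lemma antisym_absorb_word:
  assumes "hecke_functional q K \<beta>" "q \<noteq> 0" "c = - inverse q" "m \<le> Suc K"
  shows "\<forall>k\<in>set ks. Suc k < m \<Longrightarrow> antisym c m (\<lambda>w. \<beta> (w @ ks)) = c ^ length ks * antisym c m \<beta>"
proof (induction ks)
  case (Cons k ks)
  have "set ks \<subseteq> {..<K}" using Cons.prems assms(4) by auto
  then show ?case using antisym_absorb[OF assms(1-3), of k m ks] Cons assms(4) by simp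
qed simp

text \<open>The scalar arising when one strand is closed, from one circle and \<open>m\<close>
  curls. Multiplied by \<open>q - 1 / q\<close>, the sum telescopes.\<close>

lemma quantum_sum:
  fixes q :: "'a::field"
  assumes "q \<noteq> 0" "q - inverse q \<noteq> 0" "m \<le> n"
  shows "quantum_int q n + q ^ n * (\<Sum>j = 1..m. (- inverse q) ^ (2 * j - 1)) = inverse q ^ m * quantum_int q (n - m)"
proof -
  let ?z = "q - inverse q"
  define f where "f = (\<lambda>j. (- inverse q) ^ (2 * j - 1))"
  have s: "?z * (\<Sum>j = 1..m. f j) = inverse q ^ (2 * m) - 1"
  proof (induction m)
    case (Suc m)
    have "?z * f (Suc m) = inverse q ^ (2 * Suc m) - inverse q ^ (2 * m)"
      using assms(1) by (simp add: f_def field_simps power_minus_odd)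
    moreover have "?z * (\<Sum>j = 1..Suc m. f j) = ?z * (\<Sum>j = 1..m. f j) + ?z * f (Suc m)"
      by (simp add: distrib_left)
    ultimately show ?case unfolding Suc by simp
  qed simp
  have zq: "?z * quantum_int q k = q ^ k - inverse q ^ k" for k
    using assms(2) by (simp add: quantum_int_def power_int_minus power_inverse)
  have "?z * (quantum_int q n + q ^ n * (\<Sum>j = 1..m. (- inverse q) ^ (2 * j - 1))) =
     q ^ n - inverse q ^ n + q ^ n * (inverse q ^ (2 * m) - 1)"
    unfolding distrib_left zq mult.left_commute[of ?z] s[unfolded f_def] ..
  also have "\<dots> = inverse q ^ m * (q ^ (n - m) - inverse q ^ (n - m))"
  proof -
    obtain d where d: "n = m + d" using assms(3) le_Suc_ex by blast
    show ?thesis using assms(1) by (simp add: d power_add field_simps power_mult power2_eq_square)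
  qed
  also have "\<dots> = ?z * (inverse q ^ m * quantum_int q (n - m))"
    by (simp add: mult.left_commute[of ?z] zq)
  finally show ?thesis using assms(2) by simp
qed

text \<open>Partial trace over the last strand: \<beta> evaluates words on \<open>m + 1\<close>
  strands whose last strand is closed, \<beta>' words on \<open>m\<close> strands. The
  representative of length \<open>0\<close> leaves a circle; one of length \<open>j > 0\<close>
  leaves a curl and \<open>j - 1\<close> letters, which are absorbed.\<close>

lemma antisym_closure:
  fixes q :: "'a::field"
  assumes \<beta>: "hecke_functional q (m - 1) \<beta>'" and q: "q \<noteq> 0" "q - inverse q \<noteq> 0" and c: "c = - inverse q"
    and m: "1 \<le> m" "m \<le> n"
    and id: "\<And>a. \<forall>k\<in>set a. Suc k < m \<Longrightarrow> \<beta> a = quantum_int q n * \<beta>' a"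
    and curl: "\<And>a b. \<forall>k\<in>set a. Suc k < m \<Longrightarrow> \<forall>k\<in>set b. Suc k < m \<Longrightarrow> \<beta> (a @ [m - 1] @ b) = q ^ n * \<beta>' (a @ b)"
  shows "antisym c (Suc m) \<beta> = inverse q ^ m * quantum_int q (n - m) * antisym c m \<beta>'"
proof -
  obtain p where p: "m = Suc p" using m(1) by (cases m) auto
  have 1: "antisym c m (\<lambda>w. \<beta> (w @ descending m j)) = q ^ n * c ^ (j - 1) * antisym c m \<beta>'" if j: "1 \<le> j" "j \<le> m" for j
  proof -
    obtain i where i: "j = Suc i" using j by (cases j) auto
    have di: "\<forall>k\<in>set (descending p i). Suc k < m" by (auto simp: set_descending p)
    have "antisym c m (\<lambda>w. \<beta> (w @ descending m j)) = antisym c m (\<lambda>w. q ^ n * \<beta>' (w @ descending p i))"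
      by (intro antisym_cong) (use curl[OF _ di] in \<open>simp add: p i descending_Suc_Suc\<close>)
    also have "\<dots> = q ^ n * (c ^ i * antisym c m \<beta>')"
      using antisym_absorb_word[OF \<beta> q(1) c, of m "descending p i"] di j by (simp add: antisym_scale length_descending i p)
    finally show ?thesis by (simp add: i)
  qed
  have 0: "antisym c m (\<lambda>w. \<beta> (w @ descending m 0)) = quantum_int q n * antisym c m \<beta>'"
    unfolding antisym_scale[symmetric] by (intro antisym_cong) (simp add: id)
  have "antisym c (Suc m) \<beta> = (\<Sum>j\<le>m. c ^ j * antisym c m (\<lambda>w. \<beta> (w @ descending m j)))"
    unfolding antisym_Suc by (simp add: antisym_sum)
  also have "\<dots> = quantum_int q n * antisym c m \<beta>' + (\<Sum>j = 1..m. c ^ j * antisym c m (\<lambda>w. \<beta> (w @ descending m j)))"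
    using 0 by (simp add: sum.atMost_shift atLeast1_atMost_eq_remove0 atMost_atLeast0 sum.atLeast_Suc_atMost)
  \<comment> \<open>The power \<open>c ^ j\<close> comes from the coset expansion and
    \<open>c ^ (j - 1)\<close> from the absorbed letters.\<close>
  also have "(\<Sum>j = 1..m. c ^ j * antisym c m (\<lambda>w. \<beta> (w @ descending m j))) =
     (\<Sum>j = 1..m. q ^ n * antisym c m \<beta>' * c ^ (2 * j - 1))"
  proof (rule sum.cong[OF refl])
    fix j assume "j \<in> {1..m}"
    then obtain i where i: "j = Suc i" "j \<le> m" by (cases j) auto
    then show "c ^ j * antisym c m (\<lambda>w. \<beta> (w @ descending m j)) = q ^ n * antisym c m \<beta>' * c ^ (2 * j - 1)"
      using 1[of j] by (simp add: mult_2 power_add)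
  qed
  also have "quantum_int q n * antisym c m \<beta>' + \<dots> = (quantum_int q n + q ^ n * (\<Sum>j = 1..m. (- inverse q) ^ (2 * j - 1))) * antisym c m \<beta>'"
    by (simp add: sum_distrib_left sum_distrib_right c algebra_simps)
  also have "\<dots> = inverse q ^ m * quantum_int q (n - m) * antisym c m \<beta>'"
    unfolding quantum_sum[OF q m(2)] ..
  finally show ?thesis .
qed

text \<open>Permutations are enumerated by their canonical words, and a functional on the Hecke
  algebra does not distinguish equivalent braid words.\<close>

lemma sum_positive_braids:
  assumes \<beta>: "hecke_functional q (n - 1) \<beta>"
  shows "(\<Sum>\<sigma> | \<sigma> permutes {..<n}. c ^ inversions n \<sigma> * \<beta> (positive_braid n \<sigma>)) = antisym c n \<beta>"
proof -
  let ?f = "\<lambda>\<sigma>. c ^ inversions n \<sigma> * \<beta> (positive_braid n \<sigma>)"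
  have "(\<Sum>\<sigma> | \<sigma> permutes {..<n}. ?f \<sigma>) = sum_list (map ?f (map braid_permutation (canonical_words n)))"
    using sum.distinct_set_conv_list[OF canonical_words_permutations(1), of ?f n] canonical_words_permutations(2)[of n] by simp
  also have "\<dots> = antisym c n \<beta>"
    unfolding antisym_def map_map comp_def
  proof (intro arg_cong[of _ _ sum_list] map_cong refl)
    fix w assume w: "w \<in> set (canonical_words n)"
    note p = positive_braid_canonical[OF w]
    have "set (positive_braid n (braid_permutation w)) \<subseteq> {..<n - 1}"
      using braid_equiv_invariants[OF p(1)] set_canonical_word[OF w] by force
    then show "?f (braid_permutation w) = c ^ length w * \<beta> w"
      using hecke_functional_equiv[OF \<beta> p(1)] p(2) by simp
  qed
  finally show ?thesis .
qed

lemma antisym_2: "antisym c 2 \<beta> = \<beta> [] + c * \<beta> [0]"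
  by (simp add: numeral_2_eq_2 antisym_Suc descending_def)

section \<open>Isotopies of webs and partially closed braids\<close>

lemma isotopicI:
  assumes "link_isotopy a b" "u @ a @ v \<in> webs n" "u @ b @ v \<in> webs n"
  shows "isotopic n (u @ a @ v) (u @ b @ v)"
  unfolding isotopic_def
  by (rule r_into_equivclp, rule isotopy_step.intros) (use assms link_isotopy_elementary in auto)

text \<open>For \<open>m = n\<close> these are the caps of a vertex web, for \<open>m = 2\<close>
  there are none. The cases in between allow the closed strands to be removed one at a time.\<close>

definition braid_caps :: "nat \<Rightarrow> nat \<Rightarrow> web" where
  "braid_caps i m = map (\<lambda>k. (i + k, Cap Down)) [2..<m]"

definition braid_cups :: "nat \<Rightarrow> nat \<Rightarrow> web" where
  "braid_cups i m = map (\<lambda>k. (i + k, Cup Down)) (rev [2..<m])"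

lemma vertex_web_eq: "vertex_web n i = braid_caps i n @ [(i, Node Sink), (i, Node Source)] @ braid_cups i n"
  by (simp add: vertex_web_def braid_caps_def braid_cups_def)

lemma braid_caps_Suc: "2 \<le> m \<Longrightarrow> braid_caps i (Suc m) = braid_caps i m @ [(i + m, Cap Down)]"
  by (simp add: braid_caps_def)

lemma braid_cups_Suc: "2 \<le> m \<Longrightarrow> braid_cups i (Suc m) = [(i + m, Cup Down)] @ braid_cups i m"
  by (simp add: braid_cups_def)

lemma braid_word_shift: "braid_word i ks = shift i (braid_word 0 ks)"
  by (simp add: braid_word_def shift_def)

lemma arr_cap:
  "arr n (P @ downs m @ ups (m - 2) @ Q) [(length P + m, Cap Down)] (P @ downs m @ [Down, Up] @ ups (m - 2) @ Q)"
  by (rule arr_single[of _ "P @ downs m" _ _ _ "ups (m - 2) @ Q"]) (simp_all add: web_upper_plain)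

lemma arr_cup:
  "arr n (P @ downs m @ [Down, Up] @ ups (m - 2) @ Q) [(length P + m, Cup Down)] (P @ downs m @ ups (m - 2) @ Q)"
  by (rule arr_single[of _ "P @ downs m" _ _ _ "ups (m - 2) @ Q"]) (simp_all add: web_upper_plain)

lemma level_Suc:
  assumes "2 \<le> m"
  shows "P @ downs (Suc m) @ ups (Suc m - 2) @ Q = P @ downs m @ [Down, Up] @ ups (m - 2) @ Q"
proof -
  obtain k where "m = 2 + k" using assms le_Suc_ex by blast
  then show ?thesis by (simp add: replicate_simps)
qed

lemma arr_braid_caps:
  "2 \<le> m \<Longrightarrow> arr n (P @ [Down, Down] @ Q) (braid_caps (length P) m) (P @ downs m @ ups (m - 2) @ Q)"
proof (induction m rule: dec_induct)
  case base
  then show ?case by (simp add: braid_caps_def replicate_simps)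
next
  case (step m)
  show ?case unfolding braid_caps_Suc[OF step(1)] level_Suc[OF step(1)] by (rule arr_appendI[OF step.IH arr_cap])
qed

lemma arr_braid_cups:
  "2 \<le> m \<Longrightarrow> arr n (P @ downs m @ ups (m - 2) @ Q) (braid_cups (length P) m) (P @ [Down, Down] @ Q)"
proof (induction m rule: dec_induct)
  case base
  then show ?case by (simp add: braid_cups_def replicate_simps)
next
  case (step m)
  show ?case unfolding braid_cups_Suc[OF step(1)] level_Suc[OF step(1)] by (rule arr_appendI[OF arr_cup step.IH])
qed

lemma arr_sink_source:
  "arr n (P @ downs n @ Q) [(length P, Node Sink), (length P, Node Source)] (P @ downs n @ Q)"
  by (simp add: web_upper_def web_lower_def replace_at_def)

lemma arr_vertex_web:
  "2 \<le> n \<Longrightarrow> arr n (P @ [Down, Down] @ Q) (vertex_web n (length P)) (P @ [Down, Down] @ Q)"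
  unfolding vertex_web_eq
  by (intro arr_appendI[OF arr_braid_caps arr_appendI[OF arr_sink_source arr_braid_cups]])

lemma sum_2_to: "2 \<le> n \<Longrightarrow> Suc (\<Sum>{2..<n}) = n * (n - 1) div 2"
proof (induction n rule: dec_induct)
  case (step n)
  then obtain m where "n = Suc m" by (cases n) auto
  then show ?case using step by simp
qed simp

section \<open>The bracket of a vertex web\<close>

text \<open>Here \<open>t\<close> is \<open>q\<close> to the power \<open>1 / n\<close>. The last
  assumption makes \<open>quantum_int\<close> a genuine quotient.\<close>

locale web_bracket =
  fixes n :: nat and t :: "'a::field" and br :: "web \<Rightarrow> 'a"
  assumes bracket: "is_web_bracket n t br"
    and t_nz: "t \<noteq> 0" and n_ge: "2 \<le> n"
    and z_nz: "t ^ n - inverse (t ^ n) \<noteq> 0"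
begin

abbreviation q :: 'a where "q \<equiv> t ^ n"

lemma q_nz: "q \<noteq> 0" using t_nz by simp

lemma br_isotopic: "w \<in> webs n \<Longrightarrow> w' \<in> webs n \<Longrightarrow> isotopic n w w' \<Longrightarrow> br w = br w'"
  using bracket unfolding is_web_bracket_def Let_def by blast

lemma br_skein: "u @ [(i, Pos)] @ v \<in> webs n \<Longrightarrow>
    t * br (u @ [(i, Pos)] @ v) - inverse t * br (u @ [(i, Neg)] @ v) = (q - inverse q) * br (u @ v)"
  using bracket unfolding is_web_bracket_def Let_def by blast

lemma br_curl: "curl \<in> {right_curl, left_curl} \<Longrightarrow> u @ v \<in> webs n \<Longrightarrow> u @ curl Pos i @ v \<in> webs n \<Longrightarrow>
    br (u @ curl Pos i @ v) = t powi (int n * int n - 1) * br (u @ v)"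
  using bracket unfolding is_web_bracket_def Let_def by blast

lemma br_source_sink: "u @ [(i, Node Sink), (i, Node Source)] @ v \<in> webs n \<Longrightarrow>
    br (u @ [(i, Node Sink), (i, Node Source)] @ v) = q ^ (n * (n - 1)) *
      (\<Sum>\<sigma> | \<sigma> permutes {..<n}. (- (t powi (1 - int n))) ^ inversions n \<sigma> *
         br (u @ braid_word i (positive_braid n \<sigma>) @ v))"
  using bracket unfolding is_web_bracket_def Let_def by blast

lemma br_circle: "u @ [(i, Cap d), (i, Cup d)] @ v \<in> webs n \<Longrightarrow>
    br (u @ [(i, Cap d), (i, Cup d)] @ v) = quantum_int q n * br (u @ v)"
  using bracket unfolding is_web_bracket_def Let_def by blast

lemma br_Nil: "br [] = 1"
  using bracket unfolding is_web_bracket_def Let_def by blast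

sublocale tangle_relation n "\<lambda>w w'. br w = br w'"
  by unfold_locales (auto intro: br_isotopic isotopicI)

text \<open>A positive curl contains one positive crossing, whose normalizing factor
  \<open>t\<close> turns the framing factor into a power of \<open>q\<close>.\<close>

lemma curl_factor: "t * t powi (int n * int n - 1) = q ^ n"
proof -
  have "t * t powi (int n * int n - 1) = t powi (1 + (int n * int n - 1))"
    using t_nz power_int_add[of t 1 "int n * int n - 1"] by simp
  also have "\<dots> = t ^ (n * n)" by (simp flip: power_int_of_nat)
  finally show ?thesis by (simp add: power_mult)
qed

text \<open>A fixed surrounding diagram with two open downward strands, into which the vertex is
  inserted.\<close>

context
  fixes u v :: web and P Q :: "dir list"
  assumes u: "ar [] u (P @ [Down, Down] @ Q)" and v: "ar (P @ [Down, Down] @ Q) v []"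
begin

abbreviation level :: "nat \<Rightarrow> dir list" where
  "level m \<equiv> P @ downs m @ ups (m - 2) @ Q"

abbreviation top_part :: "nat \<Rightarrow> web" where
  "top_part m \<equiv> u @ braid_caps (length P) m"

abbreviation bottom_part :: "nat \<Rightarrow> web" where
  "bottom_part m \<equiv> braid_cups (length P) m @ v"

text \<open>The factor \<open>t\<close> for each crossing turns the skein relation into the
  quadratic relation of the Hecke algebra.\<close>

definition braid_value :: "nat \<Rightarrow> nat list \<Rightarrow> 'a" where
  "braid_value m ks = t ^ length ks * br (top_part m @ braid_word (length P) ks @ bottom_part m)"

lemma arr_top: "2 \<le> m \<Longrightarrow> ar [] (top_part m) (level m)"
  by (rule arr_appendI[OF u arr_braid_caps])

lemma arr_bottom: "2 \<le> m \<Longrightarrow> ar (level m) (bottom_part m) []"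
  by (rule arr_appendI[OF arr_braid_cups v])

lemma arr_braid: "\<forall>k\<in>set ks. Suc k < m \<Longrightarrow> ar (P @ downs m @ X) (braid_word (length P) ks) (P @ downs m @ X)"
  unfolding braid_word_shift[of "length P"] by (rule arr_left, rule arr_braid_word)

lemma hecke_braid_value:
  assumes "2 \<le> m"
  shows "hecke_functional q (m - 1) (braid_value m)"
  unfolding hecke_functional_def
proof (intro allI impI)
  fix a b assume "set a \<subseteq> {..<m - 1}" "set b \<subseteq> {..<m - 1}"
  then have ab: "\<forall>k\<in>set a. Suc k < m" "\<forall>k\<in>set b. Suc k < m" by auto
  have A: "ar [] (top_part m @ braid_word (length P) a) (level m)"
    using arr_appendI[OF arr_top[OF assms] arr_braid[OF ab(1)]] by simp
  have B: "ar (level m) (braid_word (length P) b @ bottom_part m) []"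
    using arr_appendI[OF arr_braid[OF ab(2)] arr_bottom[OF assms]] by simp
  have eq: "braid_value m (a @ x @ b) = braid_value m (a @ y @ b)"
    if "length x = length y" "\<And>X. teq (downs m @ X) (braid_word 0 x) (braid_word 0 y) (downs m @ X)" for x y
  proof -
    have "teq (level m) (braid_word (length P) x) (braid_word (length P) y) (level m)"
      unfolding braid_word_shift[of "length P"] using teq_left[OF that(2)] .
    from teqD(3)[OF this A B] show ?thesis by (simp add: braid_value_def that(1))
  qed
  have "braid_value m (a @ [i, j] @ b) = braid_value m (a @ [j, i] @ b)" if "Suc i < j" "j < m - 1" for i j
    by (rule eq, simp, rule braid_word_far) (use that in simp_all)
  moreover have "braid_value m (a @ [i, Suc i, i] @ b) = braid_value m (a @ [Suc i, i, Suc i] @ b)" if "Suc i < m - 1" for i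
    by (rule eq, simp, rule braid_word_braid) (use that in simp_all)
  moreover have "braid_value m (a @ [i, i] @ b) = (q - inverse q) * braid_value m (a @ [i] @ b) + braid_value m (a @ b)"
    if i: "i < m - 1" for i
  proof -
    let ?U = "top_part m @ braid_word (length P) a" and ?V = "braid_word (length P) b @ bottom_part m"
    let ?X = "[(length P + i, Pos)] :: web"
    have X: "ar (level m) ?X (level m)"
      using arr_braid[of "[i]" m "ups (m - 2) @ Q"] i by simp
    define e where "e = m - (i + 2)"
    have e: "m = i + 2 + e" using i by (simp add: e_def)
    have "teq (level m) [(length P + i, Pos), (length P + i, Neg)] [] (level m)"
      by (rule teq_in[OF pos_neg, of _ "[]" "P @ downs i" "[]" _ _ "downs e @ ups (m - 2) @ Q"])
        (simp_all add: e replicate_simps)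
    from teqD(3)[OF this A B] have n1: "br ((?U @ ?X) @ [(length P + i, Neg)] @ ?V) = br (?U @ ?V)" by simp
    have "(?U @ ?X) @ ?X @ ?V \<in> webs n"
      unfolding webs_iff_arr by (rule arr_appendI[OF arr_appendI[OF A X] arr_appendI[OF X B]])
    from br_skein[OF this] n1
    have "t * br ((?U @ ?X) @ ?X @ ?V) = inverse t * br (?U @ ?V) + (q - inverse q) * br (?U @ ?X @ ?V)"
      by (simp add: algebra_simps)
    then have "t ^ Suc (length a + length b) * (t * br ((?U @ ?X) @ ?X @ ?V)) =
       t ^ Suc (length a + length b) * (inverse t * br (?U @ ?V) + (q - inverse q) * br (?U @ ?X @ ?V))" by simp
    moreover have "t ^ Suc (length a + length b) * (inverse t * br (?U @ ?V)) = t ^ (length a + length b) * br (?U @ ?V)"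
      using t_nz by simp
    ultimately show ?thesis
      by (simp add: braid_value_def distrib_left) (simp add: algebra_simps)
  qed
  ultimately show "(\<forall>i j. Suc i < j \<longrightarrow> j < m - 1 \<longrightarrow> braid_value m (a @ [i, j] @ b) = braid_value m (a @ [j, i] @ b)) \<and>
     (\<forall>i. Suc i < m - 1 \<longrightarrow> braid_value m (a @ [i, Suc i, i] @ b) = braid_value m (a @ [Suc i, i, Suc i] @ b)) \<and>
     (\<forall>i<m - 1. braid_value m (a @ [i, i] @ b) = (q - inverse q) * braid_value m (a @ [i] @ b) + braid_value m (a @ b))"
    by blast
qed

text \<open>The last cap moves down past the braid and meets its cup.\<close>

lemma braid_value_circle:
  assumes m: "2 \<le> m" and a: "\<forall>k\<in>set a. Suc k < m"
  shows "braid_value (Suc m) a = quantum_int q n * braid_value m a"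
proof -
  let ?b = "braid_word (length P) a" and ?c = "[(length P + m, Cap Down)] :: web" and ?d = "[(length P + m, Cup Down)] :: web"
  have A: "ar [] (top_part m @ ?b) (level m)" by (rule arr_appendI[OF arr_top[OF m] arr_braid[OF a]])
  have C: "ar (level m) (?c @ ?d @ bottom_part m) []"
    by (rule arr_appendI[OF arr_cap arr_appendI[OF arr_cup arr_bottom[OF m]]])
  have "teq [] (top_part m @ ?b @ ?c @ ?d @ bottom_part m) (top_part m @ ?c @ ?b @ ?d @ bottom_part m) []"
    by (rule teq_exch[of _ "top_part m" ?b "P @ downs m" "[(0, Cap Down)]" "?d @ bottom_part m" _ "P @ downs m" "ups (m - 2) @ Q" "[Down, Up] @ ups (m - 2) @ Q"])
      (use arr_braid[OF a, of "[]"] arr_top[OF m] arr_appendI[OF arr_cup arr_bottom[OF m]] in \<open>simp_all add: web_upper_plain replace_at_def\<close>)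
  from teqD(3)[OF this, of "[]" "[]"]
  have "br (top_part (Suc m) @ ?b @ bottom_part (Suc m)) = br ((top_part m @ ?b) @ [(length P + m, Cap Down), (length P + m, Cup Down)] @ bottom_part m)"
    using m by (simp add: braid_caps_Suc braid_cups_Suc)
  also have "\<dots> = quantum_int q n * br ((top_part m @ ?b) @ bottom_part m)"
    by (rule br_circle) (use arr_appendI[OF A C] in \<open>simp add: webs_iff_arr\<close>)
  finally show ?thesis by (simp add: braid_value_def)
qed

text \<open>Cap and cup of the last strand meet at the only crossing on that strand and form a right
  curl with it.\<close>

lemma braid_value_curl:
  assumes m: "2 \<le> m" and a: "\<forall>k\<in>set a. Suc k < m" and b: "\<forall>k\<in>set b. Suc k < m"
  shows "braid_value (Suc m) (a @ [m - 1] @ b) = q ^ n * braid_value m (a @ b)"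
proof -
  obtain p where p: "m = Suc p" using m by (cases m) auto
  let ?a = "braid_word (length P) a" and ?b = "braid_word (length P) b"
  let ?c = "[(length P + m, Cap Down)] :: web" and ?d = "[(length P + m, Cup Down)] :: web" and ?X = "[(length P + p, Pos)] :: web"
  have A: "ar [] (top_part m @ ?a) (level m)" using arr_appendI[OF arr_top[OF m] arr_braid[OF a]] by simp
  have B: "ar (level m) (?b @ bottom_part m) []" by (rule arr_appendI[OF arr_braid[OF b] arr_bottom[OF m]])
  have X: "ar (P @ downs m @ [Down, Up] @ ups (m - 2) @ Q) ?X (P @ downs m @ [Down, Up] @ ups (m - 2) @ Q)"
    using arr_braid[of "[p]" "Suc m" "[Up] @ ups (m - 2) @ Q"] by (simp add: p replicate_simps)
  have b2: "ar (P @ downs m @ [Down, Up] @ ups (m - 2) @ Q) ?b (P @ downs m @ [Down, Up] @ ups (m - 2) @ Q)"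
    by (rule arr_braid[OF b])
  let ?r = "?X @ ?b @ ?d @ bottom_part m"
  have r: "ar (P @ downs m @ [Down, Up] @ ups (m - 2) @ Q) ?r []"
    by (rule arr_appendI[OF X arr_appendI[OF b2 arr_appendI[OF arr_cup arr_bottom[OF m]]]])
  have "teq [] (top_part m @ ?a @ ?c @ ?r) (top_part m @ ?c @ ?a @ ?r) []"
    by (rule teq_exch[of _ "top_part m" ?a "P @ downs m" "[(0, Cap Down)]" ?r _ "P @ downs m" "ups (m - 2) @ Q" "[Down, Up] @ ups (m - 2) @ Q"])
      (use arr_braid[OF a, of "[]"] arr_top[OF m] r in \<open>simp_all add: web_upper_plain replace_at_def del: arr.simps(2)\<close>, simp_all add: web_upper_plain replace_at_def)
  note 1 = teqD(3)[OF this, of "[]" "[]", simplified]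
  have cx: "ar [] (top_part m @ ?a @ ?c @ ?X) (P @ downs m @ [Down, Up] @ ups (m - 2) @ Q)"
    using arr_appendI[OF arr_appendI[OF A arr_cap] X] by simp
  have "teq [] ((top_part m @ ?a @ ?c @ ?X) @ ?b @ ?d @ bottom_part m) ((top_part m @ ?a @ ?c @ ?X) @ ?d @ ?b @ bottom_part m) []"
    by (rule teq_exch[of _ "top_part m @ ?a @ ?c @ ?X" ?b "P @ downs m" "[(0, Cup Down)]" "bottom_part m" _ "P @ downs m" "[Down, Up] @ ups (m - 2) @ Q" "ups (m - 2) @ Q"])
      (use arr_braid[OF b, of "[]"] arr_bottom[OF m] cx in \<open>simp_all add: web_upper_plain replace_at_def\<close>)
  note 2 = teqD(3)[OF this, of "[]" "[]", simplified]
  have "br (top_part (Suc m) @ braid_word (length P) (a @ [m - 1] @ b) @ bottom_part (Suc m)) =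
     br ((top_part m @ ?a) @ right_curl Pos (length P + p) @ (?b @ bottom_part m))"
    using 1 2 m by (simp add: braid_caps_Suc braid_cups_Suc right_curl_def p)
  also have "\<dots> = t powi (int n * int n - 1) * br ((top_part m @ ?a) @ (?b @ bottom_part m))"
  proof (rule br_curl)
    show "(top_part m @ ?a) @ ?b @ bottom_part m \<in> webs n"
      unfolding webs_iff_arr by (rule arr_appendI[OF A B])
    have "ar [] ((top_part m @ ?a @ ?c @ ?X) @ ?d @ ?b @ bottom_part m) []"
      by (rule arr_appendI[OF cx arr_appendI[OF arr_cup B]])
    then show "(top_part m @ ?a) @ right_curl Pos (length P + p) @ ?b @ bottom_part m \<in> webs n"
      unfolding webs_iff_arr by (simp add: right_curl_def p)
  qed simp
  finally have "braid_value (Suc m) (a @ [m - 1] @ b) = t ^ Suc (length (a @ b)) * (t powi (int n * int n - 1) * br (top_part m @ braid_word (length P) (a @ b) @ bottom_part m))"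
    by (simp add: braid_value_def)
  also have "\<dots> = (t * t powi (int n * int n - 1)) * braid_value m (a @ b)"
    by (simp add: braid_value_def mult_ac)
  finally show ?thesis by (simp add: curl_factor)
qed

lemma antisym_braid_value:
  "2 \<le> m \<Longrightarrow> m \<le> n \<Longrightarrow> antisym (- inverse q) m (braid_value m) =
     (\<Prod>j = 2..<m. inverse q ^ j * quantum_int q (n - j)) * antisym (- inverse q) 2 (braid_value 2)"
proof (induction m rule: dec_induct)
  case (step m)
  have "antisym (- inverse q) (Suc m) (braid_value (Suc m)) =
    inverse q ^ m * quantum_int q (n - m) * antisym (- inverse q) m (braid_value m)"
    by (rule antisym_closure[OF hecke_braid_value[OF step(1)] q_nz z_nz refl])
      (use step braid_value_circle[OF step(1)] braid_value_curl[OF step(1)] in auto)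
  then show ?case using step by simp
qed simp

text \<open>Removing the closed strands from the last to the third leaves the antisymmetrizer of two
  strands, the identity minus \<open>1 / q\<close> times the generator.\<close>

lemma br_vertex_web:
  "br (u @ vertex_web n (length P) @ v) =
     quantum_fact q (n - 2) * q ^ (n * (n - 1) div 2) * (q * br (u @ v) - t * br (u @ [(length P, Pos)] @ v))"
proof -
  let ?c = "- inverse q" and ?i = "length P"
  \<comment> \<open>The coefficient of rule (3) splits into the eigenvalue and the normalizing
    factor of a crossing.\<close>
  have c: "- (t powi (1 - int n)) = ?c * t"
    using t_nz by (simp add: power_int_diff divide_inverse mult.commute)
  have "top_part n @ [(?i, Node Sink), (?i, Node Source)] @ bottom_part n \<in> webs n"
    unfolding webs_iff_arr
    by (rule arr_appendI[OF arr_top[OF n_ge] arr_appendI[OF arr_sink_source arr_bottom[OF n_ge]]])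
  from br_source_sink[OF this]
  have "br (u @ vertex_web n ?i @ v) = q ^ (n * (n - 1)) * (\<Sum>\<sigma> | \<sigma> permutes {..<n}. (- (t powi (1 - int n))) ^ inversions n \<sigma> *
         br (top_part n @ braid_word ?i (positive_braid n \<sigma>) @ bottom_part n))"
    by (simp add: vertex_web_eq)
  also have "(\<Sum>\<sigma> | \<sigma> permutes {..<n}. (- (t powi (1 - int n))) ^ inversions n \<sigma> *
         br (top_part n @ braid_word ?i (positive_braid n \<sigma>) @ bottom_part n)) =
      (\<Sum>\<sigma> | \<sigma> permutes {..<n}. ?c ^ inversions n \<sigma> * braid_value n (positive_braid n \<sigma>))"
    unfolding c by (intro sum.cong refl) (simp only: braid_value_def positive_braid_reduced(2) power_mult_distrib mult.assoc mem_Collect_eq)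
  also have "\<dots> = antisym ?c n (braid_value n)"
    by (rule sum_positive_braids[OF hecke_braid_value[OF n_ge]])
  also have "\<dots> = (\<Prod>j = 2..<n. inverse q ^ j * quantum_int q (n - j)) * antisym ?c 2 (braid_value 2)"
    by (rule antisym_braid_value[OF n_ge order_refl])
  also have "antisym ?c 2 (braid_value 2) = inverse q * (q * br (u @ v) - t * br (u @ [(?i, Pos)] @ v))"
    using q_nz by (simp add: antisym_2 braid_value_def braid_caps_def braid_cups_def algebra_simps)
  also have "(\<Prod>j = 2..<n. inverse q ^ j * quantum_int q (n - j)) = inverse q ^ (\<Sum>{2..<n}) * quantum_fact q (n - 2)"
  proof -
    have "(\<Prod>j = 2..<n. quantum_int q (n - j)) = (\<Prod>j = 1..n - 2. quantum_int q j)"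
      by (rule prod.reindex_bij_witness[of _ "\<lambda>j. n - j" "\<lambda>j. n - j"]) auto
    then show ?thesis by (simp add: prod.distrib power_sum quantum_fact_def)
  qed
  finally have "br (u @ vertex_web n ?i @ v) = (q ^ (n * (n - 1)) * inverse q ^ Suc (\<Sum>{2..<n})) * quantum_fact q (n - 2) *
      (q * br (u @ v) - t * br (u @ [(?i, Pos)] @ v))"
    by (simp add: mult_ac)
  \<comment> \<open>One factor \<open>1 / q\<close> stems from the antisymmetrizer of two strands,
    the others from the closed strands.\<close>
  also have "q ^ (n * (n - 1)) * inverse q ^ Suc (\<Sum>{2..<n}) = q ^ (n * (n - 1) div 2)"
  proof -
    define h where "h = n * (n - 1) div 2"
    have "even (n * (n - 1))" by (cases n) auto
    then have "n * (n - 1) = h + h" unfolding h_def mult_2[symmetric] by (rule dvd_mult_div_cancel[symmetric])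
    moreover have "Suc (\<Sum>{2..<n}) = h" unfolding h_def by (rule sum_2_to[OF n_ge])
    ultimately have "q ^ (n * (n - 1)) * inverse q ^ Suc (\<Sum>{2..<n}) = q ^ h * (q ^ h * inverse q ^ h)"
      by (simp only: power_add mult.assoc)
    then show ?thesis using q_nz by (simp add: h_def flip: power_mult_distrib)
  qed
  finally show ?thesis by (simp add: mult_ac)
qed

end

end

text \<open>Positions in the state sum depend on the numbers of strands only, so webs without discs
  and singular links can be treated alike.\<close>

fun width :: "'v piece \<Rightarrow> nat" where
  "width (Cap d) = 0"
| "width p = 2"

fun height :: "'v piece \<Rightarrow> nat" where
  "height (Cup d) = 0"
| "height p = 2"

fun fits :: "nat \<Rightarrow> (nat \<times> 'v piece) list \<Rightarrow> nat \<Rightarrow> bool" where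
  "fits m [] k \<longleftrightarrow> m = k"
| "fits m ((i, p) # w) k \<longleftrightarrow> i + width p \<le> m \<and> fits (m - width p + height p) w k"

lemma web_width:
  "\<forall>v. p \<noteq> Node v \<Longrightarrow> length (web_upper m p) = width p"
  "\<forall>v. p \<noteq> Node v \<Longrightarrow> length (web_lower m p) = height p"
  by (cases p; simp add: web_upper_plain)+

lemma fits_arr: "arr m xs w ys \<Longrightarrow> plain w \<Longrightarrow> fits (length xs) w (length ys)"
  by (induction m xs w ys rule: arr.induct) (auto simp: web_width replace_at_def add.commute)

section \<open>The state sum of a link\<close>

text \<open>The states colour the strands by \<open>{1..n}\<close>; the crossings act by the \<open>R\<close>-matrix of the vector
  representation of quantum \<open>gl\<^sub>n\<close>, and a vertex acts by \<open>q - Pos\<close>.\<close>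

locale state_model =
  fixes n :: nat and r :: "'a::field"
  assumes r_nz: "r \<noteq> 0"
begin

text \<open>As \<open>r\<close> is the fourth root of \<open>q_M\<close>, this is the square root of
  \<open>q_M\<close>.\<close>

definition q :: 'a where "q = r ^ 2"

definition z :: 'a where "z = q - inverse q"

lemma q_nz: "q \<noteq> 0" using r_nz by (simp add: q_def)

lemma q_square: "q * q = 1 + z * q" "q * (q * t) = t + z * (q * t)"
  using q_nz by (simp_all add: z_def algebra_simps)

text \<open>The power of \<open>q_M\<close> with exponent \<open>(c - (n + 1) / 2) / 2\<close>: the
  contribution of half an anti-clockwise turn of a curve with label \<open>c\<close>.\<close>

definition weight :: "nat \<Rightarrow> 'a" where
  "weight c = r powi (2 * int c - int n - 1)"

definition turn_weight :: "dir \<Rightarrow> nat \<Rightarrow> 'a" where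
  "turn_weight d c = (if d = Down then weight c else inverse (weight c))"

text \<open>The diagonal entries of an \<open>R\<close>-matrix with eigenvalues \<open>q\<close> and
  \<open>- 1 / q\<close>; the entries that exchange two colours are minus
  \<open>swap\<close>.\<close>

definition stay :: "nat \<Rightarrow> nat \<Rightarrow> 'a" where
  "stay a b = (if a = b then q else if a < b then z else 0)"

definition swap :: "nat \<Rightarrow> nat \<Rightarrow> 'a" where
  "swap a b = (if a = b then 0 else 1)"

text \<open>Operators act on functions of colourings, from the lower to the upper boundary: \<psi>
  depends on the colours below the piece, the result on the colours \<open>X\<close> above it. The
  negative crossing is the positive one minus \<open>z\<close>, and this is also its
  inverse.\<close>

fun local_op :: "'v piece \<Rightarrow> (nat list \<Rightarrow> 'a) \<Rightarrow> nat list \<Rightarrow> 'a" where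
  "local_op (Cap d) \<psi> X = (\<Sum>c = 1..n. turn_weight d c * \<psi> [c, c])"
| "local_op (Cup d) \<psi> X = (if hd X = X ! 1 then turn_weight d (hd X) * \<psi> [] else 0)"
| "local_op Pos \<psi> X = stay (hd X) (X ! 1) * \<psi> [hd X, X ! 1] - swap (hd X) (X ! 1) * \<psi> [X ! 1, hd X]"
| "local_op Neg \<psi> X = (stay (hd X) (X ! 1) - z) * \<psi> [hd X, X ! 1] - swap (hd X) (X ! 1) * \<psi> [X ! 1, hd X]"
| "local_op (Node v) \<psi> X = (q - stay (hd X) (X ! 1)) * \<psi> [hd X, X ! 1] + swap (hd X) (X ! 1) * \<psi> [X ! 1, hd X]"

definition piece_op :: "nat \<times> 'v piece \<Rightarrow> (nat list \<Rightarrow> 'a) \<Rightarrow> nat list \<Rightarrow> 'a" where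
  "piece_op = (\<lambda>(i, p) \<phi> A. local_op p (\<lambda>Y. \<phi> (take i A @ Y @ drop (i + width p) A)) (take (width p) (drop i A)))"

fun word_op :: "(nat \<times> 'v piece) list \<Rightarrow> (nat list \<Rightarrow> 'a) \<Rightarrow> nat list \<Rightarrow> 'a" where
  "word_op [] \<phi> = \<phi>"
| "word_op (x # w) \<phi> = piece_op x (word_op w \<phi>)"

definition state_sum :: "(nat \<times> 'v piece) list \<Rightarrow> 'a" where
  "state_sum w = word_op w (\<lambda>_. 1) []"

lemma word_op_append: "word_op (u @ v) \<phi> = word_op u (word_op v \<phi>)"
  by (induction u) simp_all

definition colorings :: "nat \<Rightarrow> nat list set" where
  "colorings m = {A. length A = m \<and> set A \<subseteq> {1..n}}"

lemma local_op_cong: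
  assumes "X \<in> colorings (width p)" "\<And>Y. Y \<in> colorings (height p) \<Longrightarrow> \<psi> Y = \<psi>' Y"
  shows "local_op p \<psi> X = local_op p \<psi>' X"
proof -
  have "\<exists>a b. X = [a, b] \<and> a \<in> {1..n} \<and> b \<in> {1..n}" if "width p = 2"
    using assms(1) that by (auto simp: colorings_def length_Suc_conv numeral_2_eq_2)
  then show ?thesis
    using assms(2) by (cases p) (auto simp: colorings_def intro!: sum.cong)
qed

lemma local_op_cong_length:
  "(\<And>Y. length Y = height p \<Longrightarrow> \<psi> Y = \<psi>' Y) \<Longrightarrow> local_op p \<psi> X = local_op p \<psi>' X"
  by (cases p) (auto intro!: sum.cong)

lemma piece_op_decompose:
  "i = length P \<Longrightarrow> length X = width p \<Longrightarrow> piece_op (i, p) \<phi> (P @ X @ Q) = local_op p (\<lambda>Y. \<phi> (P @ Y @ Q)) X"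
  by (simp add: piece_op_def)

lemma coloring_split:
  assumes "A \<in> colorings m" "i + k \<le> m"
  obtains P X Q where "A = P @ X @ Q" "i = length P" "length X = k" "set X \<subseteq> {1..n}" "set P \<subseteq> {1..n}" "set Q \<subseteq> {1..n}"
proof -
  have *: "A = take i A @ take k (drop i A) @ drop (i + k) A"
    by (metis add.commute append_take_drop_id drop_drop)
  have "set (take k (drop i A)) \<subseteq> set A" "set (take i A) \<subseteq> set A" "set (drop (i + k) A) \<subseteq> set A"
    by (meson order_trans set_take_subset set_drop_subset)+
  then show ?thesis
    using assms that[OF *] by (force simp: colorings_def)
qed

lemma word_op_cong:
  assumes "fits m w k" "\<And>A. A \<in> colorings k \<Longrightarrow> \<phi> A = \<psi> A" "A \<in> colorings m"
  shows "word_op w \<phi> A = word_op w \<psi> A"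
  using assms
proof (induction w arbitrary: m A)
  case (Cons x w)
  obtain i p where x: "x = (i, p)" by force
  have f: "i + width p \<le> m" "fits (m - width p + height p) w k" using Cons.prems x by auto
  from coloring_split[OF Cons.prems(3) f(1)] obtain P X Q where A: "A = P @ X @ Q" "i = length P" "length X = width p"
    "set X \<subseteq> {1..n}" "set P \<subseteq> {1..n}" "set Q \<subseteq> {1..n}" by metis
  have "local_op p (\<lambda>Y. word_op w \<phi> (P @ Y @ Q)) X = local_op p (\<lambda>Y. word_op w \<psi> (P @ Y @ Q)) X"
    by (rule local_op_cong, use A in \<open>simp add: colorings_def\<close>, rule Cons.IH[OF f(2) Cons.prems(2)])
      (use A Cons.prems(3) f(1) in \<open>auto simp: colorings_def\<close>)
  then show ?case using A by (simp add: x piece_op_decompose)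
qed simp

text \<open>Only colourings by \<open>{1..n}\<close> are compared, as the sums at the caps range
  over these colours.\<close>

definition op_eq :: "nat \<Rightarrow> web \<Rightarrow> web \<Rightarrow> bool" where
  "op_eq m a b \<longleftrightarrow> (\<forall>\<phi>. \<forall>A\<in>colorings m. word_op a \<phi> A = word_op b \<phi> A)"

lemma state_sum_replace:
  assumes "fits 0 u m" "\<And>A. A \<in> colorings m \<Longrightarrow> word_op w (\<lambda>_. 1) A = \<Psi> A"
  shows "state_sum (u @ w) = word_op u \<Psi> []"
  unfolding state_sum_def word_op_append[of u]
  by (rule word_op_cong[OF assms(1)]) (use assms(2) in \<open>auto simp: colorings_def\<close>)

lemma state_sum_eq:
  assumes "u @ a @ v \<in> webs m" "plain u" "\<And>xs ys. arr m xs a ys \<Longrightarrow> op_eq (length xs) a b"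
  shows "state_sum (u @ a @ v) = state_sum (u @ b @ v)"
proof -
  obtain xs ys where u: "arr m [] u xs" "arr m xs a ys"
    using assms(1) by (auto simp: webs_iff_arr arr_append)
  have "fits 0 u (length xs)" using fits_arr[OF u(1) assms(2)] by simp
  then show ?thesis
    unfolding state_sum_def[of "u @ b @ v"] word_op_append[of u]
    by (rule state_sum_replace) (use assms(3)[OF u(2)] in \<open>auto simp: op_eq_def word_op_append\<close>)
qed

lemma length_1E: "length X = Suc 0 \<Longrightarrow> (\<And>a. X = [a] \<Longrightarrow> thesis) \<Longrightarrow> thesis"
  by (auto simp: length_Suc_conv)

lemma length_2E: "length X = 2 \<Longrightarrow> (\<And>a b. X = [a, b] \<Longrightarrow> thesis) \<Longrightarrow> thesis"
  by (auto simp: length_Suc_conv numeral_2_eq_2)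

lemma length_3E: "length X = 3 \<Longrightarrow> (\<And>a b c. X = [a, b, c] \<Longrightarrow> thesis) \<Longrightarrow> thesis"
  by (auto simp: length_Suc_conv numeral_3_eq_3)

lemma op_eqI:
  assumes "i + k \<le> m" "\<And>P X Q \<phi>. i = length P \<Longrightarrow> length X = k \<Longrightarrow> set X \<subseteq> {1..n} \<Longrightarrow>
     word_op a \<phi> (P @ X @ Q) = word_op b \<phi> (P @ X @ Q)"
  shows "op_eq m a b"
  unfolding op_eq_def using assms by (metis coloring_split)

lemma weight_nz [simp]: "weight c \<noteq> 0"
  using r_nz by (simp add: weight_def)

lemma turn_weight_opp: "turn_weight d c * turn_weight (opp d) c = 1" "turn_weight (opp d) c * turn_weight d c = 1"
  by (cases d; simp add: turn_weight_def)+

lemma weight_Suc: "weight (Suc c) = q * weight c"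
proof -
  have "2 * int (Suc c) - int n - 1 = 2 + (2 * int c - int n - 1)" by simp
  then show ?thesis unfolding weight_def
    by (simp only:) (subst power_int_add, simp_all add: r_nz q_def)
qed

lemma piece_op_eval:
  "piece_op (length P, Cap d) \<phi> (P @ Q) = (\<Sum>c = 1..n. turn_weight d c * \<phi> (P @ c # c # Q))"
  "piece_op (Suc (length P), Cap d) \<phi> (P @ x1 # Q) = (\<Sum>c = 1..n. turn_weight d c * \<phi> (P @ x1 # c # c # Q))"
  "piece_op (Suc (Suc (length P)), Cap d) \<phi> (P @ x1 # x2 # Q) = (\<Sum>c = 1..n. turn_weight d c * \<phi> (P @ x1 # x2 # c # c # Q))"
  "piece_op (Suc (Suc (Suc (length P))), Cap d) \<phi> (P @ x1 # x2 # x3 # Q) = (\<Sum>c = 1..n. turn_weight d c * \<phi> (P @ x1 # x2 # x3 # c # c # Q))"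
  "piece_op (length P, Cup d) \<phi> (P @ a # b # Q) = (if a = b then turn_weight d a * \<phi> (P @ Q) else 0)"
  "piece_op (Suc (length P), Cup d) \<phi> (P @ x1 # a # b # Q) = (if a = b then turn_weight d a * \<phi> (P @ x1 # Q) else 0)"
  "piece_op (Suc (Suc (length P)), Cup d) \<phi> (P @ x1 # x2 # a # b # Q) = (if a = b then turn_weight d a * \<phi> (P @ x1 # x2 # Q) else 0)"
  "piece_op (Suc (Suc (Suc (length P))), Cup d) \<phi> (P @ x1 # x2 # x3 # a # b # Q) = (if a = b then turn_weight d a * \<phi> (P @ x1 # x2 # x3 # Q) else 0)"
  "piece_op (length P, Pos) \<phi> (P @ a # b # Q) =
     stay a b * \<phi> (P @ a # b # Q) - swap a b * \<phi> (P @ b # a # Q)"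
  "piece_op (length P, Neg) \<phi> (P @ a # b # Q) =
     (stay a b - z) * \<phi> (P @ a # b # Q) - swap a b * \<phi> (P @ b # a # Q)"
  "piece_op (Suc (length P), Pos) \<phi> (P @ x1 # a # b # Q) =
     stay a b * \<phi> (P @ x1 # a # b # Q) - swap a b * \<phi> (P @ x1 # b # a # Q)"
  "piece_op (Suc (length P), Neg) \<phi> (P @ x1 # a # b # Q) =
     (stay a b - z) * \<phi> (P @ x1 # a # b # Q) - swap a b * \<phi> (P @ x1 # b # a # Q)"
  "piece_op (Suc (Suc (length P)), Pos) \<phi> (P @ x1 # x2 # a # b # Q) =
     stay a b * \<phi> (P @ x1 # x2 # a # b # Q) - swap a b * \<phi> (P @ x1 # x2 # b # a # Q)"
  "piece_op (Suc (Suc (length P)), Neg) \<phi> (P @ x1 # x2 # a # b # Q) =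
     (stay a b - z) * \<phi> (P @ x1 # x2 # a # b # Q) - swap a b * \<phi> (P @ x1 # x2 # b # a # Q)"
  by (simp_all add: piece_op_def)

lemmas op_eval = word_op.simps append_Cons append_Nil piece_op_eval

lemma op_zigzag_left:
  assumes "Suc i \<le> m"
  shows "op_eq m [(Suc i, Cap d), (i, Cup (opp d))] []"
proof (rule op_eqI[of i 1])
  fix P X Q :: "nat list" and \<phi> :: "nat list \<Rightarrow> 'a" assume X: "i = length P" "length X = 1" "set X \<subseteq> {1..n}"
  then obtain a where a: "X = [a]" by (auto elim: length_1E)
  have "word_op [(Suc i, Cap d), (i, Cup (opp d))] \<phi> (P @ X @ Q) =
    (\<Sum>c = 1..n. if a = c then turn_weight d c * (turn_weight (opp d) c * \<phi> (P @ a # Q)) else 0)"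
    unfolding a X(1) op_eval by (intro sum.cong refl) simp
  also have "\<dots> = \<phi> (P @ a # Q)"
    using X a by (simp add: turn_weight_opp mult.assoc[symmetric])
  finally show "word_op [(Suc i, Cap d), (i, Cup (opp d))] \<phi> (P @ X @ Q) = word_op [] \<phi> (P @ X @ Q)"
    by (simp add: a)
qed (use assms in simp)

lemma op_zigzag_right:
  assumes "Suc i \<le> m"
  shows "op_eq m [(i, Cap d), (Suc i, Cup (opp d))] []"
proof (rule op_eqI[of i 1])
  fix P X Q :: "nat list" and \<phi> :: "nat list \<Rightarrow> 'a" assume X: "i = length P" "length X = 1" "set X \<subseteq> {1..n}"
  then obtain a where a: "X = [a]" by (auto elim: length_1E)
  have "word_op [(i, Cap d), (Suc i, Cup (opp d))] \<phi> (P @ X @ Q) =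
    (\<Sum>c = 1..n. if a = c then turn_weight d c * (turn_weight (opp d) c * \<phi> (P @ a # Q)) else 0)"
    unfolding a X(1) op_eval by (intro sum.cong refl) simp
  also have "\<dots> = \<phi> (P @ a # Q)"
    using X a by (simp add: turn_weight_opp mult.assoc[symmetric])
  finally show "word_op [(i, Cap d), (Suc i, Cup (opp d))] \<phi> (P @ X @ Q) = word_op [] \<phi> (P @ X @ Q)"
    by (simp add: a)
qed (use assms in simp)

lemma op_reidemeister_2:
  assumes "i + 2 \<le> m" "(X, Y) \<in> {(Pos, Neg), (Neg, Pos)}"
  shows "op_eq m [(i, X), (i, Y)] []"
proof (rule op_eqI[OF assms(1)])
  fix P Z Q :: "nat list" and \<phi> :: "nat list \<Rightarrow> 'a" assume Z: "i = length P" "length Z = 2" "set Z \<subseteq> {1..n}"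
  then obtain a b where a: "Z = [a, b]" by (auto elim: length_2E)
  consider "a = b" | "a < b" | "b < a" by linarith
  then show "word_op [(i, X), (i, Y)] \<phi> (P @ Z @ Q) = word_op [] \<phi> (P @ Z @ Q)"
    using assms(2) unfolding a Z(1) by cases (auto simp: piece_op_def stay_def swap_def algebra_simps q_square)
qed

text \<open>The Yang-Baxter equation, checked for each relative order of the three colours.\<close>

lemma op_slide:
  assumes "i + 3 \<le> m"
  shows "op_eq m [(i, Pos), (Suc i, Pos), (i, Pos)] [(Suc i, Pos), (i, Pos), (Suc i, Pos)]"
proof (rule op_eqI[OF assms(1)])
  fix P Z Q :: "nat list" and \<phi> :: "nat list \<Rightarrow> 'a" assume Z: "i = length P" "length Z = 3" "set Z \<subseteq> {1..n}"
  then obtain a b c where a: "Z = [a, b, c]" by (auto elim: length_3E)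
  have "word_op [(i, Pos), (Suc i, Pos), (i, Pos)] \<phi> (P @ [a, b, c] @ Q) = word_op [(Suc i, Pos), (i, Pos), (Suc i, Pos)] \<phi> (P @ [a, b, c] @ Q)"
    unfolding Z(1) op_eval
    by (cases a b rule: linorder_cases; cases b c rule: linorder_cases; cases a c rule: linorder_cases;
        simp add: stay_def swap_def algebra_simps q_square)
  then show "word_op [(i, Pos), (Suc i, Pos), (i, Pos)] \<phi> (P @ Z @ Q) = word_op [(Suc i, Pos), (i, Pos), (Suc i, Pos)] \<phi> (P @ Z @ Q)"
    by (simp add: a)
qed

text \<open>Every piece acts as a finite linear combination of evaluations; interchange and
  linearity then become properties of finite sums.\<close>

lemma local_op_eq_sum:
  "\<exists>(J :: nat set) k y. \<forall>\<psi>. local_op p \<psi> X = (\<Sum>j\<in>J. k j * \<psi> (y j))"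
proof (cases p)
  case (Cap d)
  then show ?thesis by (intro exI[of _ "{1..n}"] exI[of _ "turn_weight d"] exI[of _ "\<lambda>c. [c, c]"]) simp
next
  case (Cup d)
  then show ?thesis
    by (intro exI[of _ "{0}"] exI[of _ "\<lambda>_. if hd X = X ! 1 then turn_weight d (hd X) else 0"] exI[of _ "\<lambda>_. []"]) simp
next
  case Pos
  then show ?thesis
    by (intro exI[of _ "{0, 1}"] exI[of _ "\<lambda>j. if j = 0 then stay (hd X) (X ! 1) else - swap (hd X) (X ! 1)"]
        exI[of _ "\<lambda>j. if j = 0 then [hd X, X ! 1] else [X ! 1, hd X]"]) simp
next
  case Neg
  then show ?thesis
    by (intro exI[of _ "{0, 1}"] exI[of _ "\<lambda>j. if j = 0 then stay (hd X) (X ! 1) - z else - swap (hd X) (X ! 1)"]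
        exI[of _ "\<lambda>j. if j = 0 then [hd X, X ! 1] else [X ! 1, hd X]"]) simp
next
  case (Node v)
  then show ?thesis
    by (intro exI[of _ "{0, 1}"] exI[of _ "\<lambda>j. if j = 0 then q - stay (hd X) (X ! 1) else swap (hd X) (X ! 1)"]
        exI[of _ "\<lambda>j. if j = 0 then [hd X, X ! 1] else [X ! 1, hd X]"]) simp
qed

lemma local_op_exchange:
  "local_op p (\<lambda>Y. local_op p' (\<lambda>Y'. F Y Y') X') X = local_op p' (\<lambda>Y'. local_op p (\<lambda>Y. F Y Y') X) X'"
proof -
  obtain J :: "nat set" and k y where p: "\<And>\<psi>. local_op p \<psi> X = (\<Sum>j\<in>J. k j * \<psi> (y j))"
    using local_op_eq_sum by metis
  obtain J' :: "nat set" and k' y' where p': "\<And>\<psi>. local_op p' \<psi> X' = (\<Sum>j\<in>J'. k' j * \<psi> (y' j))"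
    using local_op_eq_sum by metis
  show ?thesis
    unfolding p p' sum_distrib_left by (subst sum.swap) (simp add: mult.left_commute)
qed

lemma local_op_linear:
  "local_op p (\<lambda>Y. \<alpha> * f Y + \<beta> * g Y) X = \<alpha> * local_op p f X + \<beta> * local_op p g X"
proof -
  obtain J :: "nat set" and k y where p: "\<And>\<psi>. local_op p \<psi> X = (\<Sum>j\<in>J. k j * \<psi> (y j))"
    using local_op_eq_sum by metis
  show ?thesis unfolding p by (simp add: distrib_left sum.distrib sum_distrib_left mult.left_commute)
qed

lemma word_op_linear:
  "word_op w (\<lambda>A. \<alpha> * f A + \<beta> * g A) A = \<alpha> * word_op w f A + \<beta> * word_op w g A"
proof (induction w arbitrary: A)
  case (Cons x w)
  obtain i p where x: "x = (i, p)" by force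
  show ?case by (simp add: x piece_op_def Cons local_op_linear)
qed simp

lemma op_exchange:
  assumes "\<forall>v. p \<noteq> Node v" "\<forall>v. p' \<noteq> Node v" "l = length (web_lower 0 p)" "w = width p"
    "i + w + k + width p' \<le> m"
  shows "op_eq m [(i, p), (i + l + k, p')] [(i + w + k, p'), (i, p)]"
proof (rule op_eqI[of i "w + k + width p'"])
  fix P Z Q :: "nat list" and \<phi> :: "nat list \<Rightarrow> 'a" assume Z: "i = length P" "length Z = w + k + width p'" "set Z \<subseteq> {1..n}"
  define X K X' where "X = take w Z" and "K = take k (drop w Z)" and "X' = drop (w + k) Z"
  have Z': "Z = X @ K @ X'" "length X = w" "length K = k" "length X' = width p'"
    unfolding X_def K_def X'_def using Z(2) by (auto, metis add.commute append_take_drop_id drop_drop)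
  have l: "l = height p" using web_width(2)[OF assms(1)] assms(3) by simp
  have wp: "length X = width p" using Z' assms by simp
  have "word_op [(i, p), (i + l + k, p')] \<phi> (P @ Z @ Q) =
     local_op p (\<lambda>Y. piece_op (i + l + k, p') \<phi> (P @ Y @ K @ X' @ Q)) X"
    using piece_op_decompose[OF Z(1) wp, of _ "K @ X' @ Q"] by (simp add: Z')
  also have "\<dots> = local_op p (\<lambda>Y. local_op p' (\<lambda>Y'. \<phi> (P @ Y @ K @ Y' @ Q)) X') X"
  proof -
    have *: "piece_op (i + l + k, p') \<phi> (P @ Y @ K @ X' @ Q) = local_op p' (\<lambda>Y'. \<phi> (P @ Y @ K @ Y' @ Q)) X'"
      if "length Y = l" for Y
      using piece_op_decompose[of "i + l + k" "P @ Y @ K" X' p' \<phi> Q] that Z Z' by simp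
    show ?thesis by (rule local_op_cong_length) (rule *, simp add: l)
  qed
  also have "\<dots> = local_op p' (\<lambda>Y'. local_op p (\<lambda>Y. \<phi> (P @ Y @ K @ Y' @ Q)) X) X'"
    by (rule local_op_exchange)
  also have "\<dots> = local_op p' (\<lambda>Y'. piece_op (i, p) \<phi> (P @ X @ K @ Y' @ Q)) X'"
    using piece_op_decompose[OF Z(1) wp] by simp
  also have "\<dots> = word_op [(i + w + k, p'), (i, p)] \<phi> (P @ Z @ Q)"
    using piece_op_decompose[of "i + w + k" "P @ X @ K" X' p' _ Q] Z Z' by simp
  finally show "word_op [(i, p), (i + l + k, p')] \<phi> (P @ Z @ Q) = word_op [(i + w + k, p'), (i, p)] \<phi> (P @ Z @ Q)" .
qed (use assms in simp)

lemma sum_sum_delta: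
  assumes "a \<in> {1..n}" "b \<in> {1..n}"
  shows "(\<Sum>c = 1..n. \<Sum>d = 1..n. if c = a \<and> d = b then A c d else 0) = (A a b :: 'a)"
proof -
  have "(\<Sum>c = 1..n. \<Sum>d = 1..n. if c = a \<and> d = b then A c d else 0) = (\<Sum>c = 1..n. if c = a then A a b else 0)"
    by (intro sum.cong refl) (use assms in \<open>auto simp: sum.delta\<close>)
  then show ?thesis using assms by simp
qed

lemma swap_commute: "swap a b = swap b a"
  by (simp add: swap_def)

lemma swap_same [simp]: "swap a a = 0"
  by (simp add: swap_def)

text \<open>Each colour passes one cap and one cup with inverse weights, so that both ways of
  turning give the same matrix \<open>?R\<close>.\<close>

lemma op_turn:
  assumes "i + 2 \<le> m"
  shows "op_eq m (turn_clockwise 2 2 Pos i) (turn_anticlockwise 2 2 Pos i)"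
proof (rule op_eqI[OF assms(1)])
  fix P Z Q :: "nat list" and \<phi> :: "nat list \<Rightarrow> 'a" assume Z: "i = length P" "length Z = 2" "set Z \<subseteq> {1..n}"
  then obtain a b where a: "Z = [a, b]" "a \<in> {1..n}" "b \<in> {1..n}" by (auto elim: length_2E)
  have cl: "turn_clockwise 2 2 Pos i = [(Suc (Suc (length P)), Cap Down), (Suc (Suc (Suc (length P))), Cap Down),
      (Suc (Suc (length P)), Pos), (Suc (length P), Cup Up), (length P, Cup Up)]"
    by (simp add: turn_clockwise_def numeral_2_eq_2 Z(1))
  have acl: "turn_anticlockwise 2 2 Pos i = [(length P, Cap Up), (Suc (length P), Cap Up),
      (Suc (Suc (length P)), Pos), (Suc (Suc (Suc (length P))), Cup Down), (Suc (Suc (length P)), Cup Down)]"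
    by (simp add: turn_anticlockwise_def numeral_2_eq_2 Z(1))
  let ?R = "stay b a * \<phi> (P @ a # b # Q) - swap b a * \<phi> (P @ b # a # Q)"
  have "word_op (turn_clockwise 2 2 Pos i) \<phi> (P @ a # b # Q) =
     (\<Sum>c = 1..n. \<Sum>d = 1..n. (if c = b \<and> d = a then stay c d * \<phi> (P @ d # c # Q) else 0)
        - (if c = a \<and> d = b then swap c d * \<phi> (P @ d # c # Q) else 0))"
    unfolding cl op_eval sum_distrib_left
    by (intro sum.cong refl, rename_tac c d, case_tac "c = b"; case_tac "d = a"; case_tac "c = a"; case_tac "d = b")
      (simp_all add: turn_weight_def swap_commute field_simps)
  also have "\<dots> = ?R"
    using sum_sum_delta[OF a(3,2)] sum_sum_delta[OF a(2,3)] by (simp add: sum_subtractf swap_commute)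
  finally have 1: "word_op (turn_clockwise 2 2 Pos i) \<phi> (P @ a # b # Q) = ?R" .
  have "word_op (turn_anticlockwise 2 2 Pos i) \<phi> (P @ a # b # Q) =
     (\<Sum>c = 1..n. \<Sum>d = 1..n. (if c = a \<and> d = b then stay d c * \<phi> (P @ c # d # Q) else 0)
        - (if c = b \<and> d = a then swap d c * \<phi> (P @ c # d # Q) else 0))"
    unfolding acl op_eval sum_distrib_left
    by (intro sum.cong refl, rename_tac c d, case_tac "c = b"; case_tac "d = a"; case_tac "c = a"; case_tac "d = b")
      (simp_all add: turn_weight_def swap_commute field_simps)
  also have "\<dots> = ?R"
    using sum_sum_delta[OF a(3,2)] sum_sum_delta[OF a(2,3)] by (simp add: sum_subtractf swap_commute)
  finally show "word_op (turn_clockwise 2 2 Pos i) \<phi> (P @ Z @ Q) = word_op (turn_anticlockwise 2 2 Pos i) \<phi> (P @ Z @ Q)"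
    using 1 by (simp add: a)
qed

text \<open>Telescopes, because \<open>weight (Suc c)\<close> is
  \<open>q * weight c\<close>.\<close>

lemma weight_sum: "m \<le> k \<Longrightarrow> z * (\<Sum>c = m..<k. weight c ^ 2) = inverse q * (weight k ^ 2 - weight m ^ 2)"
proof (induction k rule: dec_induct)
  case (step k)
  have "z * (\<Sum>c = m..<Suc k. weight c ^ 2) = inverse q * (weight k ^ 2 - weight m ^ 2) + z * weight k ^ 2"
    using step by (simp add: distrib_left)
  also have "\<dots> = inverse q * (weight (Suc k) ^ 2 - weight m ^ 2)"
    using q_nz by (simp add: weight_Suc z_def field_simps power2_eq_square)
  finally show ?case .
qed simp

text \<open>The sum over the intermediate colour in the second Reidemeister move for antiparallel
  strands. For \<open>f < a\<close> only the colours from \<open>f\<close> to \<open>a\<close>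
  contribute, and the telescoping sum in between cancels the two end terms.\<close>

lemma weight_sum_stay_stay:
  assumes "a \<in> {1..n}" "f \<in> {1..n}"
  shows "(\<Sum>c = 1..n. weight c ^ 2 * (stay a c - z) * stay f c) = (if a = f then weight a ^ 2 else 0)"
proof -
  let ?g = "\<lambda>c. weight c ^ 2 * (stay a c - z) * stay f c"
  consider "a < f" | "a = f" | "f < a" by linarith
  then show ?thesis
  proof cases
    case 1
    then have "(\<Sum>c = 1..n. ?g c) = 0" by (intro sum.neutral ballI) (auto simp: stay_def)
    with 1 show ?thesis by simp
  next
    case 2
    have "?g c = (if c = a then weight a ^ 2 else 0)" for c
      using q_nz 2 by (auto simp: stay_def z_def)
    with 2 assms show ?thesis by simp
  next
    case 3
    have "(\<Sum>c = 1..n. ?g c) = (\<Sum>c = f..a. ?g c)"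
      by (rule sum.mono_neutral_right) (use assms in \<open>auto simp: stay_def\<close>)
    also have "\<dots> = ?g f + (\<Sum>c = Suc f..<a. ?g c) + ?g a"
      using 3 by (subst sum.atLeast_Suc_atMost, simp, subst sum.last_plus, simp, simp add: algebra_simps atLeastLessThanSuc_atLeastAtMost[symmetric])
    also have "(\<Sum>c = Suc f..<a. ?g c) = (\<Sum>c = Suc f..<a. - z * z * weight c ^ 2)"
      by (intro sum.cong refl) (auto simp: stay_def)
    also have "\<dots> = - z * (z * (\<Sum>c = Suc f..<a. weight c ^ 2))"
      by (simp add: sum_distrib_left sum_negf mult.assoc)
    also have "z * (\<Sum>c = Suc f..<a. weight c ^ 2) = inverse q * (weight a ^ 2 - weight (Suc f) ^ 2)"
      using 3 by (intro weight_sum) simp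
    also have "?g f + - z * (inverse q * (weight a ^ 2 - weight (Suc f) ^ 2)) + ?g a = 0"
      using 3 q_nz by (simp add: stay_def weight_Suc z_def field_simps power2_eq_square)
    finally show ?thesis using 3 by simp
  qed
qed

text \<open>The value of a right curl: the colours above \<open>a\<close> telescope, and their lower
  end cancels the term of \<open>a\<close> itself.\<close>

lemma weight_sum_stay:
  assumes "a \<in> {1..n}"
  shows "(\<Sum>c = 1..n. weight c ^ 2 * stay a c) = q ^ n"
proof -
  let ?g = "\<lambda>c. weight c ^ 2 * stay a c"
  have "(\<Sum>c = 1..n. ?g c) = (\<Sum>c = a..n. ?g c)"
    by (rule sum.mono_neutral_right) (use assms in \<open>auto simp: stay_def\<close>)
  also have "\<dots> = ?g a + (\<Sum>c = Suc a..n. ?g c)"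
    using assms by (subst sum.atLeast_Suc_atMost) auto
  also have "(\<Sum>c = Suc a..n. ?g c) = (\<Sum>c = Suc a..<Suc n. z * weight c ^ 2)"
    by (intro sum.cong) (auto simp: stay_def)
  also have "\<dots> = inverse q * (weight (Suc n) ^ 2 - weight (Suc a) ^ 2)"
    using weight_sum[of "Suc a" "Suc n"] assms by (simp add: sum_distrib_left del: sum.op_ivl_Suc)
  also have "?g a + \<dots> = inverse q * weight (Suc n) ^ 2"
    using q_nz by (simp add: stay_def weight_Suc field_simps power2_eq_square)
  also have "\<dots> = q ^ n"
  proof -
    have "weight (Suc n) = r ^ (n + 1)" by (simp add: weight_def flip: power_int_of_nat)
    then show ?thesis using r_nz by (simp add: q_def power_mult_distrib field_simps flip: power_mult)
  qed
  finally show ?thesis .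
qed

lemma weight_reflect: "c \<in> {1..n} \<Longrightarrow> inverse (weight c) = weight (n + 1 - c)"
  by (simp add: weight_def of_nat_diff flip: power_int_minus) (simp add: algebra_simps)

text \<open>Reflecting the colours, \<open>c\<close> to \<open>n + 1 - c\<close>, inverts the
  weights and reverses their order, which turns a left curl into a right one.\<close>

lemma weight_sum_stay':
  assumes "a \<in> {1..n}"
  shows "(\<Sum>c = 1..n. inverse (weight c) ^ 2 * stay c a) = q ^ n"
proof -
  have "(\<Sum>c = 1..n. inverse (weight c) ^ 2 * stay c a) = (\<Sum>c = 1..n. inverse (weight (n + 1 - c)) ^ 2 * stay (n + 1 - c) a)"
    by (subst sum.atLeastAtMost_rev) (simp add: add.commute)
  also have "\<dots> = (\<Sum>c = 1..n. weight c ^ 2 * stay (n + 1 - a) c)"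
    by (intro sum.cong refl) (use assms weight_reflect in \<open>auto simp: stay_def\<close>)
  also have "\<dots> = q ^ n" using assms by (intro weight_sum_stay) auto
  finally show ?thesis .
qed

text \<open>For distinct colours, exchanging twice gives the identity. For equal colours the double
  sum reduces to \<open>weight_sum_stay_stay\<close>.\<close>

lemma op_reidemeister_2_up_down:
  assumes "i + 2 \<le> m"
  shows "op_eq m (leftward Neg i @ rightward Pos i) []"
proof (rule op_eqI[OF assms(1)])
  fix P Z Q :: "nat list" and \<phi> :: "nat list \<Rightarrow> 'a" assume Z: "i = length P" "length Z = 2" "set Z \<subseteq> {1..n}"
  then obtain a b where a: "Z = [a, b]" "a \<in> {1..n}" "b \<in> {1..n}" by (auto elim: length_2E)
  have rw: "rightward Pos i = [(length P, Cap Up), (Suc (length P), Pos), (Suc (Suc (length P)), Cup Down)]"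
    by (simp add: rightward_def Z(1))
  have lw: "leftward Neg i = [(Suc (Suc (length P)), Cap Down), (Suc (length P), Neg), (length P, Cup Up)]"
    by (simp add: leftward_def Z(1))
  have wc: "weight c * (inverse (weight c) * t) = t" for c t by simp
  let ?\<psi> = "word_op (rightward Pos i) \<phi>"
  have R: "?\<psi> (P @ e # c # Q) = (if e = c then \<Sum>f = 1..n. inverse (weight f) * weight c * stay f c * \<phi> (P @ f # f # Q) else 0)
     - swap c e * \<phi> (P @ c # e # Q)" if c: "c \<in> {1..n}" for e c
  proof -
    have "?\<psi> (P @ e # c # Q) = (\<Sum>f = 1..n. (if e = c then inverse (weight f) * weight c * stay f c * \<phi> (P @ f # f # Q) else 0)
       - (if f = c then swap c e * \<phi> (P @ c # e # Q) else 0))"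
      unfolding rw op_eval by (intro sum.cong refl) (simp add: turn_weight_def algebra_simps wc)
    also have "\<dots> = (if e = c then \<Sum>f = 1..n. inverse (weight f) * weight c * stay f c * \<phi> (P @ f # f # Q) else 0)
       - swap c e * \<phi> (P @ c # e # Q)"
      using c by (cases "e = c") (simp_all add: sum_subtractf sum_negf)
    finally show ?thesis .
  qed
  have "word_op (leftward Neg i @ rightward Pos i) \<phi> (P @ a # b # Q) = (\<Sum>c = 1..n. 
     (if a = b then weight c * (stay a c - z) * inverse (weight a) * ?\<psi> (P @ c # c # Q) else 0)
     - (if c = a then swap b a * ?\<psi> (P @ b # a # Q) else 0))"
    unfolding word_op_append lw op_eval by (intro sum.cong refl) (simp add: turn_weight_def algebra_simps wc)
  also have "\<dots> = (\<Sum>c = 1..n. 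
     (if a = b then weight c * (stay a c - z) * inverse (weight a) * ?\<psi> (P @ c # c # Q) else 0))
     - swap b a * ?\<psi> (P @ b # a # Q)"
    using a by (simp add: sum_subtractf)
  also have "\<dots> = \<phi> (P @ a # b # Q)"
  proof (cases "a = b")
    case False
    then show ?thesis using R[OF a(2), of b] by (simp add: swap_def)
  next
    case True
    have "(\<Sum>c = 1..n. weight c * (stay a c - z) * inverse (weight a) * ?\<psi> (P @ c # c # Q)) =
       (\<Sum>c = 1..n. \<Sum>f = 1..n. inverse (weight f) * inverse (weight a) * \<phi> (P @ f # f # Q) * (weight c ^ 2 * (stay a c - z) * stay f c))"
      by (intro sum.cong refl) (simp add: R sum_distrib_left power2_eq_square mult_ac)
    also have "\<dots> = (\<Sum>f = 1..n. inverse (weight f) * inverse (weight a) * \<phi> (P @ f # f # Q) * (\<Sum>c = 1..n. weight c ^ 2 * (stay a c - z) * stay f c))"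
      by (subst sum.swap) (simp add: sum_distrib_left)
    also have "\<dots> = (\<Sum>f = 1..n. if f = a then \<phi> (P @ a # a # Q) else 0)"
      by (intro sum.cong refl, subst weight_sum_stay_stay[OF a(2)]) (auto simp: power2_eq_square field_simps)
    also have "\<dots> = \<phi> (P @ a # a # Q)" using a by simp
    finally show ?thesis using True by simp
  qed
  finally show "word_op (leftward Neg i @ rightward Pos i) \<phi> (P @ Z @ Q) = word_op [] \<phi> (P @ Z @ Q)"
    by (simp add: a)
qed

lemma op_curl:
  assumes "Suc i \<le> m" "curl \<in> {right_curl Pos, left_curl Pos}" "A \<in> colorings m"
  shows "word_op (curl i) \<phi> A = q ^ n * \<phi> A"
proof -
  have "i + 1 \<le> m" using assms(1) by simp
  from coloring_split[OF assms(3) this] obtain P Z Q where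
    A: "A = P @ Z @ Q" "i = length P" "length Z = 1" "set Z \<subseteq> {1..n}" by metis
  then obtain a where a: "Z = [a]" "a \<in> {1..n}" by (auto elim: length_1E)
  have rc: "right_curl Pos i = [(Suc (length P), Cap Down), (length P, Pos), (Suc (length P), Cup Down)]"
    and lc: "left_curl Pos i = [(length P, Cap Up), (Suc (length P), Pos), (length P, Cup Up)]"
    by (simp_all add: right_curl_def left_curl_def A(2))
  have "word_op (right_curl Pos i) \<phi> (P @ a # Q) = (\<Sum>c = 1..n. weight c ^ 2 * stay a c * \<phi> (P @ a # Q))"
    unfolding rc op_eval by (intro sum.cong refl) (simp add: turn_weight_def power2_eq_square mult_ac)
  also have "\<dots> = q ^ n * \<phi> (P @ a # Q)"
    using weight_sum_stay[OF a(2)] by (simp flip: sum_distrib_right)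
  finally have 1: "word_op (right_curl Pos i) \<phi> (P @ a # Q) = q ^ n * \<phi> (P @ a # Q)" .
  have "word_op (left_curl Pos i) \<phi> (P @ a # Q) = (\<Sum>c = 1..n. inverse (weight c) ^ 2 * stay c a * \<phi> (P @ a # Q))"
    unfolding lc op_eval by (intro sum.cong refl) (simp add: turn_weight_def power2_eq_square mult_ac)
  also have "\<dots> = q ^ n * \<phi> (P @ a # Q)"
    using weight_sum_stay'[OF a(2)] by (simp flip: sum_distrib_right)
  finally show ?thesis using 1 assms(2) by (auto simp: A a)
qed

lemma webs_splitE:
  assumes "u @ a @ v \<in> webs m" "plain u"
  obtains xs ys where "arr m xs a ys" "fits 0 u (length xs)"
proof -
  obtain xs ys where u: "arr m [] u xs" "arr m xs a ys"
    using assms(1) by (auto simp: webs_iff_arr arr_append)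
  then show ?thesis using that fits_arr[OF u(1) assms(2)] by simp
qed

text \<open>The typing of the diagram provides enough strands for each of the operator
  identities.\<close>

lemma state_sum_isotopy:
  assumes "link_isotopy a b" "u @ a @ v \<in> webs m" "plain u"
  shows "state_sum (u @ a @ v) = state_sum (u @ b @ v)"
proof (rule state_sum_eq[OF assms(2,3)])
  fix xs ys assume xs: "arr m xs a ys"
  from assms(1) show "op_eq (length xs) a b"
  proof cases
    case (exchange p p' l w i k)
    have w: "w = width p" using exchange web_width by metis
    have "i + l + k + width p' \<le> length xs - width p + l" "i + width p \<le> length xs"
      using xs exchange web_width(1)[of p m] web_width(1)[of p' m] web_width(2)[of p 0] web_width(2)[of p m]
      by (auto simp: replace_at_def)
    then show ?thesis
      using op_exchange[of p p' l w i k "length xs"] exchange w by simp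
  next
    case (zigzag_left i d)
    then show ?thesis using op_zigzag_left[of i "length xs" d] xs by (simp add: web_upper_plain)
  next
    case (zigzag_right i d)
    then show ?thesis using op_zigzag_right[of i "length xs" d] xs by (auto simp: web_upper_plain replace_at_def)
  next
    case (turn i)
    have "\<exists>w. turn_clockwise 2 2 Pos i = (i + 2, Cap Down) # w"
      by (simp add: turn_clockwise_def numeral_2_eq_2)
    then show ?thesis using op_turn[of i "length xs"] xs turn by (auto simp: web_upper_plain)
  next
    case (reidemeister_2 X Y i)
    then show ?thesis using op_reidemeister_2[of i "length xs" X Y] xs by (auto simp: web_upper_plain)
  next
    case (reidemeister_2_up_down i)
    then show ?thesis using op_reidemeister_2_up_down[of i "length xs"] xs
      by (auto simp: web_upper_plain leftward_def replace_at_def)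
  next
    case (slide i)
    then show ?thesis using op_slide[of i "length xs"] xs by (auto simp: web_upper_plain replace_at_def)
  qed
qed

lemma state_sum_curl:
  assumes "curl \<in> {right_curl Pos, left_curl Pos}" "u @ curl i @ v \<in> webs m" "plain u"
  shows "state_sum (u @ curl i @ v) = q ^ n * state_sum (u @ v)"
proof -
  from webs_splitE[OF assms(2,3)] obtain xs ys where xs: "arr m xs (curl i) ys" "fits 0 u (length xs)" by metis
  have i: "Suc i \<le> length xs"
    using xs(1) assms(1) by (auto simp: right_curl_def left_curl_def web_upper_plain replace_at_def)
  have "state_sum (u @ curl i @ v) = word_op u (\<lambda>A. q ^ n * word_op v (\<lambda>_. 1) A + 0 * 0) []"
    by (rule state_sum_replace[OF xs(2)]) (simp add: word_op_append op_curl[OF i assms(1)])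
  then show ?thesis unfolding word_op_linear by (simp add: state_sum_def word_op_append)
qed

lemma piece_op_split:
  assumes "i + 2 \<le> m" "A \<in> colorings m"
  shows "piece_op (i, Neg :: 'v piece) \<phi> A = 1 * piece_op (i, Pos :: 'v piece) \<phi> A + (- z) * \<phi> A"
    "piece_op (i, Node x :: 'v piece) \<phi> A = q * \<phi> A + (- 1) * piece_op (i, Pos :: 'v piece) \<phi> A"
proof -
  from coloring_split[OF assms(2,1)] obtain P Z Q where
    A: "A = P @ Z @ Q" "i = length P" "length Z = 2" by metis
  then obtain a b where a: "Z = [a, b]" by (auto elim: length_2E)
  show "piece_op (i, Neg :: 'v piece) \<phi> A = 1 * piece_op (i, Pos :: 'v piece) \<phi> A + (- z) * \<phi> A"
    "piece_op (i, Node x :: 'v piece) \<phi> A = q * \<phi> A + (- 1) * piece_op (i, Pos :: 'v piece) \<phi> A"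
    by (simp_all add: A a piece_op_def algebra_simps)
qed

lemma state_sum_Neg:
  assumes "fits 0 u m" "i + 2 \<le> m"
  shows "state_sum (u @ [(i, Neg)] @ v) = state_sum (u @ [(i, Pos)] @ v) - z * state_sum (u @ v)"
proof -
  have "state_sum (u @ [(i, Neg)] @ v) =
      word_op u (\<lambda>A. 1 * word_op ([(i, Pos)] @ v) (\<lambda>_. 1) A + (- z) * word_op v (\<lambda>_. 1) A) []"
    by (rule state_sum_replace[OF assms(1)]) (simp add: piece_op_split(1)[OF assms(2)])
  then show ?thesis unfolding word_op_linear by (simp add: state_sum_def word_op_append)
qed

lemma state_sum_Node:
  assumes "fits 0 u m" "i + 2 \<le> m"
  shows "state_sum (u @ [(i, Node x)] @ v) = q * state_sum (u @ v) - state_sum (u @ [(i, Pos)] @ v)"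
proof -
  have "state_sum (u @ [(i, Node x)] @ v) =
      word_op u (\<lambda>A. q * word_op v (\<lambda>_. 1) A + (- 1) * word_op ([(i, Pos)] @ v) (\<lambda>_. 1) A) []"
    by (rule state_sum_replace[OF assms(1)]) (simp add: piece_op_split(2)[OF assms(2)])
  then show ?thesis unfolding word_op_linear by (simp add: state_sum_def word_op_append)
qed

text \<open>The quantum dimension of the vector representation, which is the value of a
  circle.\<close>

lemma weight_square_sum:
  assumes "z \<noteq> 0"
  shows "(\<Sum>c = 1..n. weight c ^ 2) = quantum_int q n"
proof -
  have "z * (\<Sum>c = 1..n. weight c ^ 2) = inverse q * (weight (Suc n) ^ 2 - weight 1 ^ 2)"
    using weight_sum[of 1 "Suc n"] by (simp add: atLeastLessThanSuc_atLeastAtMost del: sum.op_ivl_Suc)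
  also have "weight (Suc n) = r ^ (n + 1)" by (simp add: weight_def flip: power_int_of_nat)
  also have "weight 1 = r * inverse (r ^ n)"
  proof -
    have "weight 1 = r powi (1 - int n)" by (simp add: weight_def)
    also have "\<dots> = r powi 1 / r powi (int n)" using r_nz by (intro power_int_diff) simp
    finally show ?thesis by (simp add: divide_inverse)
  qed
  also have "inverse q * ((r ^ (n + 1)) ^ 2 - (r * inverse (r ^ n)) ^ 2) = q ^ n - inverse (q ^ n)"
    using r_nz by (simp add: q_def field_simps power_mult_distrib flip: power_mult)
  finally have "z * (\<Sum>c = 1..n. weight c ^ 2) = q ^ n - inverse (q ^ n)" .
  then show ?thesis using assms by (simp add: quantum_int_def z_def power_int_minus field_simps)
qed

lemma state_sum_circle:
  assumes "u @ [(i, Cap Down), (i, Cup Down)] @ v \<in> webs m" "plain u" "z \<noteq> 0"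
  shows "state_sum (u @ [(i, Cap Down), (i, Cup Down)] @ v) = quantum_int q n * state_sum (u @ v)"
proof -
  from webs_splitE[OF assms(1,2)] obtain xs ys where
    xs: "arr m xs [(i, Cap Down), (i, Cup Down)] ys" "fits 0 u (length xs)" by metis
  have i: "i + 0 \<le> length xs" using xs(1) by (simp add: web_upper_plain)
  have "word_op [(i, Cap Down), (i, Cup Down)] \<phi> A = quantum_int q n * \<phi> A" if "A \<in> colorings (length xs)" for A \<phi>
  proof -
    from coloring_split[OF that i] obtain P Z Q where A: "A = P @ Z @ Q" "i = length P" "length Z = 0" by metis
    have "word_op [(length P, Cap Down), (length P, Cup Down)] \<phi> (P @ Q) = (\<Sum>c = 1..n. weight c ^ 2 * \<phi> (P @ Q))"
      unfolding op_eval by (simp add: turn_weight_def power2_eq_square mult_ac)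
    then show ?thesis using A weight_square_sum[OF assms(3)] by (simp flip: sum_distrib_right)
  qed
  then have "state_sum (u @ [(i, Cap Down), (i, Cup Down)] @ v) = word_op u (\<lambda>A. quantum_int q n * word_op v (\<lambda>_. 1) A + 0 * 0) []"
    by (intro state_sum_replace[OF xs(2)]) (simp only: word_op_append mult_zero_left add_0_right)
  then show ?thesis unfolding word_op_linear by (simp add: state_sum_def word_op_append)
qed

end

section \<open>Rotation numbers\<close>

text \<open>Records the open arcs above a horizontal line by the directions and names of their ends.
  A new arc is inserted between neighbouring ends and gets the largest name; hence arcs are nested
  with larger names inside, and the left end of arc \<open>x\<close> always has the direction of the
  left leg of its highest cap, \<open>\<tau> x\<close>.\<close>

inductive nested_arcs :: "(nat \<Rightarrow> dir) \<Rightarrow> (dir \<times> nat) list \<Rightarrow> bool" for \<tau> where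
  Nil: "nested_arcs \<tau> []"
| insert: "nested_arcs \<tau> (l @ m) \<Longrightarrow> \<forall>y\<in>snd ` set (l @ m). y < x \<Longrightarrow>
    nested_arcs \<tau> (l @ [(\<tau> x, x), (opp (\<tau> x), x)] @ m)"

definition rename :: "nat \<Rightarrow> nat \<Rightarrow> nat \<Rightarrow> nat" where
  "rename x y k = (if k = max x y then min x y else k)"

lemma map_rename_idem: "(\<And>k. k \<in> snd ` set l \<Longrightarrow> k < max x y) \<Longrightarrow> map (apsnd (rename x y)) l = l"
  by (rule map_idI) (force simp: rename_def)

lemma append_pair_cases:
  assumes "l @ [a, b] @ m = l' @ [c, d] @ m'"
  obtains "l = l'" "a = c" "b = d" "m = m'"
  | "l = l' @ [c]" "a = d" "m' = b # m"
  | "l' = l @ [a]" "c = b" "m = d # m'"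
  | k where "l = l' @ [c, d] @ k" "m' = k @ [a, b] @ m"
  | k where "l' = l @ [a, b] @ k" "m = k @ [c, d] @ m'"
proof -
  from assms consider us where "l = l' @ us" "us @ [a, b] @ m = [c, d] @ m'"
    | us where "l' = l @ us" "[a, b] @ m = us @ [c, d] @ m'"
    unfolding append_eq_append_conv2 by metis
  then show thesis
  proof cases
    case (1 us)
    then show ?thesis using that(1,2,4)
      by (cases us; cases "tl us") auto
  next
    case (2 us)
    then show ?thesis using that(1,3,5)
      by (cases us; cases "tl us") auto
  qed
qed

text \<open>Joining two neighbouring ends either closes an arc or merges two arcs; the inner or
  the lower one of the two arcs loses its name.\<close>

lemma nested_arcs_join:
  assumes "nested_arcs \<tau> (l @ [(d, x), (opp d, y)] @ m)"
  shows "x = y \<Longrightarrow> nested_arcs \<tau> (l @ m) \<and> d = \<tau> x \<and> x \<notin> snd ` set (l @ m)"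
    and "x \<noteq> y \<Longrightarrow> nested_arcs \<tau> (map (apsnd (rename x y)) (l @ m)) \<and> d = opp (\<tau> (max x y)) \<and>
      (x \<in> snd ` set (l @ m) \<or> y \<in> snd ` set (l @ m))"
proof -
  have "(x = y \<longrightarrow> nested_arcs \<tau> (l @ m) \<and> d = \<tau> x \<and> x \<notin> snd ` set (l @ m)) \<and>
    (x \<noteq> y \<longrightarrow> nested_arcs \<tau> (map (apsnd (rename x y)) (l @ m)) \<and> d = opp (\<tau> (max x y)) \<and>
      (x \<in> snd ` set (l @ m) \<or> y \<in> snd ` set (l @ m)))"
    using assms
  proof (induction "l @ [(d, x), (opp d, y)] @ m" arbitrary: l m rule: nested_arcs.induct)
    case Nil
    then show ?case by simp
  next
    case (insert l' m' z)
    have lt: "k < z" if "k \<in> snd ` set l' \<union> snd ` set m'" for k using insert(3) that by auto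
    have ren: "rename x y k < z" if "k < z" "x < z" "y < z" for k using that by (auto simp: rename_def min_def)
    \<comment> \<open>The joined pair and the pair inserted last coincide, overlap in one end, or
      are disjoint. In the disjoint cases the induction hypothesis applies to the rest, and the last
      pair is inserted again.\<close>
    from insert(4) show ?case
    proof (cases rule: append_pair_cases)
      case 1
      then show ?thesis using insert(1) lt by auto
    next
      case 2
      then have *: "x < z" "y = z" "l' = l @ [(d, x)]" "m = (d, z) # m'" "opp d = \<tau> z"
        using lt by auto
      then have mx: "max x y = z" by simp
      have "map (apsnd (rename x y)) l = l" by (rule map_rename_idem, unfold mx, rule lt) (use * in auto)
      moreover have "map (apsnd (rename x y)) m' = m'" by (rule map_rename_idem, unfold mx, rule lt) (use * in auto)
      ultimately have "map (apsnd (rename x y)) (l @ m) = l' @ m'"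
        using * by (simp add: rename_def)
      moreover have "d = opp (\<tau> (max x y))" using * by (metis max.absorb2 nless_le opp_opp)
      ultimately show ?thesis using insert(1) * by auto
    next
      case 3
      then have *: "y < z" "x = z" "m' = (opp d, y) # m" "l = l' @ [(opp d, z)]" "d = opp (\<tau> z)"
        using lt by auto
      then have mx: "max x y = z" by simp
      have "map (apsnd (rename x y)) l' = l'" by (rule map_rename_idem, unfold mx, rule lt) (use * in auto)
      moreover have "map (apsnd (rename x y)) m = m" by (rule map_rename_idem, unfold mx, rule lt) (use * in auto)
      ultimately have "map (apsnd (rename x y)) (l @ m) = l' @ m'"
        using * by (simp add: rename_def)
      moreover have "d = opp (\<tau> (max x y))" using * by (simp add: max_def)
      ultimately show ?thesis using insert(1) * by auto
    next
      case (4 k)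
      have xy: "x < z" "y < z" using lt 4 by auto
      have IH: "x = y \<longrightarrow> nested_arcs \<tau> (l @ k @ m') \<and> d = \<tau> x \<and> x \<notin> snd ` set (l @ k @ m')"
        "x \<noteq> y \<longrightarrow> nested_arcs \<tau> (map (apsnd (rename x y)) (l @ k @ m')) \<and> d = opp (\<tau> (max x y)) \<and>
           (x \<in> snd ` set (l @ k @ m') \<or> y \<in> snd ` set (l @ k @ m'))"
        using insert(2)[of l "k @ m'"] 4 by auto
      have "nested_arcs \<tau> (l @ m)" if "x = y"
        using nested_arcs.insert[of \<tau> "l @ k" m' z] IH(1) that lt 4 by auto
      moreover have "nested_arcs \<tau> (map (apsnd (rename x y)) (l @ m))" if "x \<noteq> y"
      proof -
        have lk: "j < z" if "j \<in> snd ` set (l @ k @ m')" for j using lt that 4 by auto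
        have img: "snd ` set (map (apsnd (rename x y)) (l @ k) @ map (apsnd (rename x y)) m') = rename x y ` snd ` set (l @ k @ m')"
          by (auto simp: image_Un image_image)
        have "nested_arcs \<tau> (map (apsnd (rename x y)) (l @ k) @ [(\<tau> z, z), (opp (\<tau> z), z)] @ map (apsnd (rename x y)) m')"
          by (rule nested_arcs.insert) (use IH(2) that img ren[OF lk xy] in \<open>simp_all\<close>)
        moreover have "rename x y z = z" using xy by (simp add: rename_def)
        ultimately show ?thesis using 4 by simp
      qed
      ultimately show ?thesis using IH 4 xy by auto
    next
      case (5 k)
      have xy: "x < z" "y < z" using lt 5 by auto
      have IH: "x = y \<longrightarrow> nested_arcs \<tau> (l' @ k @ m) \<and> d = \<tau> x \<and> x \<notin> snd ` set (l' @ k @ m)"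
        "x \<noteq> y \<longrightarrow> nested_arcs \<tau> (map (apsnd (rename x y)) (l' @ k @ m)) \<and> d = opp (\<tau> (max x y)) \<and>
           (x \<in> snd ` set (l' @ k @ m) \<or> y \<in> snd ` set (l' @ k @ m))"
        using insert(2)[of "l' @ k" m] 5 by auto
      have "nested_arcs \<tau> (l @ m)" if "x = y"
        using nested_arcs.insert[of \<tau> l' "k @ m" z] IH(1) that lt 5 by auto
      moreover have "nested_arcs \<tau> (map (apsnd (rename x y)) (l @ m))" if "x \<noteq> y"
      proof -
        have lk: "j < z" if "j \<in> snd ` set (l' @ k @ m)" for j using lt that 5 by auto
        have img: "snd ` set (map (apsnd (rename x y)) l' @ map (apsnd (rename x y)) (k @ m)) = rename x y ` snd ` set (l' @ k @ m)"
          by (auto simp: image_Un image_image)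
        have "nested_arcs \<tau> (map (apsnd (rename x y)) l' @ [(\<tau> z, z), (opp (\<tau> z), z)] @ map (apsnd (rename x y)) (k @ m))"
          by (rule nested_arcs.insert) (use IH(2) that img ren[OF lk xy] in \<open>simp_all\<close>)
        moreover have "rename x y z = z" using xy by (simp add: rename_def)
        ultimately show ?thesis using 5 by simp
      qed
      ultimately show ?thesis using IH 5 xy by auto
    qed
  qed
  then show "x = y \<Longrightarrow> nested_arcs \<tau> (l @ m) \<and> d = \<tau> x \<and> x \<notin> snd ` set (l @ m)"
    and "x \<noteq> y \<Longrightarrow> nested_arcs \<tau> (map (apsnd (rename x y)) (l @ m)) \<and> d = opp (\<tau> (max x y)) \<and>
      (x \<in> snd ` set (l @ m) \<or> y \<in> snd ` set (l @ m))" by blast+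
qed

section \<open>Sweeping a diagram of disjoint closed curves\<close>

fun dir_sign :: "dir \<Rightarrow> int" where
  "dir_sign Down = 1"
| "dir_sign Up = - 1"

lemma dir_sign_opp [simp]: "dir_sign (opp d) = - dir_sign d"
  by (cases d) auto

text \<open>One slice of the diagram formed by the strands of a single colour; the last argument
  counts half turns, and \<open>t\<close> is the left leg of a cap in the slice. For a single
  colour, merging and splitting edges look like \<open>pass\<close>.\<close>

inductive slice :: "('v \<Rightarrow> dir) \<Rightarrow> 'v \<Rightarrow> 'v list \<Rightarrow> 'v list \<Rightarrow> ('v \<times> 'v) set \<Rightarrow> int \<Rightarrow> bool" for \<delta> t where
  pass: "map \<delta> a = map \<delta> a' \<Longrightarrow> slice \<delta> t a a' (set (zip a a')) 0"
| cap: "map \<delta> a = map \<delta> a' \<Longrightarrow> map \<delta> b = map \<delta> b' \<Longrightarrow> \<delta> w = opp (\<delta> t) \<Longrightarrow>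
    slice \<delta> t (a @ b) (a' @ [t, w] @ b') (set (zip a a') \<union> set (zip b b') \<union> {(t, w)}) (dir_sign (\<delta> t))"
| cup: "map \<delta> a = map \<delta> a' \<Longrightarrow> map \<delta> b = map \<delta> b' \<Longrightarrow> \<delta> w = opp (\<delta> u) \<Longrightarrow>
    slice \<delta> t (a @ [u, w] @ b) (a' @ b') (set (zip a a') \<union> set (zip b b') \<union> {(u, w)}) (dir_sign (\<delta> u))"

lemma function_override:
  assumes "distinct ys" "length ys = length zs"
  obtains f where "map f ys = zs" "\<And>v. v \<notin> set ys \<Longrightarrow> f v = g v"
proof -
  let ?f = "\<lambda>v. case map_of (zip ys zs) v of Some z \<Rightarrow> z | None \<Rightarrow> g v"
  have "map ?f ys = zs"
    using assms by (intro nth_equalityI) (auto simp: map_of_zip_nth)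
  moreover have "?f v = g v" if "v \<notin> set ys" for v
  proof -
    have "map_of (zip ys zs) v = None" using that assms(2) map_of_zip_is_None[of ys zs v] by simp
    then show ?thesis by simp
  qed
  ultimately show ?thesis using that by blast
qed

lemma map_eq_zip: "map f xs = map g ys \<Longrightarrow> (v, w) \<in> set (zip xs ys) \<Longrightarrow> f v = g w"
  by (metis (no_types, lifting) in_set_zip length_map nth_map prod.sel(1) prod.sel(2))

lemma map_pair_cong:
  "map f xs = map f' ys \<Longrightarrow> map g xs = map g' ys \<Longrightarrow> map (\<lambda>v. (f v, g v)) xs = map (\<lambda>v. (f' v, g' v)) ys"
proof (induction xs arbitrary: ys)
  case (Cons x xs)
  then show ?case by (cases ys) auto
qed simp

definition sym_rtrancl :: "('v \<times> 'v) set \<Rightarrow> ('v \<times> 'v) set" where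
  "sym_rtrancl E = (E \<union> E\<inverse>)\<^sup>*"

lemma sym_rtrancl_simps:
  "(v, v) \<in> sym_rtrancl E"
  "(v, w) \<in> E \<Longrightarrow> (v, w) \<in> sym_rtrancl E"
  "(v, w) \<in> sym_rtrancl E \<Longrightarrow> (w, v) \<in> sym_rtrancl E"
  "(u, v) \<in> sym_rtrancl E \<Longrightarrow> (v, w) \<in> sym_rtrancl E \<Longrightarrow> (u, w) \<in> sym_rtrancl E"
  unfolding sym_rtrancl_def
  by (auto intro: rtrancl_trans) (metis converse_Un converse_converse rtrancl_converseI sup_commute)

lemma sym_rtrancl_mono: "E \<subseteq> F \<Longrightarrow> sym_rtrancl E \<subseteq> sym_rtrancl F"
  unfolding sym_rtrancl_def by (intro rtrancl_mono) auto

lemma sym_rtrancl_invariant: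
  "(v, w) \<in> sym_rtrancl E \<Longrightarrow> (\<And>v w. (v, w) \<in> E \<Longrightarrow> f v = f w) \<Longrightarrow> f v = f w"
  unfolding sym_rtrancl_def by (induction rule: rtrancl_induct) auto

text \<open>\<open>vs k\<close> lists the vertices on line \<open>k\<close> from left to right, and
  \<open>top k\<close> is the left leg of a cap just above that line.\<close>

locale arc_diagram =
  fixes \<delta> :: "'v \<Rightarrow> dir" and top :: "nat \<Rightarrow> 'v" and vs :: "nat \<Rightarrow> 'v list" and E :: "nat \<Rightarrow> ('v \<times> 'v) set"
    and sg :: "nat \<Rightarrow> int" and lvl pos :: "'v \<Rightarrow> nat" and N :: nat
  assumes start: "vs 0 = []"
    and slices: "k < N \<Longrightarrow> slice \<delta> (top (Suc k)) (vs k) (vs (Suc k)) (E k) (sg k)"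
    and lvl: "v \<in> set (vs k) \<Longrightarrow> lvl v = k"
    and pos: "sorted_wrt (\<lambda>u v. pos u < pos v) (vs k)"
begin

lemma distinct_vs: "distinct (vs k)"
proof -
  have "sorted_wrt (<) (map pos (vs k))" using pos by (simp add: sorted_wrt_map)
  then show ?thesis by (simp add: strict_sorted_iff distinct_map)
qed

definition vertices :: "nat \<Rightarrow> 'v set" where
  "vertices m = (\<Union>k\<le>m. set (vs k))"

definition edges :: "nat \<Rightarrow> ('v \<times> 'v) set" where
  "edges m = (\<Union>k<m. E k)"

text \<open>The invariant of the sweep after \<open>m\<close> slices. Its last clause counts half
  turns: an open arc keeps one, with the sign of its highest cap, a closed curve keeps two, and all
  others have cancelled.\<close>

definition named :: "nat \<Rightarrow> ('v \<Rightarrow> nat) \<Rightarrow> bool" where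
  "named m \<iota> \<longleftrightarrow>
     (\<forall>(v, w)\<in>edges m. \<iota> v = \<iota> w) \<and>
     (\<forall>v\<in>vertices m. (v, top (\<iota> v)) \<in> sym_rtrancl (edges m) \<and> \<iota> v \<le> lvl v \<and>
        top (\<iota> v) \<in> set (vs (\<iota> v)) \<and> (\<iota> v = lvl v \<longrightarrow> pos (top (\<iota> v)) \<le> pos v)) \<and>
     nested_arcs (\<lambda>x. \<delta> (top x)) (map (\<lambda>v. (\<delta> v, \<iota> v)) (vs m)) \<and>
     (\<Sum>k<m. sg k) = (\<Sum>x\<in>\<iota> ` vertices m. (if x \<in> \<iota> ` set (vs m) then 1 else 2) * dir_sign (\<delta> (top x)))"

lemma vertices_Suc: "vertices (Suc m) = vertices m \<union> set (vs (Suc m))"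
  by (auto simp: vertices_def le_Suc_eq)

lemma edges_Suc: "edges (Suc m) = edges m \<union> E m"
  by (auto simp: edges_def less_Suc_eq)

lemma vs_subset_vertices: "set (vs m) \<subseteq> vertices m"
  by (auto simp: vertices_def)

lemma lvl_vertices: "v \<in> vertices m \<Longrightarrow> lvl v \<le> m"
  by (auto simp: vertices_def lvl)

lemma finite_vertices: "finite (vertices m)"
  by (simp add: vertices_def)

lemma new_not_old: "v \<in> set (vs (Suc m)) \<Longrightarrow> v \<notin> vertices m"
  using lvl_vertices[of v m] lvl[of v "Suc m"] by auto

lemma slice_edges:
  assumes "slice \<delta> t a b F s" "(v, w) \<in> F"
  shows "v \<in> set a \<union> set b" "w \<in> set a \<union> set b"
  using assms by (auto elim!: slice.cases dest: set_zip_leftD set_zip_rightD)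

lemma edges_in_vertices: "m \<le> N \<Longrightarrow> (v, w) \<in> edges m \<Longrightarrow> v \<in> vertices m \<and> w \<in> vertices m"
proof -
  assume "m \<le> N" "(v, w) \<in> edges m"
  then obtain k where k: "k < m" "(v, w) \<in> E k" "k < N" by (auto simp: edges_def)
  with slice_edges[OF slices[of k] k(2)] show ?thesis by (fastforce simp: vertices_def)
qed

text \<open>The common part of the three kinds of slices: \<rho> renames the old names and
  \<open>f\<close> is the new naming.\<close>

lemma named_step:
  assumes \<iota>: "named m \<iota>" and m: "m < N"
    and old: "\<And>v. v \<in> vertices m \<Longrightarrow> f v = \<rho> (\<iota> v)"
    and \<rho>: "\<And>x. \<rho> x \<le> x" "\<And>x. x \<in> \<iota> ` vertices m \<Longrightarrow> \<rho> x \<in> \<iota> ` vertices m"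
      "\<And>x. x \<in> \<iota> ` vertices m \<Longrightarrow> (top x, top (\<rho> x)) \<in> sym_rtrancl (edges (Suc m))"
    and edge: "\<And>v w. (v, w) \<in> E m \<Longrightarrow> f v = f w"
    and new: "\<And>v. v \<in> set (vs (Suc m)) \<Longrightarrow> (\<exists>u\<in>set (vs m). (u, v) \<in> E m) \<or>
      f v = Suc m \<and> top (Suc m) \<in> set (vs (Suc m)) \<and> (v = top (Suc m) \<or> (top (Suc m), v) \<in> E m) \<and> pos (top (Suc m)) \<le> pos v"
    and nested: "nested_arcs (\<lambda>x. \<delta> (top x)) (map (\<lambda>v. (\<delta> v, f v)) (vs (Suc m)))"
    and sum: "(\<Sum>x\<in>\<iota> ` vertices m. (if x \<in> \<iota> ` set (vs m) then 1 else 2) * dir_sign (\<delta> (top x))) + sg m =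
      (\<Sum>x\<in>f ` vertices (Suc m). (if x \<in> f ` set (vs (Suc m)) then 1 else 2) * dir_sign (\<delta> (top x)))"
  shows "named (Suc m) f"
proof -
  note inv = \<iota>[unfolded named_def]
  have sub: "sym_rtrancl (edges m) \<subseteq> sym_rtrancl (edges (Suc m))" "E m \<subseteq> sym_rtrancl (edges (Suc m))"
    by (rule sym_rtrancl_mono) (auto simp: edges_Suc intro: sym_rtrancl_simps(2))
  have top\<rho>: "(v, top (\<rho> (\<iota> v))) \<in> sym_rtrancl (edges (Suc m))" "top (\<rho> (\<iota> v)) \<in> set (vs (\<rho> (\<iota> v)))"
    if v: "v \<in> vertices m" for v
  proof -
    have "(v, top (\<iota> v)) \<in> sym_rtrancl (edges (Suc m))" using inv v sub(1) by blast
    with \<rho>(3)[of "\<iota> v"] v show "(v, top (\<rho> (\<iota> v))) \<in> sym_rtrancl (edges (Suc m))"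
      by (blast intro: sym_rtrancl_simps(4))
    obtain u where "u \<in> vertices m" "\<rho> (\<iota> v) = \<iota> u" using \<rho>(2)[of "\<iota> v"] v by blast
    then show "top (\<rho> (\<iota> v)) \<in> set (vs (\<rho> (\<iota> v)))" using inv by auto
  qed
  have "\<forall>(v, w)\<in>edges (Suc m). f v = f w"
    using inv edge old edges_in_vertices[of m] m unfolding edges_Suc by fastforce
  moreover have "(v, top (f v)) \<in> sym_rtrancl (edges (Suc m)) \<and> f v \<le> lvl v \<and>
      top (f v) \<in> set (vs (f v)) \<and> (f v = lvl v \<longrightarrow> pos (top (f v)) \<le> pos v)" if v: "v \<in> vertices (Suc m)" for v
  proof (cases "v \<in> vertices m")
    case True
    then have "\<iota> v \<le> lvl v" "\<iota> v = lvl v \<longrightarrow> pos (top (\<iota> v)) \<le> pos v" using inv by auto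
    moreover have "f v = \<rho> (\<iota> v)" "\<rho> (\<iota> v) \<le> \<iota> v" using old True \<rho>(1) by auto
    ultimately show ?thesis using top\<rho>[OF True] by auto
  next
    case False
    then have v': "v \<in> set (vs (Suc m))" using v by (simp add: vertices_Suc)
    from new[OF v'] show ?thesis
    proof
      assume "\<exists>u\<in>set (vs m). (u, v) \<in> E m"
      then obtain u where u: "u \<in> vertices m" "(u, v) \<in> E m" using vs_subset_vertices by blast
      then have fv: "f v = \<rho> (\<iota> u)" using edge old by metis
      have "\<iota> u \<le> lvl u" using inv u by auto
      then have "f v \<le> m" using fv \<rho>(1)[of "\<iota> u"] lvl_vertices[OF u(1)] by linarith
      moreover have "(v, top (\<rho> (\<iota> u))) \<in> sym_rtrancl (edges (Suc m))"
        using top\<rho>(1)[OF u(1)] u(2) sub(2) by (blast intro: sym_rtrancl_simps)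
      ultimately show ?thesis using top\<rho>(2)[OF u(1)] fv lvl[OF v'] by auto
    next
      assume *: "f v = Suc m \<and> top (Suc m) \<in> set (vs (Suc m)) \<and> (v = top (Suc m) \<or> (top (Suc m), v) \<in> E m) \<and> pos (top (Suc m)) \<le> pos v"
      then have "(v, top (Suc m)) \<in> sym_rtrancl (edges (Suc m))"
        using sub(2) by (blast intro: sym_rtrancl_simps)
      with * lvl[OF v'] show ?thesis by auto
    qed
  qed
  moreover have "(\<Sum>k<Suc m. sg k) = (\<Sum>x\<in>f ` vertices (Suc m). (if x \<in> f ` set (vs (Suc m)) then 1 else 2) * dir_sign (\<delta> (top x)))"
    using inv sum by simp
  ultimately show ?thesis using nested unfolding named_def by blast
qed

lemma zip_new:
  assumes "length a = length a'" "v \<in> set a'"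
  shows "\<exists>u\<in>set a. (u, v) \<in> set (zip a a')"
proof -
  obtain i where "i < length a'" "v = a' ! i" using assms(2) by (metis in_set_conv_nth)
  then show ?thesis using assms(1) by (intro bexI[of _ "a ! i"]) (auto simp: in_set_zip)
qed

text \<open>Names are inherited through the slice; a cap receives the number of its line as a fresh
  name, and at a cup two names are identified.\<close>

lemma ex_named: "m \<le> N \<Longrightarrow> \<exists>\<iota>. named m \<iota>"
proof (induction m)
  case 0
  then show ?case by (simp add: named_def edges_def vertices_def start nested_arcs.Nil)
next
  case (Suc m)
  then obtain \<iota> where \<iota>: "named m \<iota>" and m: "m < N" by auto
  note inv = \<iota>[unfolded named_def]
  have sl: "slice \<delta> (top (Suc m)) (vs m) (vs (Suc m)) (E m) (sg m)" using slices m by simp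
  have not_new: "v \<notin> set (vs (Suc m))" if "v \<in> vertices m" for v using new_not_old that by blast
  have le: "\<iota> v \<le> m" if "v \<in> vertices m" for v using inv lvl_vertices[OF that] that by fastforce
  have vsub: "set (vs m) \<subseteq> vertices m" by (rule vs_subset_vertices)
  from sl show ?case
  proof cases
    case pass
    then have len: "length (vs (Suc m)) = length (vs m)" by (metis map_eq_imp_length_eq)
    obtain f where f: "map f (vs (Suc m)) = map \<iota> (vs m)" "\<And>v. v \<notin> set (vs (Suc m)) \<Longrightarrow> f v = \<iota> v"
      using function_override[OF distinct_vs[of "Suc m"], of "map \<iota> (vs m)" \<iota>] len by auto
    have img: "f ` set (vs (Suc m)) = \<iota> ` set (vs m)" using f(1) by (metis list.set_map)
    have fold: "f v = \<iota> v" if "v \<in> vertices m" for v using f(2) not_new that by simp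
    have img': "f ` vertices (Suc m) = \<iota> ` vertices m"
      using img vsub fold unfolding vertices_Suc by (auto simp: image_Un)
    have "named (Suc m) f"
    proof (rule named_step[OF \<iota> m, where \<rho> = id])
      show "f v = f w" if "(v, w) \<in> E m" for v w
      proof -
        have "v \<in> set (vs m)" using that pass(1) by (auto dest: set_zip_leftD)
        moreover have "\<iota> v = f w" using map_eq_zip[of \<iota> "vs m" f "vs (Suc m)"] f(1) that pass(1) by simp
        ultimately show ?thesis using fold vsub by auto
      qed
      show "(\<exists>u\<in>set (vs m). (u, v) \<in> E m) \<or> f v = Suc m \<and> top (Suc m) \<in> set (vs (Suc m)) \<and>
          (v = top (Suc m) \<or> (top (Suc m), v) \<in> E m) \<and> pos (top (Suc m)) \<le> pos v" if "v \<in> set (vs (Suc m))" for v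
        using zip_new[of "vs m" "vs (Suc m)" v] that len pass by simp
      have "map (\<lambda>v. (\<delta> v, f v)) (vs (Suc m)) = map (\<lambda>v. (\<delta> v, \<iota> v)) (vs m)"
        using map_pair_cong[OF pass(3)[symmetric] f(1)] .
      then show "nested_arcs (\<lambda>x. \<delta> (top x)) (map (\<lambda>v. (\<delta> v, f v)) (vs (Suc m)))" using inv by simp
    qed (use fold img img' pass in \<open>auto intro: sym_rtrancl_simps\<close>)
    then show ?thesis by blast
  next
    case (cap a a' b b' w)
    let ?t = "top (Suc m)"
    have lens: "length a = length a'" "length b = length b'" using cap by (metis map_eq_imp_length_eq)+
    obtain f where f: "map f (vs (Suc m)) = map \<iota> a @ [Suc m, Suc m] @ map \<iota> b" "\<And>v. v \<notin> set (vs (Suc m)) \<Longrightarrow> f v = \<iota> v"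
      using function_override[OF distinct_vs[of "Suc m"], of "map \<iota> a @ [Suc m, Suc m] @ map \<iota> b" \<iota>] lens cap(2) by auto
    have f': "map f a' = map \<iota> a" "map f b' = map \<iota> b" "f ?t = Suc m" "f w = Suc m"
      using f(1) lens cap(2) by auto
    have img: "f ` set (vs (Suc m)) = insert (Suc m) (\<iota> ` set (vs m))"
    proof -
      have "f ` set (vs (Suc m)) = set (map f (vs (Suc m)))" by simp
      also have "\<dots> = insert (Suc m) (\<iota> ` set (vs m))" unfolding f(1) cap(1) by auto
      finally show ?thesis .
    qed
    have fold: "f v = \<iota> v" if "v \<in> vertices m" for v using f(2) not_new that by simp
    have img': "f ` vertices (Suc m) = insert (Suc m) (\<iota> ` vertices m)"
      using img vsub fold unfolding vertices_Suc by (auto simp: image_Un)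
    have srt: "sorted_wrt (\<lambda>u v. pos u < pos v) (a' @ [?t, w] @ b')" using pos[of "Suc m"] cap(2) by simp
    have "named (Suc m) f"
    proof (rule named_step[OF \<iota> m, where \<rho> = id])
      show "f v = f w" if "(v, w) \<in> E m" for v w
      proof -
        have "v \<in> set a \<and> (v, w) \<in> set (zip a a') \<or> v \<in> set b \<and> (v, w) \<in> set (zip b b') \<or> f v = f w"
          using that f' unfolding cap(3) by (auto dest: set_zip_leftD)
        moreover have "f v = f w" if "v \<in> set a" "(v, w) \<in> set (zip a a')"
          using map_eq_zip[OF f'(1)[symmetric] that(2)] that(1) fold[of v] vsub cap(1) by auto
        moreover have "f v = f w" if "v \<in> set b" "(v, w) \<in> set (zip b b')"
          using map_eq_zip[OF f'(2)[symmetric] that(2)] that(1) fold[of v] vsub cap(1) by auto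
        ultimately show ?thesis by blast
      qed
      show "(\<exists>u\<in>set (vs m). (u, v) \<in> E m) \<or> f v = Suc m \<and> ?t \<in> set (vs (Suc m)) \<and>
          (v = ?t \<or> (?t, v) \<in> E m) \<and> pos ?t \<le> pos v" if "v \<in> set (vs (Suc m))" for v
        using zip_new[OF lens(1), of v] zip_new[OF lens(2), of v] that f' srt
        unfolding cap(1,2,3) by (auto simp: sorted_wrt_append)
      have "map (\<lambda>v. (\<delta> v, f v)) (vs (Suc m)) =
         map (\<lambda>v. (\<delta> v, \<iota> v)) a @ [(\<delta> ?t, Suc m), (opp (\<delta> ?t), Suc m)] @ map (\<lambda>v. (\<delta> v, \<iota> v)) b"
        using map_pair_cong[OF cap(5)[symmetric] f'(1)] map_pair_cong[OF cap(6)[symmetric] f'(2)] f'(3,4) cap(7)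
        unfolding cap(2) by simp
      moreover have "nested_arcs (\<lambda>x. \<delta> (top x)) (map (\<lambda>v. (\<delta> v, \<iota> v)) a @ [(\<delta> ?t, Suc m), (opp (\<delta> ?t), Suc m)] @ map (\<lambda>v. (\<delta> v, \<iota> v)) b)"
        by (rule nested_arcs.insert) (use inv le vsub cap(1) in \<open>fastforce simp: less_Suc_eq_le\<close>)+
      ultimately show "nested_arcs (\<lambda>x. \<delta> (top x)) (map (\<lambda>v. (\<delta> v, f v)) (vs (Suc m)))" by simp
      have notin: "Suc m \<notin> \<iota> ` vertices m" using le by fastforce
      show "(\<Sum>x\<in>\<iota> ` vertices m. (if x \<in> \<iota> ` set (vs m) then 1 else 2) * dir_sign (\<delta> (top x))) + sg m =
        (\<Sum>x\<in>f ` vertices (Suc m). (if x \<in> f ` set (vs (Suc m)) then 1 else 2) * dir_sign (\<delta> (top x)))"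
        unfolding img img' using notin finite_vertices[of m] cap(4)
        by (subst sum.insert) (auto intro!: sum.cong dest: le)
    qed (use fold in \<open>auto intro: sym_rtrancl_simps\<close>)
    then show ?thesis by blast
  next
    case (cup a a' b b' w u)
    have lens: "length a = length a'" "length b = length b'" using cup by (metis map_eq_imp_length_eq)+
    \<comment> \<open>The names of the two ends joined by the cup; the cup closes a curve if they
      agree and merges two arcs otherwise.\<close>
    define x y where "x = \<iota> u" and "y = \<iota> w"
    define \<rho> where "\<rho> = (if x = y then id else rename x y)"
    have uw: "u \<in> vertices m" "w \<in> vertices m" using vsub cup(1) by auto
    have xy: "x \<in> \<iota> ` vertices m" "y \<in> \<iota> ` vertices m" using uw x_def y_def by auto
    have ab: "set a \<subseteq> vertices m" "set b \<subseteq> vertices m" using vsub cup(1) by auto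
    let ?F = "\<lambda>v. (\<delta> v, \<iota> v)"
    have nest: "nested_arcs (\<lambda>x. \<delta> (top x)) (map ?F a @ [(\<delta> u, x), (opp (\<delta> u), y)] @ map ?F b)"
      using inv cup(1,7) by (simp add: x_def y_def)
    obtain f0 where f0: "map f0 (vs (Suc m)) = map (\<rho> \<circ> \<iota>) (a @ b)" "\<And>v. v \<notin> set (vs (Suc m)) \<Longrightarrow> f0 v = (\<rho> \<circ> \<iota>) v"
      using function_override[OF distinct_vs[of "Suc m"], of "map (\<rho> \<circ> \<iota>) (a @ b)" "\<rho> \<circ> \<iota>"] lens cup(2) by auto
    define f where "f = f0"
    have f: "map f (vs (Suc m)) = map (\<rho> \<circ> \<iota>) (a @ b)" using f0 f_def by simp
    have f': "map f a' = map (\<rho> \<circ> \<iota>) a" "map f b' = map (\<rho> \<circ> \<iota>) b"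
      using f lens cup(2) by auto
    have fold: "f v = \<rho> (\<iota> v)" if "v \<in> vertices m" for v using f0(2) not_new that by (simp add: f_def)
    have img: "f ` set (vs (Suc m)) = \<rho> ` \<iota> ` (set a \<union> set b)"
    proof -
      have "f ` set (vs (Suc m)) = set (map f (vs (Suc m)))" by simp
      also have "\<dots> = \<rho> ` \<iota> ` (set a \<union> set b)" unfolding f by auto
      finally show ?thesis .
    qed
    have img': "f ` vertices (Suc m) = \<rho> ` \<iota> ` vertices m"
      using img ab fold unfolding vertices_Suc by (auto simp: image_Un)
    have sn: "snd ` set (map ?F a @ map ?F b) = \<iota> ` (set a \<union> set b)"
      by (simp add: image_Un image_image)
    have \<rho>xy: "\<rho> x = \<rho> y" by (auto simp: \<rho>_def rename_def min_def max_def)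
    have conn: "(top x, top y) \<in> sym_rtrancl (edges (Suc m))"
    proof -
      have "(u, top x) \<in> sym_rtrancl (edges m)" "(w, top y) \<in> sym_rtrancl (edges m)" using inv uw x_def y_def by auto
      moreover have "sym_rtrancl (edges m) \<subseteq> sym_rtrancl (edges (Suc m))" by (rule sym_rtrancl_mono) (auto simp: edges_Suc)
      moreover have "(u, w) \<in> sym_rtrancl (edges (Suc m))" by (rule sym_rtrancl_simps(2)) (simp add: edges_Suc cup(3))
      ultimately show ?thesis by (meson subsetD sym_rtrancl_simps(3,4))
    qed
    have "named (Suc m) f"
    proof (rule named_step[OF \<iota> m, where \<rho> = \<rho>])
      show "\<rho> k \<le> k" for k by (auto simp: \<rho>_def rename_def min_def)
      show "\<rho> k \<in> \<iota> ` vertices m" if "k \<in> \<iota> ` vertices m" for k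
        using that xy by (auto simp: \<rho>_def rename_def min_def)
      show "(top k, top (\<rho> k)) \<in> sym_rtrancl (edges (Suc m))" if "k \<in> \<iota> ` vertices m" for k
        using conn sym_rtrancl_simps(3)[OF conn] by (auto simp: \<rho>_def rename_def min_def max_def sym_rtrancl_simps(1))
      show "f v = f v'" if "(v, v') \<in> E m" for v v'
      proof -
        have "v \<in> set a \<and> (v, v') \<in> set (zip a a') \<or> v \<in> set b \<and> (v, v') \<in> set (zip b b') \<or> f v = f v'"
          using that fold[OF uw(1)] fold[OF uw(2)] \<rho>xy unfolding cup(3) x_def y_def by (auto dest: set_zip_leftD)
        moreover have "f v = f v'" if "v \<in> set a" "(v, v') \<in> set (zip a a')"
          using map_eq_zip[OF f'(1)[symmetric] that(2)] that(1) fold[of v] ab by auto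
        moreover have "f v = f v'" if "v \<in> set b" "(v, v') \<in> set (zip b b')"
          using map_eq_zip[OF f'(2)[symmetric] that(2)] that(1) fold[of v] ab by auto
        ultimately show ?thesis by blast
      qed
      show "(\<exists>u\<in>set (vs m). (u, v) \<in> E m) \<or> f v = Suc m \<and> top (Suc m) \<in> set (vs (Suc m)) \<and>
          (v = top (Suc m) \<or> (top (Suc m), v) \<in> E m) \<and> pos (top (Suc m)) \<le> pos v" if "v \<in> set (vs (Suc m))" for v
        using zip_new[OF lens(1), of v] zip_new[OF lens(2), of v] that
        unfolding cup(1,2,3) by auto
      have l: "map (\<lambda>v. (\<delta> v, f v)) (vs (Suc m)) = map (apsnd \<rho>) (map ?F a @ map ?F b)"
        using map_pair_cong[OF cup(5)[symmetric] f'(1)] map_pair_cong[OF cup(6)[symmetric] f'(2)]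
        unfolding cup(2) by simp
      show "nested_arcs (\<lambda>x. \<delta> (top x)) (map (\<lambda>v. (\<delta> v, f v)) (vs (Suc m)))"
        unfolding l using nested_arcs_join[OF nest] by (cases "x = y") (simp_all add: \<rho>_def)
      show "(\<Sum>x\<in>\<iota> ` vertices m. (if x \<in> \<iota> ` set (vs m) then 1 else 2) * dir_sign (\<delta> (top x))) + sg m =
        (\<Sum>x\<in>f ` vertices (Suc m). (if x \<in> f ` set (vs (Suc m)) then 1 else 2) * dir_sign (\<delta> (top x)))"
      \<comment> \<open>If the names agree, the cup is the second half turn of a closed curve.
        Otherwise it cancels the half turn of the arc that loses its name.\<close>
      proof (cases "x = y")
        case True
        have x: "\<delta> u = \<delta> (top x)" "x \<notin> \<iota> ` (set a \<union> set b)"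
          using nested_arcs_join(1)[OF nest True] sn by simp_all
        have o: "\<iota> ` set (vs m) = insert x (\<iota> ` (set a \<union> set b))" "f ` set (vs (Suc m)) = \<iota> ` (set a \<union> set b)"
          "f ` vertices (Suc m) = \<iota> ` vertices m"
          using True img img' by (auto simp: cup(1) \<rho>_def x_def y_def)
        show ?thesis unfolding o cup(4) x(1)
          using finite_vertices[of m] xy(1) x(2) by (subst (1 2) sum.remove[of _ x]) (auto intro!: sum.cong)
      next
        case False
        let ?M = "max x y" and ?L = "\<iota> ` vertices m" and ?O = "\<iota> ` (set a \<union> set b)"
        have x: "\<delta> u = opp (\<delta> (top ?M))" "x \<in> ?O \<or> y \<in> ?O"
          using nested_arcs_join(2)[OF nest False] sn by simp_all
        have M: "?M \<in> ?L" "min x y \<in> ?L" "min x y \<noteq> ?M" using xy False by (auto simp: max_def min_def)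
        have r: "\<rho> = rename x y" using False by (simp add: \<rho>_def)
        have o: "\<iota> ` set (vs m) = insert x (insert y ?O)"
          by (auto simp: cup(1) x_def y_def)
        have i1: "f ` vertices (Suc m) = ?L - {?M}"
          unfolding img' r using M by (auto simp: rename_def image_iff) 
        have i2: "f ` set (vs (Suc m)) = insert x (insert y ?O) - {?M}"
          unfolding img r using x(2) False by (auto simp: rename_def image_iff max_def min_def split: if_splits)
        have "?M \<in> insert x (insert y ?O)" by (auto simp: max_def)
        then show ?thesis unfolding o i1 i2 cup(4) x(1)
          using finite_vertices[of m] M(1) by (subst sum.remove[of _ ?M]) (auto intro!: sum.cong)
      qed
    qed (use fold in auto)
    then show ?thesis by blast
  qed
qed

text \<open>
  Every cap and cup of a closed diagram of disjoint arcs contributes half a turn; the name of a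
  curve is the level of its highest cap.
\<close>

theorem sum_curves:
  fixes rc :: "'v set \<Rightarrow> int"
  assumes "vs N = []"
    and rc: "\<And>C v. C \<subseteq> vertices N \<Longrightarrow> v \<in> C \<Longrightarrow>
      (\<And>w. w \<in> C \<Longrightarrow> lvl v \<le> lvl w \<and> (lvl w = lvl v \<longrightarrow> pos v \<le> pos w)) \<Longrightarrow> rc C = dir_sign (\<delta> v)"
  shows "2 * (\<Sum>C\<in>vertices N // sym_rtrancl (edges N). rc C) = (\<Sum>k<N. sg k)"
proof -
  obtain \<iota> where \<iota>: "named N \<iota>" using ex_named by blast
  note inv = \<iota>[unfolded named_def]
  let ?V = "vertices N" and ?R = "sym_rtrancl (edges N)"
  \<comment> \<open>Names correspond to curves: each vertex is connected to the top of its name, and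
    names are constant along edges.\<close>
  define cls where "cls = (\<lambda>x. {w \<in> ?V. \<iota> w = x})"
  have inV: "w \<in> ?V" if "(v, w) \<in> ?R" "v \<in> ?V" for v w
    using that unfolding sym_rtrancl_def
    by (induction rule: rtrancl_induct) (auto dest: edges_in_vertices[OF order_refl])
  have eq: "\<iota> v = \<iota> w" if "(v, w) \<in> ?R" for v w
    using sym_rtrancl_invariant[OF that, of \<iota>] inv by auto
  have cl: "?R `` {v} = cls (\<iota> v)" if v: "v \<in> ?V" for v
  proof (intro equalityI subsetI)
    fix w assume "w \<in> ?R `` {v}"
    then show "w \<in> cls (\<iota> v)" using inV[OF _ v] eq by (auto simp: cls_def)
  next
    fix w assume "w \<in> cls (\<iota> v)"
    then have w: "w \<in> ?V" "\<iota> w = \<iota> v" by (auto simp: cls_def)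
    have "(v, top (\<iota> v)) \<in> ?R" "(w, top (\<iota> w)) \<in> ?R" using inv v w(1) by auto
    then show "w \<in> ?R `` {v}" using w(2) by (auto intro: sym_rtrancl_simps)
  qed
  have quot: "?V // ?R = cls ` \<iota> ` ?V"
    using cl by (auto simp: quotient_def)
  have inj: "inj_on cls (\<iota> ` ?V)" by (rule inj_onI) (auto simp: cls_def)
  have "rc (cls x) = dir_sign (\<delta> (top x))" if x: "x \<in> \<iota> ` ?V" for x
  proof -
    obtain v where v: "v \<in> ?V" "x = \<iota> v" using x by blast
    then have t: "(v, top x) \<in> ?R" "top x \<in> set (vs x)" using inv by auto
    then have "top x \<in> cls x" using cl[OF v(1)] v(2) by blast
    moreover have "lvl (top x) \<le> lvl w \<and> (lvl w = lvl (top x) \<longrightarrow> pos (top x) \<le> pos w)" if "w \<in> cls x" for w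
      using inv that lvl[OF t(2)] by (auto simp: cls_def)
    moreover have "cls x \<subseteq> ?V" by (auto simp: cls_def)
    ultimately show ?thesis using rc[of "cls x" "top x"] by blast
  qed
  then have "(\<Sum>C\<in>?V // ?R. rc C) = (\<Sum>x\<in>\<iota> ` ?V. dir_sign (\<delta> (top x)))"
    unfolding quot by (subst sum.reindex[OF inj]) (auto intro!: sum.cong)
  then show ?thesis using inv assms(1) by (simp add: sum_distrib_left)
qed

end

lemma closes_levels:
  assumes "closes U L xs w"
  shows "length (levels U L xs w) = Suc (length w)" "levels U L xs w ! 0 = xs"
    "levels U L xs w ! length w = []"
    "k < length w \<Longrightarrow> \<exists>P Q. length P = fst (w ! k) \<and>
       levels U L xs w ! k = P @ U (snd (w ! k)) @ Q \<and> levels U L xs w ! Suc k = P @ L (snd (w ! k)) @ Q"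
proof -
  have "length (levels U L xs w) = Suc (length w) \<and> levels U L xs w ! 0 = xs \<and> levels U L xs w ! length w = [] \<and>
    (\<forall>k<length w. \<exists>P Q. length P = fst (w ! k) \<and>
       levels U L xs w ! k = P @ U (snd (w ! k)) @ Q \<and> levels U L xs w ! Suc k = P @ L (snd (w ! k)) @ Q)"
    using assms
  proof (induction U L xs w rule: closes.induct)
    case (2 U L xs i p w)
    let ?ys = "replace_at i (length (U p)) (L p) xs"
    have IH: "length (levels U L ?ys w) = Suc (length w)" "levels U L ?ys w ! 0 = ?ys" "levels U L ?ys w ! length w = []"
      "\<forall>k<length w. \<exists>P Q. length P = fst (w ! k) \<and>
       levels U L ?ys w ! k = P @ U (snd (w ! k)) @ Q \<and> levels U L ?ys w ! Suc k = P @ L (snd (w ! k)) @ Q"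
      using 2 by auto
    have i: "i + length (U p) \<le> length xs" "take (length (U p)) (drop i xs) = U p" using 2 by auto
    have "xs = take i xs @ U p @ drop (i + length (U p)) xs"
      by (metis append_take_drop_id i(2) drop_drop add.commute)
    then have 0: "\<exists>P Q. length P = i \<and> xs = P @ U p @ Q \<and> ?ys = P @ L p @ Q"
      using i(1) by (intro exI[of _ "take i xs"] exI[of _ "drop (i + length (U p)) xs"]) (auto simp: replace_at_def)
    show ?case
    proof (intro conjI allI impI)
      fix k assume k: "k < length ((i, p) # w)"
      show "\<exists>P Q. length P = fst (((i, p) # w) ! k) \<and> levels U L xs ((i, p) # w) ! k = P @ U (snd (((i, p) # w) ! k)) @ Q \<and>
        levels U L xs ((i, p) # w) ! Suc k = P @ L (snd (((i, p) # w) ! k)) @ Q"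
      proof (cases k)
        case 0
        then show ?thesis using \<open>\<exists>P Q. length P = i \<and> xs = P @ U p @ Q \<and> ?ys = P @ L p @ Q\<close> IH(2) by simp
      next
        case (Suc j)
        then show ?thesis using IH(4) k by simp
      qed
    qed (use IH in auto)
  qed auto
  then show "length (levels U L xs w) = Suc (length w)" "levels U L xs w ! 0 = xs"
    "levels U L xs w ! length w = []"
    "k < length w \<Longrightarrow> \<exists>P Q. length P = fst (w ! k) \<and>
       levels U L xs w ! k = P @ U (snd (w ! k)) @ Q \<and> levels U L xs w ! Suc k = P @ L (snd (w ! k)) @ Q"
    by auto
qed

section \<open>The Murakami--Ohtsuki--Yamada bracket as a state sum\<close>

definition color_positions :: "nat \<Rightarrow> nat set list \<Rightarrow> nat list" where
  "color_positions c A = filter (\<lambda>j. c \<in> A ! j) [0..<length A]"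

lemma set_color_positions: "set (color_positions c A) = {j. j < length A \<and> c \<in> A ! j}"
  by (auto simp: color_positions_def)

lemma color_positions_append:
  "color_positions c (A @ B) = color_positions c A @ map ((+) (length A)) (color_positions c B)"
proof -
  have "[0..<length (A @ B)] = [0..<length A] @ map ((+) (length A)) [0..<length B]"
    using map_add_upt[of "length A" "length B"] upt_add_eq_append[of 0 "length A" "length B"]
    by (simp add: add.commute[of "length B"] add.commute[of _ "length A"] comp_def)
  then show ?thesis
    unfolding color_positions_def by (auto simp: filter_map comp_def nth_append intro!: filter_cong arg_cong2[of _ _ _ _ "(@)"])
qed

lemma color_positions_Nil [simp]: "color_positions c [] = []"
  by (simp add: color_positions_def)

lemma color_positions_single: "color_positions c [s] = (if c \<in> s then [0] else [])"
  by (simp add: color_positions_def)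

lemma color_positions_pair:
  "color_positions c [s, s'] = (if c \<in> s then [0] else []) @ (if c \<in> s' then [1] else [])"
  using color_positions_append[of c "[s]" "[s']"] by (simp add: color_positions_single)

text \<open>Half turns of the curve with label \<open>c\<close>. Merging and splitting contribute
  none, since all edges at a vertex run downwards.\<close>

fun piece_sign :: "nat \<Rightarrow> nat \<times> graph_piece \<Rightarrow> nat set list \<Rightarrow> nat set list \<Rightarrow> int" where
  "piece_sign c (i, GCap d e) A B = (if c \<in> B ! i then dir_sign d else 0)"
| "piece_sign c (i, GCup d e) A B = (if c \<in> A ! i then dir_sign d else 0)"
| "piece_sign c (i, _) A B = 0"

definition level_vertices :: "nat \<Rightarrow> nat set list \<Rightarrow> nat \<Rightarrow> (nat \<times> nat) list" where
  "level_vertices c A k = map (Pair k) (color_positions c A)"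

lemma set_level_vertices: "set (level_vertices c A k) = {(k, j) | j. j < length A \<and> c \<in> A ! j}"
  by (auto simp: level_vertices_def set_color_positions)

lemma level_vertices_append:
  "level_vertices c (A @ B @ C) k =
     level_vertices c A k @ map (\<lambda>j. (k, length A + j)) (color_positions c B) @
     map (\<lambda>j. (k, length A + length B + j)) (color_positions c C)"
  by (simp add: level_vertices_def color_positions_append add.assoc)

lemma zip_map_same: "zip (map f xs) (map g xs) = map (\<lambda>x. (f x, g x)) xs"
  by (induction xs) auto

text \<open>At a vertex, a label of the large edge lies in exactly one of the two smaller edges, so
  its curve simply passes.\<close>

lemma slice_of_piece:
  assumes st: "state_at p X Y" and P: "length P = i"
    and U: "length X = length (graph_upper p)" "length Y = length (graph_lower p)"
    and \<delta>P: "\<And>j. j < i \<Longrightarrow> \<delta> (k, j) = \<delta> (Suc k, j)"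
    and \<delta>Q: "\<And>j. j < length Q \<Longrightarrow> \<delta> (k, i + length X + j) = \<delta> (Suc k, i + length Y + j)"
    and \<delta>U: "\<And>j. j < length X \<Longrightarrow> \<delta> (k, i + j) = fst (graph_upper p ! j)"
    and \<delta>L: "\<And>j. j < length Y \<Longrightarrow> \<delta> (Suc k, i + j) = fst (graph_lower p ! j)"
    and V: "\<And>j. (k, j) \<in> V \<longleftrightarrow> j < length (P @ X @ Q) \<and> c \<in> (P @ X @ Q) ! j"
      "\<And>j. (Suc k, j) \<in> V \<longleftrightarrow> j < length (P @ Y @ Q) \<and> c \<in> (P @ Y @ Q) ! j"
  shows "slice \<delta> (Suc k, i) (level_vertices c (P @ X @ Q) k) (level_vertices c (P @ Y @ Q) (Suc k))
    (adjacent_in_slice k (i, p) \<inter> V \<times> V) (piece_sign c (i, p) (P @ X @ Q) (P @ Y @ Q))"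
proof -
  let ?P = "color_positions c P" and ?Q = "color_positions c Q"
  let ?a = "map (Pair k) ?P" and ?a' = "map (Pair (Suc k)) ?P"
  let ?b = "map (\<lambda>j. (k, i + length X + j)) ?Q" and ?b' = "map (\<lambda>j. (Suc k, i + length Y + j)) ?Q"
  let ?x = "map (\<lambda>j. (k, i + j)) (color_positions c X)" and ?y = "map (\<lambda>j. (Suc k, i + j)) (color_positions c Y)"
  have v: "level_vertices c (P @ X @ Q) k = ?a @ ?x @ ?b" "level_vertices c (P @ Y @ Q) (Suc k) = ?a' @ ?y @ ?b'"
    by (simp_all add: level_vertices_append P) (simp_all add: level_vertices_def)
  have \<delta>a: "map \<delta> ?a = map \<delta> ?a'" using \<delta>P P by (auto simp: set_color_positions)
  have \<delta>b: "map \<delta> ?b = map \<delta> ?b'" using \<delta>Q by (auto simp: set_color_positions)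
  define F where "F = (case p of
        GCap d e \<Rightarrow> {((Suc k, i), (Suc k, i + 1))}
      | GCup d e \<Rightarrow> {((k, i), (k, i + 1))}
      | Merge \<Rightarrow> {((k, i), (Suc k, i)), ((k, i + 1), (Suc k, i))}
      | Split \<Rightarrow> {((k, i), (Suc k, i)), ((k, i), (Suc k, i + 1))}
      | _ \<Rightarrow> {})"
  have adj: "adjacent_in_slice k (i, p) \<inter> V \<times> V = set (zip ?a ?a') \<union> set (zip ?b ?b') \<union> F \<inter> V \<times> V"
  proof -
    have "{((k, j), (Suc k, j)) | j. j < i} \<inter> V \<times> V = set (zip ?a ?a')"
      unfolding zip_map_same using P by (auto simp: V set_color_positions nth_append)
    moreover have "{((k, i + length (graph_upper p) + j), (Suc k, i + length (graph_lower p) + j)) | j. True} \<inter> V \<times> V = set (zip ?b ?b')"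
      unfolding zip_map_same using P U by (auto simp: V set_color_positions nth_append)
    moreover have "adjacent_in_slice k (i, p) = {((k, j), (Suc k, j)) | j. j < i} \<union>
      {((k, i + length (graph_upper p) + j), (Suc k, i + length (graph_lower p) + j)) | j. True} \<union> F"
      by (simp add: adjacent_in_slice_def F_def)
    ultimately show ?thesis by auto
  qed
  have pass: "slice \<delta> t (?a @ ?x @ ?b) (?a' @ ?y @ ?b') (set (zip ?a ?a') \<union> set (zip ?b ?b') \<union> set (zip ?x ?y)) 0"
    if "map \<delta> ?x = map \<delta> ?y" for t
  proof -
    have "length ?x = length ?y" using that by (rule map_eq_imp_length_eq)
    then have "set (zip ?a ?a') \<union> set (zip ?b ?b') \<union> set (zip ?x ?y) = set (zip (?a @ ?x @ ?b) (?a' @ ?y @ ?b'))"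
      by auto
    then show ?thesis using slice.pass[of \<delta> "?a @ ?x @ ?b" "?a' @ ?y @ ?b'" t] \<delta>a \<delta>b that by simp
  qed
  show ?thesis
  proof (cases p)
    case (GCap d e)
    then obtain s where s: "X = []" "Y = [s, s]" using st by auto
    have \<delta>': "\<delta> (Suc k, i) = d" "\<delta> (Suc k, Suc i) = opp d" using \<delta>L[of 0] \<delta>L[of 1] s GCap by auto
    show ?thesis
    proof (cases "c \<in> s")
      case True
      have "F \<inter> V \<times> V = {((Suc k, i), (Suc k, Suc i))}"
        using True s P GCap by (auto simp: F_def V nth_append)
      moreover have "slice \<delta> (Suc k, i) (?a @ ?b) (?a' @ [(Suc k, i), (Suc k, Suc i)] @ ?b')
        (set (zip ?a ?a') \<union> set (zip ?b ?b') \<union> {((Suc k, i), (Suc k, Suc i))}) (dir_sign (\<delta> (Suc k, i)))"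
        by (rule slice.cap[OF \<delta>a \<delta>b]) (simp add: \<delta>')
      ultimately show ?thesis unfolding v adj using True s P GCap \<delta>'
        by (simp add: color_positions_pair nth_append)
    next
      case False
      have "F \<inter> V \<times> V = {}"
        using False s P GCap by (auto simp: F_def V nth_append)
      then show ?thesis unfolding v adj using pass[of "(Suc k, i)"] False s P GCap
        by (simp add: color_positions_pair nth_append)
    qed
  next
    case (GCup d e)
    then obtain s where s: "Y = []" "X = [s, s]" using st by auto
    have \<delta>': "\<delta> (k, i) = d" "\<delta> (k, Suc i) = opp d" using \<delta>U[of 0] \<delta>U[of 1] s GCup by auto
    show ?thesis
    proof (cases "c \<in> s")
      case True
      have "F \<inter> V \<times> V = {((k, i), (k, Suc i))}"
        using True s P GCup by (auto simp: F_def V nth_append)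
      moreover have "slice \<delta> (Suc k, i) (?a @ [(k, i), (k, Suc i)] @ ?b) (?a' @ ?b')
        (set (zip ?a ?a') \<union> set (zip ?b ?b') \<union> {((k, i), (k, Suc i))}) (dir_sign (\<delta> (k, i)))"
        by (rule slice.cup[OF \<delta>a \<delta>b]) (simp add: \<delta>')
      ultimately show ?thesis unfolding v adj using True s P GCup \<delta>'
        by (simp add: color_positions_pair nth_append)
    next
      case False
      have "F \<inter> V \<times> V = {}"
        using False s P GCup by (auto simp: F_def V nth_append)
      then show ?thesis unfolding v adj using pass[of "(Suc k, i)"] False s P GCup
        by (simp add: color_positions_pair nth_append)
    qed
  next
    case Merge
    then obtain s s' where s: "X = [s, s']" "Y = [s \<union> s']" "s \<inter> s' = {}" using st by auto
    have \<delta>': "\<delta> (Suc k, i) = Down" "\<delta> (k, i) = Down" "\<delta> (k, Suc i) = Down"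
      using \<delta>U[of 0] \<delta>U[of 1] \<delta>L[of 0] s Merge by auto
    have "F \<inter> V \<times> V = set (zip ?x ?y)"
      using s P Merge by (auto simp: F_def V nth_append color_positions_pair color_positions_single)
    then show ?thesis unfolding v adj using pass[of "(Suc k, i)"] s P Merge \<delta>'
      by (auto simp add: color_positions_pair color_positions_single)
  next
    case Split
    then obtain s s' where s: "Y = [s, s']" "X = [s \<union> s']" "s \<inter> s' = {}" using st by auto
    have \<delta>': "\<delta> (k, i) = Down" "\<delta> (Suc k, i) = Down" "\<delta> (Suc k, Suc i) = Down"
      using \<delta>U[of 0] \<delta>L[of 1] \<delta>L[of 0] s Split by auto
    have "F \<inter> V \<times> V = set (zip ?x ?y)"
      using s P Split by (auto simp: F_def V nth_append color_positions_pair color_positions_single)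
    then show ?thesis unfolding v adj using pass[of "(Suc k, i)"] s P Split \<delta>'
      by (auto simp add: color_positions_pair color_positions_single)
  qed (use st in simp_all)
qed

lemma state_at_length: "state_at p X Y \<Longrightarrow> length X = length (graph_upper p) \<and> length Y = length (graph_lower p)"
  by (cases p) auto

lemma sum_rot_curve:
  assumes G: "closes graph_upper graph_lower [] G" and S: "S \<in> states n G"
  shows "2 * (\<Sum>C\<in>curves G S c. rot_curve G C) = (\<Sum>k<length G. piece_sign c (G ! k) (S ! k) (S ! Suc k))"
proof -
  let ?lev = "\<lambda>k. graph_levels G ! k"
  define N where "N = length G"
  define \<delta> where "\<delta> = (\<lambda>(k, j). fst (?lev k ! j))"
  define V where "V = {(k, j). k < length S \<and> j < length (S ! k) \<and> c \<in> S ! k ! j}"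
  \<comment> \<open>Lines beyond \<open>N\<close> are declared empty, since the conditions on
    \<open>vs\<close> are required for all \<open>k\<close>.\<close>
  define vs where "vs = (\<lambda>k. if k \<le> N then level_vertices c (S ! k) k else [])"
  define E where "E = (\<lambda>k. adjacent_in_slice k (G ! k) \<inter> V \<times> V)"
  define sg where "sg = (\<lambda>k. piece_sign c (G ! k) (S ! k) (S ! Suc k))"
  \<comment> \<open>The slice of piece \<open>k - 1\<close> ends on line \<open>k\<close>, and the
    left leg of a cap stands in the position of that piece.\<close>
  define top where "top = (\<lambda>k. (k, fst (G ! (k - 1))))"
  note lv = closes_levels[OF G, folded graph_levels_def]
  have lenS: "length S = Suc N"
    using S lv(1) by (auto simp: states_def N_def dest: list_all2_lengthD)
  have lenSk: "length (S ! k) = length (?lev k)" if "k \<le> N" for k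
  proof -
    have "list_all2 (\<lambda>s (d, e). s \<subseteq> {1..n} \<and> card s = e) (S ! k) (?lev k)"
      using S lenS that by (auto simp: states_def intro: list_all2_nthD)
    then show ?thesis by (rule list_all2_lengthD)
  qed
  have V_iff: "(k, j) \<in> V \<longleftrightarrow> k \<le> N \<and> j < length (S ! k) \<and> c \<in> S ! k ! j" for k j
    by (auto simp: V_def lenS)
  have sl: "slice \<delta> (top (Suc k)) (vs k) (vs (Suc k)) (E k) (sg k)" if k: "k < N" for k
  proof -
    obtain i p where ip: "G ! k = (i, p)" by force
    have "state_across (G ! k) (S ! k) (S ! Suc k)" using S k by (simp add: states_def N_def)
    then obtain P X Y Q where PX: "length P = i" "S ! k = P @ X @ Q" "S ! Suc k = P @ Y @ Q" "state_at p X Y"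
      by (auto simp: state_across_def ip)
    obtain P' Q' where P': "length P' = i" "?lev k = P' @ graph_upper p @ Q'" "?lev (Suc k) = P' @ graph_lower p @ Q'"
      using lv(4)[of k] k ip by (auto simp: N_def)
    note len = state_at_length[OF PX(4)]
    have "slice \<delta> (Suc k, i) (level_vertices c (P @ X @ Q) k) (level_vertices c (P @ Y @ Q) (Suc k))
      (adjacent_in_slice k (i, p) \<inter> V \<times> V) (piece_sign c (i, p) (P @ X @ Q) (P @ Y @ Q))"
    proof (rule slice_of_piece[OF PX(4,1)])
      show "length X = length (graph_upper p)" "length Y = length (graph_lower p)" using len by auto
      show "\<delta> (k, j) = \<delta> (Suc k, j)" if "j < i" for j using that P' by (simp add: \<delta>_def nth_append)
      show "\<delta> (k, i + length X + j) = \<delta> (Suc k, i + length Y + j)" if "j < length Q" for j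
        using that P' len by (simp add: \<delta>_def nth_append)
      show "\<delta> (k, i + j) = fst (graph_upper p ! j)" if "j < length X" for j
        using that P' len by (simp add: \<delta>_def nth_append)
      show "\<delta> (Suc k, i + j) = fst (graph_lower p ! j)" if "j < length Y" for j
        using that P' len by (simp add: \<delta>_def nth_append)
      show "(k, j) \<in> V \<longleftrightarrow> j < length (P @ X @ Q) \<and> c \<in> (P @ X @ Q) ! j" for j
        using k by (simp add: V_iff PX)
      show "(Suc k, j) \<in> V \<longleftrightarrow> j < length (P @ Y @ Q) \<and> c \<in> (P @ Y @ Q) ! j" for j
        using k by (simp add: V_iff PX)
    qed
    then show ?thesis using k by (simp add: vs_def E_def sg_def top_def ip PX)
  qed
  have "S ! 0 = []" "S ! N = []" using lenSk[of 0] lenSk[of N] lv(2,3) by (simp_all add: N_def)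
  then have ends: "vs 0 = []" "vs N = []" by (simp_all add: vs_def level_vertices_def)
  interpret arc_diagram \<delta> top vs E sg fst snd N
  proof
    show "vs 0 = []" by (rule ends)
    show "slice \<delta> (top (Suc k)) (vs k) (vs (Suc k)) (E k) (sg k)" if "k < N" for k using sl that .
    show "fst v = k" if "v \<in> set (vs k)" for v k
      using that by (auto simp: vs_def set_level_vertices split: if_splits)
    show "sorted_wrt (\<lambda>u v. snd u < snd v) (vs k)" for k
      by (simp add: vs_def level_vertices_def sorted_wrt_map color_positions_def sorted_wrt_filter strict_sorted_iff)
  qed
  have VV: "vertices N = V"
    unfolding vertices_def by (auto simp: vs_def set_level_vertices V_iff)
  have EE: "edges N = adjacent G \<inter> V \<times> V"
    unfolding edges_def by (auto simp: E_def adjacent_def N_def)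
  have "curves G S c = vertices N // sym_rtrancl (edges N)"
    by (simp add: curves_def Let_def VV EE sym_rtrancl_def V_def)
  moreover have "rot_curve G C = dir_sign (\<delta> v)"
    if C: "C \<subseteq> vertices N" "v \<in> C" "\<And>w. w \<in> C \<Longrightarrow> fst v \<le> fst w \<and> (fst w = fst v \<longrightarrow> snd v \<le> snd w)" for C v
  proof -
    have fin: "finite C" using C(1) finite_vertices finite_subset by blast
    have k: "Min (fst ` C) = fst v" using C fin by (intro Min_eqI) auto
    have "{j. (fst v, j) \<in> C} \<subseteq> snd ` C" by force
    then have "finite {j. (fst v, j) \<in> C}" using fin finite_subset by blast
    then have j: "Min {j. (fst v, j) \<in> C} = snd v" using C by (intro Min_eqI) force+
    have "rot_curve G C = (if fst (?lev (fst v) ! snd v) = Down then 1 else - 1)"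
      by (simp add: rot_curve_def Let_def k j)
    then show ?thesis by (cases "fst (?lev (fst v) ! snd v)") (auto simp: \<delta>_def case_prod_beta)
  qed
  ultimately show ?thesis using sum_curves[OF ends(2), of "rot_curve G"] by (simp add: sg_def N_def)
qed

text \<open>The factor \<open>4\<close> clears the halves in the coefficients of the labels and in
  the half turns, so that the floor in \<open>quarter_power\<close> is taken of an integer.\<close>

lemma rot_eq:
  assumes G: "closes graph_upper graph_lower [] G" and S: "S \<in> states n G"
  shows "4 * rot n G S = of_int (\<Sum>k<length G. \<Sum>c = 1..n. (2 * int c - int n - 1) * piece_sign c (G ! k) (S ! k) (S ! Suc k))"
proof -
  have *: "of_int (\<Sum>C\<in>curves G S c. rot_curve G C) = (of_int (\<Sum>k<length G. piece_sign c (G ! k) (S ! k) (S ! Suc k)) / 2 :: rat)" for c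
    using arg_cong[OF sum_rot_curve[OF G S, of c], of "of_int :: int \<Rightarrow> rat"] by simp
  have half: "4 * ((of_nat c - (of_nat n + 1) / 2) * (of_int t / 2)) = (of_int ((2 * int c - int n - 1) * t) :: rat)" for c t
    by (simp add: field_simps)
  have "4 * rot n G S = 4 * (\<Sum>c = 1..n. (of_nat c - (of_nat n + 1) / 2) * of_int (\<Sum>C\<in>curves G S c. rot_curve G C))"
    by (simp add: rot_def sum_distrib_left)
  also have "\<dots> = (\<Sum>c = 1..n. of_int ((2 * int c - int n - 1) * (\<Sum>k<length G. piece_sign c (G ! k) (S ! k) (S ! Suc k))))"
    unfolding * sum_distrib_left[of 4] by (intro sum.cong refl half)
  also have "\<dots> = of_int (\<Sum>c = 1..n. \<Sum>k<length G. (2 * int c - int n - 1) * piece_sign c (G ! k) (S ! k) (S ! Suc k))"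
    by (simp add: sum_distrib_left)
  also have "(\<Sum>c = 1..n. \<Sum>k<length G. (2 * int c - int n - 1) * piece_sign c (G ! k) (S ! k) (S ! Suc k)) =
    (\<Sum>k<length G. \<Sum>c = 1..n. (2 * int c - int n - 1) * piece_sign c (G ! k) (S ! k) (S ! Suc k))"
    by (rule sum.swap)
  finally show ?thesis .
qed

definition slice_weight :: "nat \<Rightarrow> 'a::field \<Rightarrow> nat \<times> graph_piece \<Rightarrow> nat set list \<Rightarrow> nat set list \<Rightarrow> 'a" where
  "slice_weight n r x A B = r powi (\<Sum>c = 1..n. (2 * int c - int n - 1) * piece_sign c x A B) * quarter_power r (vertex_exponent x A B)"

lemma power_int_sum: "r \<noteq> 0 \<Longrightarrow> r powi (\<Sum>k\<in>K. f k) = (\<Prod>k\<in>K. r powi f k)" for r :: "'a::field"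
  by (induction K rule: infinite_finite_induct) (simp_all add: power_int_add)

lemma planar_bracket_eq:
  assumes "closes graph_upper graph_lower [] G" "r \<noteq> 0"
  shows "planar_bracket n r G = (\<Sum>S\<in>states n G. \<Prod>k<length G. slice_weight n r (G ! k) (S ! k) (S ! Suc k))"
proof -
  have "quarter_power r (rot n G S) = (\<Prod>k<length G. r powi (\<Sum>c = 1..n. (2 * int c - int n - 1) * piece_sign c (G ! k) (S ! k) (S ! Suc k)))"
    if "S \<in> states n G" for S
    unfolding quarter_power_def rot_eq[OF assms(1) that] floor_of_int by (rule power_int_sum[OF assms(2)])
  then show ?thesis
    unfolding planar_bracket_def slice_weight_def by (intro sum.cong refl) (simp add: prod.distrib)
qed

section \<open>Transfer matrices\<close>

definition typed :: "nat \<Rightarrow> nat set list \<Rightarrow> (dir \<times> nat) list \<Rightarrow> bool" where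
  "typed n = list_all2 (\<lambda>s (d, e). s \<subseteq> {1..n} \<and> card s = e)"

lemma finite_typed: "finite {B. typed n B ys \<and> Q B}"
proof (rule finite_subset)
  show "{B. typed n B ys \<and> Q B} \<subseteq> {B. set B \<subseteq> Pow {1..n} \<and> length B = length ys}"
    by (auto simp: typed_def list_all2_conv_all_nth in_set_conv_nth case_prod_beta; meson atLeastAtMost_iff subsetD)
qed (simp add: finite_lists_length_eq)

definition next_level :: "(dir \<times> nat) list \<Rightarrow> nat \<times> graph_piece \<Rightarrow> (dir \<times> nat) list" where
  "next_level xs = (\<lambda>(i, p). replace_at i (length (graph_upper p)) (graph_lower p) xs)"

text \<open>The states of the part of a diagram below a line whose segments carry the subsets
  \<open>A\<close>.\<close>

definition paths :: "nat \<Rightarrow> (dir \<times> nat) list \<Rightarrow> graph \<Rightarrow> nat set list \<Rightarrow> nat set list list set" where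
  "paths n xs G A = {S. list_all2 (typed n) S (levels graph_upper graph_lower xs G) \<and>
     (\<forall>k<length G. state_across (G ! k) (S ! k) (S ! Suc k)) \<and> S ! 0 = A}"

text \<open>Types are carried along because \<open>state_across\<close> alone does not determine the
  sizes of the subsets at a cap.\<close>

fun transfer :: "nat \<Rightarrow> 'a::field \<Rightarrow> (dir \<times> nat) list \<Rightarrow> graph \<Rightarrow> nat set list \<Rightarrow> 'a" where
  "transfer n r xs [] A = 1"
| "transfer n r xs (x # G) A = (\<Sum>B | typed n B (next_level xs x) \<and> state_across x A B.
     slice_weight n r x A B * transfer n r (next_level xs x) G B)"

lemma levels_Cons: "levels graph_upper graph_lower xs (x # G) = xs # levels graph_upper graph_lower (next_level xs x) G"
  by (cases x) (simp add: next_level_def)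

lemma levels_nonempty: "levels U L xs w \<noteq> [] \<and> hd (levels U L xs w) = xs"
  by (cases w) auto

lemma paths_Cons:
  assumes "typed n A xs"
  shows "paths n xs (x # G) A =
    (\<lambda>(B, S). A # S) ` (SIGMA B:{B. typed n B (next_level xs x) \<and> state_across x A B}. paths n (next_level xs x) G B)"
proof (intro equalityI subsetI)
  fix S assume S: "S \<in> paths n xs (x # G) A"
  then obtain S' where S': "S = A # S'" "list_all2 (typed n) S' (levels graph_upper graph_lower (next_level xs x) G)"
    unfolding paths_def levels_Cons by (auto simp: list_all2_Cons2)
  then obtain B S'' where B: "S' = B # S''" "typed n B (next_level xs x)"
    using levels_nonempty[of graph_upper graph_lower "next_level xs x" G]
    by (cases "levels graph_upper graph_lower (next_level xs x) G") (auto simp: list_all2_Cons2)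
  have "\<forall>k<Suc (length G). state_across ((x # G) ! k) (S ! k) (S ! Suc k)" using S by (simp add: paths_def)
  then have "state_across x A B" "\<forall>k<length G. state_across (G ! k) (S' ! k) (S' ! Suc k)"
    using S' B by (auto simp: All_less_Suc2)
  then show "S \<in> (\<lambda>(B, S). A # S) ` (SIGMA B:{B. typed n B (next_level xs x) \<and> state_across x A B}. paths n (next_level xs x) G B)"
    using S' B by (auto simp: paths_def image_iff)
next
  fix S assume "S \<in> (\<lambda>(B, S). A # S) ` (SIGMA B:{B. typed n B (next_level xs x) \<and> state_across x A B}. paths n (next_level xs x) G B)"
  then obtain B S' where "S = A # S'" "typed n B (next_level xs x)" "state_across x A B" "S' \<in> paths n (next_level xs x) G B"
    by auto
  then show "S \<in> paths n xs (x # G) A"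
    using assms unfolding paths_def levels_Cons by (auto simp: All_less_Suc2)
qed

lemma finite_paths: "typed n A xs \<Longrightarrow> finite (paths n xs G A)"
proof (induction G arbitrary: xs A)
  case Nil
  have "paths n xs [] A \<subseteq> {[A]}" by (auto simp: paths_def list_all2_Cons2)
  then show ?case by (rule finite_subset) simp
next
  case (Cons x G)
  show ?case unfolding paths_Cons[OF Cons.prems]
    by (intro finite_imageI finite_SigmaI finite_typed Cons.IH) auto
qed

lemma sum_paths:
  "typed n A xs \<Longrightarrow> (\<Sum>S\<in>paths n xs G A. \<Prod>k<length G. slice_weight n r (G ! k) (S ! k) (S ! Suc k)) = transfer n r xs G A"
proof (induction G arbitrary: xs A)
  case Nil
  have "paths n xs [] A = {[A]}" using Nil by (auto simp: paths_def list_all2_Cons2)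
  then show ?case by simp
next
  case (Cons x G)
  let ?N = "{B. typed n B (next_level xs x) \<and> state_across x A B}"
  have inj: "inj_on (\<lambda>(B, S). A # S) (SIGMA B:?N. paths n (next_level xs x) G B)"
    by (rule inj_onI) (auto simp: paths_def)
  have 0: "S ! 0 = B" if "S \<in> paths n (next_level xs x) G B" for S B using that by (simp add: paths_def)
  have "(\<Sum>S\<in>paths n xs (x # G) A. \<Prod>k<length (x # G). slice_weight n r ((x # G) ! k) (S ! k) (S ! Suc k)) =
    (\<Sum>(B, S)\<in>(SIGMA B:?N. paths n (next_level xs x) G B). slice_weight n r x A B * (\<Prod>k<length G. slice_weight n r (G ! k) (S ! k) (S ! Suc k)))"
    unfolding paths_Cons[OF Cons.prems] sum.reindex[OF inj]
    by (intro sum.cong refl) (auto simp: prod.lessThan_Suc_shift 0 simp del: prod.lessThan_Suc)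
  also have "\<dots> = (\<Sum>B\<in>?N. \<Sum>S\<in>paths n (next_level xs x) G B. slice_weight n r x A B * (\<Prod>k<length G. slice_weight n r (G ! k) (S ! k) (S ! Suc k)))"
    by (intro sum.Sigma[symmetric] finite_typed ballI finite_paths) auto
  also have "\<dots> = transfer n r xs (x # G) A"
    by (simp add: Cons.IH flip: sum_distrib_left)
  finally show ?case .
qed

lemma planar_bracket_transfer:
  assumes "closes graph_upper graph_lower [] G" "r \<noteq> 0"
  shows "planar_bracket n r G = transfer n r [] G []"
proof -
  have "states n G = paths n [] G []"
  proof -
    have "S ! 0 = []" if "list_all2 (typed n) S (levels graph_upper graph_lower [] G)" for S
      using that levels_nonempty[of graph_upper graph_lower "[]" G]
      by (cases "levels graph_upper graph_lower [] G") (auto simp: list_all2_Cons2 typed_def)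
    then show ?thesis by (auto simp: states_def paths_def graph_levels_def typed_def)
  qed
  then show ?thesis
    using planar_bracket_eq[OF assms] sum_paths[where n = n and A = "[]" and xs = "[]" and G = G and r = r] by (simp add: typed_def)
qed

text \<open>The decomposition in \<open>state_across\<close> is unique, as the piece determines the
  lengths of its parts.\<close>

lemma state_across_iff:
  assumes "length P = i" "length X = length (graph_upper p)"
  shows "state_across (i, p) (P @ X @ Q) B \<longleftrightarrow> (\<exists>Y. B = P @ Y @ Q \<and> state_at p X Y)"
proof
  assume "state_across (i, p) (P @ X @ Q) B"
  then obtain P' X' Y Q' where *: "length P' = i" "P @ X @ Q = P' @ X' @ Q'" "B = P' @ Y @ Q'" "state_at p X' Y"
    by (auto simp: state_across_def)
  moreover have "length X' = length X" using state_at_length[OF *(4)] assms by simp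
  ultimately show "\<exists>Y. B = P @ Y @ Q \<and> state_at p X Y" using assms by auto
next
  assume "\<exists>Y. B = P @ Y @ Q \<and> state_at p X Y"
  then show "state_across (i, p) (P @ X @ Q) B" using assms(1) by (auto simp: state_across_def)
qed

lemma slice_weight_local:
  assumes "length P = i" "state_at p X Y"
  shows "slice_weight n r (i, p) (P @ X @ Q) (P @ Y @ Q) = slice_weight n r (0, p) X Y"
proof -
  have "piece_sign c (i, p) (P @ X @ Q) (P @ Y @ Q) = piece_sign c (0, p) X Y" for c
    using assms by (cases p) (auto simp: nth_append)
  moreover have "vertex_exponent (i, p) (P @ X @ Q) (P @ Y @ Q) = vertex_exponent (0, p) X Y"
    using assms by (cases p) (auto simp: nth_append)
  ultimately show ?thesis by (simp add: slice_weight_def)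
qed

text \<open>The strands beside the piece keep their subsets, so the sum over whole levels reduces to
  the strands below the piece.\<close>

lemma transfer_step:
  assumes "length P = i" "length xP = i" "typed n P xP" "typed n Q xQ" "length X = length (graph_upper p)"
  shows "transfer n r (xP @ graph_upper p @ xQ) ((i, p) # G) (P @ X @ Q) =
    (\<Sum>Y | typed n Y (graph_lower p) \<and> state_at p X Y.
       slice_weight n r (0, p) X Y * transfer n r (xP @ graph_lower p @ xQ) G (P @ Y @ Q))"
proof -
  have nx: "next_level (xP @ graph_upper p @ xQ) (i, p) = xP @ graph_lower p @ xQ"
    using assms(2) by (simp add: next_level_def replace_at_def)
  have ty: "typed n (P @ Y @ Q) (xP @ graph_lower p @ xQ) \<longleftrightarrow> typed n Y (graph_lower p)"
    if "length Y = length (graph_lower p)" for Y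
    using that assms by (auto simp: typed_def list_all2_append)
  have eq: "{B. typed n B (xP @ graph_lower p @ xQ) \<and> state_across (i, p) (P @ X @ Q) B} =
     (\<lambda>Y. P @ Y @ Q) ` {Y. typed n Y (graph_lower p) \<and> state_at p X Y}"
    using ty state_at_length unfolding state_across_iff[OF assms(1,5)] by blast
  have inj: "inj_on (\<lambda>Y. P @ Y @ Q) {Y. typed n Y (graph_lower p) \<and> state_at p X Y}"
    by (rule inj_onI) simp
  show ?thesis
    unfolding transfer.simps nx eq sum.reindex[OF inj] comp_def
    by (intro sum.cong refl) (auto simp: slice_weight_local[OF assms(1)])
qed

section \<open>Links without crossings\<close>

definition link_upper :: "link_node piece \<Rightarrow> dir list" where
  "link_upper = upper (\<lambda>_. [Down, Down])"

definition link_lower :: "link_node piece \<Rightarrow> dir list" where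
  "link_lower = lower (\<lambda>_. [Down, Down])"

lemma singular_links_iff: "D \<in> singular_links \<longleftrightarrow> closes link_upper link_lower [] D"
  by (simp add: singular_links_def link_upper_def link_lower_def)

lemma link_width: "length (link_upper p) = width p" "length (link_lower p) = height p"
  by (cases p; simp add: link_upper_def link_lower_def)+

lemma closes_link_Cons:
  "closes link_upper link_lower ds ((i, p) # D) \<longleftrightarrow>
     (\<exists>P Q. length P = i \<and> ds = P @ link_upper p @ Q \<and> closes link_upper link_lower (P @ link_lower p @ Q) D)"
  (is "?L \<longleftrightarrow> ?R")
proof
  assume ?L
  then have "ds = take i ds @ link_upper p @ drop (i + length (link_upper p)) ds"
    using take_drop_eqD[of i "link_upper p" ds] by simp
  with \<open>?L\<close> show ?R
    by (intro exI[of _ "take i ds"] exI[of _ "drop (i + length (link_upper p)) ds"]) (auto simp: replace_at_def)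
qed (auto simp: replace_at_def)

definition crossingless :: "singular_link \<Rightarrow> bool" where
  "crossingless D \<longleftrightarrow> (\<forall>(i, p)\<in>set D. p \<noteq> Pos \<and> p \<noteq> Neg)"

abbreviation labelled :: "dir list \<Rightarrow> (dir \<times> nat) list" where
  "labelled \<equiv> map (\<lambda>d. (d, 1))"

abbreviation singletons :: "nat list \<Rightarrow> nat set list" where
  "singletons \<equiv> map (\<lambda>a. {a})"

lemma closes_Phi:
  "crossingless D \<Longrightarrow> closes link_upper link_lower ds D \<Longrightarrow> closes graph_upper graph_lower (labelled ds) (Phi D)"
proof (induction D arbitrary: ds)
  case Nil
  then show ?case by (simp add: Phi_def)
next
  case (Cons x D)
  obtain i p where x: "x = (i, p)" by force
  obtain P Q where PQ: "length P = i" "ds = P @ link_upper p @ Q" "closes link_upper link_lower (P @ link_lower p @ Q) D"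
    using Cons.prems closes_link_Cons x by blast
  have IH: "closes graph_upper graph_lower (labelled (P @ link_lower p @ Q)) (Phi D)"
    using Cons.IH[OF _ PQ(3)] Cons.prems by (simp add: crossingless_def)
  have "p \<noteq> Pos" "p \<noteq> Neg" using Cons.prems x by (auto simp: crossingless_def)
  then show ?case
  proof (cases p)
    case (Node v)
    then have "v = Vertex" by (cases v) simp
    then show ?thesis using IH PQ Node x
      by (simp add: Phi_def link_upper_def link_lower_def replace_at_def)
  qed (use IH PQ x in \<open>simp_all add: Phi_def link_upper_def link_lower_def replace_at_def\<close>)
qed

context state_model
begin

lemma typed_singletons: "length A = length ds \<Longrightarrow> set A \<subseteq> {1..n} \<Longrightarrow> typed n (singletons A) (labelled ds)"
  by (auto simp: typed_def list_all2_conv_all_nth) (metis nth_mem subsetD atLeastAtMost_iff One_nat_def)+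

lemma typed_pair: "typed n Y [(d, 1), (d', 1)] \<longleftrightarrow> (\<exists>a\<in>{1..n}. \<exists>b\<in>{1..n}. Y = [{a}, {b}])"
  by (auto simp: typed_def list_all2_Cons2 card_1_singleton_iff)

text \<open>The powers of \<open>q_M\<close> with exponents \<open>1 / 4 - 1 / 2\<close> and
  \<open>1 / 4\<close>. Here \<open>a\<close> is the colour of the left edge as drawn downwards; it
  plays the role of \<open>f\<^sub>2\<close>.\<close>

definition vertex_weight :: "nat \<Rightarrow> nat \<Rightarrow> 'a" where
  "vertex_weight a b = (if a < b then inverse r else r)"

lemma slice_weight_turn:
  assumes "a \<in> {1..n}"
  shows "slice_weight n r (0, GCap d e) [] [{a}, {a}] = turn_weight d a"
    "slice_weight n r (0, GCup d e) [{a}, {a}] [] = turn_weight d a"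
proof -
  have "(\<Sum>c = 1..n. (2 * int c - int n - 1) * (if c \<in> {a} then dir_sign d else 0)) = (2 * int a - int n - 1) * dir_sign d"
  proof -
    have "(\<Sum>c = 1..n. (2 * int c - int n - 1) * (if c \<in> {a} then dir_sign d else 0)) =
       (\<Sum>c = 1..n. if c = a then (2 * int a - int n - 1) * dir_sign d else 0)"
      by (intro sum.cong refl) auto
    then show ?thesis using assms by simp
  qed
  moreover have "r powi ((2 * int a - int n - 1) * dir_sign d) = turn_weight d a"
    by (cases d) (simp_all add: turn_weight_def weight_def flip: power_int_minus)
  ultimately show "slice_weight n r (0, GCap d e) [] [{a}, {a}] = turn_weight d a"
    "slice_weight n r (0, GCup d e) [{a}, {a}] [] = turn_weight d a"
    by (simp_all add: slice_weight_def quarter_power_def)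
qed

lemma pi_count_single: "pi_count {a} {b} = (if b < a then 1 else 0)"
proof -
  have "{(x, y). x \<in> {a} \<and> y \<in> {b} \<and> x > y} = (if b < a then {(a, b)} else {})" by auto
  then show ?thesis by (simp add: pi_count_def)
qed

lemma slice_weight_vertex:
  "slice_weight n r (0, Merge) [{a}, {b}] Y = vertex_weight a b"
  "slice_weight n r (0, Split) Y [{a}, {b}] = vertex_weight a b"
proof -
  have "\<lfloor>- 1 :: rat\<rfloor> = - 1" by (simp add: floor_eq_iff)
  then show "slice_weight n r (0, Merge) [{a}, {b}] Y = vertex_weight a b"
    "slice_weight n r (0, Split) Y [{a}, {b}] = vertex_weight a b"
    by (simp_all add: slice_weight_def quarter_power_def pi_count_single vertex_weight_def power_int_minus)
qed

text \<open>Edges labelled \<open>1\<close> carry singletons, that is, colours. At a vertex the edge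
  labelled \<open>2\<close> carries \<open>{a, b}\<close> with distinct colours and splits in two
  ways; the products of the weights are the entries of the operator of a vertex.\<close>

lemma transfer_Phi:
  "crossingless D \<Longrightarrow> closes link_upper link_lower ds D \<Longrightarrow> A \<in> colorings (length ds) \<Longrightarrow>
     transfer n r (labelled ds) (Phi D) (singletons A) = word_op D (\<lambda>_. 1) A"
proof (induction D arbitrary: ds A)
  case Nil
  then show ?case by (simp add: Phi_def)
next
  case (Cons x D)
  obtain i p where x: "x = (i, p)" by force
  obtain P' Q' where ds: "length P' = i" "ds = P' @ link_upper p @ Q'" "closes link_upper link_lower (P' @ link_lower p @ Q') D"
    using Cons.prems closes_link_Cons x by blast
  have "i + width p \<le> length ds" using ds by (simp add: link_width)
  from coloring_split[OF Cons.prems(3) this] obtain P X Q where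
    A: "A = P @ X @ Q" "i = length P" "length X = width p" "set X \<subseteq> {1..n}" "set P \<subseteq> {1..n}" "set Q \<subseteq> {1..n}" by metis
  have lenQ: "length Q' = length Q" using Cons.prems(3) A ds by (simp add: colorings_def link_width)
  have ty: "typed n (singletons P) (labelled P')" "typed n (singletons Q) (labelled Q')"
    using typed_singletons A ds(1) lenQ by auto
  have IH: "transfer n r (labelled P' @ labelled (link_lower p) @ labelled Q') (Phi D) (singletons P @ singletons Y @ singletons Q) =
     word_op D (\<lambda>_. 1) (P @ Y @ Q)" if "Y \<in> colorings (height p)" for Y
    using Cons.IH[OF _ ds(3), of "P @ Y @ Q"] Cons.prems(1) that A ds(1) lenQ
    by (simp add: crossingless_def colorings_def link_width)
  note step = transfer_step[where P = "singletons P" and Q = "singletons Q" and xP = "labelled P'" and xQ = "labelled Q'" and i = i, OF _ _ ty]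
  have R: "word_op (x # D) (\<lambda>_. 1) A = local_op p (\<lambda>Y. word_op D (\<lambda>_. 1) (P @ Y @ Q)) X"
    using A by (simp add: x piece_op_decompose)
  have p: "p \<noteq> Pos" "p \<noteq> Neg" using Cons.prems x by (auto simp: crossingless_def)
  show ?case
  proof (cases p)
    case (Cap d)
    have X: "X = []" using A Cap by simp
    have Y: "{Y. typed n Y (graph_lower (GCap d 1)) \<and> state_at (GCap d 1) [] Y} = (\<lambda>c. [{c}, {c}]) ` {1..n}"
      by (auto simp: typed_pair[unfolded One_nat_def])
    have "transfer n r (labelled ds) (Phi (x # D)) (singletons A) =
      (\<Sum>Y\<in>(\<lambda>c. [{c}, {c}]) ` {1..n}. slice_weight n r (0, GCap d 1) [] Y * transfer n r (labelled P' @ [(d, 1), (opp d, 1)] @ labelled Q') (Phi D) (singletons P @ Y @ singletons Q))"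
      using step[of "[]" "GCap d 1" r "Phi D"] A ds X Cap x unfolding Y by (simp add: Phi_def link_upper_def)
    also have "\<dots> = (\<Sum>c = 1..n. turn_weight d c * word_op D (\<lambda>_. 1) (P @ [c, c] @ Q))"
      by (subst sum.reindex, force intro: inj_onI, intro sum.cong refl)
        (use IH[of "[c, c]" for c] in \<open>auto simp: slice_weight_turn Cap link_lower_def colorings_def\<close>)
    finally show ?thesis using R by (simp add: Cap)
  next
    case (Cup d)
    obtain a b where X: "X = [a, b]" using A Cup by (auto elim: length_2E)
    have ab: "a \<in> {1..n}" "b \<in> {1..n}" using A X by auto
    have Y: "{Y. typed n Y (graph_lower (GCup d 1)) \<and> state_at (GCup d 1) [{a}, {b}] Y} = (if a = b then {[]} else {})"
      by (auto simp: typed_def)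
    have "transfer n r (labelled ds) (Phi (x # D)) (singletons A) =
      (\<Sum>Y\<in>(if a = b then {[]} else {}). slice_weight n r (0, GCup d 1) [{a}, {b}] Y * transfer n r (labelled P' @ labelled Q') (Phi D) (singletons P @ Y @ singletons Q))"
      using step[of "[{a}, {b}]" "GCup d 1" r "Phi D"] A ds X Cup x unfolding Y by (simp add: Phi_def link_upper_def)
    also have "\<dots> = local_op p (\<lambda>Y. word_op D (\<lambda>_. 1) (P @ Y @ Q)) X"
      using IH[of "[]"] ab by (simp add: Cup X link_lower_def colorings_def slice_weight_turn)
    finally show ?thesis using R by simp
  next
    case (Node v)
    then have v: "p = Node Vertex" by (cases v) simp
    obtain a b where X: "X = [a, b]" using A Node by (auto elim: length_2E)
    have ab: "a \<in> {1..n}" "b \<in> {1..n}" using A X by auto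
    let ?\<psi> = "\<lambda>Y. word_op D (\<lambda>_. 1) (P @ Y @ Q)"
    have Y: "{Y. typed n Y (graph_lower Merge) \<and> state_at Merge [{a}, {b}] Y} = (if a = b then {} else {[{a, b}]})"
      using ab by (auto simp: typed_def card_insert_if)
    have "transfer n r (labelled ds) (Phi (x # D)) (singletons A) =
      (\<Sum>Y\<in>(if a = b then {} else {[{a, b}]}). slice_weight n r (0, Merge) [{a}, {b}] Y *
         transfer n r (labelled P' @ [(Down, 2)] @ labelled Q') ((i, Split) # Phi D) (singletons P @ Y @ singletons Q))"
      using step[of "[{a}, {b}]" Merge r "(i, Split) # Phi D"] A ds X v x unfolding Y by (simp add: Phi_def link_upper_def)
    also have "\<dots> = (if a = b then 0 else vertex_weight a b * 
         transfer n r (labelled P' @ [(Down, 2)] @ labelled Q') ((i, Split) # Phi D) (singletons P @ [{a, b}] @ singletons Q))"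
      by (simp add: slice_weight_vertex)
    also have "\<dots> = local_op p ?\<psi> X"
    proof (cases "a = b")
      case True
      then show ?thesis by (simp add: v X stay_def)
    next
      case False
      have Y2: "{Y. typed n Y (graph_lower Split) \<and> state_at Split [{a, b}] Y} = {[{a}, {b}], [{b}, {a}]}"
      proof (intro equalityI subsetI)
        fix Y assume "Y \<in> {Y. typed n Y (graph_lower Split) \<and> state_at Split [{a, b}] Y}"
        then obtain c d where "Y = [{c}, {d}]" "{a, b} = {c} \<union> {d}"
          by (auto simp: typed_pair[unfolded One_nat_def])
        then show "Y \<in> {[{a}, {b}], [{b}, {a}]}" by (auto simp: doubleton_eq_iff)
      next
        fix Y assume "Y \<in> {[{a}, {b}], [{b}, {a}]}"
        then show "Y \<in> {Y. typed n Y (graph_lower Split) \<and> state_at Split [{a, b}] Y}"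
          using ab False by (auto simp: typed_pair[unfolded One_nat_def])
      qed
      have "transfer n r (labelled P' @ [(Down, 2)] @ labelled Q') ((i, Split) # Phi D) (singletons P @ [{a, b}] @ singletons Q) =
        (\<Sum>Y\<in>{[{a}, {b}], [{b}, {a}]}. slice_weight n r (0, Split) [{a, b}] Y *
          transfer n r (labelled P' @ [(Down, 1), (Down, 1)] @ labelled Q') (Phi D) (singletons P @ Y @ singletons Q))"
        using step[of "[{a, b}]" Split r "Phi D"] A ds unfolding Y2 by simp
      also have "\<dots> = vertex_weight a b * ?\<psi> [a, b] + vertex_weight b a * ?\<psi> [b, a]"
        using IH[of "[a, b]"] IH[of "[b, a]"] ab False
        by (simp add: v link_lower_def colorings_def slice_weight_vertex)
      \<comment> \<open>The squares of the weights are \<open>q\<close> and \<open>1 / q\<close>,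
        the latter being \<open>q - z\<close>, and the mixed product is \<open>1\<close>.\<close>
      finally show ?thesis
        using False r_nz by (cases "a < b") (simp_all add: v X stay_def swap_def vertex_weight_def q_def z_def field_simps power2_eq_square)
    qed
    finally show ?thesis using R by simp
  qed (use p in simp_all)
qed

section \<open>Resolving the crossings\<close>

lemma closes_link_append:
  assumes "link_upper p = link_lower p" "closes link_upper link_lower ds (D @ (i, p) # D')"
  shows "closes link_upper link_lower ds (D @ D')"
  using assms(2)
proof (induction D arbitrary: ds)
  case Nil
  then show ?case using assms(1) by (auto simp: closes_link_Cons simp del: closes.simps(2))
next
  case (Cons x D)
  obtain j p' where "x = (j, p')" by force
  then show ?case using Cons by (auto simp: closes_link_Cons simp del: closes.simps(2))
qed

lemma closes_link_exchange:
  assumes "link_upper p = link_upper p'" "link_lower p = link_lower p'" "closes link_upper link_lower ds (D @ (i, p) # D')"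
  shows "closes link_upper link_lower ds (D @ (i, p') # D')"
  using assms(3)
proof (induction D arbitrary: ds)
  case Nil
  then show ?case using assms(1,2) by (auto simp: closes_link_Cons simp del: closes.simps(2))
next
  case (Cons x D)
  obtain j p' where "x = (j, p')" by force
  then show ?case using Cons by (auto simp: closes_link_Cons simp del: closes.simps(2))
qed

lemma closes_link_fits:
  "closes link_upper link_lower ds (D @ (i, p) # D') \<Longrightarrow> \<exists>m. fits (length ds) D m \<and> i + width p \<le> m"
proof (induction D arbitrary: ds)
  case Nil
  then show ?case by (auto simp: closes_link_Cons link_width simp del: closes.simps(2))
next
  case (Cons x D)
  obtain j p' where x: "x = (j, p')" by force
  obtain P Q where ds: "length P = j" "ds = P @ link_upper p' @ Q" "closes link_upper link_lower (P @ link_lower p' @ Q) (D @ (i, p) # D')"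
    using Cons.prems x by (auto simp: closes_link_Cons simp del: closes.simps(2))
  have "length ds - width p' + height p' = length (P @ link_lower p' @ Q)" "j + width p' \<le> length ds"
    using ds by (simp_all add: link_width)
  then show ?case using Cons.IH[OF ds(3)] by (simp add: x)
qed

lemma state_sum_vertex:
  assumes "D @ [(i, Node Vertex)] @ D' \<in> singular_links"
  shows "state_sum (D @ [(i, Node Vertex)] @ D') = q * state_sum (D @ D') - state_sum (D @ [(i, Pos)] @ D')"
proof -
  obtain m where "fits 0 D m" "i + 2 \<le> m"
    using closes_link_fits[of "[]" D i "Node Vertex" D'] assms by (auto simp: singular_links_iff)
  then show ?thesis by (rule state_sum_Node)
qed

text \<open>Both crossing rules agree with the operators: \<open>q\<close> minus the vertex is the
  positive crossing, and \<open>1 / q\<close> minus the vertex is that crossing minus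
  \<open>z\<close>, the negative one. As in \<open>resolve\<close>, the part \<open>D0\<close> has
  already been freed of crossings.\<close>

lemma resolve_Phi:
  "crossingless D0 \<Longrightarrow> D0 @ D \<in> singular_links \<Longrightarrow> resolve n r (Phi D0) (Phi D) = state_sum (D0 @ D)"
proof (induction D arbitrary: D0)
  case Nil
  then have "planar_bracket n r (Phi D0) = transfer n r [] (Phi D0) []"
    using planar_bracket_transfer closes_Phi[of D0 "[]"] r_nz by (simp add: singular_links_iff)
  then show ?case using transfer_Phi[of D0 "[]" "[]"] Nil by (simp add: Phi_def singular_links_iff colorings_def state_sum_def)
next
  case (Cons x D)
  obtain i p where x: "x = (i, p)" by force
  have Phi: "Phi (y # D) = graph_of_piece y @ Phi D" "Phi (D0 @ [y]) = Phi D0 @ graph_of_piece y" for y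
    by (simp_all add: Phi_def)
  have 1: "resolve n r (Phi (D0 @ [x])) (Phi D) = state_sum (D0 @ x # D)" if "p \<noteq> Pos" "p \<noteq> Neg"
    using Cons.IH[of "D0 @ [x]"] Cons.prems that x by (simp add: crossingless_def)
  have 2: "resolve n r (Phi D0) (Phi D) = state_sum (D0 @ D)"
    "resolve n r (Phi (D0 @ [(i, Node Vertex)])) (Phi D) = q * state_sum (D0 @ D) - state_sum (D0 @ [(i, Pos)] @ D)"
    "state_sum (D0 @ [(i, Neg)] @ D) = state_sum (D0 @ [(i, Pos)] @ D) - z * state_sum (D0 @ D)"
    if "p = Pos \<or> p = Neg"
  proof -
    have up: "link_upper p = [Down, Down]" "link_lower p = [Down, Down]" "link_upper (Node v) = [Down, Down]" "link_lower (Node v) = [Down, Down]" for v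
      using that by (auto simp: link_upper_def link_lower_def)
    have c: "closes link_upper link_lower [] (D0 @ (i, p) # D)" using Cons.prems x by (simp add: singular_links_iff)
    have "D0 @ D \<in> singular_links" using closes_link_append[OF _ c] up by (simp add: singular_links_iff)
    then show "resolve n r (Phi D0) (Phi D) = state_sum (D0 @ D)" using Cons by simp
    have V: "D0 @ [(i, Node Vertex)] @ D \<in> singular_links"
      using closes_link_exchange[OF _ _ c, of "Node Vertex"] up by (simp add: singular_links_iff)
    then have "resolve n r (Phi (D0 @ [(i, Node Vertex)])) (Phi D) = state_sum (D0 @ [(i, Node Vertex)] @ D)"
      using Cons.IH[of "D0 @ [(i, Node Vertex)]"] Cons.prems by (simp add: crossingless_def)
    then show "resolve n r (Phi (D0 @ [(i, Node Vertex)])) (Phi D) = q * state_sum (D0 @ D) - state_sum (D0 @ [(i, Pos)] @ D)"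
      using state_sum_vertex[OF V] by simp
    have "width p = 2" using that by auto
    then obtain m where "fits 0 D0 m" "i + 2 \<le> m" using closes_link_fits[OF c] by auto
    then show "state_sum (D0 @ [(i, Neg)] @ D) = state_sum (D0 @ [(i, Pos)] @ D) - z * state_sum (D0 @ D)"
      by (rule state_sum_Neg)
  qed
  have qp: "quarter_power r (1 / 2) = q" "quarter_power r (- (1 / 2)) = inverse q"
    by (simp_all add: quarter_power_def q_def power_int_minus)
  show ?case
  proof (cases p)
    case Pos
    then show ?thesis using 2 by (simp add: Phi x qp)
  next
    case Neg
    have "inverse q * state_sum (D0 @ D) - (q * state_sum (D0 @ D) - state_sum (D0 @ [(i, Pos)] @ D)) = state_sum (D0 @ [(i, Neg)] @ D)"
      using 2(3) Neg by (simp only: z_def) (simp add: algebra_simps)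
    then show ?thesis using 2(1,2) Neg by (simp add: Phi x qp)
  next
    case (Node v)
    then have "p = Node Vertex" by (cases v) simp
    then show ?thesis using 1 by (simp add: Phi x)
  qed (use 1 Phi x in simp_all)
qed

theorem moy_bracket_state_sum: "D \<in> singular_links \<Longrightarrow> moy_bracket n r (Phi D) = state_sum D"
  using resolve_Phi[of "[]" D] by (simp add: moy_bracket_def crossingless_def Phi_def)

end

section \<open>Comparison of the brackets\<close>

fun piece_writhe :: "'v piece \<Rightarrow> int" where
  "piece_writhe Pos = 1"
| "piece_writhe Neg = - 1"
| "piece_writhe _ = 0"

definition word_writhe :: "(nat \<times> 'v piece) list \<Rightarrow> int" where
  "word_writhe w = (\<Sum>(i, p)\<leftarrow>w. piece_writhe p)"

lemma word_writhe_simps [simp]: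
  "word_writhe [] = 0"
  "word_writhe ((i, p) # w) = piece_writhe p + word_writhe w"
  "word_writhe (a @ b) = word_writhe a + word_writhe b"
  by (simp_all add: word_writhe_def)

lemma link_isotopy_plain: "link_isotopy a b \<Longrightarrow> plain a \<and> plain b"
  by (induction rule: link_isotopy.induct)
    (auto simp: leftward_def rightward_def turn_clockwise_def turn_anticlockwise_def numeral_2_eq_2)

lemma link_isotopy_writhe: "link_isotopy a b \<Longrightarrow> word_writhe a = word_writhe b"
  by (induction rule: link_isotopy.induct)
    (auto simp: leftward_def rightward_def turn_clockwise_def turn_anticlockwise_def numeral_2_eq_2)

lemma writhe_word: "writhe D = word_writhe D"
proof (induction D)
  case Nil
  then show ?case by (simp add: writhe_def number_of_def)
next
  case (Cons x D)
  obtain i p where "x = (i, p)" by force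
  with Cons show ?case by (cases p) (auto simp: writhe_def number_of_def)
qed

lemma Psi_simps [simp]:
  "Psi n [] = []" "Psi n (x # D) = web_of_piece n x @ Psi n D" "Psi n (D @ D') = Psi n D @ Psi n D'"
  by (simp_all add: Psi_def)

lemma Psi_arr:
  assumes "2 \<le> n"
  shows "closes link_upper link_lower ds (D @ D') \<Longrightarrow>
    \<exists>es. arr n ds (Psi n D) es \<and> closes link_upper link_lower es D'"
proof (induction D arbitrary: ds)
  case (Cons x D)
  obtain i p where x: "x = (i, p)" by force
  obtain P Q where PQ: "length P = i" "ds = P @ link_upper p @ Q" "closes link_upper link_lower (P @ link_lower p @ Q) (D @ D')"
    using Cons.prems x by (auto simp: closes_link_Cons simp del: closes.simps(2))
  have "arr n ds (web_of_piece n x) (P @ link_lower p @ Q)"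
  proof (cases p)
    case (Node v)
    then have "p = Node Vertex" by (cases v) simp
    then show ?thesis using arr_vertex_web[OF assms, of P Q] PQ x by (simp add: link_upper_def link_lower_def)
  qed (use PQ x in \<open>auto simp: link_upper_def link_lower_def web_upper_plain replace_at_def\<close>)
  with Cons.IH[OF PQ(3)] show ?case by (auto intro: arr_appendI)
qed simp

text \<open>Both brackets share the same \<open>q\<close>. As \<open>t\<close> is not a root of
  unity, all quantum integers of positive index are invertible.\<close>

locale evaluation = web_bracket n t br + M: state_model n r
  for n and t :: "'a::field" and br and r :: 'a +
  assumes r_square: "r ^ 2 = t ^ n"
    and t_pow: "0 < k \<Longrightarrow> t ^ k \<noteq> 1"
begin

lemma Mq: "M.q = q" by (simp add: M.q_def r_square)

lemma Mz: "M.z = q - inverse q" by (simp add: M.z_def Mq)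

text \<open>The correction by the writhe removes the factors \<open>t\<close> from the skein
  relation and makes a positive curl contribute \<open>q ^ n\<close>, as in the state sum.\<close>

definition corrected_bracket :: "web \<Rightarrow> 'a" where
  "corrected_bracket w = br w * t powi word_writhe w"

lemma corrected_bracket_skein:
  assumes "u @ [(i, Pos)] @ v \<in> webs n"
  shows "corrected_bracket (u @ [(i, Pos)] @ v) - corrected_bracket (u @ [(i, Neg)] @ v) = (q - inverse q) * corrected_bracket (u @ v)"
proof -
  let ?w = "word_writhe u + word_writhe v"
  have "t powi (word_writhe u + (1 + word_writhe v)) = t * t powi ?w"
    using t_nz power_int_add[of t 1 ?w] by (simp add: add.left_commute)
  moreover have "t powi (word_writhe u + (- 1 + word_writhe v)) = inverse t * t powi ?w"
    using t_nz power_int_add[of t "- 1" ?w] by (simp add: power_int_minus add_diff_eq)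
  ultimately have "corrected_bracket (u @ [(i, Pos)] @ v) - corrected_bracket (u @ [(i, Neg)] @ v) =
    (t * br (u @ [(i, Pos)] @ v) - inverse t * br (u @ [(i, Neg)] @ v)) * t powi ?w"
    by (simp add: corrected_bracket_def algebra_simps)
  then show ?thesis using br_skein[OF assms] by (simp add: corrected_bracket_def)
qed

text \<open>The implication puts all words with discs into the set, so that the closure properties
  can be stated for all words.\<close>

definition good :: "web set" where
  "good = {w. plain w \<longrightarrow> corrected_bracket w = M.state_sum w}"

lemma skein_state_sum:
  assumes "u @ [(i, Pos)] @ v \<in> webs n" "plain u"
  shows "M.state_sum (u @ [(i, Pos)] @ v) - M.state_sum (u @ [(i, Neg)] @ v) = (q - inverse q) * M.state_sum (u @ v)"
proof -
  from M.webs_splitE[OF assms] obtain xs ys where xs: "arr n xs [(i, Pos)] ys" "fits 0 u (length xs)" by metis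
  have "i + 2 \<le> length xs" using xs(1) by (simp add: web_upper_plain)
  from M.state_sum_Neg[OF xs(2) this] show ?thesis by (simp add: Mz)
qed

lemma link_evaluation_good: "link_evaluation n good"
proof
  fix a b u v assume iso: "link_isotopy a b" and w: "u @ a @ v \<in> webs n" "u @ b @ v \<in> webs n"
  have "br (u @ a @ v) = br (u @ b @ v)" by (rule R_isotopy[OF iso w])
  moreover have "M.state_sum (u @ a @ v) = M.state_sum (u @ b @ v)" if "plain u"
    by (rule M.state_sum_isotopy[OF iso w(1) that])
  ultimately show "u @ a @ v \<in> good \<longleftrightarrow> u @ b @ v \<in> good"
    using link_isotopy_plain[OF iso] link_isotopy_writhe[OF iso] by (auto simp: good_def corrected_bracket_def)
next
  fix curl u i v
  assume c: "curl \<in> {right_curl Pos, left_curl Pos}" and w: "u @ curl i @ v \<in> webs n" "u @ v \<in> webs n"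
  obtain k where k: "k \<in> {right_curl, left_curl}" "curl = k Pos" using c by blast
  have pl: "plain (curl i)" "word_writhe (curl i) = 1" using c by (auto simp: right_curl_def left_curl_def)
  have "br (u @ curl i @ v) = t powi (int n * int n - 1) * br (u @ v)"
    using br_curl[OF k(1) w(2)] w(1) k(2) by simp
  moreover have "t powi (word_writhe u + (1 + word_writhe v)) = t * t powi (word_writhe u + word_writhe v)"
    using t_nz power_int_add[of t 1 "word_writhe u + word_writhe v"] by (simp add: add.left_commute)
  ultimately have "corrected_bracket (u @ curl i @ v) = (t * t powi (int n * int n - 1)) * corrected_bracket (u @ v)"
    by (simp add: corrected_bracket_def pl)
  then have "corrected_bracket (u @ curl i @ v) = q ^ n * corrected_bracket (u @ v)" by (simp only: curl_factor)
  moreover have "M.state_sum (u @ curl i @ v) = q ^ n * M.state_sum (u @ v)" if "plain u"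
    using M.state_sum_curl[OF c w(1) that] by (simp add: Mq)
  \<comment> \<open>Both values are multiplied by the invertible factor \<open>q ^ n\<close>, which
    gives both directions.\<close>
  ultimately show "u @ curl i @ v \<in> good \<longleftrightarrow> u @ v \<in> good"
    using pl q_nz by (auto simp: good_def)
next
  fix u i v assume w: "u @ [(i, Pos)] @ v \<in> webs n"
  note * = corrected_bracket_skein[OF w] skein_state_sum[OF w]
  show "u @ [(i, Pos)] @ v \<in> good" if "u @ [(i, Neg)] @ v \<in> good" "u @ v \<in> good"
    using that * by (auto simp: good_def diff_eq_eq)
  show "u @ [(i, Neg)] @ v \<in> good" if "u @ [(i, Pos)] @ v \<in> good" "u @ v \<in> good"
    using that * by (auto simp: good_def diff_eq_eq)
next
  fix u i v assume w: "u @ [(i, Cap Down), (i, Cup Down)] @ v \<in> webs n" and g: "u @ v \<in> good"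
  have "corrected_bracket (u @ [(i, Cap Down), (i, Cup Down)] @ v) = quantum_int q n * corrected_bracket (u @ v)"
    using br_circle[OF w] by (simp add: corrected_bracket_def)
  moreover have "M.state_sum (u @ [(i, Cap Down), (i, Cup Down)] @ v) = quantum_int q n * M.state_sum (u @ v)" if "plain u"
    using M.state_sum_circle[OF w that] z_nz by (simp add: Mz Mq)
  ultimately show "u @ [(i, Cap Down), (i, Cup Down)] @ v \<in> good" using g by (auto simp: good_def)
next
  show "[] \<in> good" by (simp add: good_def corrected_bracket_def br_Nil M.state_sum_def)
qed

lemma corrected_bracket_plain: "plain w \<Longrightarrow> w \<in> webs n \<Longrightarrow> corrected_bracket w = M.state_sum w"
  using link_evaluation.plain_webs_Z[OF link_evaluation_good] by (auto simp: good_def)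

definition vertex_factor :: 'a where
  "vertex_factor = quantum_fact q (n - 2) * q ^ (n * (n - 1) div 2)"

text \<open>Otherwise \<open>q ^ k\<close> would be its own inverse and \<open>t\<close> a root of
  unity.\<close>

lemma quantum_int_nz: "0 < k \<Longrightarrow> quantum_int q k \<noteq> 0"
proof
  assume k: "0 < k" "quantum_int q k = 0"
  then have "q ^ k = inverse (q ^ k)" using z_nz by (simp add: quantum_int_def power_int_minus)
  then have "q ^ k * q ^ k = 1" using q_nz by (metis right_inverse power_not_zero)
  then have "t ^ (n * k + n * k) = 1" by (simp add: power_add power_mult)
  then show False using t_pow[of "n * k + n * k"] k n_ge by simp
qed

lemma vertex_factor_nz: "vertex_factor \<noteq> 0"
  using q_nz by (simp add: vertex_factor_def quantum_fact_def quantum_int_nz)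

lemma singular_bracket_value:
  "singular_bracket n t br D = br (Psi n D) * vertex_factor powi (- int (number_of (Node Vertex) D)) * t powi word_writhe D"
  by (simp add: singular_bracket_def vertex_factor_def writhe_word)

text \<open>The normalization of a vertex cancels the factor in \<open>br_vertex_web\<close>, and
  the writhe of the new positive crossing accounts for the factor \<open>t\<close> there.\<close>

lemma singular_bracket_vertex:
  assumes "D @ [(i, Node Vertex)] @ D' \<in> singular_links"
  shows "singular_bracket n t br (D @ [(i, Node Vertex)] @ D') =
    q * singular_bracket n t br (D @ D') - singular_bracket n t br (D @ [(i, Pos)] @ D')"
proof -
  have "closes link_upper link_lower [] (D @ (i, Node Vertex) # D')" using assms by (simp add: singular_links_iff)
  then obtain es where es: "arr n [] (Psi n D) es" "closes link_upper link_lower es ((i, Node Vertex) # D')"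
    using Psi_arr[OF n_ge] by blast
  have "link_upper (Node Vertex) = [Down, Down]" "link_lower (Node Vertex) = [Down, Down]"
    by (simp_all add: link_upper_def link_lower_def)
  with es(2) obtain P Q where PQ: "length P = i" "es = P @ [Down, Down] @ Q" "closes link_upper link_lower (P @ [Down, Down] @ Q) D'"
    unfolding closes_link_Cons by metis
  have v: "arr n (P @ [Down, Down] @ Q) (Psi n D') []"
    using Psi_arr[OF n_ge, of _ D' "[]"] PQ(3) by auto
  have br: "br (Psi n D @ vertex_web n i @ Psi n D') = vertex_factor * (q * br (Psi n D @ Psi n D') - t * br (Psi n D @ [(i, Pos)] @ Psi n D'))"
    using br_vertex_web[of "Psi n D" P Q "Psi n D'"] es(1) v PQ by (simp add: vertex_factor_def)
  define k where "k = number_of (Node Vertex) (D @ D')"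
  define w where "w = word_writhe D + word_writhe D'"
  have k: "number_of (Node Vertex) (D @ [(i, Node Vertex)] @ D') = Suc k" "number_of (Node Vertex) (D @ [(i, Pos)] @ D') = k"
    by (simp_all add: k_def number_of_def)
  have "vertex_factor powi (- int (Suc k)) = inverse vertex_factor * vertex_factor powi (- int k)"
    using vertex_factor_nz power_int_add[of vertex_factor "- 1" "- int k"] by (simp add: power_int_minus)
  moreover have "t powi (word_writhe D + (1 + word_writhe D')) = t * t powi w"
    using t_nz power_int_add[of t 1 w] by (simp add: w_def add.left_commute)
  moreover have "vertex_factor * (q * x - t * y) * (inverse vertex_factor * f) * p = q * (x * f * p) - y * f * (t * p)" for x y f p
    using vertex_factor_nz by (simp add: field_simps)
  ultimately show ?thesis
    unfolding singular_bracket_value k k_def[symmetric] by (simp add: br w_def[symmetric])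
qed

lemma vertexless_Psi:
  "number_of (Node Vertex) D = 0 \<Longrightarrow> plain (Psi n D) \<and> word_writhe (Psi n D) = word_writhe D \<and>
     M.word_op (Psi n D) \<phi> = M.word_op D \<phi>"
proof (induction D)
  case (Cons x D)
  obtain i p where x: "x = (i, p)" by force
  show ?case
  proof (cases p)
    case (Node v)
    then show ?thesis using Cons.prems x by (cases v) (simp add: number_of_def)
  qed (use Cons x in \<open>auto simp: number_of_def M.piece_op_def\<close>)
qed simp

text \<open>Both sides expand a vertex in the same way, which lowers the number of vertices by one.
  Without vertices, \<open>Psi\<close> only changes the type of a word.\<close>

theorem singular_bracket_state_sum:
  "D \<in> singular_links \<Longrightarrow> singular_bracket n t br D = M.state_sum D"
proof (induction "number_of (Node Vertex) D" arbitrary: D)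
  case 0
  have "Psi n D \<in> webs n" using Psi_arr[OF n_ge, of "[]" D "[]"] 0(2) by (auto simp: singular_links_iff webs_iff_arr)
  then have "corrected_bracket (Psi n D) = M.state_sum (Psi n D)" using corrected_bracket_plain vertexless_Psi 0(1) by metis
  then show ?case using vertexless_Psi[of D "\<lambda>_. 1"] 0(1)
    by (simp add: singular_bracket_value corrected_bracket_def M.state_sum_def flip: 0(1))
next
  case (Suc k)
  have "(\<exists>i. (i, Node Vertex) \<in> set D)"
  proof (rule ccontr)
    assume "\<nexists>i. (i, Node Vertex) \<in> set D"
    then have "filter (\<lambda>(i, p'). p' = Node Vertex) D = []" by (auto simp: filter_empty_conv)
    with Suc(2) show False by (simp add: number_of_def)
  qed
  then obtain i D1 D2 where D: "D = D1 @ [(i, Node Vertex)] @ D2" by (metis append_Cons append_Nil split_list)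
  have c: "closes link_upper link_lower [] (D1 @ (i, Node Vertex) # D2)" using Suc(3) D by (simp add: singular_links_iff)
  have up: "link_upper (Node Vertex) = [Down, Down]" "link_lower (Node Vertex) = [Down, Down]" "link_upper Pos = [Down, Down]" "link_lower Pos = [Down, Down]"
    by (simp_all add: link_upper_def link_lower_def)
  have s: "D1 @ D2 \<in> singular_links" "D1 @ [(i, Pos)] @ D2 \<in> singular_links"
    using M.closes_link_append[OF _ c] M.closes_link_exchange[OF _ _ c, of Pos] up by (simp_all add: singular_links_iff)
  have k: "number_of (Node Vertex) (D1 @ D2) = k" "number_of (Node Vertex) (D1 @ [(i, Pos)] @ D2) = k"
    using Suc(2) by (simp_all add: D number_of_def)
  have "singular_bracket n t br (D1 @ D2) = M.state_sum (D1 @ D2)"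
    "singular_bracket n t br (D1 @ [(i, Pos)] @ D2) = M.state_sum (D1 @ [(i, Pos)] @ D2)"
    using Suc(1) k s by metis+
  then show ?case
    using singular_bracket_vertex[of D1 i D2] M.state_sum_vertex[of D1 i D2] Suc(3) by (simp add: D Mq)
qed

end

text \<open>The indeterminate stands for \<open>q\<close> to the power \<open>1 / (2 n)\<close>: its
  square is \<open>q\<close> to the power \<open>1 / n\<close>, and its \<open>n\<close>-th power is
  the fourth root of \<open>q_M\<close>, since \<open>q_M\<close> is the square of
  \<open>q\<close>.\<close>

theorem proposition7:
  fixes n :: nat and q_root q_M_root :: "rat fls" and br :: "web \<Rightarrow> rat fls" and L :: singular_link
  assumes "n \<ge> 2"
    and "q_root = fls_X ^ 2"
    and "q_M_root = fls_X ^ n"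
    and "is_web_bracket n q_root br"
    and "L \<in> singular_links"
  shows "singular_bracket n q_root br L = moy_bracket n q_M_root (Phi L)"
proof -
  have X: "(fls_X :: rat fls) ^ k \<noteq> 1" if "0 < k" for k
  proof
    assume "(fls_X :: rat fls) ^ k = 1"
    then have "fls_nth ((fls_X :: rat fls) ^ k) 0 = 1" by simp
    then show False using that by (simp add: fls_X_power_nth)
  qed
  have t: "q_root ^ k \<noteq> 1" if "0 < k" for k
    using X[of "2 * k"] that by (simp add: assms(2) flip: power_mult)
  have nz: "q_root \<noteq> 0" "q_M_root \<noteq> 0" by (simp_all add: assms)
  have z: "q_root ^ n - inverse (q_root ^ n) \<noteq> 0"
  proof
    assume "q_root ^ n - inverse (q_root ^ n) = 0"
    then have "q_root ^ n = inverse (q_root ^ n)" by simp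
    then have "q_root ^ n * q_root ^ n = 1" using nz by (metis power_not_zero right_inverse)
    then show False using t[of "n + n"] assms(1) by (simp add: power_add)
  qed
  interpret evaluation n q_root br q_M_root
    by unfold_locales (use assms nz z t in \<open>simp_all add: mult.commute flip: power_mult\<close>)
  show ?thesis
    using singular_bracket_state_sum[OF assms(5)] M.moy_bracket_state_sum[OF assms(5)] by simp
qed

end
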